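(* Let $m_1,m_2\ge 1$ be integers, let $\mathbf{\Sigma}_{\mathbf{S}_1,\mathbf{S}_2}\succ\mathbf{0}$ be the covariance matrix of the jointly Gaussian zero-mean source vectors $(\mathbf{S}_1,\mathbf{S}_2)$ of sizes $m_1\times 1$ and $m_2\times 1$, let $\mathbf{\Sigma}_{\mathbf{S}_2}$ be the covariance matrix of $\mathbf{S}_2$, let $N_2>N_1>0$, and let $\mathbf{D}_1\succ\mathbf{0}$ ($m_1\times m_1$) and $\mathbf{D}_2\succ\mathbf{0}$ ($m_2\times m_2$). Let $P(\mathbf{D}_1,\mathbf{D}_2)$ be the minimum-power function of the source-channel broadcast problem defined in the context. Then $$P(\mathbf{D}_1,\mathbf{D}_2)\geq\inf_{\mathbf{\Theta}}\ \sup_{\mathbf{\Sigma}_{\mathbf{U}_1,\mathbf{U}_2}\succ \mathbf{0}}\left[N_1\frac{|\mathbf{\Sigma}_{\mathbf{S}_1,\mathbf{S}_2}|\,|\mathbf{\Theta}_2+\mathbf{\Sigma}_{\mathbf{U}_2}|}{|\mathbf{\Theta}|\,|\mathbf{D}_2+\mathbf{\Sigma}_{\mathbf{U}_2}|}+(N_2-N_1)\frac{|\mathbf{\Sigma}_{\mathbf{S}_2}+\mathbf{\Sigma}_{\mathbf{U}_2}|}{|\mathbf{D}_2+\mathbf{\Sigma}_{\mathbf{U}_2}|}-N_2\right],$$ where the supremum is over all positive definite $(m_1+m_2)\times(m_1+m_2)$ matrices $\mathbf{\Sigma}_{\mathbf{U}_1,\mathbf{U}_2}$, with $\mathbf{\Sigma}_{\mathbf{U}_2}$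 denoting the lower-right $m_2\times m_2$ diagonal block of $\mathbf{\Sigma}_{\mathbf{U}_1,\mathbf{U}_2}$, and the infimum is over all symmetric $(m_1+m_2)\times(m_1+m_2)$ matrices $\mathbf{\Theta}$ satisfying $$\mathbf{0}\prec\mathbf{\Theta}\preceq\mathbf{\Sigma}_{\mathbf{S}_1,\mathbf{S}_2},\qquad \mathbf{\Theta}_1\preceq\mathbf{D}_1,$$ with $\mathbf{\Theta}_1$ and $\mathbf{\Theta}_2$ denoting the upper-left $m_1\times m_1$ and lower-right $m_2\times m_2$ diagonal blocks of $\mathbf{\Theta}$, respectively.
   Context: Notation: $|\cdot|$ is the determinant; $\mathbf{A}\preceq\mathbf{B}$ (resp. $\mathbf{A}\prec\mathbf{B}$) means $\mathbf{B}-\mathbf{A}$ is positive semidefinite (resp. positive definite). Sources and channel: $\mathbf{S}_1,\mathbf{S}_2$ are zero-mean jointly Gaussian random vectors of sizes $m_1\times1$, $m_2\times 1$ with joint covariance matrix $\mathbf{\Sigma}_{\mathbf{S}_1,\mathbf{S}_2}$ (the covariance of the stacked vector $(\mathbf{S}_1^T,\mathbf{S}_2^T)^T$), and $\mathbf{\Sigma}_{\mathbf{S}_i}=\mathbb{E}[\mathbf{S}_i\mathbf{S}_i^T]$. The channel noises $Z_1,Z_2$ are zero-mean Gaussian random variables with variances $N_1,N_2$, where $N_2>N_1>0$, and the pair $(Z_1,Z_2)$ is independent of $(\mathbf{S}_1,\mathbf{S}_2)$. Let $\{(\mathbf{S}_1(t),\mathbf{S}_2(t),Z_1(t),Z_2(t))\}_{t\ge1}$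 be i.i.d. copies of $(\mathbf{S}_1,\mathbf{S}_2,Z_1,Z_2)$. Write $\mathbf{S}_i^n=(\mathbf{S}_i(1),\dots,\mathbf{S}_i(n))$, an $m_i\times n$ random matrix, and $Z_i^n=(Z_i(1),\dots,Z_i(n))$, a $1\times n$ row vector. Codes: an $(n,P,\mathbf{D}_1,\mathbf{D}_2)$ source-channel broadcast code consists of a (measurable) encoding function $f:\mathbb{R}^{m_1\times n}\times\mathbb{R}^{m_2\times n}\to\mathbb{R}^n$ and two (measurable) decoding functions $g_i:\mathbb{R}^n\to\mathbb{R}^{m_i\times n}$, $i=1,2$, such that $$\tfrac1n\mathbb{E}[X^n(X^n)^T]\le P,\qquad \tfrac1n\mathbb{E}[(\mathbf{S}_i^n-\hat{\mathbf{S}}_i^n)(\mathbf{S}_i^n-\hat{\mathbf{S}}_i^n)^T]\preceq\mathbf{D}_i,\quad i=1,2,$$ where $X^n=f(\mathbf{S}_1^n,\mathbf{S}_2^n)$ (a $1\times n$ row vector), $Y_i^n=X^n+Z_i^n$ and $\hat{\mathbf{S}}_i^n=g_i(Y_i^n)$. The triple $(P,\mathbf{D}_1,\mathbf{D}_2)$ is achievable if there exists an $(n,P,\mathbf{D}_1,\mathbf{D}_2)$ source-channel broadcast code (for some $n\ge1$). $\mathcal{PD}$ is the closure of the set of all achievable triples, and $$P(\mathbf{D}_1,\mathbf{D}_2)=\inf\{P:(P,\mathbf{D}_1,\mathbf{D}_2)\in\mathcal{PD}\}.$$ *)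

theory Defs
  imports "HOL-Probability.Probability"
begin

section \<open>Loewner order and block matrices\<close>

definition pos_semidef :: "real^'n^'n \<Rightarrow> bool" where
  "pos_semidef A \<longleftrightarrow> transpose A = A \<and> (\<forall>x. 0 \<le> x \<bullet> (A *v x))"

definition pos_def :: "real^'n^'n \<Rightarrow> bool" where
  "pos_def A \<longleftrightarrow> transpose A = A \<and> (\<forall>x. x \<noteq> 0 \<longrightarrow> 0 < x \<bullet> (A *v x))"

definition loewner_le :: "real^'n^'n \<Rightarrow> real^'n^'n \<Rightarrow> bool" (infix "\<preceq>" 50) where
  "A \<preceq> B \<longleftrightarrow> pos_semidef (B - A)"

definition loewner_less :: "real^'n^'n \<Rightarrow> real^'n^'n \<Rightarrow> bool" (infix "\<prec>" 50) where
  "A \<prec> B \<longleftrightarrow> pos_def (B - A)"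

text \<open>Vectors of size m1 + m2 are indexed by the sum type; \<^term>\<open>Inl\<close> gives the first m1
  coordinates and \<^term>\<open>Inr\<close> the last m2.\<close>

definition stack :: "real^'a \<Rightarrow> real^'b \<Rightarrow> real^('a + 'b)" where
  "stack x y = (\<chi> k. case k of Inl i \<Rightarrow> x $ i | Inr j \<Rightarrow> y $ j)"

definition upper_left :: "real^('a::finite + 'b::finite)^('a + 'b) \<Rightarrow> real^'a^'a" where
  "upper_left A = (\<chi> i j. A $ Inl i $ Inl j)"

definition lower_right :: "real^('a::finite + 'b::finite)^('a + 'b) \<Rightarrow> real^'b^'b" where
  "lower_right A = (\<chi> i j. A $ Inr i $ Inr j)"

section \<open>Gaussian random vectors\<close>

text \<open>A random vector is Gaussian if all its linear functionals are univariate Gaussian, where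
  constants count as Gaussians of variance 0.\<close>

definition gaussian_var :: "'w measure \<Rightarrow> ('w \<Rightarrow> real) \<Rightarrow> bool" where
  "gaussian_var M X \<longleftrightarrow>
     (\<exists>\<mu> \<sigma>. 0 < \<sigma> \<and> distributed M lborel X (normal_density \<mu> \<sigma>)) \<or>
     (X \<in> borel_measurable M \<and> (\<exists>c. AE \<omega> in M. X \<omega> = c))"

definition gaussian_vec :: "'w measure \<Rightarrow> ('w \<Rightarrow> real^'n) \<Rightarrow> bool" where
  "gaussian_vec M X \<longleftrightarrow>
     X \<in> borel_measurable M \<and> (\<forall>a. gaussian_var M (\<lambda>\<omega>. a \<bullet> X \<omega>))"

definition mean_vec :: "'w measure \<Rightarrow> ('w \<Rightarrow> real^'n) \<Rightarrow> real^'n" where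
  "mean_vec M X = (\<chi> i. \<integral>\<omega>. X \<omega> $ i \<partial>M)"

definition cov_matrix :: "'w measure \<Rightarrow> ('w \<Rightarrow> real^'n) \<Rightarrow> real^'n^'n" where
  "cov_matrix M X =
     (\<chi> i j. \<integral>\<omega>. (X \<omega> $ i - mean_vec M X $ i) * (X \<omega> $ j - mean_vec M X $ j) \<partial>M)"

section \<open>The Gaussian broadcast setting\<close>

text \<open>Time runs through 0, 1, 2, ...; the sources and noises are sequences indexed by time.
  The joint law of the two noises is left unspecified. Independence of the noise pair from the
  source pair is stated through the generated sigma-algebras because \<^const>\<open>prob_space.indep_var\<close>
  forces both variables to have the same value type.\<close>

locale gaussian_broadcast = prob_space M
  for M :: "'w measure" +
  fixes \<Sigma> :: "real^('m1::finite + 'm2::finite)^('m1 + 'm2)"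
    and N1 N2 :: real
    and S1 :: "nat \<Rightarrow> 'w \<Rightarrow> real^'m1"
    and S2 :: "nat \<Rightarrow> 'w \<Rightarrow> real^'m2"
    and Z1 Z2 :: "nat \<Rightarrow> 'w \<Rightarrow> real"
  assumes source_gaussian: "gaussian_vec M (\<lambda>\<omega>. stack (S1 t \<omega>) (S2 t \<omega>))"
    and source_mean: "mean_vec M (\<lambda>\<omega>. stack (S1 t \<omega>) (S2 t \<omega>)) = 0"
    and source_cov: "cov_matrix M (\<lambda>\<omega>. stack (S1 t \<omega>) (S2 t \<omega>)) = \<Sigma>"
    and noise1: "distributed M lborel (Z1 t) (normal_density 0 (sqrt N1))"
    and noise2: "distributed M lborel (Z2 t) (normal_density 0 (sqrt N2))"
    and noise_indep_source:
      "indep_set (sets (vimage_algebra (space M) (\<lambda>\<omega>. (Z1 t \<omega>, Z2 t \<omega>)) borel))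
                 (sets (vimage_algebra (space M) (\<lambda>\<omega>. (S1 t \<omega>, S2 t \<omega>)) borel))"
    and indep_over_time:
      "indep_vars (\<lambda>_. borel) (\<lambda>t \<omega>. (S1 t \<omega>, S2 t \<omega>, Z1 t \<omega>, Z2 t \<omega>)) (UNIV :: nat set)"
    and identically_distributed:
      "distr M borel (\<lambda>\<omega>. (S1 t \<omega>, S2 t \<omega>, Z1 t \<omega>, Z2 t \<omega>)) =
       distr M borel (\<lambda>\<omega>. (S1 0 \<omega>, S2 0 \<omega>, Z1 0 \<omega>, Z2 0 \<omega>))"

section \<open>Source-channel broadcast codes\<close>

text \<open>A block of n letters (the columns of an m by n matrix) is a function on \<^term>\<open>{..<n}\<close>, an
  element of the n-fold product measurable space.\<close>

abbreviation blocks :: "nat \<Rightarrow> (nat \<Rightarrow> 'a::topological_space) measure" where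
  "blocks n \<equiv> Pi\<^sub>M {..<n} (\<lambda>_. borel)"

definition block :: "nat \<Rightarrow> (nat \<Rightarrow> 'w \<Rightarrow> 'a) \<Rightarrow> 'w \<Rightarrow> nat \<Rightarrow> 'a" where
  "block n S \<omega> = (\<lambda>t\<in>{..<n}. S t \<omega>)"

definition channel_input ::
  "nat \<Rightarrow> (nat \<Rightarrow> 'w \<Rightarrow> real^'m1) \<Rightarrow> (nat \<Rightarrow> 'w \<Rightarrow> real^'m2) \<Rightarrow>
   ((nat \<Rightarrow> real^'m1) \<times> (nat \<Rightarrow> real^'m2) \<Rightarrow> nat \<Rightarrow> real) \<Rightarrow> 'w \<Rightarrow> nat \<Rightarrow> real" where
  "channel_input n S1 S2 f \<omega> = f (block n S1 \<omega>, block n S2 \<omega>)"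

definition channel_output ::
  "nat \<Rightarrow> ('w \<Rightarrow> nat \<Rightarrow> real) \<Rightarrow> (nat \<Rightarrow> 'w \<Rightarrow> real) \<Rightarrow> 'w \<Rightarrow> nat \<Rightarrow> real" where
  "channel_output n X Z \<omega> = (\<lambda>t\<in>{..<n}. X \<omega> t + Z t \<omega>)"

text \<open>Bochner integrals of non-integrable functions are 0, so finiteness of the second moments
  is part of both constraints.\<close>

definition power_le :: "'w measure \<Rightarrow> nat \<Rightarrow> ('w \<Rightarrow> nat \<Rightarrow> real) \<Rightarrow> real \<Rightarrow> bool" where
  "power_le M n X P \<longleftrightarrow>
     integrable M (\<lambda>\<omega>. \<Sum>t<n. (X \<omega> t)\<^sup>2) \<and>
     (1 / real n) * (\<integral>\<omega>. (\<Sum>t<n. (X \<omega> t)\<^sup>2) \<partial>M) \<le> P"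

definition distortion_le ::
  "'w measure \<Rightarrow> nat \<Rightarrow> (nat \<Rightarrow> 'w \<Rightarrow> real^'m) \<Rightarrow> ('w \<Rightarrow> nat \<Rightarrow> real^'m) \<Rightarrow> real^'m^'m \<Rightarrow> bool" where
  "distortion_le M n S S' D \<longleftrightarrow>
     (\<forall>i j. integrable M (\<lambda>\<omega>. \<Sum>t<n. (S t \<omega> - S' \<omega> t) $ i * (S t \<omega> - S' \<omega> t) $ j)) \<and>
     (\<chi> i j. (1 / real n) *
        (\<integral>\<omega>. (\<Sum>t<n. (S t \<omega> - S' \<omega> t) $ i * (S t \<omega> - S' \<omega> t) $ j) \<partial>M)) \<preceq> D"

definition broadcast_code ::
  "'w measure \<Rightarrow> (nat \<Rightarrow> 'w \<Rightarrow> real^'m1) \<Rightarrow> (nat \<Rightarrow> 'w \<Rightarrow> real^'m2) \<Rightarrow>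
   (nat \<Rightarrow> 'w \<Rightarrow> real) \<Rightarrow> (nat \<Rightarrow> 'w \<Rightarrow> real) \<Rightarrow>
   nat \<Rightarrow> real \<Rightarrow> real^'m1^'m1 \<Rightarrow> real^'m2^'m2 \<Rightarrow>
   ((nat \<Rightarrow> real^'m1) \<times> (nat \<Rightarrow> real^'m2) \<Rightarrow> nat \<Rightarrow> real) \<Rightarrow>
   ((nat \<Rightarrow> real) \<Rightarrow> nat \<Rightarrow> real^'m1) \<Rightarrow> ((nat \<Rightarrow> real) \<Rightarrow> nat \<Rightarrow> real^'m2) \<Rightarrow> bool" where
  "broadcast_code M S1 S2 Z1 Z2 n P D1 D2 f g1 g2 \<longleftrightarrow>
     f \<in> blocks n \<Otimes>\<^sub>M blocks n \<rightarrow>\<^sub>M blocks n \<and>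
     g1 \<in> blocks n \<rightarrow>\<^sub>M blocks n \<and>
     g2 \<in> blocks n \<rightarrow>\<^sub>M blocks n \<and>
     (let X = channel_input n S1 S2 f in
        power_le M n X P \<and>
        distortion_le M n S1 (\<lambda>\<omega>. g1 (channel_output n X Z1 \<omega>)) D1 \<and>
        distortion_le M n S2 (\<lambda>\<omega>. g2 (channel_output n X Z2 \<omega>)) D2)"

definition achievable ::
  "'w measure \<Rightarrow> (nat \<Rightarrow> 'w \<Rightarrow> real^'m1) \<Rightarrow> (nat \<Rightarrow> 'w \<Rightarrow> real^'m2) \<Rightarrow>
   (nat \<Rightarrow> 'w \<Rightarrow> real) \<Rightarrow> (nat \<Rightarrow> 'w \<Rightarrow> real) \<Rightarrow>
   (real \<times> (real^'m1^'m1) \<times> (real^'m2^'m2)) set" where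
  "achievable M S1 S2 Z1 Z2 =
     {(P, D1, D2). \<exists>n\<ge>1. \<exists>f g1 g2. broadcast_code M S1 S2 Z1 Z2 n P D1 D2 f g1 g2}"

definition power_distortion_region ::
  "'w measure \<Rightarrow> (nat \<Rightarrow> 'w \<Rightarrow> real^'m1) \<Rightarrow> (nat \<Rightarrow> 'w \<Rightarrow> real^'m2) \<Rightarrow>
   (nat \<Rightarrow> 'w \<Rightarrow> real) \<Rightarrow> (nat \<Rightarrow> 'w \<Rightarrow> real) \<Rightarrow>
   (real \<times> (real^'m1^'m1) \<times> (real^'m2^'m2)) set" where
  "power_distortion_region M S1 S2 Z1 Z2 = closure (achievable M S1 S2 Z1 Z2)"

text \<open>Extended reals, so that the infimum of the empty set is infinity.\<close>

definition min_power ::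
  "'w measure \<Rightarrow> (nat \<Rightarrow> 'w \<Rightarrow> real^'m1) \<Rightarrow> (nat \<Rightarrow> 'w \<Rightarrow> real^'m2) \<Rightarrow>
   (nat \<Rightarrow> 'w \<Rightarrow> real) \<Rightarrow> (nat \<Rightarrow> 'w \<Rightarrow> real) \<Rightarrow>
   real^'m1^'m1 \<Rightarrow> real^'m2^'m2 \<Rightarrow> ereal" where
  "min_power M S1 S2 Z1 Z2 D1 D2 =
     (INF P \<in> {P. (P, D1, D2) \<in> power_distortion_region M S1 S2 Z1 Z2}. ereal P)"

end

theory Submission
  imports Defs
begin

text \<open>
  Let \<open>U = S2 + V\<close> with Gaussian \<open>V\<close> of covariance \<open>K\<close>, and degrade the first receiver to the
  second: \<open>Y1 = X + Z1\<close>, \<open>Y2 = Y1 + W\<close>. Instead of entropies and the entropy power inequality the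
  proof uses two likelihood ratios of mean at most 1, hence \<open>E ln R \<le> 0\<close> for both.
  The second one, \<open>R2\<close>, compares the law of \<open>(S, U, Y1)\<close> with \<open>p(U, Y1) q(S | U, Y1)\<close>, where \<open>q\<close> is
  the Gaussian posterior belonging to a linear estimate of \<open>S\<close> from the output of the first decoder,
  with error covariance \<open>\<Theta>\<close>. The first one, \<open>R1\<close>, compares the law of \<open>(U, Y1, Y2)\<close> with a Gaussian
  \<open>Q(U, Y2)\<close> times test densities for each letter of \<open>Y1\<close> given \<open>Y2\<close> and the earlier letters of \<open>Y1\<close>.
  These are built from the monotone map that transports the conditional law of that letter to the
  standard normal law, and the concavity of \<open>ln\<close> turns them into the conditional entropy power
  inequality with weight \<open>\<lambda>\<close>. In \<open>ln R1 + \<lambda> ln R2\<close> the unknown density \<open>p(U, Y1)\<close> cancels, and only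
  second moments remain; they are bounded by the power and distortion constraints. The choice of \<open>\<lambda>\<close>
  that equalises the two terms gives the bound for a single code, and a compactness argument
  extends it to the closure of the achievable region.
\<close>

text \<open>The hypotheses leave the joint law of the two noises open, but a code is judged only
  through the pairs (source, \<open>Z1\<close>) and (source, \<open>Z2\<close>). The second noise
  may therefore be replaced by the first plus an independent W of variance N2 - N1; moments are
  transferred to that model pair by pair. Entropies would require integrability of the logarithm of
  the unknown mixture density of (U, Y1). The proof works pointwise instead: this logarithm has
  coefficient -1 + (1 - \<lambda>) in the lower bound for ln R1 and \<lambda> in \<lambda> ln R2,
  and ln R \<le> R - 1 is integrated only after it has cancelled. What survives of the transport map
  S is its product with W, of mean 0 because W is independent of (U, Y1); so S needs only a first
  moment. The Gaussian posterior needs an invertible \<Theta>, which is not evident for the optimal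
  linear estimate. Hence the perturbation by \<epsilon>, removed in the same limit as the closure.
  \<Theta> is chosen before K, as the order of infimum and supremum demands.\<close>

subsection \<open>Linear changes of variables\<close>

lemma prod_Basis_vec:
  fixes v :: "real^'n"
  shows "(\<Prod>b\<in>Basis. v \<bullet> b) = (\<Prod>i\<in>UNIV. v $ i)"
proof -
  have B: "(Basis :: (real^'n) set) = range (\<lambda>i. axis i 1)" by (auto simp: Basis_vec_def)
  have inj: "inj (\<lambda>i. axis i 1 :: real^'n)" by (auto simp: inj_def axis_eq_axis)
  show ?thesis unfolding B prod.reindex[OF inj] by (simp add: cart_eq_inner_axis[symmetric])
qed

lemma borel_measurable_vec_lambda [measurable (raw)]:
  fixes f :: "'a \<Rightarrow> 'n::finite \<Rightarrow> real"
  assumes "\<And>i. (\<lambda>x. f x i) \<in> borel_measurable M"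
  shows "(\<lambda>x. \<chi> i. f x i) \<in> borel_measurable M"
  by (subst borel_measurable_euclidean_space) (auto simp: Basis_vec_def cart_eq_inner_axis[symmetric] assms)

lemma borel_measurable_vec_nth' [measurable (raw)]:
  fixes f :: "'a \<Rightarrow> real^'n"
  assumes "f \<in> borel_measurable M"
  shows "(\<lambda>x. f x $ i) \<in> borel_measurable M"
  unfolding cart_eq_inner_axis using assms by measurable

lemma borel_measurable_matrix_vector_mult [measurable (raw)]:
  fixes f :: "'a \<Rightarrow> real^'n"
  assumes [measurable]: "f \<in> borel_measurable M"
  shows "(\<lambda>x. A *v f x) \<in> borel_measurable M"
  unfolding matrix_vector_mult_def by measurable

lemma nn_integral_lborel_translate:
  fixes c :: "'a::euclidean_space"
  assumes [measurable]: "f \<in> borel_measurable borel"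
  shows "(\<integral>\<^sup>+x. f (c + x) \<partial>lborel) = (\<integral>\<^sup>+x. f x \<partial>lborel)"
  by (subst (2) lborel_distr_plus[of c, symmetric], subst nn_integral_distr) auto

lemma nn_integral_lborel_coords:
  fixes f :: "'a::euclidean_space \<Rightarrow> ennreal"
  assumes [measurable]: "f \<in> borel_measurable borel"
  shows "(\<integral>\<^sup>+x. f x \<partial>lborel) = (\<integral>\<^sup>+y. f (\<Sum>b\<in>Basis. y b *\<^sub>R b) \<partial>(\<Pi>\<^sub>M b\<in>Basis. (lborel :: real measure)))"
  by (subst lborel_eq, subst nn_integral_distr) auto

text \<open>The added multiple of coordinate \<open>n\<close> is constant while coordinate
  \<open>m\<close> is integrated, so on each line in direction \<open>m\<close> the shear is a
  translation.\<close>

lemma nn_integral_shear: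
  fixes f :: "real^'n \<Rightarrow> ennreal"
  assumes [measurable]: "f \<in> borel_measurable borel" and mn: "m \<noteq> n"
  shows "(\<integral>\<^sup>+x. f (x + (c * x $ n) *\<^sub>R axis m 1) \<partial>lborel) = (\<integral>\<^sup>+x. f x \<partial>lborel)"
proof -
  interpret product_sigma_finite "\<lambda>_::real^'n. (lborel :: real measure)" ..
  let ?e = "axis m 1 :: real^'n" and ?k = "axis n 1 :: real^'n"
  let ?B = "Basis - {?e} :: (real^'n) set"
  let ?s = "\<lambda>y. \<Sum>b\<in>Basis. y b *\<^sub>R b :: real^'n"
  have e: "?e \<in> Basis" "?k \<in> Basis" "?k \<noteq> ?e" using mn by (auto simp: axis_eq_axis axis_in_Basis_iff)
  then have B: "insert ?e ?B = Basis" by auto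
  have sn: "?s y $ n = y ?k" for y
    using e by (simp add: cart_eq_inner_axis inner_sum_left inner_Basis if_distrib cong: if_cong)
  have su: "?s (z(?e := t)) + (c * ?s (z(?e:=t)) $ n) *\<^sub>R ?e = ?s (z(?e := c * z ?k + t))" for z t
  proof -
    have "?s (z(?e := t)) = t *\<^sub>R ?e + (\<Sum>b\<in>?B. z b *\<^sub>R b)" for t
      using e by (subst sum.remove[of _ ?e]) (auto intro!: sum.cong)
    then show ?thesis unfolding sn using e by (simp add: algebra_simps)
  qed
  note [measurable] = measurable_fun_upd
  have "(\<integral>\<^sup>+x. f (x + (c * x $ n) *\<^sub>R ?e) \<partial>lborel)
      = (\<integral>\<^sup>+y. f (?s y + (c * ?s y $ n) *\<^sub>R ?e) \<partial>(\<Pi>\<^sub>M b\<in>insert ?e ?B. lborel))"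
    unfolding B by (rule nn_integral_lborel_coords) measurable
  also have "\<dots> = (\<integral>\<^sup>+z. \<integral>\<^sup>+t. f (?s (z(?e := t)) + (c * ?s (z(?e:=t)) $ n) *\<^sub>R ?e) \<partial>lborel \<partial>(\<Pi>\<^sub>M b\<in>?B. lborel))"
    by (rule product_nn_integral_insert) (auto simp: B)
  also have "\<dots> = (\<integral>\<^sup>+z. \<integral>\<^sup>+t. f (?s (z(?e := t))) \<partial>lborel \<partial>(\<Pi>\<^sub>M b\<in>?B. lborel))"
    unfolding su
  proof (rule nn_integral_cong)
    fix z :: "real^'n \<Rightarrow> real"
    have "(\<lambda>t. f (?s (z(?e := t)))) \<in> borel_measurable borel" by (auto simp: fun_upd_def)
    from nn_integral_lborel_translate[OF this, of "c * z ?k"]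
    show "(\<integral>\<^sup>+t. f (?s (z(?e := c * z ?k + t))) \<partial>lborel) = (\<integral>\<^sup>+t. f (?s (z(?e := t))) \<partial>lborel)" .
  qed
  also have "\<dots> = (\<integral>\<^sup>+y. f (?s y) \<partial>(\<Pi>\<^sub>M b\<in>insert ?e ?B. lborel))"
    by (rule product_nn_integral_insert[symmetric]) (auto simp: B)
  also have "\<dots> = (\<integral>\<^sup>+x. f x \<partial>lborel)"
    unfolding B by (rule nn_integral_lborel_coords[symmetric]) measurable
  finally show ?thesis .
qed

lemma nn_integral_scale_coords:
  fixes f :: "real^'n \<Rightarrow> ennreal"
  assumes [measurable]: "f \<in> borel_measurable borel" and c: "\<And>i. c i \<noteq> 0"
  shows "ennreal (\<Prod>i\<in>UNIV. \<bar>c i\<bar>) * (\<integral>\<^sup>+x. f (\<chi> i. c i * x $ i) \<partial>lborel) = (\<integral>\<^sup>+x. f x \<partial>lborel)"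
proof -
  \<comment> \<open>The affine formula takes one coefficient per basis vector; \<open>SOME\<close>
    recovers the index, which is unique because \<open>axis\<close> is injective.\<close>
  define d where "d b = c (SOME i. b = axis i 1)" for b :: "real^'n"
  have d: "d (axis i 1) = c i" for i by (simp add: d_def axis_eq_axis)
  have B: "(Basis :: (real^'n) set) = range (\<lambda>i. axis i 1)" by (auto simp: Basis_vec_def)
  have inj: "inj (\<lambda>i. axis i 1 :: real^'n)" by (auto simp: inj_def axis_eq_axis)
  have T: "0 + (\<Sum>j\<in>Basis. (d j * (x \<bullet> j)) *\<^sub>R j) = (\<chi> i. c i * x $ i)" for x :: "real^'n"
    unfolding B sum.reindex[OF inj]
    by (simp add: d vec_eq_iff cart_eq_inner_axis[symmetric]) (simp add: axis_def if_distrib cong: if_cong)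
  have P: "(\<Prod>j\<in>Basis. \<bar>d j\<bar>) = (\<Prod>i\<in>UNIV. \<bar>c i\<bar>)"
    unfolding B prod.reindex[OF inj] by (simp add: d)
  have "\<And>j. j \<in> Basis \<Longrightarrow> d j \<noteq> 0" using c by (simp add: d_def)
  from lborel_affine_euclidean[OF this, of "\<lambda>j. j" 0]
  have "lborel = density (distr lborel borel (\<lambda>x::real^'n. \<chi> i. c i * x $ i)) (\<lambda>_. ennreal (\<Prod>i\<in>UNIV. \<bar>c i\<bar>))"
    unfolding T P by simp
  then have "(\<integral>\<^sup>+x. f x \<partial>lborel) = (\<integral>\<^sup>+x. f x \<partial>(density (distr lborel borel (\<lambda>x::real^'n. \<chi> i. c i * x $ i)) (\<lambda>_. ennreal (\<Prod>i\<in>UNIV. \<bar>c i\<bar>))))"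
    by simp
  also have "\<dots> = ennreal (\<Prod>i\<in>UNIV. \<bar>c i\<bar>) * (\<integral>\<^sup>+x. f (\<chi> i. c i * x $ i) \<partial>lborel)"
    by (subst nn_integral_density, simp, simp, subst nn_integral_distr) (auto simp: nn_integral_cmult)
  finally show ?thesis by simp
qed

text \<open>The library's linear change of variables asks for a well-ordered index type, which sum types
  are not.\<close>

lemma nn_integral_linear_change:
  fixes A :: "real^'n^'n"
  assumes "det A \<noteq> 0" "f \<in> borel_measurable borel"
  shows "ennreal \<bar>det A\<bar> * (\<integral>\<^sup>+x. f (A *v x) \<partial>lborel) = (\<integral>\<^sup>+x. f x \<partial>lborel)"
proof -
  \<comment> \<open>Determinant 1 and the explicit action on vectors reduce the shear case of the
    induction to \<open>nn_integral_shear\<close>.\<close>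
  have sh: "ennreal \<bar>det S\<bar> * (\<integral>\<^sup>+x. f (S *v x) \<partial>lborel) = (\<integral>\<^sup>+x. f x \<partial>lborel)"
    if S: "S = (\<chi> i j. if i = m \<and> j = n then c else of_bool (i = j))" and mn: "m \<noteq> n"
      and f: "f \<in> borel_measurable borel"
    for S :: "real^'n^'n" and m n c and f :: "real^'n \<Rightarrow> ennreal"
  proof -
    have "S = (\<chi> k. if k = m then row m (mat 1) + c *s row n (mat 1) else row k (mat 1))"
      using mn by (auto simp: S vec_eq_iff row_def mat_def)
    then have "det S = 1" using mn by (simp add: det_row_operation)
    moreover have "S *v x = x + (c * x $ n) *\<^sub>R axis m 1" for x
      using mn
      by (auto simp: S vec_eq_iff matrix_vector_mult_def axis_def if_distrib[where f="\<lambda>y. y * _"] sum.If_cases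
         of_bool_def cong: if_cong)
    ultimately show ?thesis using nn_integral_shear[OF f mn, of c] by simp
  qed
  have "det A \<noteq> 0 \<longrightarrow> (\<forall>f\<in>borel_measurable borel. ennreal \<bar>det A\<bar> * (\<integral>\<^sup>+x. f (A *v x) \<partial>lborel) = (\<integral>\<^sup>+x. f x \<partial>lborel))"
  \<comment> \<open>The premise \<open>det A \<noteq> 0\<close> stays inside the induction: it makes
    the case of a zero row vacuous and passes from a product to both factors.\<close>
  proof (induct A rule: induct_matrix_elementary)
    case (1 A B)
    show ?case
    proof (intro impI ballI)
      fix f :: "real^'n \<Rightarrow> ennreal" assume d: "det (A ** B) \<noteq> 0" and f[measurable]: "f \<in> borel_measurable borel"
      have m: "(\<lambda>x. f (A *v x)) \<in> borel_measurable borel" by measurable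
      have "ennreal \<bar>det (A ** B)\<bar> * (\<integral>\<^sup>+x. f ((A ** B) *v x) \<partial>lborel)
         = ennreal \<bar>det A\<bar> * (ennreal \<bar>det B\<bar> * (\<integral>\<^sup>+x. f (A *v (B *v x)) \<partial>lborel))"
        by (simp add: det_mul abs_mult ennreal_mult mult.assoc matrix_vector_mul_assoc)
      also have "\<dots> = (\<integral>\<^sup>+x. f x \<partial>lborel)"
      proof -
        have nz: "det A \<noteq> 0" "det B \<noteq> 0" using d by (auto simp: det_mul)
        have "ennreal \<bar>det B\<bar> * (\<integral>\<^sup>+x. f (A *v (B *v x)) \<partial>lborel) = (\<integral>\<^sup>+x. f (A *v x) \<partial>lborel)"
          using 1(2) nz m by (auto dest!: bspec[of _ _ "\<lambda>x. f (A *v x)"])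
        then show ?thesis using 1(1) nz f by simp
      qed
      finally show "ennreal \<bar>det (A ** B)\<bar> * (\<integral>\<^sup>+x. f ((A ** B) *v x) \<partial>lborel) = (\<integral>\<^sup>+x. f x \<partial>lborel)" .
    qed
  next
    case (2 A i) then show ?case using det_zero_row(1)[of i A] by (simp add: row_def vec_eq_iff)
  next
    case (3 A)
    show ?case
    proof (intro impI ballI)
      fix f :: "real^'n \<Rightarrow> ennreal" assume d: "det A \<noteq> 0" and f[measurable]: "f \<in> borel_measurable borel"
      have dd: "det A = (\<Prod>i\<in>UNIV. A $ i $ i)" by (rule det_diagonal) (use 3 in auto)
      have "A *v x = (\<chi> i. A $ i $ i * x $ i)" for x
      proof -
        have "(\<Sum>j\<in>UNIV. A $ i $ j * x $ j) = A $ i $ i * x $ i" for i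
          by (subst sum.remove[of _ i]) (use 3 in auto)
        then show ?thesis by (simp add: vec_eq_iff matrix_vector_mult_def)
      qed
      then show "ennreal \<bar>det A\<bar> * (\<integral>\<^sup>+x. f (A *v x) \<partial>lborel) = (\<integral>\<^sup>+x. f x \<partial>lborel)"
        using nn_integral_scale_coords[OF f, of "\<lambda>i. A $ i $ i"] d by (simp add: dd abs_prod)
    qed
  next
    case (4 m n)
    let ?T = "Transposition.transpose m n"
    let ?A = "\<chi> i j. mat 1 $ i $ ?T j :: real^'n^'n"
    have "?A *v x = (\<chi> i. x $ ?T i)" for x :: "real^'n"
    proof -
      have "(\<Sum>j\<in>UNIV. (mat 1 :: real^'n^'n) $ i $ ?T j * x $ j) = (\<Sum>j\<in>UNIV. if j = ?T i then x $ j else 0)" for i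
        by (intro sum.cong) (auto simp: mat_def)
      then show ?thesis by (simp add: vec_eq_iff matrix_vector_mult_def)
    qed
    note T = this
    have "\<bar>det ?A\<bar> = 1"
      using det_permute_columns[of ?T "mat 1 :: real^'n^'n"] permutes_swap_id[of m UNIV n]
        det_I[where 'n='n and 'a=real]
      by (simp add: sign_swap_id mat_def)
    \<comment> \<open>A transposition of coordinates maps boxes to boxes of equal volume, and
      Lebesgue measure is determined by its values on boxes.\<close>
    moreover have "distr lborel borel (\<lambda>x::real^'n. (\<chi> i. x $ ?T i)) = lborel"
    proof (rule lborel_eqI[symmetric])
      fix l u :: "real^'n" assume le: "\<And>b. b \<in> Basis \<Longrightarrow> l \<bullet> b \<le> u \<bullet> b"
      have le': "l $ i \<le> u $ i" for i using le[of "axis i 1"] by (simp add: cart_eq_inner_axis)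
      let ?sw = "\<lambda>x::real^'n. (\<chi> i. x $ ?T i) :: real^'n"
      have inv: "?T (?T i) = i" for i by simp
      have "?sw -` box l u = box (?sw l) (?sw u)"
        apply (auto simp: mem_box_cart)
         apply (metis inv)+
        done
      then have "emeasure (distr lborel borel ?sw) (box l u) = emeasure lborel (box (?sw l) (?sw u))"
        by (simp add: emeasure_distr)
      also have "\<dots> = (\<Prod>b\<in>Basis. (?sw u - ?sw l) \<bullet> b)"
        by (subst emeasure_lborel_box) (use le' in \<open>auto simp: Basis_vec_def cart_eq_inner_axis[symmetric]\<close>)
      also have "(\<Prod>b\<in>Basis. (?sw u - ?sw l) \<bullet> b) = (\<Prod>i\<in>UNIV. (u - l) $ ?T i)"
        by (simp add: prod_Basis_vec)
      also have "\<dots> = (\<Prod>i\<in>UNIV. (u - l) $ i)"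
        by (rule prod.reindex_bij_betw[OF bij_betw_byWitness[where f'="?T"]]) auto
      also have "\<dots> = (\<Prod>b\<in>Basis. (u - l) \<bullet> b)"
        by (simp add: prod_Basis_vec)
      finally show "emeasure (distr lborel borel ?sw) (box l u) = (\<Prod>b\<in>Basis. (u - l) \<bullet> b)" .
    qed simp
    then have "(\<integral>\<^sup>+x. f (\<chi> i. x $ ?T i) \<partial>lborel) = (\<integral>\<^sup>+x. f x \<partial>lborel)"
      if [measurable]: "f \<in> borel_measurable borel" for f :: "real^'n \<Rightarrow> ennreal"
      using nn_integral_distr[of "\<lambda>x::real^'n. (\<chi> i. x $ ?T i)" lborel borel f] by simp
    ultimately show ?case unfolding T by simp
  next
    case (5 m n c) then show ?case using sh by auto
  qed
  then show ?thesis using assms by auto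
qed

subsection \<open>Positive definite matrices\<close>

lemma matrix_inv_mult:
  fixes A :: "real^'n^'n"
  assumes "det A \<noteq> 0"
  shows "matrix_inv A ** A = mat 1" "A ** matrix_inv A = mat 1"
  using someI_ex[of "\<lambda>A'. A ** A' = mat 1 \<and> A' ** A = mat 1"] assms
  by (auto simp: matrix_inv_def invertible_det_nz[symmetric] invertible_def)

lemma matrix_inv_eq:
  fixes A :: "real^'n^'n"
  assumes "A ** B = mat 1"
  shows "matrix_inv A = B"
proof -
  have "det A \<noteq> 0" using assms by (metis det_I det_mul mult_zero_left zero_neq_one)
  then show ?thesis by (metis assms matrix_inv_mult(1) matrix_mul_assoc matrix_mul_lid matrix_mul_rid)
qed

lemma inner_matrix_vector: "x \<bullet> (A *v y) = (transpose A *v x) \<bullet> y" for A :: "real^'n^'m"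
  by (simp add: dot_lmul_matrix)

lemma inner_matrix_vector_sum: "x \<bullet> (A *v y) = (\<Sum>i\<in>UNIV. \<Sum>j\<in>UNIV. A $ i $ j * (x $ i * y $ j))" for A :: "real^'n^'m"
  by (simp add: inner_vec_def matrix_vector_mult_def sum_distrib_left algebra_simps)

lemma pos_def_imp_semidef: "pos_def A \<Longrightarrow> pos_semidef A"
  by (auto simp: pos_def_def pos_semidef_def) (metis inner_zero_left less_eq_real_def)

lemma pos_def_zero_less: "0 \<prec> A \<longleftrightarrow> pos_def A" by (simp add: loewner_less_def)

lemma transpose_add: "transpose (A + B) = transpose A + transpose (B :: real^'n^'m)"
  by (simp add: transpose_def vec_eq_iff)

lemma transpose_diff: "transpose (A - B) = transpose A - transpose (B :: real^'n^'m)"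
  by (simp add: transpose_def vec_eq_iff)

lemma pos_def_add: "pos_def A \<Longrightarrow> pos_semidef B \<Longrightarrow> pos_def (A + B)"
  by (auto simp: pos_def_def pos_semidef_def transpose_add matrix_vector_mult_add_rdistrib inner_add_right add_pos_nonneg)

text \<open>Gram-Schmidt for the inner product \<open>x \<bullet> (A *v y)\<close>. As long as fewer
  vectors than the dimension have been found, some vector lies outside their span.\<close>

lemma pos_def_orthonormal_set:
  fixes A :: "real^'n^'n"
  assumes A: "pos_def A" and "k \<le> CARD('n)"
  shows "\<exists>T. finite T \<and> card T = k \<and> (\<forall>x\<in>T. \<forall>y\<in>T. x \<bullet> (A *v y) = of_bool (x = y))"
  using assms(2)
proof (induction k)
  case 0 then show ?case by (intro exI[of _ "{}"]) auto
next
  case (Suc k)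
  then obtain T where T: "finite T" "card T = k" "\<forall>x\<in>T. \<forall>y\<in>T. x \<bullet> (A *v y) = of_bool (x = y)" by auto
  have "dim (span T) < CARD('n)" using T Suc.prems dim_le_card'[of T] by (simp add: dim_span)
  then have "span T \<noteq> UNIV" by (metis dim_UNIV DIM_cart DIM_real less_irrefl mult.right_neutral)
  then obtain x where x: "x \<notin> span T" by auto
  define y where "y = x - (\<Sum>t\<in>T. (t \<bullet> (A *v x)) *\<^sub>R t)"
  have "y \<noteq> 0"
  proof
    assume "y = 0"
    then have "x = (\<Sum>t\<in>T. (t \<bullet> (A *v x)) *\<^sub>R t)" by (simp add: y_def)
    also have "\<dots> \<in> span T" by (intro span_sum span_scale span_base)
    finally show False using x by simp
  qed
  have sym: "u \<bullet> (A *v v) = v \<bullet> (A *v u)" for u v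
    using A by (metis inner_commute inner_matrix_vector pos_def_def)
  have ty: "t \<bullet> (A *v y) = 0" if "t \<in> T" for t
  proof -
    have "A *v y = A *v x - (\<Sum>s\<in>T. (s \<bullet> (A *v x)) *\<^sub>R (A *v s))"
      unfolding y_def by (simp add: matrix_vector_mult_diff_distrib linear_sum[OF matrix_vector_mul_linear] matrix_vector_mult_scaleR)
    then have "t \<bullet> (A *v y) = t \<bullet> (A *v x) - (\<Sum>s\<in>T. (s \<bullet> (A *v x)) * (t \<bullet> (A *v s)))"
      by (simp add: inner_diff_right inner_sum_right)
    also have "(\<Sum>s\<in>T. (s \<bullet> (A *v x)) * (t \<bullet> (A *v s))) = (\<Sum>s\<in>T. if s = t then t \<bullet> (A *v x) else 0)"
      using T that by (intro sum.cong) auto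
    finally show ?thesis using T that by simp
  qed
  have yy: "y \<bullet> (A *v y) > 0" using A \<open>y \<noteq> 0\<close> by (auto simp: pos_def_def)
  define z where "z = (1 / sqrt (y \<bullet> (A *v y))) *\<^sub>R y"
  have zz: "z \<bullet> (A *v z) = 1" using yy by (simp add: z_def matrix_vector_mult_scaleR)
  have tz: "t \<bullet> (A *v z) = 0" "z \<bullet> (A *v t) = 0" if "t \<in> T" for t
    using ty[OF that] sym[of z t] by (auto simp: z_def matrix_vector_mult_scaleR)
  have "z \<notin> T" using tz zz by force
  with T tz zz show ?case by (intro exI[of _ "insert z T"]) (auto simp: of_bool_def)
qed

text \<open>The columns of \<open>B\<close> are a basis that is orthonormal for the inner product of
  \<open>A\<close>. This congruence stands in for a square root of the inverse everywhere below: for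
  determinants, for Gaussian densities and for traces.\<close>

lemma pos_def_whitening:
  fixes A :: "real^'n^'n"
  assumes A: "pos_def A"
  obtains B where "det B \<noteq> 0" "transpose B ** A ** B = mat 1" "matrix_inv A = B ** transpose B"
    "det A * (det B)\<^sup>2 = 1"
proof -
  obtain T where T: "finite T" "card T = CARD('n)" "\<forall>x\<in>T. \<forall>y\<in>T. x \<bullet> (A *v y) = of_bool (x = y)"
    using pos_def_orthonormal_set[OF A order_refl] by auto
  obtain g where g: "bij_betw g (UNIV :: 'n set) T"
    using T finite_same_card_bij[of "UNIV :: 'n set" T] by auto
  define B :: "real^'n^'n" where "B = (\<chi> i j. g j $ i)"
  have "(transpose B ** A ** B) $ i $ j = g i \<bullet> (A *v g j)" for i j
    unfolding matrix_mul_assoc[symmetric]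
    by (simp add: inner_vec_def matrix_matrix_mult_def transpose_def B_def matrix_vector_mult_def)
  moreover have "g i \<bullet> (A *v g j) = of_bool (i = j)" for i j
    using g T by (auto simp: bij_betw_def inj_def)
  ultimately have 1: "transpose B ** A ** B = mat 1" by (simp add: vec_eq_iff mat_def of_bool_def)
  then have "det (transpose B ** A ** B) = 1" by simp
  then have d: "det A * (det B)\<^sup>2 = 1" by (simp add: det_mul power2_eq_square algebra_simps)
  have "A ** (B ** transpose B) = mat 1"
    using 1 by (metis matrix_left_right_inverse matrix_mul_assoc)
  from matrix_inv_eq[OF this] d 1 show ?thesis by (intro that) auto
qed

lemma pos_def_det_pos:
  assumes "pos_def A" shows "0 < det A"
proof -
  obtain B where B0: "det B \<noteq> 0" "transpose B ** A ** B = mat 1" and B: "matrix_inv A = B ** transpose B"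
    "det A * (det B)\<^sup>2 = 1" by (rule pos_def_whitening[OF assms])
  show ?thesis
    using B(2) mult_nonpos_nonneg[of "det A" "(det B)\<^sup>2"] by (cases "0 < det A") auto
qed

lemma pos_def_inv:
  assumes A: "pos_def A" shows "pos_def (matrix_inv A)"
proof -
  obtain B where B0: "det B \<noteq> 0" "transpose B ** A ** B = mat 1" and B: "matrix_inv A = B ** transpose B"
    "det A * (det B)\<^sup>2 = 1" by (rule pos_def_whitening[OF assms])
  have "x \<bullet> (matrix_inv A *v x) = (transpose B *v x) \<bullet> (transpose B *v x)" for x
    unfolding B(1) matrix_vector_mul_assoc[symmetric] inner_matrix_vector ..
  moreover have "transpose B *v x \<noteq> 0" if "x \<noteq> 0" for x
    using that B0(1) by (metis det_transpose invertible_det_nz matrix_inv_mult(1) matrix_vector_mul_assoc matrix_vector_mul_lid matrix_vector_mult_0_right)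
  ultimately show ?thesis by (auto simp: pos_def_def B matrix_transpose_mul)
qed

subsection \<open>Gaussian densities on finite-dimensional spaces\<close>

text \<open>Indexes the coordinates by the type \<open>'n\<close> instead of by basis vectors, so
  that integrands which are products over coordinates split into one-dimensional integrals.\<close>

lemma lborel_vec_eq: "(lborel :: (real^'n) measure) = distr (Pi\<^sub>M UNIV (\<lambda>_::'n. lborel :: real measure)) borel (\<lambda>f. \<chi> i. f i)"
proof (rule lborel_eqI)
  interpret product_sigma_finite "\<lambda>_::'n. (lborel :: real measure)" ..
  fix l u :: "real^'n" assume le: "\<And>b. b \<in> Basis \<Longrightarrow> l \<bullet> b \<le> u \<bullet> b"
  have le': "l $ i \<le> u $ i" for i using le[of "axis i 1"] by (simp add: inner_axis)
  have m[measurable]: "(\<lambda>f. \<chi> i. (f i :: real)) \<in> Pi\<^sub>M UNIV (\<lambda>_::'n. lborel :: real measure) \<rightarrow>\<^sub>M borel"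
    by (intro borel_measurable_vec_lambda) measurable
  have "(\<lambda>f. \<chi> i. f i) -` box l u \<inter> space (Pi\<^sub>M UNIV (\<lambda>_::'n. lborel :: real measure)) = Pi\<^sub>E UNIV (\<lambda>i. {l $ i<..<u $ i})"
    by (auto simp: mem_box_cart space_PiM PiE_def Pi_iff)
  then have "emeasure (distr (Pi\<^sub>M UNIV (\<lambda>_::'n. lborel :: real measure)) borel (\<lambda>f. \<chi> i. f i)) (box l u) = (\<Prod>i\<in>UNIV. emeasure lborel {l $ i<..<u $ i})"
    by (simp add: emeasure_distr emeasure_PiM)
  also have "\<dots> = (\<Prod>i\<in>UNIV. ennreal ((u - l) $ i))"
    using le' by (intro prod.cong) auto
  also have "\<dots> = ennreal (\<Prod>b\<in>Basis. (u - l) \<bullet> b)"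
    using le' by (simp add: prod_Basis_vec prod_ennreal)
  finally show "emeasure (distr (Pi\<^sub>M UNIV (\<lambda>_::'n. lborel :: real measure)) borel (\<lambda>f. \<chi> i. f i)) (box l u) = ennreal (\<Prod>b\<in>Basis. (u - l) \<bullet> b)" .
qed simp

lemma measurable_vec_lambda_PiM [measurable]: "(\<lambda>f. \<chi> i. (f i :: real)) \<in> Pi\<^sub>M UNIV (\<lambda>_::'n::finite. lborel :: real measure) \<rightarrow>\<^sub>M borel"
  by (intro borel_measurable_vec_lambda) measurable

lemma nn_integral_vec_prod:
  fixes f :: "'n::finite \<Rightarrow> real \<Rightarrow> ennreal"
  assumes [measurable]: "\<And>i. f i \<in> borel_measurable borel"
  shows "(\<integral>\<^sup>+x. (\<Prod>i\<in>UNIV. f i (x $ i)) \<partial>lborel) = (\<Prod>i\<in>UNIV. \<integral>\<^sup>+x. f i x \<partial>lborel)"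
proof -
  interpret product_sigma_finite "\<lambda>_::'n. (lborel :: real measure)" ..
  show ?thesis
    by (subst lborel_vec_eq, subst nn_integral_distr) (auto simp: product_nn_integral_prod)
qed

text \<open>The codomain is a general field because real moments and the complex characteristic
  function both factor this way.\<close>

lemma integral_vec_prod:
  fixes f :: "'n::finite \<Rightarrow> real \<Rightarrow> 'c::{real_normed_field, banach, second_countable_topology}"
  assumes [simp]: "\<And>i. integrable lborel (f i)"
  shows "integrable lborel (\<lambda>x. \<Prod>i\<in>UNIV. f i (x $ i))"
    "(\<integral>x. (\<Prod>i\<in>UNIV. f i (x $ i)) \<partial>lborel) = (\<Prod>i\<in>UNIV. \<integral>x. f i x \<partial>lborel)"
proof -
  interpret product_sigma_finite "\<lambda>_::'n. (lborel :: real measure)" ..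
  have [measurable]: "f i \<in> borel_measurable borel" for i
    using borel_measurable_integrable[OF assms[of i]] by simp
  show "integrable lborel (\<lambda>x. \<Prod>i\<in>UNIV. f i (x $ i))"
    by (subst lborel_vec_eq, subst integrable_distr_eq) (auto intro!: product_integrable_prod)
  show "(\<integral>x. (\<Prod>i\<in>UNIV. f i (x $ i)) \<partial>lborel) = (\<Prod>i\<in>UNIV. \<integral>x. f i x \<partial>lborel)"
    by (subst lborel_vec_eq, subst integral_distr) (auto simp: product_integral_prod)
qed

definition std_gauss :: "real^'n \<Rightarrow> real" where
  "std_gauss x = (\<Prod>i\<in>UNIV. std_normal_density (x $ i))"

definition gauss_density :: "real^'n^'n \<Rightarrow> real^'n \<Rightarrow> real" where
  "gauss_density A x = exp (- (x \<bullet> (matrix_inv A *v x)) / 2) / sqrt ((2 * pi) ^ CARD('n) * det A)"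

lemma std_gauss_eq: "std_gauss x = exp (- (x \<bullet> x) / 2) / sqrt ((2 * pi) ^ CARD('n))" for x :: "real^'n"
proof -
  have "std_gauss x = (1 / sqrt (2 * pi)) ^ CARD('n) * exp (\<Sum>i\<in>UNIV. - (x $ i)\<^sup>2 / 2)"
    unfolding std_gauss_def std_normal_density_def prod.distrib by (simp add: exp_sum)
  also have "(\<Sum>i\<in>UNIV. - (x $ i)\<^sup>2 / 2) = - (x \<bullet> x) / 2"
    by (simp add: inner_vec_def power2_eq_square sum_negf sum_divide_distrib)
  finally show ?thesis by (simp add: power_divide real_sqrt_power[symmetric])
qed

lemma std_gauss_measurable [measurable]: "std_gauss \<in> borel_measurable borel"
  unfolding std_gauss_def by measurable

lemma gauss_density_measurable [measurable]: "gauss_density A \<in> borel_measurable borel"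
  unfolding gauss_density_def by measurable

lemma gauss_density_pos: "pos_def A \<Longrightarrow> 0 < gauss_density A x"
  by (simp add: gauss_density_def pos_def_det_pos)

lemma std_gauss_nonneg: "0 \<le> std_gauss x" by (simp add: std_gauss_def prod_nonneg)

text \<open>In the coordinates \<open>transpose B *v x\<close> the quadratic form becomes the
  Euclidean one, and \<open>\<bar>det B\<bar>\<close> is both the Jacobian and the ratio of the
  normalising constants.\<close>

lemma gauss_density_whitening:
  fixes A :: "real^'n^'n"
  assumes B: "matrix_inv A = B ** transpose B" "det A * (det B)\<^sup>2 = 1"
  shows "gauss_density A x = \<bar>det B\<bar> * std_gauss (transpose B *v x)"
proof -
  have "x \<bullet> (matrix_inv A *v x) = (transpose B *v x) \<bullet> (transpose B *v x)"
    unfolding B matrix_vector_mul_assoc[symmetric] inner_matrix_vector ..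
  moreover have "1 / sqrt (det A) = \<bar>det B\<bar>"
    using B(2) by (metis nonzero_divide_eq_eq mult.commute mult_zero_left real_sqrt_abs real_sqrt_mult real_sqrt_one zero_neq_one)
  ultimately show ?thesis
    by (simp add: gauss_density_def std_gauss_eq real_sqrt_mult divide_simps)
qed

lemma nn_integral_std_gauss: "(\<integral>\<^sup>+x. std_gauss x \<partial>(lborel :: (real^'n) measure)) = 1"
proof -
  have "(\<integral>\<^sup>+x. std_normal_density x \<partial>lborel) = 1"
    by (subst nn_integral_eq_integral) auto
  then show ?thesis
    using nn_integral_vec_prod[of "\<lambda>_::'n. \<lambda>x. ennreal (std_normal_density x)"]
    by (simp add: std_gauss_def prod_ennreal)
qed

lemma nn_integral_gauss_density_eq:
  fixes A :: "real^'n^'n"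
  assumes B: "matrix_inv A = B ** transpose B" "det A * (det B)\<^sup>2 = 1"
    and [measurable]: "h \<in> borel_measurable borel"
  shows "(\<integral>\<^sup>+x. ennreal (gauss_density A x) * h x \<partial>lborel) = (\<integral>\<^sup>+x. ennreal (std_gauss x) * h ((A ** B) *v x) \<partial>lborel)"
proof -
  have d: "det (transpose B) \<noteq> 0" "det A \<noteq> 0" using B(2) by auto
  \<comment> \<open>So \<open>A ** B\<close> undoes the whitening map \<open>transpose B\<close>,
    and a standard Gaussian vector mapped by \<open>A ** B\<close> has covariance
    \<open>A\<close>.\<close>
  have "A ** B ** transpose B = mat 1"
    using matrix_inv_mult(2)[OF d(2)] by (simp add: B(1) matrix_mul_assoc)
  then have e: "(A ** B) *v (transpose B *v x) = x" for x
    by (metis matrix_vector_mul_assoc matrix_vector_mul_lid)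
  have "(\<integral>\<^sup>+x. ennreal (gauss_density A x) * h x \<partial>lborel)
     = (\<integral>\<^sup>+x. ennreal \<bar>det (transpose B)\<bar> * (ennreal (std_gauss (transpose B *v x)) * h ((A ** B) *v (transpose B *v x))) \<partial>lborel)"
    unfolding gauss_density_whitening[OF B] e by (simp add: ennreal_mult' mult.assoc del: transpose_matrix_vector)
  also have "\<dots> = ennreal \<bar>det (transpose B)\<bar> * (\<integral>\<^sup>+x. ennreal (std_gauss (transpose B *v x)) * h ((A ** B) *v (transpose B *v x)) \<partial>lborel)"
    by (rule nn_integral_cmult) measurable
  also have "\<dots> = (\<integral>\<^sup>+x. ennreal (std_gauss x) * h ((A ** B) *v x) \<partial>lborel)"
    by (rule nn_integral_linear_change[OF d(1)]) measurable
  finally show ?thesis .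
qed

lemma nn_integral_gauss_density:
  fixes A :: "real^'n^'n"
  assumes "pos_def A"
  shows "(\<integral>\<^sup>+x. gauss_density A x \<partial>lborel) = 1"
proof -
  obtain B where B0: "det B \<noteq> 0" "transpose B ** A ** B = mat 1" and B: "matrix_inv A = B ** transpose B"
    "det A * (det B)\<^sup>2 = 1" by (rule pos_def_whitening[OF assms])
  from nn_integral_gauss_density_eq[OF B, of "\<lambda>_. 1"] show ?thesis by (simp add: nn_integral_std_gauss)
qed

definition gauss_measure :: "real^'n^'n \<Rightarrow> (real^'n) measure" where
  "gauss_measure A = density lborel (gauss_density A)"

lemma sets_gauss_measure [simp, measurable_cong]: "sets (gauss_measure A) = sets borel"
  and space_gauss_measure [simp]: "space (gauss_measure A) = UNIV"
  by (simp_all add: gauss_measure_def)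

lemma prob_space_gauss_measure: "pos_def A \<Longrightarrow> prob_space (gauss_measure A)"
  by (rule prob_spaceI) (simp add: gauss_measure_def emeasure_density nn_integral_gauss_density)

lemma std_gauss_moments:
  fixes k l :: "'n::finite"
  shows "integrable lborel (\<lambda>x::real^'n. std_gauss x * (x $ k))" "(\<integral>x. std_gauss x * (x $ k) \<partial>lborel) = 0"
    "integrable lborel (\<lambda>x::real^'n. std_gauss x * (x $ k * x $ l))" "(\<integral>x. std_gauss x * (x $ k * x $ l) \<partial>lborel) = of_bool (k = l)"
proof -
  have m: "integrable lborel (\<lambda>x. std_normal_density x)" "(\<integral>x. std_normal_density x \<partial>lborel) = 1"
    "integrable lborel (\<lambda>x. std_normal_density x * x)" "(\<integral>x. std_normal_density x * x \<partial>lborel) = 0"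
    "integrable lborel (\<lambda>x. std_normal_density x * x^2)" "(\<integral>x. std_normal_density x * x^2 \<partial>lborel) = 1"
    using std_normal_moment_even[of 1] integrable_std_normal_moment[of 1] integral_std_normal_moment_odd[of 0]
      integrable_std_normal_moment[of 2]
    by (auto simp: has_bochner_integral_iff)
  define f where "f i x = std_normal_density x * (if i = k then x else 1)" for i x
  define g where "g i x = std_normal_density x * ((if i = k then x else 1) * (if i = l then x else 1))" for i x
  have f: "std_gauss x * (x $ k) = (\<Prod>i\<in>UNIV. f i (x $ i))" for x
    by (simp add: std_gauss_def f_def prod.distrib)
  have g: "std_gauss x * (x $ k * x $ l) = (\<Prod>i\<in>UNIV. g i (x $ i))" for x
    by (simp add: std_gauss_def g_def prod.distrib)
  have fi: "integrable lborel (f i)" "(\<integral>x. f i x \<partial>lborel) = (if i = k then 0 else 1)" for i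
    unfolding f_def using m by (cases "i = k", auto)+
  have gi: "integrable lborel (g i)" "(\<integral>x. g i x \<partial>lborel) = (if (i = k) \<noteq> (i = l) then 0 else 1)" for i
    unfolding g_def using m by (cases "i = k"; cases "i = l"; auto simp: power2_eq_square)+
  show "integrable lborel (\<lambda>x::real^'n. std_gauss x * (x $ k))" "(\<integral>x. std_gauss x * (x $ k) \<partial>lborel) = 0"
    unfolding f using integral_vec_prod[of f] fi by auto
  \<comment> \<open>A factor vanishes exactly if its coordinate is one of \<open>k\<close>,
    \<open>l\<close> but not both, and such a coordinate exists if and only if
    \<open>k \<noteq> l\<close>.\<close>
  have "(\<Prod>i\<in>UNIV. if (i = k) \<noteq> (i = l) then 0 else 1) = (of_bool (k = l) :: real)"
  proof (cases "k = l")
    case False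
    then show ?thesis by (simp add: prod_zero_iff) auto
  qed simp
  then show "integrable lborel (\<lambda>x::real^'n. std_gauss x * (x $ k * x $ l))" "(\<integral>x. std_gauss x * (x $ k * x $ l) \<partial>lborel) = of_bool (k = l)"
    unfolding g using integral_vec_prod[of g] gi by auto
qed

lemma gauss_measure_eq_distr:
  fixes A :: "real^'n^'n"
  assumes B: "matrix_inv A = B ** transpose B" "det A * (det B)\<^sup>2 = 1"
  shows "gauss_measure A = distr (density lborel std_gauss) borel (\<lambda>x. (A ** B) *v x)"
proof (rule measure_eqI)
  fix X assume "X \<in> sets (gauss_measure A)"
  then have [measurable]: "X \<in> sets borel" by simp
  have "emeasure (gauss_measure A) X = (\<integral>\<^sup>+x. ennreal (gauss_density A x) * indicator X x \<partial>lborel)"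
    by (simp add: gauss_measure_def emeasure_density)
  also have "\<dots> = (\<integral>\<^sup>+x. indicator X x \<partial>distr (density lborel std_gauss) borel (\<lambda>x. (A ** B) *v x))"
    by (subst nn_integral_gauss_density_eq[OF B]) (simp_all add: nn_integral_distr nn_integral_density del: nn_integral_indicator)
  finally show "emeasure (gauss_measure A) X = emeasure (distr (density lborel std_gauss) borel (\<lambda>x. (A ** B) *v x)) X"
    by simp
qed simp

lemma gauss_measure_moments:
  fixes A :: "real^'n^'n"
  assumes "pos_def A"
  shows "integrable (gauss_measure A) (\<lambda>x. x $ i)" "(\<integral>x. x $ i \<partial>gauss_measure A) = 0"
    "integrable (gauss_measure A) (\<lambda>x. x $ i * x $ j)" "(\<integral>x. x $ i * x $ j \<partial>gauss_measure A) = A $ i $ j"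
proof -
  obtain B where B0: "det B \<noteq> 0" "transpose B ** A ** B = mat 1" and B: "matrix_inv A = B ** transpose B"
    "det A * (det B)\<^sup>2 = 1" by (rule pos_def_whitening[OF assms])
  \<comment> \<open>\<open>L\<close> turns standard Gaussian vectors into vectors of covariance
    \<open>L ** transpose L\<close>, which is \<open>A\<close>.\<close>
  define L where "L = A ** B"
  have LL: "L ** transpose L = A ** (B ** transpose B) ** transpose A"
    by (simp add: L_def matrix_transpose_mul matrix_mul_assoc)
  have "det A \<noteq> 0" using B(2) by auto
  then have "A ** (B ** transpose B) ** transpose A = A"
    using assms B(2) matrix_inv_mult(2)[of A] by (auto simp: pos_def_def B(1) matrix_mul_assoc)
  with LL have "L ** transpose L = A" by simp
  then have L: "(\<Sum>k\<in>UNIV. L $ i $ k * L $ j $ k) = A $ i $ j"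
    by (auto simp: vec_eq_iff matrix_matrix_mult_def transpose_def)
  have Lx: "(L *v x) $ i = (\<Sum>k\<in>UNIV. L $ i $ k * x $ k)" for x i by (simp add: matrix_vector_mult_def)
  have [simp]: "AE x in lborel. 0 \<le> std_gauss x" by (simp add: std_gauss_nonneg)
  have e1: "std_gauss x * (L *v x) $ i = (\<Sum>k\<in>UNIV. L $ i $ k * (std_gauss x * x $ k))" for x
    by (simp add: Lx sum_distrib_left algebra_simps)
  have e2: "std_gauss x * ((L *v x) $ i * (L *v x) $ j) = (\<Sum>k\<in>UNIV. \<Sum>l\<in>UNIV. L $ i $ k * L $ j $ l * (std_gauss x * (x $ k * x $ l)))" for x
    unfolding Lx sum_product by (simp add: sum_distrib_left algebra_simps)
  note d = gauss_measure_eq_distr[OF B, folded L_def]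
  show "integrable (gauss_measure A) (\<lambda>x. x $ i)" "(\<integral>x. x $ i \<partial>gauss_measure A) = 0"
    "integrable (gauss_measure A) (\<lambda>x. x $ i * x $ j)"
    unfolding d by (simp_all add: integrable_distr_eq integral_distr integrable_density integral_density e1 e2 std_gauss_moments)
  have "(\<integral>x. x $ i * x $ j \<partial>gauss_measure A) = (\<Sum>k\<in>UNIV. \<Sum>l\<in>UNIV. L $ i $ k * L $ j $ l * of_bool (k = l))"
    unfolding d by (simp add: integral_distr integral_density e2 std_gauss_moments)
  also have "\<dots> = A $ i $ j" using L by (simp add: of_bool_def if_distrib cong: if_cong)
  finally show "(\<integral>x. x $ i * x $ j \<partial>gauss_measure A) = A $ i $ j" .
qed

text \<open>Completion of the square in the joint exponent of s and u = P s + v, for s and v of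
  covariance \<open>A\<close> and \<open>K\<close>. The vector \<open>m\<close> is the posterior
  mean of s given u, so no term linear in \<open>s - m\<close> remains, and what depends on u alone
  is the exponent of its marginal.\<close>

lemma quadratic_completion:
  fixes P :: "real^'a^'b" and u :: "real^'b"
  assumes A: "pos_def A" and K: "pos_def K" and Q: "Q = P ** A ** transpose P + K"
    and Qi: "det Q \<noteq> 0"
  defines "m \<equiv> A *v (transpose P *v (matrix_inv Q *v u))"
  shows "s \<bullet> (matrix_inv A *v s) + (u - P *v s) \<bullet> (matrix_inv K *v (u - P *v s))
    = (s - m) \<bullet> (matrix_inv A *v (s - m)) + (P *v (s - m)) \<bullet> (matrix_inv K *v (P *v (s - m))) + u \<bullet> (matrix_inv Q *v u)"
proof -
  define y where "y = matrix_inv Q *v u"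
  define h where "h = s - m"
  have s: "s = m + h" by (simp add: h_def)
  have "Q *v y = u" unfolding y_def by (metis Qi matrix_inv_mult(2) matrix_vector_mul_assoc matrix_vector_mul_lid)
  moreover have "Q *v y = P *v (A *v (transpose P *v y)) + K *v y"
    by (simp add: Q matrix_vector_mult_add_rdistrib matrix_vector_mul_assoc[symmetric] del: transpose_matrix_vector)
  ultimately have u: "u = P *v m + K *v y" by (simp add: m_def y_def)
  have us: "u - P *v s = K *v y - P *v h" by (simp add: u s matrix_vector_right_distrib)
  have dA: "det A \<noteq> 0" and dK: "det K \<noteq> 0" using pos_def_det_pos[OF A] pos_def_det_pos[OF K] by auto
  have Am: "matrix_inv A *v m = transpose P *v y"
    unfolding m_def y_def[symmetric] by (metis dA matrix_inv_mult(1) matrix_vector_mul_assoc matrix_vector_mul_lid)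
  have Ky: "matrix_inv K *v (K *v y) = y"
    by (metis dK matrix_inv_mult(1) matrix_vector_mul_assoc matrix_vector_mul_lid)
  have symA: "x \<bullet> (matrix_inv A *v z) = (matrix_inv A *v x) \<bullet> z" for x z
    using pos_def_inv[OF A] by (metis inner_matrix_vector pos_def_def)
  have symK: "x \<bullet> (matrix_inv K *v z) = (matrix_inv K *v x) \<bullet> z" for x z
    using pos_def_inv[OF K] by (metis inner_matrix_vector pos_def_def)
  have PT: "(transpose P *v y) \<bullet> z = y \<bullet> (P *v z)" for z by (simp add: inner_matrix_vector)
  have uy: "u \<bullet> y = (P *v m) \<bullet> y + (K *v y) \<bullet> y" by (simp add: u inner_add_left)
  have 1: "s \<bullet> (matrix_inv A *v s) = y \<bullet> (P *v m) + 2 * (y \<bullet> (P *v h)) + h \<bullet> (matrix_inv A *v h)"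
    using symA[of h m] symA[of m h] PT[of m] PT[of h]
    by (simp add: s matrix_vector_right_distrib inner_add_left inner_add_right Am inner_commute del: transpose_matrix_vector)
  have 2: "(u - P *v s) \<bullet> (matrix_inv K *v (u - P *v s)) = (K *v y) \<bullet> y - 2 * (y \<bullet> (P *v h)) + (P *v h) \<bullet> (matrix_inv K *v (P *v h))"
    unfolding us using symK[of "K *v y" "P *v h"]
    by (simp add: matrix_vector_mult_diff_distrib inner_diff_left inner_diff_right Ky inner_commute)
  show ?thesis unfolding 1 2 h_def[symmetric] y_def[symmetric] uy by (simp add: inner_commute)
qed

text \<open>The normalising constant of the convolution is not computed: both sides integrate to 1.\<close>

lemma gauss_density_convolution:
  fixes P :: "real^'a^'b"
  assumes A: "pos_def A" and K: "pos_def K"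
  defines "Q \<equiv> P ** A ** transpose P + K"
  shows "pos_def Q"
    "(\<integral>\<^sup>+s. gauss_density A s * gauss_density K (u - P *v s) \<partial>lborel) = gauss_density Q u"
proof -
  have "pos_semidef (P ** A ** transpose P)"
  proof -
    have "x \<bullet> (P ** A ** transpose P *v x) = (transpose P *v x) \<bullet> (A *v (transpose P *v x))" for x
      by (simp add: matrix_vector_mul_assoc[symmetric] inner_matrix_vector)
    then show ?thesis
      using pos_def_imp_semidef[OF A] by (auto simp: pos_semidef_def matrix_transpose_mul matrix_mul_assoc)
  qed
  from pos_def_add[OF K this] show Q: "pos_def Q" by (simp add: Q_def add.commute)
  then have dQ: "det Q > 0" by (rule pos_def_det_pos)
  \<comment> \<open>The unnormalised posterior density around its mean. Its shape does not depend on
    \<open>u\<close>, so by translation invariance its integral does not either.\<close>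
  define G where "G s = exp (- (s \<bullet> (matrix_inv A *v s) + (P *v s) \<bullet> (matrix_inv K *v (P *v s))) / 2)" for s
  define c where "c = 1 / sqrt ((2 * pi) ^ CARD('a) * det A) / sqrt ((2 * pi) ^ CARD('b) * det K)"
  define d where "d = sqrt ((2 * pi) ^ CARD('b) * det Q)"
  have d0: "d > 0" using dQ by (simp add: d_def)
  have [measurable]: "G \<in> borel_measurable borel" unfolding G_def by measurable
  define C where "C = c * d * (\<integral>\<^sup>+s. G s \<partial>lborel)"
  have c0: "c \<ge> 0" using pos_def_det_pos[OF A] pos_def_det_pos[OF K] by (simp add: c_def)
  have *: "(\<integral>\<^sup>+s. gauss_density A s * gauss_density K (u - P *v s) \<partial>lborel) = C * gauss_density Q u" for u
  proof -
    define m where "m = A *v (transpose P *v (matrix_inv Q *v u))"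
    have ex: "exp (- (p + q) / 2) = exp (- p / 2) * exp (- q / 2)" for p q :: real
      by (simp add: exp_add[symmetric] add_divide_distrib[symmetric])
    have 1: "gauss_density A s * gauss_density K (u - P *v s)
       = c * exp (- (s \<bullet> (matrix_inv A *v s) + (u - P *v s) \<bullet> (matrix_inv K *v (u - P *v s))) / 2)" for s
      unfolding ex by (simp add: gauss_density_def c_def)
    have 2: "d * gauss_density Q u = exp (- (u \<bullet> (matrix_inv Q *v u)) / 2)"
      using d0 dQ by (simp add: gauss_density_def d_def)
    have 3: "s \<bullet> (matrix_inv A *v s) + (u - P *v s) \<bullet> (matrix_inv K *v (u - P *v s))
      = (s - m) \<bullet> (matrix_inv A *v (s - m)) + (P *v (s - m)) \<bullet> (matrix_inv K *v (P *v (s - m))) + u \<bullet> (matrix_inv Q *v u)" for s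
      unfolding m_def by (rule quadratic_completion[OF A K]) (use dQ in \<open>auto simp: Q_def\<close>)
    have "gauss_density A s * gauss_density K (u - P *v s) = c * (G (s - m) * (d * gauss_density Q u))" for s
      unfolding 1 2 3 G_def ex[of "_ + _" "u \<bullet> _"] ..
    then have "gauss_density A s * gauss_density K (u - P *v s) = c * d * gauss_density Q u * G (- m + s)" for s
      by (simp add: mult_ac)
    then have "(\<integral>\<^sup>+s. gauss_density A s * gauss_density K (u - P *v s) \<partial>lborel)
       = (\<integral>\<^sup>+s. ennreal (c * d * gauss_density Q u) * G (- m + s) \<partial>lborel)"
      using c0 d0 gauss_density_pos[OF Q, of u] by (simp add: ennreal_mult' G_def)
    also have "\<dots> = ennreal (c * d * gauss_density Q u) * (\<integral>\<^sup>+s. G s \<partial>lborel)"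
      by (subst nn_integral_cmult, simp, subst nn_integral_lborel_translate) auto
    finally show ?thesis
      using c0 d0 gauss_density_pos[OF Q, of u] by (simp add: C_def ennreal_mult' mult_ac)
  qed
  \<comment> \<open>Integrating the identity \<open>*\<close> over \<open>u\<close> determines
    \<open>C\<close>: one side is \<open>C\<close>, the other is 1 by Fubini and translation
    invariance.\<close>
  have "C * 1 = (\<integral>\<^sup>+u. C * gauss_density Q u \<partial>lborel)"
    by (simp add: nn_integral_cmult nn_integral_gauss_density[OF Q])
  also have "\<dots> = (\<integral>\<^sup>+u. \<integral>\<^sup>+s. gauss_density A s * gauss_density K (u - P *v s) \<partial>lborel \<partial>lborel)"
    by (simp add: *)
  also have "\<dots> = (\<integral>\<^sup>+s. \<integral>\<^sup>+u. gauss_density A s * gauss_density K (u - P *v s) \<partial>lborel \<partial>lborel)"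
    by (rule lborel_pair.Fubini') measurable
  also have "\<dots> = (\<integral>\<^sup>+s. gauss_density A s * (\<integral>\<^sup>+u. gauss_density K (- (P *v s) + u) \<partial>lborel) \<partial>lborel)"
    by (subst nn_integral_cmult[symmetric]) (auto simp: ennreal_mult' gauss_density_pos[OF A] less_imp_le)
  also have "\<dots> = 1"
    by (subst nn_integral_lborel_translate) (auto simp: nn_integral_gauss_density A K)
  finally show "(\<integral>\<^sup>+s. gauss_density A s * gauss_density K (u - P *v s) \<partial>lborel) = gauss_density Q u"
    by (simp add: *)
qed

subsection \<open>The law of a Gaussian vector\<close>

lemma std_gauss_eq_norm: "std_gauss x = exp (- (norm x)\<^sup>2 / 2) / sqrt ((2 * pi) ^ CARD('n))" for x :: "real^'n"
  by (simp add: std_gauss_eq power2_norm_eq_inner)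

lemma prob_space_std_gauss: "prob_space (density lborel (std_gauss :: real^'n \<Rightarrow> real))"
  by (rule prob_spaceI) (simp add: emeasure_density nn_integral_std_gauss)

lemma char_std_gauss:
  fixes t :: "real^'n"
  shows "(\<integral>x. iexp (t \<bullet> x) \<partial>density lborel std_gauss) = complex_of_real (exp (- (norm t)\<^sup>2 / 2))"
proof -
  have 1: "integrable lborel (\<lambda>x. complex_of_real (std_normal_density x) * iexp (s * x))" for s
    by (rule Bochner_Integration.integrable_bound[where f="std_normal_density"]) (auto simp: norm_mult)
  have 2: "(\<integral>x. complex_of_real (std_normal_density x) * iexp (s * x) \<partial>lborel) = complex_of_real (exp (- s\<^sup>2 / 2))" for s
    using char_std_normal_distribution by (auto simp: char_def integral_density scaleR_conv_of_real fun_eq_iff)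
  have "(\<integral>x. iexp (t \<bullet> x) \<partial>density lborel std_gauss) = (\<integral>x. (\<Prod>i\<in>UNIV. complex_of_real (std_normal_density (x $ i)) * iexp (t $ i * x $ i)) \<partial>lborel)"
  proof -
    have "(\<integral>x. iexp (t \<bullet> x) \<partial>density lborel std_gauss) = (\<integral>x. complex_of_real (std_gauss x) * iexp (t \<bullet> x) \<partial>lborel)"
      by (simp add: integral_density std_gauss_nonneg scaleR_conv_of_real)
    then show ?thesis
      by (simp add: std_gauss_def prod.distrib exp_sum[symmetric] inner_vec_def sum_distrib_left)
  qed
  also have "\<dots> = (\<Prod>i\<in>UNIV. complex_of_real (exp (- (t $ i)\<^sup>2 / 2)))"
    by (subst integral_vec_prod(2)[OF 1]) (simp only: 2)
  also have "\<dots> = complex_of_real (exp (\<Sum>i\<in>UNIV. - (t $ i)\<^sup>2 / 2))"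
    by (simp add: exp_sum)
  also have "(\<Sum>i\<in>UNIV. - (t $ i)\<^sup>2 / 2) = - (norm t)\<^sup>2 / 2"
    unfolding power2_norm_eq_inner by (simp add: inner_vec_def power2_eq_square sum_negf sum_divide_distrib)
  finally show ?thesis .
qed

text \<open>The indicator of a closed set is the pointwise limit of continuous functions of the
  distance to it, so dominated convergence gives equality on closed sets, which are stable under
  intersection and generate the Borel sets.\<close>

lemma measure_eqI_continuous:
  fixes \<mu> \<nu> :: "'a::metric_space measure"
  assumes "finite_measure \<mu>" "finite_measure \<nu>" and s: "sets \<mu> = sets borel" "sets \<nu> = sets borel"
    and eq: "\<And>f::'a \<Rightarrow> real. continuous_on UNIV f \<Longrightarrow> (\<And>x. 0 \<le> f x \<and> f x \<le> 1) \<Longrightarrow> (\<integral>x. f x \<partial>\<mu>) = (\<integral>x. f x \<partial>\<nu>)"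
  shows "\<mu> = \<nu>"
proof -
  interpret \<mu>: finite_measure \<mu> by fact
  interpret \<nu>: finite_measure \<nu> by fact
  note [measurable_cong] = s
  have m: "emeasure \<mu> C = emeasure \<nu> C" if C: "closed C" for C
  proof (cases "C = {}")
    case False
    define f where "f k x = max 0 (1 - real k * infdist x C)" for k x
    have c: "continuous_on UNIV (f k)" for k unfolding f_def by (intro continuous_intros)
    then have [measurable]: "f k \<in> borel_measurable borel" for k by (rule borel_measurable_continuous_onI)
    have [measurable]: "C \<in> sets borel" using C by simp
    have b: "0 \<le> f k x \<and> f k x \<le> 1" for k x by (auto simp: f_def infdist_nonneg)
    have lim: "(\<lambda>k. f k x) \<longlonglongrightarrow> indicator C x" for x
    proof (cases "x \<in> C")
      case True then show ?thesis by (simp add: f_def)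
    next
      case False
      then have d: "infdist x C > 0" using C \<open>C \<noteq> {}\<close> by (metis in_closed_iff_infdist_zero infdist_nonneg less_eq_real_def)
      obtain N where N: "1 / infdist x C < real N" using reals_Archimedean2 by blast
      have "f k x = 0" if "k \<ge> N" for k
      proof -
        have "1 / infdist x C < real k" using N that by (meson less_le_trans of_nat_mono)
        then show ?thesis using d by (simp add: f_def field_simps)
      qed
      then have "\<forall>\<^sub>F k in sequentially. f k x = 0" by (auto simp: eventually_sequentially)
      then show ?thesis using False by (simp add: tendsto_eventually)
    qed
    have "(\<lambda>k. \<integral>x. f k x \<partial>\<mu>) \<longlonglongrightarrow> (\<integral>x. indicator C x \<partial>\<mu>)"
      by (rule integral_dominated_convergence[where w="\<lambda>_. 1"]) (use b lim in auto)
    moreover have "(\<lambda>k. \<integral>x. f k x \<partial>\<nu>) \<longlonglongrightarrow> (\<integral>x. indicator C x \<partial>\<nu>)"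
      by (rule integral_dominated_convergence[where w="\<lambda>_. 1"]) (use b lim in auto)
    ultimately have "(\<integral>x. indicator C x \<partial>\<mu>) = (\<integral>x. indicator C x \<partial>\<nu> :: real)"
      using eq[OF c b] LIMSEQ_unique by fastforce
    then show ?thesis by (simp add: \<mu>.emeasure_eq_measure \<nu>.emeasure_eq_measure)
  qed simp
  show ?thesis
  proof (rule measure_eqI_generator_eq[where E="Collect closed" and A="\<lambda>_. UNIV" and \<Omega>=UNIV])
    show "Int_stable (Collect closed)" by (auto simp: Int_stable_def)
    show "sets \<mu> = sigma_sets UNIV (Collect closed)" "sets \<nu> = sigma_sets UNIV (Collect closed)"
      by (simp_all add: s borel_eq_closed)
  qed (use m in auto)
qed

lemma nn_integral_scaleR_change:
  fixes f :: "real^'n \<Rightarrow> ennreal"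
  assumes [measurable]: "f \<in> borel_measurable borel" and "s \<noteq> 0"
  shows "ennreal (\<bar>s\<bar> ^ CARD('n)) * (\<integral>\<^sup>+x. f (s *\<^sub>R x) \<partial>lborel) = (\<integral>\<^sup>+x. f x \<partial>lborel)"
  using nn_integral_scale_coords[of f "\<lambda>_. s"] assms
  by (simp add: scaleR_vec_def)

text \<open>Both measures are smoothed by a scaled Gaussian vector; the smoothed densities are determined
  by the characteristic function, and the scale tends to 0.\<close>

lemma char_determines_measure:
  fixes \<mu> \<nu> :: "(real^'n) measure"
  assumes p: "prob_space \<mu>" "prob_space \<nu>" and s: "sets \<mu> = sets borel" "sets \<nu> = sets borel"
    and eq: "\<And>t. (\<integral>x. iexp (t \<bullet> x) \<partial>\<mu>) = (\<integral>x. iexp (t \<bullet> x) \<partial>\<nu>)"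
  shows "\<mu> = \<nu>"
proof -
  let ?G = "density lborel (std_gauss :: real^'n \<Rightarrow> real)"
  interpret G: prob_space ?G by (rule prob_space_std_gauss)
  \<comment> \<open>A Gaussian bump is the characteristic function of the standard Gaussian law.
    Fubini therefore writes its integral against a measure as an integral of the characteristic
    function of that measure.\<close>
  have bump: "(\<integral>y. exp (- (r * norm (x - y))\<^sup>2 / 2) \<partial>\<mu>) = (\<integral>y. exp (- (r * norm (x - y))\<^sup>2 / 2) \<partial>\<nu>)" for x :: "real^'n" and r :: real
  proof -
    have "complex_of_real (\<integral>y. exp (- (r * norm (x - y))\<^sup>2 / 2) \<partial>m) = (\<integral>t. iexp (r * (t \<bullet> x)) * (\<integral>y. iexp ((- r *\<^sub>R t) \<bullet> y) \<partial>m) \<partial>?G)"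
      if m: "prob_space m" and s: "sets m = sets borel" for m
    proof -
      interpret m: prob_space m by fact
      interpret mG: pair_prob_space m ?G ..
      note [measurable_cong] = s
      have "complex_of_real (exp (- (r * norm (x - y))\<^sup>2 / 2)) = (\<integral>t. iexp (r * (t \<bullet> x)) * iexp ((- r *\<^sub>R t) \<bullet> y) \<partial>?G)" for y
      proof -
        have n: "(norm (r *\<^sub>R (x - y)))\<^sup>2 = (r * norm (x - y))\<^sup>2" by (simp add: power_mult_distrib)
        have i: "(r *\<^sub>R (x - y)) \<bullet> t = r * (t \<bullet> x) + (- r *\<^sub>R t) \<bullet> y" for t
          by (simp add: inner_diff_right inner_commute right_diff_distrib)
        show ?thesis
          using char_std_gauss[of "r *\<^sub>R (x - y)"] unfolding n i of_real_add distrib_left exp_add by simp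
      qed
      then have "complex_of_real (\<integral>y. exp (- (r * norm (x - y))\<^sup>2 / 2) \<partial>m) = (\<integral>y. (\<integral>t. iexp (r * (t \<bullet> x)) * iexp ((- r *\<^sub>R t) \<bullet> y) \<partial>?G) \<partial>m)"
        by (simp only: integral_complex_of_real[symmetric])
      also have "\<dots> = (\<integral>t. (\<integral>y. iexp (r * (t \<bullet> x)) * iexp ((- r *\<^sub>R t) \<bullet> y) \<partial>m) \<partial>?G)"
        by (rule mG.Fubini_integral[symmetric], rule mG.integrable_const_bound[where B=1]) (auto simp: norm_mult)
      finally show ?thesis by simp
    qed
    note F = this
    have "complex_of_real (\<integral>y. exp (- (r * norm (x - y))\<^sup>2 / 2) \<partial>\<mu>) = complex_of_real (\<integral>y. exp (- (r * norm (x - y))\<^sup>2 / 2) \<partial>\<nu>)"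
      unfolding F[OF p(1) s(1)] F[OF p(2) s(2)] eq ..
    then show ?thesis by (simp only: of_real_eq_iff)
  qed
  define c where "c = 1 / sqrt ((2 * pi) ^ CARD('n))"
  \<comment> \<open>Here \<open>z / r\<close> with standard Gaussian \<open>z\<close> is added to a
    point drawn from \<open>m\<close>; the density of the sum at \<open>x\<close> is the bump
    integral, up to the constant \<open>r ^ CARD('n) * c\<close>.\<close>
  have smooth: "(\<integral>\<^sup>+y. (\<integral>\<^sup>+z. ennreal (f (y + (1/r) *\<^sub>R z)) \<partial>?G) \<partial>m)
      = (\<integral>\<^sup>+x. ennreal (f x * (r ^ CARD('n) * c) * (\<integral>y. exp (- (r * norm (x - y))\<^sup>2 / 2) \<partial>m)) \<partial>lborel)"
    if m: "prob_space m" and s: "sets m = sets borel" and r: "r > 0" and [measurable]: "f \<in> borel_measurable borel" and f0: "\<And>x. 0 \<le> f x"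
    for m :: "(real^'n) measure" and f and r :: real
  proof -
    interpret m: prob_space m by fact
    interpret mL: pair_sigma_finite m "lborel :: (real^'n) measure" ..
    note [measurable_cong] = s
    have sg: "std_gauss (r *\<^sub>R (x - y)) = c * exp (- (r * norm (x - y))\<^sup>2 / 2)" for x y :: "real^'n"
      by (simp add: std_gauss_eq_norm c_def power_mult_distrib)
    have c0: "c > 0" by (simp add: c_def)
    have 1: "(\<integral>\<^sup>+z. ennreal (f (y + (1/r) *\<^sub>R z)) \<partial>?G) = (\<integral>\<^sup>+x. ennreal (f x * (r ^ CARD('n) * c) * exp (- (r * norm (x - y))\<^sup>2 / 2)) \<partial>lborel)" for y
    proof -
      have "(\<integral>\<^sup>+z. ennreal (f (y + (1/r) *\<^sub>R z)) \<partial>?G) = (\<integral>\<^sup>+z. ennreal (std_gauss z * f (y + (1/r) *\<^sub>R z)) \<partial>lborel)"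
        by (simp add: nn_integral_density ennreal_mult' std_gauss_nonneg)
      also have "\<dots> = ennreal (\<bar>r\<bar> ^ CARD('n)) * (\<integral>\<^sup>+x. ennreal (std_gauss (r *\<^sub>R x) * f (y + x)) \<partial>lborel)"
        using nn_integral_scaleR_change[of "\<lambda>z. ennreal (std_gauss z * f (y + (1/r) *\<^sub>R z))" r] r by simp
      also have "(\<integral>\<^sup>+x. ennreal (std_gauss (r *\<^sub>R x) * f (y + x)) \<partial>lborel) = (\<integral>\<^sup>+x. ennreal (std_gauss (r *\<^sub>R (x - y)) * f x) \<partial>lborel)"
        using nn_integral_lborel_translate[of "\<lambda>x. ennreal (std_gauss (r *\<^sub>R (x - y)) * f x)" y] by simp
      also have "ennreal (\<bar>r\<bar> ^ CARD('n)) * \<dots> = (\<integral>\<^sup>+x. ennreal (\<bar>r\<bar> ^ CARD('n)) * ennreal (std_gauss (r *\<^sub>R (x - y)) * f x) \<partial>lborel)"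
        by (rule nn_integral_cmult[symmetric]) measurable
      also have "\<dots> = (\<integral>\<^sup>+x. ennreal (f x * (r ^ CARD('n) * c) * exp (- (r * norm (x - y))\<^sup>2 / 2)) \<partial>lborel)"
        using r c0 by (simp add: sg ennreal_mult'[symmetric] mult_ac)
      finally show ?thesis .
    qed
    have int: "integrable m (\<lambda>y. exp (- (r * norm (x - y))\<^sup>2 / 2))" for x
      by (rule m.integrable_const_bound[where B=1]) auto
    have "(\<integral>\<^sup>+y. (\<integral>\<^sup>+z. ennreal (f (y + (1/r) *\<^sub>R z)) \<partial>?G) \<partial>m)
      = (\<integral>\<^sup>+x. \<integral>\<^sup>+y. ennreal (f x * (r ^ CARD('n) * c) * exp (- (r * norm (x - y))\<^sup>2 / 2)) \<partial>m \<partial>lborel)"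
      unfolding 1 by (rule mL.Fubini'[symmetric]) measurable
    also have "\<dots> = (\<integral>\<^sup>+x. ennreal (f x * (r ^ CARD('n) * c) * (\<integral>y. exp (- (r * norm (x - y))\<^sup>2 / 2) \<partial>m)) \<partial>lborel)"
    proof (rule nn_integral_cong)
      fix x
      have "0 \<le> f x * (r ^ CARD('n) * c)" using f0[of x] r c0 by simp
      then show "(\<integral>\<^sup>+y. ennreal (f x * (r ^ CARD('n) * c) * exp (- (r * norm (x - y))\<^sup>2 / 2)) \<partial>m)
        = ennreal (f x * (r ^ CARD('n) * c) * (\<integral>y. exp (- (r * norm (x - y))\<^sup>2 / 2) \<partial>m))"
        by (subst nn_integral_eq_integral[OF integrable_mult_right[OF int[of x]]]) (simp_all del: minus_divide_left)
    qed
    finally show ?thesis .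
  qed
  show ?thesis
  proof (rule measure_eqI_continuous)
    show "finite_measure \<mu>" "finite_measure \<nu>" using p by (simp_all add: prob_space_def)
    fix f :: "real^'n \<Rightarrow> real" assume c: "continuous_on UNIV f" and b: "\<And>x. 0 \<le> f x \<and> f x \<le> 1"
    have [measurable]: "f \<in> borel_measurable borel" using c by (rule borel_measurable_continuous_onI)
    \<comment> \<open>The integral of \<open>f\<close> against the smoothed measure at scale
      \<open>1 / Suc k\<close>. It is determined by the bump integrals and tends to the integral
      against \<open>m\<close> itself, because \<open>f\<close> is bounded and continuous.\<close>
    define I where "I m k = (\<integral>p. f (fst p + (1 / real (Suc k)) *\<^sub>R snd p) \<partial>(m \<Otimes>\<^sub>M ?G))" for m k
    have lim: "I m \<longlonglongrightarrow> (\<integral>x. f x \<partial>m)" 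
      and In: "ennreal (I m k) = (\<integral>\<^sup>+x. ennreal (f x * (real (Suc k) ^ CARD('n) * c) * (\<integral>y. exp (- (real (Suc k) * norm (x - y))\<^sup>2 / 2) \<partial>m)) \<partial>lborel)"
      if m: "prob_space m" and s: "sets m = sets borel" for m k
    proof -
      interpret m: prob_space m by fact
      interpret mG: pair_prob_space m ?G ..
      note [measurable_cong] = s
      have "I m \<longlonglongrightarrow> (\<integral>p. f (fst p) \<partial>(m \<Otimes>\<^sub>M ?G))"
        unfolding I_def
      proof (rule integral_dominated_convergence[where w="\<lambda>_. 1"])
        show "AE p in m \<Otimes>\<^sub>M ?G. (\<lambda>k. f (fst p + (1 / real (Suc k)) *\<^sub>R snd p)) \<longlonglongrightarrow> f (fst p)"
        proof (rule AE_I2)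
          fix p :: "(real^'n) \<times> (real^'n)"
          have "(\<lambda>k. fst p + (1 / real (Suc k)) *\<^sub>R snd p) \<longlonglongrightarrow> fst p + 0 *\<^sub>R snd p"
            using LIMSEQ_inverse_real_of_nat by (intro tendsto_intros) (simp add: inverse_eq_divide)
          then show "(\<lambda>k. f (fst p + (1 / real (Suc k)) *\<^sub>R snd p)) \<longlonglongrightarrow> f (fst p)"
            by (intro continuous_on_tendsto_compose[OF c]) auto
        qed
      qed (use b in auto)
      also have "(\<integral>p. f (fst p) \<partial>(m \<Otimes>\<^sub>M ?G)) = (\<integral>x. (\<integral>z. f x \<partial>?G) \<partial>m)"
        by (subst mG.integral_fst'[symmetric], rule mG.integrable_const_bound[where B=1]) (use b in auto)
      also have "\<dots> = (\<integral>x. f x \<partial>m)" using G.prob_space by simp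
      finally show "I m \<longlonglongrightarrow> (\<integral>x. f x \<partial>m)" .
      have "ennreal (I m k) = (\<integral>\<^sup>+p. ennreal (f (fst p + (1 / real (Suc k)) *\<^sub>R snd p)) \<partial>(m \<Otimes>\<^sub>M ?G))"
        unfolding I_def
        by (subst nn_integral_eq_integral) (use b in \<open>auto intro!: mG.integrable_const_bound[where B=1]\<close>)
      also have "\<dots> = (\<integral>\<^sup>+y. (\<integral>\<^sup>+z. ennreal (f (y + (1/real (Suc k)) *\<^sub>R z)) \<partial>?G) \<partial>m)"
        by (subst G.nn_integral_fst[symmetric]) auto
      also have "\<dots> = (\<integral>\<^sup>+x. ennreal (f x * (real (Suc k) ^ CARD('n) * c) * (\<integral>y. exp (- (real (Suc k) * norm (x - y))\<^sup>2 / 2) \<partial>m)) \<partial>lborel)"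
        by (rule smooth[OF m s]) (use b in auto)
      finally show "ennreal (I m k) = (\<integral>\<^sup>+x. ennreal (f x * (real (Suc k) ^ CARD('n) * c) * (\<integral>y. exp (- (real (Suc k) * norm (x - y))\<^sup>2 / 2) \<partial>m)) \<partial>lborel)" .
    qed
    have "ennreal (I \<mu> k) = ennreal (I \<nu> k)" for k
      unfolding In[OF p(1) s(1)] In[OF p(2) s(2)] bump ..
    moreover have "0 \<le> I m k" for m k unfolding I_def using b by (intro integral_nonneg_AE) auto
    ultimately have "I \<mu> = I \<nu>" by (simp add: fun_eq_iff)
    then show "(\<integral>x. f x \<partial>\<mu>) = (\<integral>x. f x \<partial>\<nu>)"
      using lim[OF p(1) s(1)] lim[OF p(2) s(2)] LIMSEQ_unique by metis
  qed (use s in auto)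
qed

lemma char_gauss_measure:
  fixes A :: "real^'n^'n"
  assumes "pos_def A"
  shows "(\<integral>x. iexp (t \<bullet> x) \<partial>gauss_measure A) = complex_of_real (exp (- (t \<bullet> (A *v t)) / 2))"
proof -
  obtain B where B0: "det B \<noteq> 0" "transpose B ** A ** B = mat 1" and B: "matrix_inv A = B ** transpose B"
    "det A * (det B)\<^sup>2 = 1" by (rule pos_def_whitening[OF assms])
  have tA: "transpose A = A" using assms by (simp add: pos_def_def)
  let ?s = "transpose B *v (A *v t)"
  have st: "t \<bullet> ((A ** B) *v x) = ?s \<bullet> x" for x
    by (metis inner_matrix_vector matrix_vector_mul_assoc tA)
  have "A ** (B ** transpose B) = mat 1"
    using B(2) matrix_inv_mult(2)[of A] unfolding B(1) by force
  then have "(A ** B) *v ?s = A *v t"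
    by (metis matrix_mul_assoc matrix_mul_lid matrix_vector_mul_assoc)
  then have n: "(norm ?s)\<^sup>2 = t \<bullet> (A *v t)" using st[of ?s] by (simp add: power2_norm_eq_inner)
  have "(\<integral>x. iexp (t \<bullet> x) \<partial>gauss_measure A) = (\<integral>x. iexp (?s \<bullet> x) \<partial>density lborel std_gauss)"
    unfolding gauss_measure_eq_distr[OF B] by (subst integral_distr) (simp_all only: st, measurable)
  then show ?thesis unfolding char_std_gauss n .
qed

lemma integrable_mult_of_squares:
  fixes f g :: "'a \<Rightarrow> real"
  assumes [measurable]: "f \<in> borel_measurable M" "g \<in> borel_measurable M"
    and "integrable M (\<lambda>x. (f x)\<^sup>2)" "integrable M (\<lambda>x. (g x)\<^sup>2)"
  shows "integrable M (\<lambda>x. f x * g x)"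
proof (rule Bochner_Integration.integrable_bound)
  show "integrable M (\<lambda>x. (f x)\<^sup>2 + (g x)\<^sup>2)" using assms by simp
  have "\<bar>a * b\<bar> \<le> \<bar>a\<^sup>2 + b\<^sup>2\<bar>" for a b :: real
  proof -
    have "2 * \<bar>a * b\<bar> \<le> a\<^sup>2 + b\<^sup>2" using sum_squares_bound[of "\<bar>a\<bar>" "\<bar>b\<bar>"] by (simp add: abs_mult)
    then show ?thesis by linarith
  qed
  then show "AE x in M. norm (f x * g x) \<le> norm ((f x)\<^sup>2 + (g x)\<^sup>2)" by simp
qed simp

lemma gaussian_var_square_integrable:
  assumes "prob_space M" "gaussian_var M X"
  shows "integrable M X" "integrable M (\<lambda>x. (X x)\<^sup>2)"
proof -
  interpret prob_space M by fact
  have "integrable M X \<and> integrable M (\<lambda>x. (X x)\<^sup>2)"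
    using assms(2) unfolding gaussian_var_def
  proof (elim disjE exE conjE)
    fix \<mu> \<sigma> :: real assume \<sigma>: "0 < \<sigma>" and d: "distributed M lborel X (normal_density \<mu> \<sigma>)"
    have i1: "integrable lborel (\<lambda>x. normal_density \<mu> \<sigma> x * x)" by (rule integrable_normal_moment_nz_1[OF \<sigma>])
    \<comment> \<open>The second moment about 0 is assembled from central moments through x^2 = (x -
      \<mu>)^2 + 2 \<mu> x - \<mu>^2.\<close>
    have "integrable lborel (\<lambda>x. normal_density \<mu> \<sigma> x * (x - \<mu>)^2 + 2 * \<mu> * (normal_density \<mu> \<sigma> x * x) - \<mu>^2 * normal_density \<mu> \<sigma> x)"
      by (intro Bochner_Integration.integrable_add Bochner_Integration.integrable_diff integrable_normal_moment i1 integrable_mult_right integrable_normal_density \<sigma>)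
    then have i2: "integrable lborel (\<lambda>x. normal_density \<mu> \<sigma> x * x^2)"
      by (simp add: power2_eq_square algebra_simps)
    show "integrable M X \<and> integrable M (\<lambda>x. (X x)\<^sup>2)"
      using distributed_integrable[OF d, of "\<lambda>x. x"] i1 distributed_integrable[OF d, of "\<lambda>x. x^2"] i2 by simp
  next
    fix c assume [measurable]: "X \<in> borel_measurable M" and c: "AE \<omega> in M. X \<omega> = c"
    have "integrable M X" by (subst integrable_cong_AE[of _ _ "\<lambda>_. c"]) (use c in auto)
    moreover have "integrable M (\<lambda>x. (X x)\<^sup>2)" by (subst integrable_cong_AE[of _ _ "\<lambda>_. c^2"]) (use c in auto)
    ultimately show "integrable M X \<and> integrable M (\<lambda>x. (X x)\<^sup>2)" by simp
  qed
  then show "integrable M X" "integrable M (\<lambda>x. (X x)\<^sup>2)" by auto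
qed

text \<open>With mean 0, a nonzero second moment excludes the constant case of
  \<open>gaussian_var\<close>, so the variable is a rescaled standard normal one.\<close>

lemma gaussian_var_char:
  assumes "prob_space M" "gaussian_var M X" "(\<integral>x. X x \<partial>M) = 0" "(\<integral>x. (X x)\<^sup>2 \<partial>M) \<noteq> 0"
  shows "(\<integral>x. iexp (X x) \<partial>M) = complex_of_real (exp (- (\<integral>x. (X x)\<^sup>2 \<partial>M) / 2))"
proof -
  interpret prob_space M by fact
  show ?thesis using assms(2) unfolding gaussian_var_def
  proof (elim disjE exE conjE)
    fix \<mu> \<sigma> :: real assume \<sigma>: "0 < \<sigma>" and d: "distributed M lborel X (normal_density \<mu> \<sigma>)"
    have \<mu>: "\<mu> = 0" using normal_distributed_expectation[OF \<sigma> d] assms(3) by simp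
    have v: "(\<integral>x. (X x)\<^sup>2 \<partial>M) = \<sigma>\<^sup>2" using normal_distributed_variance[OF \<sigma> d] assms(3) by simp
    have "distributed M lborel (\<lambda>x. X x / \<sigma>) std_normal_density"
      using normal_standard_normal_convert[OF \<sigma>, of X \<mu>] d by (simp add: \<mu>)
    then have e: "distr M lborel (\<lambda>x. X x / \<sigma>) = density lborel std_normal_density" and [measurable]: "(\<lambda>x. X x / \<sigma>) \<in> borel_measurable M"
      by (auto simp: distributed_def)
    have "(\<integral>x. iexp (X x) \<partial>M) = (\<integral>x. iexp (\<sigma> * x) \<partial>distr M lborel (\<lambda>x. X x / \<sigma>))"
      using \<sigma> by (subst integral_distr) auto
    also have "\<dots> = char std_normal_distribution \<sigma>" by (simp add: e char_def)
    also have "\<dots> = complex_of_real (exp (- \<sigma>\<^sup>2 / 2))" by (simp add: char_std_normal_distribution)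
    finally show ?thesis by (simp add: v)
  next
    fix c assume [measurable]: "X \<in> borel_measurable M" and c: "AE \<omega> in M. X \<omega> = c"
    have "(\<integral>x. X x \<partial>M) = (\<integral>x. c \<partial>M)" by (rule integral_cong_AE) (use c in auto)
    then have "c = 0" using assms(3) by (simp add: prob_space)
    have "(\<integral>x. (X x)\<^sup>2 \<partial>M) = (\<integral>x. c^2 \<partial>M)" by (rule integral_cong_AE) (use c in auto)
    then show ?thesis using assms(4) \<open>c = 0\<close> by simp
  qed
qed

text \<open>Each linear functional of \<open>X\<close> is a centred Gaussian variable of variance
  \<open>t \<bullet> (A *v t)\<close>, so the characteristic functions agree. The direction
  \<open>t = 0\<close> is treated apart because its variance vanishes; positive definiteness
  excludes degeneracy in all others.\<close>

lemma gaussian_vec_distr: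
  fixes X :: "'w \<Rightarrow> real^'n"
  assumes "prob_space M" and g: "gaussian_vec M X" and m0: "mean_vec M X = 0" and C: "cov_matrix M X = A" and A: "pos_def A"
  shows "distr M borel X = gauss_measure A"
    and "integrable M (\<lambda>\<omega>. X \<omega> $ i)" and "integrable M (\<lambda>\<omega>. X \<omega> $ i * X \<omega> $ j)"
    and "(\<integral>\<omega>. X \<omega> $ i * X \<omega> $ j \<partial>M) = A $ i $ j" and "(\<integral>\<omega>. X \<omega> $ i \<partial>M) = 0"
proof -
  interpret prob_space M by fact
  have [measurable]: "X \<in> borel_measurable M" using g by (simp add: gaussian_vec_def)
  have gv: "gaussian_var M (\<lambda>\<omega>. a \<bullet> X \<omega>)" for a using g by (simp add: gaussian_vec_def)
  have i: "integrable M (\<lambda>\<omega>. X \<omega> $ i)" "integrable M (\<lambda>\<omega>. (X \<omega> $ i)\<^sup>2)" for i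
    using gaussian_var_square_integrable[OF assms(1) gv[of "axis i 1"]] by (simp_all add: inner_axis')
  have ij: "integrable M (\<lambda>\<omega>. X \<omega> $ i * X \<omega> $ j)" for i j
    by (rule integrable_mult_of_squares[OF _ _ i(2) i(2)]) auto
  have m: "(\<integral>\<omega>. X \<omega> $ i \<partial>M) = 0" for i using m0 by (simp add: mean_vec_def vec_eq_iff)
  have c: "(\<integral>\<omega>. X \<omega> $ i * X \<omega> $ j \<partial>M) = A $ i $ j" for i j
    using C by (auto simp: cov_matrix_def m0 vec_eq_iff)
  show "integrable M (\<lambda>\<omega>. X \<omega> $ i)" "integrable M (\<lambda>\<omega>. X \<omega> $ i * X \<omega> $ j)"
    "(\<integral>\<omega>. X \<omega> $ i * X \<omega> $ j \<partial>M) = A $ i $ j" "(\<integral>\<omega>. X \<omega> $ i \<partial>M) = 0"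
    by (fact i ij m c)+
  show "distr M borel X = gauss_measure A"
  proof (rule char_determines_measure)
    show "prob_space (distr M borel X)" by (rule prob_space_distr) simp
    show "prob_space (gauss_measure A)" by (rule prob_space_gauss_measure[OF A])
    fix t :: "real^'n"
    have mt: "(\<integral>\<omega>. t \<bullet> X \<omega> \<partial>M) = 0" by (simp add: inner_vec_def i m)
    have e: "(t \<bullet> x)\<^sup>2 = (\<Sum>i\<in>UNIV. \<Sum>j\<in>UNIV. t $ i * t $ j * (x $ i * x $ j))" for x
      unfolding inner_vec_def power2_eq_square sum_product by (simp add: mult_ac)
    have vt: "(\<integral>\<omega>. (t \<bullet> X \<omega>)\<^sup>2 \<partial>M) = t \<bullet> (A *v t)"
      unfolding e by (simp add: ij c inner_matrix_vector_sum mult_ac)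
    show "(\<integral>x. iexp (t \<bullet> x) \<partial>distr M borel X) = (\<integral>x. iexp (t \<bullet> x) \<partial>gauss_measure A)"
    proof (cases "t = 0")
      case True
      interpret A: prob_space "gauss_measure A" by (rule prob_space_gauss_measure[OF A])
      interpret D: prob_space "distr M borel X" by (rule prob_space_distr) simp
      show ?thesis using True A.prob_space D.prob_space by simp
    next
      case False
      then have "t \<bullet> (A *v t) \<noteq> 0" using A by (auto simp: pos_def_def)
      then show ?thesis
        using gaussian_var_char[OF assms(1) gv[of t] mt] by (simp add: integral_distr char_gauss_measure[OF A] vt)
    qed
  qed simp_all
qed

subsection \<open>Transport to the standard normal law\<close>

lemma real_derivative_imp_continuous_on:
  assumes "\<And>x. x \<in> A \<Longrightarrow> (f has_real_derivative f' x) (at x)"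
  shows "continuous_on A f"
  by (rule continuous_at_imp_continuous_on) (use assms in \<open>auto dest: DERIV_isCont\<close>)

text \<open>Only an inequality, since the image of the monotone map \<open>g\<close> may be a proper
  interval. The substitution rule holds on compact intervals, which exhaust the line.\<close>

lemma nn_integral_substitution_le:
  fixes f :: "real \<Rightarrow> ennreal"
  assumes f[measurable]: "f \<in> borel_measurable borel"
    and d: "\<And>x. (g has_real_derivative g' x) (at x)"
    and c: "continuous_on UNIV g'" and nn: "\<And>x. 0 \<le> g' x"
  shows "(\<integral>\<^sup>+x. f (g x) * g' x \<partial>lborel) \<le> (\<integral>\<^sup>+x. f x \<partial>lborel)"
proof -
  have [measurable]: "g' \<in> borel_measurable borel" using c by (rule borel_measurable_continuous_onI)
  have "continuous_on UNIV g" using d by (rule real_derivative_imp_continuous_on)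
  then have [measurable]: "g \<in> borel_measurable borel" by (rule borel_measurable_continuous_onI)
  let ?h = "\<lambda>k x. f (g x) * g' x * indicator {- real (Suc k)..real (Suc k)} x"
  have "(\<integral>\<^sup>+x. f (g x) * g' x \<partial>lborel) = (\<integral>\<^sup>+x. (SUP k. ?h k x) \<partial>lborel)"
  proof (rule nn_integral_cong)
    fix x
    obtain k where "\<bar>x\<bar> < real k" using reals_Archimedean2 by blast
    then have "?h k x = f (g x) * g' x" by (auto simp: indicator_def)
    then have "f (g x) * g' x \<le> (SUP k. ?h k x)" by (metis (lifting) SUP_upper UNIV_I)
    moreover have "(SUP k. ?h k x) \<le> f (g x) * g' x" by (rule SUP_least) (auto simp: indicator_def)
    ultimately show "f (g x) * g' x = (SUP k. ?h k x)" by (rule antisym)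
  qed
  also have "\<dots> = (SUP k. \<integral>\<^sup>+x. ?h k x \<partial>lborel)"
    by (rule nn_integral_monotone_convergence_SUP) (auto simp: incseq_def le_fun_def indicator_def)
  also have "\<dots> \<le> (\<integral>\<^sup>+x. f x \<partial>lborel)"
  proof (rule SUP_least)
    fix k
    have "(\<integral>\<^sup>+x. ?h k x \<partial>lborel) = (\<integral>\<^sup>+x. f x * indicator {g (- real (Suc k))..g (real (Suc k))} x \<partial>lborel)"
      by (rule nn_integral_substitution_aux[symmetric]) (use d nn c in \<open>auto intro: continuous_on_subset\<close>)
    also have "\<dots> \<le> (\<integral>\<^sup>+x. f x \<partial>lborel)"
      by (rule nn_integral_mono) (auto simp: indicator_def)
    finally show "(\<integral>\<^sup>+x. ?h k x \<partial>lborel) \<le> (\<integral>\<^sup>+x. f x \<partial>lborel)" .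
  qed
  finally show ?thesis .
qed

definition density_cdf :: "(real \<Rightarrow> real) \<Rightarrow> real \<Rightarrow> real" where
  "density_cdf p x = measure (density lborel p) {..x}"

text \<open>Continuity makes the distribution function differentiable and positivity makes it
  strictly increasing, so the transport map to the normal law has a continuous positive
  derivative.\<close>

locale positive_density =
  fixes p :: "real \<Rightarrow> real"
  assumes cont: "continuous_on UNIV p" and pos: "\<And>x. 0 < p x" and mass: "(\<integral>\<^sup>+x. p x \<partial>lborel) = 1"
begin

lemma measurable_p [measurable]: "p \<in> borel_measurable borel"
  using cont by (rule borel_measurable_continuous_onI)

sublocale D: real_distribution "density lborel p"
  by (intro real_distribution.intro prob_spaceI real_distribution_axioms.intro) (auto simp: emeasure_density mass)

lemma density_cdf_eq: "density_cdf p x = cdf (density lborel p) x"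
  by (simp add: density_cdf_def cdf_def)

lemma integrable_p: "integrable lborel p"
  using mass pos by (intro integrableI_nonneg) (auto intro: less_imp_le)

lemma density_cdf_diff:
  assumes "a < y"
  shows "density_cdf p y = density_cdf p a + integral {a..y} p"
proof -
  have "density_cdf p y - density_cdf p a = measure (density lborel p) {a<..y}"
    unfolding density_cdf_eq by (rule D.cdf_diff_eq[OF assms])
  also have "\<dots> = (\<integral>x. indicator {a<..y} x *\<^sub>R p x \<partial>lborel)"
  proof -
    have "emeasure (density lborel p) {a<..y} = (\<integral>\<^sup>+x. ennreal (indicator {a<..y} x *\<^sub>R p x) \<partial>lborel)"
      by (subst emeasure_density) (auto intro!: nn_integral_cong simp: indicator_def)
    also have "\<dots> = ennreal (\<integral>x. indicator {a<..y} x *\<^sub>R p x \<partial>lborel)"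
    proof (rule nn_integral_eq_integral)
      show "integrable lborel (\<lambda>x. indicator {a<..y} x *\<^sub>R p x)"
        by (intro integrable_mult_indicator integrable_p) simp
    qed (use pos in \<open>simp add: less_imp_le\<close>)
    finally show ?thesis using pos by (simp add: measure_def integral_nonneg_AE less_imp_le)
  qed
  also have "\<dots> = (LBINT x:{a..y}. p x)"
    unfolding set_lebesgue_integral_def
    by (rule integral_cong_AE) (use AE_lborel_singleton[of a] in \<open>auto simp: indicator_def elim!: eventually_mono\<close>)
  also have "\<dots> = integral {a..y} p"
    by (rule set_borel_integral_eq_integral(2)) (use integrable_p in \<open>auto simp: set_integrable_def intro!: integrable_mult_indicator[where 'b=real, simplified]\<close>)
  finally show ?thesis by simp
qed

lemma density_cdf_deriv: "(density_cdf p has_real_derivative p x) (at x)"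
proof -
  \<comment> \<open>The base point \<open>x - 1\<close> puts \<open>x\<close> into the interior of
    the interval, which turns the derivative within the interval into a two-sided one.\<close>
  have "((\<lambda>y. integral {x - 1..y} p) has_real_derivative p x) (at x within {x - 1..x + 1})"
    by (rule integral_has_real_derivative) (auto intro: continuous_on_subset[OF cont])
  then have "((\<lambda>y. density_cdf p (x - 1) + integral {x - 1..y} p) has_real_derivative 0 + p x) (at x)"
    by (intro DERIV_add DERIV_const) (simp add: at_within_interior[of x "{x - 1..x + 1}"])
  moreover have "\<forall>\<^sub>F y in nhds x. density_cdf p (x - 1) + integral {x - 1..y} p = density_cdf p y"
    using density_cdf_diff[of "x - 1"] by (intro eventually_nhds_in_open[of "{x-1<..}" x, THEN eventually_mono]) auto
  ultimately show ?thesis using DERIV_cong_ev[OF refl, of "\<lambda>y. density_cdf p (x - 1) + integral {x - 1..y} p" "density_cdf p" x "p x" "p x"] by simp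
qed

lemma density_cdf_strict_mono: "x < y \<Longrightarrow> density_cdf p x < density_cdf p y"
  by (rule DERIV_pos_imp_increasing) (auto intro: density_cdf_deriv pos)

lemma density_cdf_bounds: "0 < density_cdf p x" "density_cdf p x < 1"
proof -
  have "0 \<le> density_cdf p (x - 1)" by (simp add: density_cdf_def)
  then show "0 < density_cdf p x" using density_cdf_strict_mono[of "x - 1" x] by simp
  have "density_cdf p (x + 1) \<le> 1" by (simp add: density_cdf_eq D.cdf_bounded_prob)
  then show "density_cdf p x < 1" using density_cdf_strict_mono[of x "x + 1"] by simp
qed

lemma density_cdf_cont: "continuous_on A (density_cdf p)"
  by (rule real_derivative_imp_continuous_on) (rule density_cdf_deriv)

lemma density_cdf_onto:
  assumes "0 < q" "q < 1" shows "\<exists>x. density_cdf p x = q"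
proof -
  have "\<forall>\<^sub>F i in sequentially. density_cdf p (- real i) < q"
    using D.cdf_lim_neg_infty assms by (intro order_tendstoD) (auto simp: density_cdf_eq)
  moreover have "\<forall>\<^sub>F i in sequentially. q < density_cdf p (real i)"
    using D.cdf_lim_infty_prob assms by (intro order_tendstoD) (auto simp: density_cdf_eq)
  ultimately have "\<forall>\<^sub>F i in sequentially. density_cdf p (- real i) < q \<and> q < density_cdf p (real i)"
    by (rule eventually_conj)
  then obtain i where "density_cdf p (- real i) < q" "q < density_cdf p (real i)"
    by (auto simp: eventually_sequentially)
  then show ?thesis
    using IVT'[of "density_cdf p" "- real i" q "real i"] density_cdf_cont by fastforce
qed

end

interpretation std: positive_density std_normal_density
proof
  show "(\<integral>\<^sup>+x. std_normal_density x \<partial>lborel) = 1" by (subst nn_integral_eq_integral) auto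
  show "continuous_on UNIV std_normal_density" unfolding normal_density_def by (intro continuous_intros) auto
qed (simp add: normal_density_pos)

text \<open>The value 0 off the open unit interval is a default that makes the function measurable
  on the whole line; by \<open>density_cdf_bounds\<close> it is never reached from a distribution
  function of the locale.\<close>

definition std_normal_quantile :: "real \<Rightarrow> real" where
  "std_normal_quantile q = (if q \<in> {0<..<1} then THE x. density_cdf std_normal_density x = q else 0)"

lemma std_normal_quantile_cdf [simp]: "std_normal_quantile (density_cdf std_normal_density x) = x"
proof -
  have "(THE y. density_cdf std_normal_density y = density_cdf std_normal_density x) = x"
    by (rule the_equality) (auto, metis std.density_cdf_strict_mono less_irrefl linorder_less_linear)
  then show ?thesis using std.density_cdf_bounds[of x] by (simp add: std_normal_quantile_def)
qed

lemma cdf_std_normal_quantile: "0 < q \<Longrightarrow> q < 1 \<Longrightarrow> density_cdf std_normal_density (std_normal_quantile q) = q"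
  using std.density_cdf_onto[of q] by auto

lemma std_normal_quantile_deriv:
  assumes "0 < q" "q < 1"
  shows "(std_normal_quantile has_real_derivative inverse (std_normal_density (std_normal_quantile q))) (at q)"
proof -
  let ?x = "std_normal_quantile q"
  have x: "density_cdf std_normal_density ?x = q" using assms by (rule cdf_std_normal_quantile)
  have "isCont std_normal_quantile (density_cdf std_normal_density ?x)"
    by (rule isCont_inverse_function[where d=1]) (auto intro: DERIV_isCont std.density_cdf_deriv)
  then show ?thesis
    using std.density_cdf_deriv[of ?x] std.pos[of ?x] assms unfolding x
    by (intro DERIV_inverse_function[where f="density_cdf std_normal_density" and a=0 and b=1]) (auto intro: cdf_std_normal_quantile)
qed

lemma std_normal_quantile_measurable [measurable]: "std_normal_quantile \<in> borel_measurable borel"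
proof -
  have c: "continuous_on {0<..<1} (\<lambda>q. THE x. density_cdf std_normal_density x = q)"
  proof -
    have "continuous_on {0<..<1} std_normal_quantile"
      by (rule real_derivative_imp_continuous_on) (rule std_normal_quantile_deriv, auto)
    then show ?thesis by (rule continuous_on_eq) (simp add: std_normal_quantile_def)
  qed
  show ?thesis
    unfolding std_normal_quantile_def[abs_def]
    by (rule borel_measurable_continuous_on_if) (use c in auto)
qed

definition gauss_transport :: "(real \<Rightarrow> real) \<Rightarrow> real \<Rightarrow> real" where
  "gauss_transport p x = std_normal_quantile (density_cdf p x)"

context positive_density
begin

text \<open>Conservation of mass under the transport: the derivative carries the density
  \<open>p\<close>. Through this derivative, ln p enters the logarithm of the test density.\<close>

lemma gauss_transport_deriv:
  "(gauss_transport p has_real_derivative p x / std_normal_density (gauss_transport p x)) (at x)"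
  using DERIV_chain2[OF std_normal_quantile_deriv density_cdf_deriv, OF density_cdf_bounds, of x]
  unfolding gauss_transport_def[abs_def] by (simp add: field_simps)

lemma gauss_transport_cont: "continuous_on A (gauss_transport p)"
  by (rule real_derivative_imp_continuous_on) (rule gauss_transport_deriv)

lemma gauss_transport_deriv_cont: "continuous_on A (\<lambda>x. p x / std_normal_density (gauss_transport p x))"
proof -
  have "continuous_on A (std_normal_density \<circ> gauss_transport p)"
    using gauss_transport_cont by (rule continuous_on_compose) (rule continuous_on_subset[OF std.cont], simp)
  then show ?thesis
    using cont by (intro continuous_on_divide) (auto simp: comp_def std.pos[THEN less_imp_neq, symmetric] intro: continuous_on_subset)
qed

text \<open>The second factor is the derivative of the increasing map
  \<open>b S(y) - c (z - y)\<close>, S being the transport map, and the first factor is the normal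
  density at its value. The integrand is a normal density pulled back along that map.\<close>

lemma backward_channel_mass_le:
  assumes "0 \<le> c" "0 \<le> b"
  shows "(\<integral>\<^sup>+y. std_normal_density (c * (z - y) - b * gauss_transport p y)
      * (c + b * (p y / std_normal_density (gauss_transport p y))) \<partial>lborel) \<le> 1"
proof -
  let ?g = "\<lambda>y. b * gauss_transport p y - c * (z - y)"
  let ?g' = "\<lambda>y. c + b * (p y / std_normal_density (gauss_transport p y))"
  have p0: "0 \<le> p y / std_normal_density x" for y x using pos[of y] by (simp add: less_imp_le)
  have "std_normal_density (c * (z - y) - b * gauss_transport p y) = std_normal_density (?g y)" for y
    by (simp add: std_normal_density_def power2_commute)
  then have "(\<integral>\<^sup>+y. std_normal_density (c * (z - y) - b * gauss_transport p y) * ?g' y \<partial>lborel)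
    = (\<integral>\<^sup>+y. ennreal (std_normal_density (?g y)) * ennreal (?g' y) \<partial>lborel)"
    by (simp add: ennreal_mult')
  also have "\<dots> \<le> (\<integral>\<^sup>+x. std_normal_density x \<partial>lborel)"
  proof (rule nn_integral_substitution_le)
    show "(?g has_real_derivative ?g' x) (at x)" for x
      by (rule derivative_eq_intros gauss_transport_deriv | simp)+
    show "continuous_on UNIV ?g'" by (intro continuous_on_add continuous_on_mult continuous_on_const gauss_transport_deriv_cont)
    show "0 \<le> ?g' x" for x using assms p0 by (simp del: times_divide_eq_right)
  qed simp
  finally show ?thesis by (simp add: std.mass)
qed

text \<open>The transported variable has the first absolute moment of a normal one at most. This
  makes the product of the transport map with the added noise integrable later on.\<close>

lemma abs_gauss_transport_le:
  "(\<integral>\<^sup>+y. \<bar>gauss_transport p y\<bar> * p y \<partial>lborel) \<le> (\<integral>\<^sup>+x. std_normal_density x * \<bar>x\<bar> \<partial>lborel)"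
proof -
  let ?g' = "\<lambda>y. p y / std_normal_density (gauss_transport p y)"
  have "(\<integral>\<^sup>+y. \<bar>gauss_transport p y\<bar> * p y \<partial>lborel)
    = (\<integral>\<^sup>+y. ennreal (std_normal_density (gauss_transport p y) * \<bar>gauss_transport p y\<bar>) * ennreal (?g' y) \<partial>lborel)"
    using pos std.pos[THEN less_imp_neq] by (intro nn_integral_cong, subst ennreal_mult'[symmetric]) (auto simp: field_simps)
  also have "\<dots> \<le> (\<integral>\<^sup>+x. std_normal_density x * \<bar>x\<bar> \<partial>lborel)"
    by (rule nn_integral_substitution_le[OF _ gauss_transport_deriv gauss_transport_deriv_cont])
      (use pos in \<open>auto simp: less_imp_le\<close>)
  finally show ?thesis .
qed

end

text \<open>The density may depend measurably on a parameter: the distribution function is then a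
  parameter integral over a half-line, followed by the measurable quantile function.\<close>

lemma gauss_transport_measurable [measurable (raw)]:
  assumes [measurable]: "(\<lambda>(w, x). p w x) \<in> borel_measurable (N \<Otimes>\<^sub>M borel)" "g \<in> borel_measurable N"
  shows "(\<lambda>w. gauss_transport (p w) (g w)) \<in> borel_measurable N"
proof -
  have e: "density_cdf (p w) (g w) = enn2real (\<integral>\<^sup>+t. ennreal (p w t) * indicator {t. t \<le> g w} t \<partial>lborel)" if "w \<in> space N" for w
  proof -
    have [measurable]: "p w \<in> borel_measurable borel"
      using measurable_compose[OF measurable_Pair1' assms(1), OF that] by simp
    show ?thesis by (simp add: density_cdf_def measure_def emeasure_density atMost_def)
  qed
  have "(\<lambda>w. enn2real (\<integral>\<^sup>+t. ennreal (p w t) * indicator {t. t \<le> g w} t \<partial>lborel)) \<in> borel_measurable N"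
    by measurable
  then have "(\<lambda>w. density_cdf (p w) (g w)) \<in> borel_measurable N"
    by (subst measurable_cong[OF e]) auto
  then show ?thesis unfolding gauss_transport_def by measurable
qed

text \<open>A product of conditional subdensities, each given the earlier coordinates, has mass at most 1.\<close>

lemma nn_integral_chain_le_1:
  fixes b :: "nat \<Rightarrow> (nat \<Rightarrow> real) \<Rightarrow> real \<Rightarrow> ennreal"
  assumes m: "\<And>t. t < n \<Longrightarrow> (\<lambda>(y, x). b t y x) \<in> borel_measurable (Pi\<^sub>M {..<t} (\<lambda>_. lborel) \<Otimes>\<^sub>M lborel)"
    and le: "\<And>t y. t < n \<Longrightarrow> y \<in> space (Pi\<^sub>M {..<t} (\<lambda>_. lborel :: real measure)) \<Longrightarrow> (\<integral>\<^sup>+x. b t y x \<partial>lborel) \<le> 1"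
  shows "(\<integral>\<^sup>+y. (\<Prod>t<n. b t (restrict y {..<t}) (y t)) \<partial>Pi\<^sub>M {..<n} (\<lambda>_. lborel)) \<le> 1"
  using assms
proof (induction n)
  case 0
  then show ?case by (simp add: lessThan_0 PiM_empty nn_integral_count_space_finite)
next
  case (Suc n)
  interpret product_sigma_finite "\<lambda>_::nat. (lborel :: real measure)" ..
  have ins: "{..<Suc n} = insert n {..<n}" by auto
  have mb: "(\<lambda>y. b t (restrict y {..<t}) (y t)) \<in> borel_measurable (Pi\<^sub>M I (\<lambda>_. lborel))" if "t < Suc n" "{..t} \<subseteq> I" for t I
  proof -
    have "(\<lambda>y. (restrict y {..<t}, y t)) \<in> Pi\<^sub>M I (\<lambda>_. lborel) \<rightarrow>\<^sub>M Pi\<^sub>M {..<t} (\<lambda>_. lborel) \<Otimes>\<^sub>M lborel"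
      using that by (intro measurable_Pair measurable_restrict_subset measurable_component_singleton) auto
    from measurable_compose[OF this Suc.prems(1)[OF that(1)]] show ?thesis by simp
  qed
  have r: "restrict (y(n := x)) {..<t} = restrict y {..<t}" if "t < Suc n" for y x t
    using that by (auto simp: restrict_def fun_eq_iff)
  have "(\<integral>\<^sup>+y. (\<Prod>t<Suc n. b t (restrict y {..<t}) (y t)) \<partial>Pi\<^sub>M {..<Suc n} (\<lambda>_. lborel))
    = (\<integral>\<^sup>+y. (\<integral>\<^sup>+x. (\<Prod>t<n. b t (restrict y {..<t}) (y t)) * b n (restrict y {..<n}) x \<partial>lborel) \<partial>Pi\<^sub>M {..<n} (\<lambda>_. lborel))"
    unfolding ins
  proof (subst product_nn_integral_insert)
    show "(\<lambda>y. \<Prod>t\<in>insert n {..<n}. b t (restrict y {..<t}) (y t)) \<in> borel_measurable (Pi\<^sub>M (insert n {..<n}) (\<lambda>_. lborel))"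
      by (intro borel_measurable_prod_ennreal mb) auto
    show "(\<integral>\<^sup>+ x. \<integral>\<^sup>+ y. (\<Prod>t\<in>insert n {..<n}. b t (restrict (x(n := y)) {..<t}) ((x(n := y)) t)) \<partial>lborel \<partial>Pi\<^sub>M {..<n} (\<lambda>_. lborel))
      = (\<integral>\<^sup>+y. (\<integral>\<^sup>+x. (\<Prod>t<n. b t (restrict y {..<t}) (y t)) * b n (restrict y {..<n}) x \<partial>lborel) \<partial>Pi\<^sub>M {..<n} (\<lambda>_. lborel))"
      by (intro nn_integral_cong) (auto simp: r mult.commute intro!: arg_cong2[where f="(*)"] prod.cong)
  qed auto
  \<comment> \<open>Only the last factor contains coordinate \<open>n\<close>; it is integrated
    first, with the earlier coordinates fixed.\<close>
  also have "\<dots> \<le> (\<integral>\<^sup>+y. (\<Prod>t<n. b t (restrict y {..<t}) (y t)) \<partial>Pi\<^sub>M {..<n} (\<lambda>_. lborel))"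
  proof (rule nn_integral_mono)
    fix y assume y: "y \<in> space (Pi\<^sub>M {..<n} (\<lambda>_. lborel :: real measure))"
    then have ry: "restrict y {..<n} = y" by (simp add: space_PiM PiE_restrict)
    have [measurable]: "b n y \<in> borel_measurable lborel"
      using measurable_compose[OF measurable_Pair1'[OF y] Suc.prems(1)[OF lessI]] by simp
    show "(\<integral>\<^sup>+x. (\<Prod>t<n. b t (restrict y {..<t}) (y t)) * b n (restrict y {..<n}) x \<partial>lborel) \<le> (\<Prod>t<n. b t (restrict y {..<t}) (y t))"
      unfolding ry using Suc.prems(2)[OF lessI y] by (subst nn_integral_cmult) (auto intro: mult_left_le)
  qed
  also have "\<dots> \<le> 1" using Suc.prems by (intro Suc.IH) auto
  finally show ?case .
qed

subsection \<open>Mixtures of Gaussian channels\<close>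

text \<open>\<open>MS\<close> is the law of the source block \<open>s\<close>, \<open>k s u\<close> the density of the auxiliary variable given \<open>s\<close>,
  \<open>f\<close> the encoder. Then \<open>dens t\<close> is the joint density of \<open>u\<close> and the first \<open>t\<close> channel outputs, and
  \<open>cond t u y\<close> the conditional density of output \<open>t\<close> given \<open>u\<close> and the outputs before \<open>t\<close>.\<close>

locale gauss_mixture = prob_space MS for MS :: "'s measure" +
  fixes LU :: "'u measure" and k :: "'s \<Rightarrow> 'u \<Rightarrow> real" and f :: "'s \<Rightarrow> nat \<Rightarrow> real" and \<sigma> :: real
  assumes \<sigma>: "0 < \<sigma>"
    and k_meas: "(\<lambda>(s, u). k s u) \<in> borel_measurable (MS \<Otimes>\<^sub>M LU)"
    and k_pos: "\<And>s u. 0 < k s u"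
    and k_int: "\<And>u. u \<in> space LU \<Longrightarrow> integrable MS (\<lambda>s. k s u)"
    and f_meas [measurable]: "\<And>i. (\<lambda>s. f s i) \<in> borel_measurable MS"
begin

lemma k_measurable [measurable (raw)]:
  assumes "g \<in> N \<rightarrow>\<^sub>M MS" "h \<in> N \<rightarrow>\<^sub>M LU"
  shows "(\<lambda>x. k (g x) (h x)) \<in> borel_measurable N"
  using measurable_compose[OF measurable_Pair[OF assms] k_meas] by simp

definition dens :: "nat \<Rightarrow> 'u \<Rightarrow> (nat \<Rightarrow> real) \<Rightarrow> real" where
  "dens t u y = (\<integral>s. k s u * (\<Prod>i<t. normal_density (f s i) \<sigma> (y i)) \<partial>MS)"

text \<open>The maximum of a normal density of deviation \<open>\<sigma>\<close>. It dominates the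
  channel factors uniformly in the outputs, which gives integrability and continuity of the
  mixtures.\<close>

definition peak :: real where "peak = 1 / sqrt (2 * pi * \<sigma>\<^sup>2)"

lemma normal_density_le_peak: "normal_density m \<sigma> x \<le> peak"
  unfolding normal_density_def peak_def by (rule mult_left_le) auto

lemma prod_nonneg_normal: "0 \<le> (\<Prod>i<t. normal_density (f s i) \<sigma> (y i))"
  by (simp add: prod_nonneg)

lemma prod_pos_normal: "0 < (\<Prod>i<t. normal_density (f s i) \<sigma> (y i))"
  by (intro prod_pos) (simp add: normal_density_pos \<sigma>)

lemma prod_le_peak: "(\<Prod>i<t. normal_density (f s i) \<sigma> (y i)) \<le> peak ^ t"
  using prod_mono[of "{..<t}" "\<lambda>i. normal_density (f s i) \<sigma> (y i)" "\<lambda>_. peak"] by (simp add: normal_density_le_peak)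

lemma normal_density_measurable2 [measurable (raw)]:
  assumes [measurable]: "m \<in> borel_measurable N" "g \<in> borel_measurable N"
  shows "(\<lambda>x. normal_density (m x) \<tau> (g x)) \<in> borel_measurable N"
  unfolding normal_density_def by measurable

lemma dens_integrable:
  assumes [measurable]: "u \<in> space LU"
  shows "integrable MS (\<lambda>s. k s u * (\<Prod>i<t. normal_density (f s i) \<sigma> (y i)))"
proof (rule Bochner_Integration.integrable_bound)
  show "integrable MS (\<lambda>s. k s u * peak ^ t)" using k_int[OF assms] by simp
  show "AE s in MS. norm (k s u * (\<Prod>i<t. normal_density (f s i) \<sigma> (y i))) \<le> norm (k s u * peak ^ t)"
    using k_pos prod_nonneg_normal prod_le_peak
    by (intro AE_I2) (auto simp: abs_mult intro!: mult_mono less_imp_le[OF k_pos] order_trans[OF prod_le_peak])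
qed measurable

lemma dens_pos:
  assumes "u \<in> space LU" shows "0 < dens t u y"
proof -
  have p: "0 < k s u * (\<Prod>i<t. normal_density (f s i) \<sigma> (y i))" for s using k_pos prod_pos_normal by simp
  have "dens t u y \<noteq> 0"
  proof
    assume "dens t u y = 0"
    then have "AE s in MS. k s u * (\<Prod>i<t. normal_density (f s i) \<sigma> (y i)) = 0"
      unfolding dens_def using integral_nonneg_eq_0_iff_AE[OF dens_integrable[OF assms]] p by (auto simp: less_imp_le)
    then have "AE s in MS. False"
    proof eventually_elim
      case (elim s) then show ?case using less_imp_neq[OF p[of s]] by argo
    qed
    then show False using AE_False by simp
  qed
  moreover have "0 \<le> dens t u y" unfolding dens_def using p by (intro integral_nonneg_AE) (simp add: less_imp_le)
  ultimately show ?thesis by simp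
qed

lemma dens_nn: "u \<in> space LU \<Longrightarrow> ennreal (dens t u y) = (\<integral>\<^sup>+s. k s u * (\<Prod>i<t. normal_density (f s i) \<sigma> (y i)) \<partial>MS)"
  unfolding dens_def using k_pos prod_pos_normal
  by (intro nn_integral_eq_integral[symmetric] dens_integrable) (auto intro!: mult_nonneg_nonneg less_imp_le)

lemma dens_measurable [measurable (raw)]:
  assumes [measurable]: "g \<in> N \<rightarrow>\<^sub>M LU" "\<And>i. i < t \<Longrightarrow> (\<lambda>x. Y x i) \<in> borel_measurable N"
  shows "(\<lambda>x. dens t (g x) (Y x)) \<in> borel_measurable N"
proof -
  have [measurable]: "(\<lambda>p. Y (fst p) i) \<in> borel_measurable (N \<Otimes>\<^sub>M MS)" if "i < t" for i
    using measurable_compose[OF measurable_fst assms(2)[OF that]] .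
  show ?thesis unfolding dens_def by (rule borel_measurable_lebesgue_integral) measurable
qed

lemma dens_cong: "(\<And>i. i < t \<Longrightarrow> y i = y' i) \<Longrightarrow> dens t u y = dens t u y'"
  by (simp add: dens_def)

definition cond :: "nat \<Rightarrow> 'u \<Rightarrow> (nat \<Rightarrow> real) \<Rightarrow> real \<Rightarrow> real" where
  "cond t u y x = dens (Suc t) u (y(t := x)) / dens t u y"

lemma dens_Suc: "dens (Suc t) u (y(t := x)) = (\<integral>s. k s u * (\<Prod>i<t. normal_density (f s i) \<sigma> (y i)) * normal_density (f s t) \<sigma> x \<partial>MS)"
  by (simp add: dens_def mult.assoc)

lemma cond_restrict: "cond t u (restrict y {..<t}) = cond t u y"
  unfolding cond_def by (intro ext arg_cong2[where f="(/)"] dens_cong) auto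

lemma cond_self: "cond t u y (y t) = dens (Suc t) u y / dens t u y"
  by (simp add: cond_def)

text \<open>Continuity is dominated convergence under the mixture, with \<open>peak\<close> bounding
  the newest channel factor. The mass is 1 because integrating the newest output out of the mixture
  leaves the density of the earlier ones.\<close>

lemma cond_positive_density:
  assumes u[measurable]: "u \<in> space LU"
  shows "positive_density (cond t u y)"
proof
  show "0 < cond t u y x" for x by (simp add: cond_def dens_pos u)
  show "continuous_on UNIV (cond t u y)"
    unfolding cond_def
  proof (intro continuous_on_divide continuous_on_const)
    show "continuous_on UNIV (\<lambda>x. dens (Suc t) u (y(t := x)))"
      unfolding dens_Suc continuous_on_sequentially
    proof (intro allI impI ballI, simp only: comp_def, rule integral_dominated_convergence)
      fix X x assume X: "(\<forall>n. X n \<in> UNIV) \<and> X \<longlonglongrightarrow> (x :: real)"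
      show "integrable MS (\<lambda>s. k s u * (\<Prod>i<t. normal_density (f s i) \<sigma> (y i)) * peak)"
        by (intro integrable_mult_left dens_integrable u)
      have "continuous_on UNIV (normal_density m \<sigma>)" for m
        unfolding normal_density_def using \<sigma> by (intro continuous_intros) auto
      then have "(\<lambda>n. normal_density m \<sigma> (X n)) \<longlonglongrightarrow> normal_density m \<sigma> x" for m
        by (rule continuous_on_tendsto_compose) (use X in auto)
      then show "AE s in MS. (\<lambda>n. k s u * (\<Prod>i<t. normal_density (f s i) \<sigma> (y i)) * normal_density (f s t) \<sigma> (X n))
        \<longlonglongrightarrow> k s u * (\<Prod>i<t. normal_density (f s i) \<sigma> (y i)) * normal_density (f s t) \<sigma> x"
        by (intro AE_I2 tendsto_intros)
      show "AE s in MS. norm (k s u * (\<Prod>i<t. normal_density (f s i) \<sigma> (y i)) * normal_density (f s t) \<sigma> (X n))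
        \<le> k s u * (\<Prod>i<t. normal_density (f s i) \<sigma> (y i)) * peak" for n
        using k_pos prod_nonneg_normal
        by (intro AE_I2) (auto simp: abs_mult less_imp_le intro!: mult_left_mono normal_density_le_peak)
    qed measurable
  qed (simp add: dens_pos[OF u, THEN less_imp_neq, symmetric])
  have "(\<integral>\<^sup>+x. dens (Suc t) u (y(t := x)) \<partial>lborel)
    = (\<integral>\<^sup>+x. \<integral>\<^sup>+s. k s u * (\<Prod>i<t. normal_density (f s i) \<sigma> (y i)) * normal_density (f s t) \<sigma> x \<partial>MS \<partial>lborel)"
    by (simp add: dens_nn u mult.assoc)
  also have "\<dots> = (\<integral>\<^sup>+s. \<integral>\<^sup>+x. k s u * (\<Prod>i<t. normal_density (f s i) \<sigma> (y i)) * normal_density (f s t) \<sigma> x \<partial>lborel \<partial>MS)"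
  proof -
    interpret pair_sigma_finite MS "lborel :: real measure" ..
    show ?thesis by (rule Fubini') measurable
  qed
  also have "\<dots> = (\<integral>\<^sup>+s. ennreal (k s u * (\<Prod>i<t. normal_density (f s i) \<sigma> (y i))) * 1 \<partial>MS)"
  proof (intro nn_integral_cong)
    fix s
    have "(\<integral>\<^sup>+x. normal_density (f s t) \<sigma> x \<partial>lborel) = 1"
      by (subst nn_integral_eq_integral) (use \<sigma> in auto)
    then show "(\<integral>\<^sup>+x. k s u * (\<Prod>i<t. normal_density (f s i) \<sigma> (y i)) * normal_density (f s t) \<sigma> x \<partial>lborel) = ennreal (k s u * (\<Prod>i<t. normal_density (f s i) \<sigma> (y i))) * 1"
      using k_pos[of s u] prod_nonneg_normal[of s y t]
      by (subst ennreal_mult) (auto simp: nn_integral_cmult less_imp_le)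
  qed
  also have "\<dots> = dens t u y" by (simp add: dens_nn u)
  finally have 1: "(\<integral>\<^sup>+x. dens (Suc t) u (y(t := x)) \<partial>lborel) = dens t u y" .
  have d: "dens t u y > 0" by (rule dens_pos[OF u])
  have "(\<integral>\<^sup>+x. cond t u y x \<partial>lborel) = (\<integral>\<^sup>+x. ennreal (1 / dens t u y) * dens (Suc t) u (y(t := x)) \<partial>lborel)"
    using d by (intro nn_integral_cong) (simp add: cond_def ennreal_mult''[symmetric] dens_pos[OF u] less_imp_le)
  also have "\<dots> = ennreal (1 / dens t u y) * dens t u y"
  proof (subst nn_integral_cmult)
    have "(\<lambda>x. dens (Suc t) u (y(t := x))) \<in> borel_measurable borel"
      by (rule dens_measurable) (auto simp: fun_upd_def)
    then show "(\<lambda>x. ennreal (dens (Suc t) u (y(t := x)))) \<in> borel_measurable lborel" by simp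
  qed (simp add: 1)
  also have "\<dots> = 1" using d by (simp add: ennreal_mult''[symmetric])
  finally show "(\<integral>\<^sup>+x. cond t u y x \<partial>lborel) = 1" .
qed

lemma cond_measurable [measurable (raw)]:
  assumes [measurable]: "g \<in> N \<rightarrow>\<^sub>M LU" "\<And>i. i < t \<Longrightarrow> (\<lambda>x. Y x i) \<in> borel_measurable N" "h \<in> borel_measurable N"
  shows "(\<lambda>x. cond t (g x) (Y x) (h x)) \<in> borel_measurable N"
proof -
  have "(\<lambda>x. ((Y x)(t := h x)) i) \<in> borel_measurable N" if "i < Suc t" for i
    using that assms(2)[of i] by (cases "i = t") auto
  then show ?thesis unfolding cond_def by measurable
qed

definition transp :: "nat \<Rightarrow> 'u \<Rightarrow> (nat \<Rightarrow> real) \<Rightarrow> real" where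
  "transp t u y = gauss_transport (cond t u y) (y t)"

lemma transp_measurable [measurable (raw)]:
  assumes [measurable]: "g \<in> N \<rightarrow>\<^sub>M LU" and Y[measurable]: "\<And>i. i < t \<Longrightarrow> (\<lambda>x. Y x i) \<in> borel_measurable N" "h \<in> borel_measurable N"
  shows "(\<lambda>x. gauss_transport (cond t (g x) (Y x)) (h x)) \<in> borel_measurable N"
proof -
  have [measurable]: "(\<lambda>p. Y (fst p) i) \<in> borel_measurable (N \<Otimes>\<^sub>M (borel :: real measure))" if "i < t" for i
    using measurable_compose[OF measurable_fst Y(1)[OF that]] .
  have "(\<lambda>(w, x). cond t (g w) (Y w) x) \<in> borel_measurable (N \<Otimes>\<^sub>M borel)"
    unfolding case_prod_beta by measurable
  then show ?thesis by measurable
qed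

text \<open>A test density for output \<open>x\<close> given the degraded output \<open>z\<close> and the past: the standard normal
  density pulled back along the increasing map \<open>x \<mapsto> b S x - c (z - x)\<close>, where \<open>S\<close> is the transport
  map. With \<open>c\<^sup>2 = \<lambda> / \<delta>\<close> and \<open>b\<^sup>2 = 1 - \<lambda>\<close> the terms in \<open>S\<^sup>2\<close> of its logarithm cancel.\<close>

definition backward :: "real \<Rightarrow> real \<Rightarrow> nat \<Rightarrow> 'u \<Rightarrow> real \<Rightarrow> (nat \<Rightarrow> real) \<Rightarrow> real \<Rightarrow> real" where
  "backward c b t u z y x = std_normal_density (c * (z - x) - b * gauss_transport (cond t u y) x)
     * (c + b * (cond t u y x / std_normal_density (gauss_transport (cond t u y) x)))"

lemma backward_measurable [measurable (raw)]:
  assumes [measurable]: "g \<in> N \<rightarrow>\<^sub>M LU" "\<And>i. i < t \<Longrightarrow> (\<lambda>x. Y x i) \<in> borel_measurable N" "h \<in> borel_measurable N" "z \<in> borel_measurable N"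
  shows "(\<lambda>x. backward c b t (g x) (z x) (Y x) (h x)) \<in> borel_measurable N"
  unfolding backward_def by measurable

lemma backward_restrict: "backward c b t u z (restrict y {..<t}) x = backward c b t u z y x"
  by (simp add: backward_def cond_restrict)

lemma backward_pos:
  assumes "u \<in> space LU" "0 < c" "0 \<le> b"
  shows "0 < backward c b t u z y x"
proof -
  interpret positive_density "cond t u y" by (rule cond_positive_density[OF assms(1)])
  show ?thesis unfolding backward_def
    using assms pos[of x] by (intro mult_pos_pos add_pos_nonneg mult_nonneg_nonneg divide_nonneg_pos) (auto simp: std.pos less_imp_le)
qed

text \<open>With \<open>u\<close> and the degraded block \<open>z\<close> fixed, each test density
  depends only on earlier letters of \<open>y\<close>, so the letters can be integrated out from the
  last to the first. A bound by 1 is all that a likelihood ratio needs.\<close>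

lemma nn_integral_backward_le:
  assumes u: "u \<in> space LU" and "0 \<le> c" "0 \<le> b"
  shows "(\<integral>\<^sup>+y. (\<Prod>t<n. ennreal (backward c b t u (z t) y (y t))) \<partial>Pi\<^sub>M {..<n} (\<lambda>_. lborel)) \<le> 1"
proof -
  have "(\<integral>\<^sup>+y. (\<Prod>t<n. ennreal (backward c b t u (z t) (restrict y {..<t}) (y t))) \<partial>Pi\<^sub>M {..<n} (\<lambda>_. lborel)) \<le> 1"
  proof (rule nn_integral_chain_le_1)
    fix t :: nat and y :: "nat \<Rightarrow> real"
    have [measurable]: "(\<lambda>x. fst x i) \<in> borel_measurable (Pi\<^sub>M {..<t} (\<lambda>_. lborel) \<Otimes>\<^sub>M lborel)" if "i < t" for i
      using that by (intro measurable_compose[OF measurable_fst measurable_component_singleton[of i, where M="\<lambda>_. lborel", simplified]]) auto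
    show "(\<lambda>(y, x). ennreal (backward c b t u (z t) y x)) \<in> borel_measurable (Pi\<^sub>M {..<t} (\<lambda>_. lborel) \<Otimes>\<^sub>M lborel)"
      using u unfolding case_prod_beta by measurable
    interpret positive_density "cond t u y" by (rule cond_positive_density[OF u])
    show "(\<integral>\<^sup>+x. ennreal (backward c b t u (z t) y x) \<partial>lborel) \<le> 1"
      unfolding backward_def by (rule backward_channel_mass_le) fact+
  qed
  then show ?thesis by (simp add: backward_restrict)
qed

lemma prod_cond: 
  assumes "u \<in> space LU"
  shows "(\<Prod>t<n. cond t u y (y t)) = dens n u y / dens 0 u y"
  unfolding cond_self
proof (induction n)
  case 0 then show ?case using dens_pos[OF assms, of 0 y] by simp
next
  case (Suc n) then show ?case using dens_pos[OF assms, of n y] by simp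
qed

text \<open>The factors before letter \<open>t\<close> are conditional densities of mass 1, and
  given them the transported letter has a bounded first absolute moment. The point \<open>y0\<close>
  is arbitrary since the density of no outputs does not depend on the outputs.\<close>

lemma nn_integral_abs_transp_le:
  assumes u: "u \<in> space LU" and t: "t < n"
  shows "(\<integral>\<^sup>+y. ennreal (\<bar>transp t u y\<bar> * dens n u y) \<partial>Pi\<^sub>M {..<n} (\<lambda>_. lborel))
    \<le> ennreal ((\<integral>x. std_normal_density x * \<bar>x\<bar> \<partial>lborel) + 1) * dens 0 u y0"
proof -
  define C where "C = (\<integral>x. std_normal_density x * \<bar>x\<bar> \<partial>lborel) + 1"
  have C0: "C > 0" unfolding C_def by (intro add_nonneg_pos integral_nonneg_AE) auto
  have "(\<integral>\<^sup>+x. std_normal_density x * \<bar>x\<bar> \<partial>lborel) = ennreal (\<integral>x. std_normal_density x * \<bar>x\<bar> \<partial>lborel)"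
    using integrable_std_normal_moment_abs[of 1] by (intro nn_integral_eq_integral) auto
  also have "\<dots> \<le> C" unfolding C_def by (intro ennreal_leI) simp
  finally have C: "(\<integral>\<^sup>+x. std_normal_density x * \<bar>x\<bar> \<partial>lborel) \<le> C" .
  \<comment> \<open>The conditional densities, with the one at letter \<open>t\<close> weighted by
    the absolute transport map. Dividing by \<open>C\<close> makes the weighted factor a subdensity;
    the 1 added in \<open>C\<close> makes it positive without evaluating the integral.\<close>
  define b where "b i y x = cond i u y x * (if i = t then \<bar>gauss_transport (cond i u y) x\<bar> / C else 1)" for i y x
  have b0: "0 \<le> b i y x" for i y x
    using C0 dens_pos[OF u] by (auto simp: b_def cond_def less_imp_le)
  have "(\<integral>\<^sup>+y. (\<Prod>i<n. ennreal (b i (restrict y {..<i}) (y i))) \<partial>Pi\<^sub>M {..<n} (\<lambda>_. lborel)) \<le> 1"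
  proof (rule nn_integral_chain_le_1)
    fix i :: nat and y :: "nat \<Rightarrow> real"
    have [measurable]: "(\<lambda>x. fst x j) \<in> borel_measurable (Pi\<^sub>M {..<i} (\<lambda>_. lborel) \<Otimes>\<^sub>M lborel)" if "j < i" for j
      using that by (intro measurable_compose[OF measurable_fst measurable_component_singleton[of j, where M="\<lambda>_. lborel", simplified]]) auto
    show "(\<lambda>(y, x). ennreal (b i y x)) \<in> borel_measurable (Pi\<^sub>M {..<i} (\<lambda>_. lborel) \<Otimes>\<^sub>M lborel)"
      using u unfolding case_prod_beta b_def by (cases "i = t"; simp; measurable)
    interpret positive_density "cond i u y" by (rule cond_positive_density[OF u])
    show "(\<integral>\<^sup>+x. ennreal (b i y x) \<partial>lborel) \<le> 1"
    proof (cases "i = t")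
      case True
      have [measurable]: "gauss_transport (cond i u y) \<in> borel_measurable borel"
        using gauss_transport_cont by (rule borel_measurable_continuous_onI)
      have "(\<integral>\<^sup>+x. ennreal (b i y x) \<partial>lborel) = (\<integral>\<^sup>+x. ennreal (1 / C) * ennreal (\<bar>gauss_transport (cond i u y) x\<bar> * cond i u y x) \<partial>lborel)"
        using True C0 pos by (intro nn_integral_cong) (simp add: b_def ennreal_mult'[symmetric] mult.commute)
      also have "\<dots> = ennreal (1 / C) * (\<integral>\<^sup>+x. \<bar>gauss_transport (cond i u y) x\<bar> * cond i u y x \<partial>lborel)"
        by (rule nn_integral_cmult) measurable
      also have "\<dots> \<le> ennreal (1 / C) * C"
        by (intro mult_left_mono order_trans[OF abs_gauss_transport_le C]) simp
      also have "\<dots> = 1" using C0 by (simp add: ennreal_mult''[symmetric])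
      finally show ?thesis .
    qed (simp add: b_def mass)
  qed
  moreover have "(\<Prod>i<n. ennreal (b i (restrict y {..<i}) (y i))) = ennreal (\<bar>transp t u y\<bar> * dens n u y) * ennreal (1 / (C * dens 0 u y0))" for y
  proof -
    have "b i (restrict y {..<i}) (y i) = cond i u y (y i) * (if i = t then \<bar>transp i u y\<bar> / C else 1)" for i
      by (simp add: b_def cond_restrict transp_def)
    then have "(\<Prod>i<n. b i (restrict y {..<i}) (y i)) = dens n u y / dens 0 u y * (\<bar>transp t u y\<bar> / C)"
      using t by (simp add: prod.distrib prod_cond[OF u])
    moreover have "dens 0 u y = dens 0 u y0" by (rule dens_cong) simp
    ultimately show ?thesis
      using b0 C0 dens_pos[OF u] by (simp add: prod_ennreal ennreal_mult''[symmetric] less_imp_le mult_ac)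
  qed
  ultimately have le: "(\<integral>\<^sup>+y. ennreal (\<bar>transp t u y\<bar> * dens n u y) * ennreal (1 / (C * dens 0 u y0)) \<partial>Pi\<^sub>M {..<n} (\<lambda>_. lborel)) \<le> 1" by simp
  have [measurable]: "(\<lambda>y. y i) \<in> borel_measurable (Pi\<^sub>M {..<n} (\<lambda>_. lborel :: real measure))" if "i < n" for i
    using that measurable_component_singleton[of i "{..<n}" "\<lambda>_. lborel :: real measure"] by simp
  have "(\<lambda>y. transp t u y) \<in> borel_measurable (Pi\<^sub>M {..<n} (\<lambda>_. lborel))"
    unfolding transp_def by (rule transp_measurable) (use u t in auto)
  moreover have "(\<lambda>y. dens n u y) \<in> borel_measurable (Pi\<^sub>M {..<n} (\<lambda>_. lborel))"
    by (rule dens_measurable) (use u in auto)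
  ultimately have "(\<lambda>y. ennreal (\<bar>transp t u y\<bar> * dens n u y)) \<in> borel_measurable (Pi\<^sub>M {..<n} (\<lambda>_. lborel))"
    by measurable
  with le have le: "(\<integral>\<^sup>+y. ennreal (\<bar>transp t u y\<bar> * dens n u y) \<partial>Pi\<^sub>M {..<n} (\<lambda>_. lborel)) * ennreal (1 / (C * dens 0 u y0)) \<le> 1"
    by (simp add: nn_integral_multc)
  have d: "0 < dens 0 u y0" by (rule dens_pos[OF u])
  have "(\<integral>\<^sup>+y. ennreal (\<bar>transp t u y\<bar> * dens n u y) \<partial>Pi\<^sub>M {..<n} (\<lambda>_. lborel))
    = (\<integral>\<^sup>+y. ennreal (\<bar>transp t u y\<bar> * dens n u y) \<partial>Pi\<^sub>M {..<n} (\<lambda>_. lborel)) * (ennreal (1 / (C * dens 0 u y0)) * ennreal (C * dens 0 u y0))"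
    using d C0 by (simp add: ennreal_mult''[symmetric])
  also have "\<dots> \<le> 1 * ennreal (C * dens 0 u y0)"
    unfolding mult.assoc[symmetric] by (rule mult_right_mono[OF le]) simp
  finally show ?thesis using C0 d by (simp add: C_def ennreal_mult')
qed

text \<open>The logarithm of the derivative factor is split by concavity. Its share
  \<open>1 - lam\<close> of - ln of the normal density at \<open>S\<close> yields (1 - lam) S^2 / 2,
  which cancels the same term of the normal exponent. What remains of \<open>S\<close> is the cross
  term with \<open>z - x\<close>, the noise added by the second receiver.\<close>

lemma ln_backward_ge:
  fixes t u y and x z lam \<delta> :: real
  assumes u: "u \<in> space LU" and lam: "0 < lam" "lam < 1" and \<delta>: "0 < \<delta>"
  defines "S \<equiv> gauss_transport (cond t u y) x"
  shows "ln (backward (sqrt (lam / \<delta>)) (sqrt (1 - lam)) t u z y x) \<ge>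
    - lam / 2 * ln (2 * pi) - lam * (z - x)\<^sup>2 / (2 * \<delta>) + sqrt (lam / \<delta>) * sqrt (1 - lam) * (S * (z - x))
    - lam / 2 * ln (lam * \<delta>) - (1 - lam) / 2 * ln (1 - lam) + (1 - lam) * ln (cond t u y x)"
proof -
  interpret positive_density "cond t u y" by (rule cond_positive_density[OF u])
  define c b r where "c = sqrt (lam / \<delta>)" and "b = sqrt (1 - lam)" and "r = cond t u y x"
  have c: "0 < c" "c\<^sup>2 = lam / \<delta>" and b: "0 < b" "b\<^sup>2 = 1 - lam" using lam \<delta> by (auto simp: c_def b_def)
  have r: "0 < r" by (simp add: r_def pos)
  have s: "0 < std_normal_density S" by (rule std.pos)
  have lns: "ln (std_normal_density v) = - ln (2 * pi) / 2 - v\<^sup>2 / 2" for v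
    by (simp add: std_normal_density_def ln_mult ln_div ln_sqrt field_simps)
  \<comment> \<open>The sum is read as a convex combination with weights \<open>lam\<close> and
    \<open>1 - lam\<close>. Dividing each summand by its weight produces the terms in ln lam and ln
    (1 - lam), which later make the choice of \<open>lam\<close> an optimisation.\<close>
  have "ln (c + b * (r / std_normal_density S)) \<ge> lam * ln (c / lam) + (1 - lam) * ln (b / (1 - lam) * (r / std_normal_density S))"
  proof -
    have p: "0 < c / lam" "0 < b / (1 - lam) * (r / std_normal_density S)" using c b r s lam by auto
    have "concave_on {0<..} (ln :: real \<Rightarrow> real)" by (rule ln_concave)
    from concave_onD[OF this, of "1 - lam" "c / lam" "b / (1 - lam) * (r / std_normal_density S)"]
    show ?thesis using p lam by simp
  qed
  moreover have "ln (c / lam) = - ln (lam * \<delta>) / 2"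
    using lam \<delta> by (simp add: c_def ln_div ln_sqrt ln_mult)
  moreover have "ln (b / (1 - lam) * (r / std_normal_density S)) = - ln (1 - lam) / 2 + ln r + ln (2 * pi) / 2 + S\<^sup>2 / 2"
  proof -
    have "ln (b / (1 - lam) * (r / std_normal_density S)) = ln b - ln (1 - lam) + (ln r - ln (std_normal_density S))"
      using b r s lam by (simp add: ln_mult ln_div)
    moreover have "ln b = ln (1 - lam) / 2" using lam by (simp add: b_def ln_sqrt)
    ultimately show ?thesis using lns[of S] by linarith
  qed
  moreover have "ln (backward c b t u z y x) = - ln (2 * pi) / 2 - (c * (z - x) - b * S)\<^sup>2 / 2 + ln (c + b * (r / std_normal_density S))"
  proof -
    have "0 < c + b * (r / std_normal_density S)" using b c r s by (simp add: add_pos_pos)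
    then show ?thesis
      using std.pos[of "c * (z - x) - b * S"]
      unfolding backward_def S_def[symmetric] r_def[symmetric] by (subst ln_mult) (auto simp: lns)
  qed
  moreover have "(c * (z - x) - b * S)\<^sup>2 = lam / \<delta> * (z - x)\<^sup>2 - 2 * c * b * (S * (z - x)) + (1 - lam) * S\<^sup>2"
    unfolding c(2)[symmetric] b(2)[symmetric] by (simp add: power2_eq_square algebra_simps)
  ultimately have "ln (backward c b t u z y x) \<ge> - ln (2 * pi) / 2 - (lam / \<delta> * (z - x)\<^sup>2 - 2 * c * b * (S * (z - x)) + (1 - lam) * S\<^sup>2) / 2
    + (lam * (- ln (lam * \<delta>) / 2) + (1 - lam) * (- ln (1 - lam) / 2 + ln r + ln (2 * pi) / 2 + S\<^sup>2 / 2))" by simp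
  then show ?thesis unfolding c_def[symmetric] b_def[symmetric] r_def[symmetric] by (simp add: field_simps)
qed

end

subsection \<open>Two likelihood ratios\<close>

abbreviation block_measure :: "nat \<Rightarrow> 'a measure \<Rightarrow> (nat \<Rightarrow> 'a) measure" where
  "block_measure n M \<equiv> Pi\<^sub>M {..<n} (\<lambda>_. M)"

lemma measurable_coord:
  assumes "g \<in> N \<rightarrow>\<^sub>M Pi\<^sub>M I (\<lambda>_. M)" "i \<in> I"
  shows "(\<lambda>x. g x i) \<in> N \<rightarrow>\<^sub>M M"
  using measurable_compose[OF assms(1) measurable_component_singleton[OF assms(2)]] .

lemma sets_block_measure_cong: "sets M = sets N \<Longrightarrow> sets (block_measure n M) = sets (block_measure n N)"
  by (rule sets_PiM_cong) auto

text \<open>Turns an expectation over independent additive noise into an integral against Lebesgue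
  measure with an explicit transition density, for noise of any dimension and any shift
  \<open>c\<close>. Each letter is one translation.\<close>

lemma nn_integral_block_density:
  fixes p :: "'a::euclidean_space \<Rightarrow> ennreal"
  assumes p[measurable]: "p \<in> borel_measurable borel" and sf: "sigma_finite_measure (density lborel p)"
    and h: "h \<in> borel_measurable (block_measure n lborel)"
  shows "(\<integral>\<^sup>+v. h (\<lambda>t\<in>{..<n}. c t + v t) \<partial>block_measure n (density lborel p))
    = (\<integral>\<^sup>+u. (\<Prod>t<n. p (u t - c t)) * h u \<partial>block_measure n lborel)"
  using h
proof (induction n arbitrary: h)
  case 0
  then show ?case by (simp add: PiM_empty nn_integral_count_space_finite)
next
  case (Suc n)
  interpret L: product_sigma_finite "\<lambda>_::nat. (lborel :: 'a measure)" ..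
  interpret D: product_sigma_finite "\<lambda>_::nat. density lborel p" using sf by (simp add: product_sigma_finite_def)
  interpret Ln: sigma_finite_measure "block_measure n (lborel :: 'a measure)" by (rule L.sigma_finite) simp
  have ins: "{..<Suc n} = insert n {..<n}" by auto
  have sD[measurable_cong]: "sets (block_measure m (density lborel p)) = sets (block_measure m lborel)" for m
    by (rule sets_block_measure_cong) simp
  have shift[measurable]: "(\<lambda>v. \<lambda>t\<in>{..<m}. c t + v t) \<in> block_measure m lborel \<rightarrow>\<^sub>M block_measure m lborel" for m
    by (intro measurable_restrict) (auto intro!: borel_measurable_add)
  note [measurable] = Suc.prems
  have upd[measurable]: "(\<lambda>(y, x). y(n := x)) \<in> block_measure n lborel \<Otimes>\<^sub>M lborel \<rightarrow>\<^sub>M block_measure (Suc n) lborel"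
    unfolding ins by (rule measurable_add_dim)
  \<comment> \<open>What is left of the integrand after the last letter has been integrated; it
    depends on the earlier letters only, so the induction hypothesis applies to it.\<close>
  define H where "H y = (\<integral>\<^sup>+x. p (x - c n) * h (y(n := x)) \<partial>lborel)" for y
  have hm[measurable]: "(\<lambda>q. h ((fst q)(n := snd q))) \<in> borel_measurable (block_measure n lborel \<Otimes>\<^sub>M lborel)"
    using measurable_compose[OF upd Suc.prems] by (simp add: case_prod_beta)
  have Hm: "H \<in> borel_measurable (block_measure n lborel)"
    unfolding H_def by (rule lborel.borel_measurable_nn_integral) (simp add: case_prod_beta, measurable)
  have inner: "(\<integral>\<^sup>+x. h (\<lambda>t\<in>{..<Suc n}. c t + (v(n := x)) t) \<partial>density lborel p) = H (\<lambda>t\<in>{..<n}. c t + v t)"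
    if v: "v \<in> space (block_measure n lborel)" for v
  proof -
    let ?y = "\<lambda>t\<in>{..<n}. c t + v t"
    have e: "(\<lambda>t\<in>{..<Suc n}. c t + (v(n := x)) t) = ?y(n := c n + x)" for x by (auto simp: fun_eq_iff restrict_def)
    have y: "?y \<in> space (block_measure n (lborel :: 'a measure))" by (simp add: space_PiM)
    have [measurable]: "(\<lambda>x. h (?y(n := x))) \<in> borel_measurable borel"
      using measurable_compose[OF measurable_Pair1'[OF y] hm] by simp
    have "(\<integral>\<^sup>+x. h (\<lambda>t\<in>{..<Suc n}. c t + (v(n := x)) t) \<partial>density lborel p) = (\<integral>\<^sup>+x. p ((c n + x) - c n) * h (?y(n := c n + x)) \<partial>lborel)"
    proof -
      have "(\<lambda>x. c n + x) \<in> lborel \<rightarrow>\<^sub>M borel" by measurable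
      from measurable_compose[OF this, of "\<lambda>x. h (?y(n := x))"]
      have "(\<lambda>x. h (?y(n := c n + x))) \<in> borel_measurable lborel" by measurable
      from nn_integral_density[OF _ this, of p] show ?thesis unfolding e add_diff_cancel_left' using p by simp
    qed
    also have "\<dots> = H ?y" unfolding H_def by (rule nn_integral_lborel_translate) measurable
    finally show ?thesis .
  qed
  have "(\<integral>\<^sup>+v. h (\<lambda>t\<in>{..<Suc n}. c t + v t) \<partial>block_measure (Suc n) (density lborel p))
    = (\<integral>\<^sup>+v. \<integral>\<^sup>+x. h (\<lambda>t\<in>{..<Suc n}. c t + (v(n := x)) t) \<partial>density lborel p \<partial>block_measure n (density lborel p))"
    unfolding ins
  proof (rule D.product_nn_integral_insert)
    show "(\<lambda>v. h (\<lambda>t\<in>insert n {..<n}. c t + v t)) \<in> borel_measurable (Pi\<^sub>M (insert n {..<n}) (\<lambda>_. density lborel p))"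
      unfolding ins[symmetric] by measurable
  qed auto
  also have "\<dots> = (\<integral>\<^sup>+v. H (\<lambda>t\<in>{..<n}. c t + v t) \<partial>block_measure n (density lborel p))"
    by (intro nn_integral_cong inner) (simp add: space_PiM)
  also have "\<dots> = (\<integral>\<^sup>+u. (\<Prod>t<n. p (u t - c t)) * H u \<partial>block_measure n lborel)"
    by (rule Suc.IH[OF Hm])
  also have "\<dots> = (\<integral>\<^sup>+u. \<integral>\<^sup>+x. (\<Prod>t<Suc n. p ((u(n := x)) t - c t)) * h (u(n := x)) \<partial>lborel \<partial>block_measure n lborel)"
  proof (rule nn_integral_cong)
    fix u assume u: "u \<in> space (block_measure n (lborel :: 'a measure))"
    have [measurable]: "(\<lambda>x. h (u(n := x))) \<in> borel_measurable borel"
      using measurable_compose[OF measurable_Pair1'[OF u] hm] by simp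
    show "(\<Prod>t<n. p (u t - c t)) * H u = (\<integral>\<^sup>+x. (\<Prod>t<Suc n. p ((u(n := x)) t - c t)) * h (u(n := x)) \<partial>lborel)"
      unfolding H_def by (subst nn_integral_cmult[symmetric]) (auto intro!: nn_integral_cong simp: mult.assoc)
  qed
  also have "\<dots> = (\<integral>\<^sup>+u. (\<Prod>t<Suc n. p (u t - c t)) * h u \<partial>block_measure (Suc n) lborel)"
    unfolding ins
  proof (rule L.product_nn_integral_insert[symmetric])
    have "(\<lambda>u. (\<Prod>t<Suc n. p (u t - c t)) * h u) \<in> borel_measurable (block_measure (Suc n) lborel)"
      using measurable_coord[OF measurable_id, of _ "{..<Suc n}" "lborel :: 'a measure"]
      by (intro borel_measurable_times_ennreal borel_measurable_prod_ennreal Suc.prems) (auto intro!: measurable_compose[OF _ p] borel_measurable_diff)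
    then show "(\<lambda>u. (\<Prod>t\<in>insert n {..<n}. p (u t - c t)) * h u) \<in> borel_measurable (Pi\<^sub>M (insert n {..<n}) (\<lambda>_. lborel))"
      unfolding ins .
  qed auto
  finally show ?case .
qed

lemma nn_integral_block_prod:
  fixes p :: "nat \<Rightarrow> 'a \<Rightarrow> ennreal"
  assumes "sigma_finite_measure M" "\<And>t. p t \<in> borel_measurable M"
  shows "(\<integral>\<^sup>+x. (\<Prod>t<n. p t (x t)) \<partial>block_measure n M) = (\<Prod>t<n. \<integral>\<^sup>+x. p t x \<partial>M)"
proof -
  interpret product_sigma_finite "\<lambda>_::nat. M" using assms by (simp add: product_sigma_finite_def)
  show ?thesis using assms(2) by (intro product_nn_integral_prod) auto
qed

lemma sigma_finite_block_lborel: "sigma_finite_measure (block_measure n (lborel :: 'a::euclidean_space measure))"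
proof -
  interpret product_sigma_finite "\<lambda>_::nat. (lborel :: 'a measure)" ..
  show ?thesis by (rule sigma_finite) simp
qed

abbreviation noise :: "real \<Rightarrow> real measure" where
  "noise N \<equiv> density lborel (normal_density 0 (sqrt N))"

text \<open>\<open>A\<close> is the covariance of the source, \<open>Th\<close> that of the estimation error of \<open>sh\<close>, \<open>P\<close> the
  projection to the second source, \<open>K\<close> the covariance of the auxiliary noise, \<open>D = D2 + K\<close>,
  \<open>\<delta> = N2 - N1\<close>, and \<open>Q\<close> the power of the second output.\<close>

locale broadcast_model =
  fixes n :: nat and A Th :: "real^'k^'k" and K D :: "real^'j^'j" and P :: "real^'k^'j"
    and N1 \<delta> Q :: real and f :: "(nat \<Rightarrow> real^'k) \<Rightarrow> nat \<Rightarrow> real"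
    and sh :: "(nat \<Rightarrow> real) \<Rightarrow> nat \<Rightarrow> real^'k" and uh :: "(nat \<Rightarrow> real) \<Rightarrow> nat \<Rightarrow> real^'j"
  assumes A: "pos_def A" and Th: "pos_def Th" and K: "pos_def K" and D: "pos_def D"
    and N1: "0 < N1" and \<delta>: "0 < \<delta>" and Q: "0 < Q"
    and f_meas: "\<And>t. (\<lambda>s. f s t) \<in> borel_measurable (block_measure n borel)"
    and sh_meas: "\<And>t. (\<lambda>y. sh y t) \<in> borel_measurable (block_measure n borel)"
    and uh_meas: "\<And>t. (\<lambda>y. uh y t) \<in> borel_measurable (block_measure n borel)"
begin

abbreviation "LS \<equiv> block_measure n (lborel :: (real^'k) measure)"
abbreviation "LU \<equiv> block_measure n (lborel :: (real^'j) measure)"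
abbreviation "LY \<equiv> block_measure n (lborel :: real measure)"
abbreviation "MuS \<equiv> block_measure n (gauss_measure A)"
abbreviation "MuV \<equiv> block_measure n (gauss_measure K)"
abbreviation "MuZ \<equiv> block_measure n (noise N1)"
abbreviation "MuW \<equiv> block_measure n (noise \<delta>)"

lemma sets_M [measurable_cong]: "sets MuS = sets LS" "sets MuV = sets LU" "sets MuZ = sets LY" "sets MuW = sets LY"
  by (auto intro!: sets_block_measure_cong)

lemma sets_L [measurable_cong]: "sets LS = sets (block_measure n borel)" "sets LU = sets (block_measure n borel)" "sets LY = sets (block_measure n borel)"
  by (auto intro!: sets_block_measure_cong)

lemma prob_base: "prob_space (gauss_measure A)" "prob_space (gauss_measure K)" "prob_space (noise N1)" "prob_space (noise \<delta>)"
  by (auto intro!: prob_space_gauss_measure prob_space_normal_density A K simp: N1 \<delta>)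

sublocale MuS: prob_space MuS using prob_base by (intro prob_space_PiM) auto
sublocale MuV: prob_space MuV using prob_base by (intro prob_space_PiM) auto
sublocale MuZ: prob_space MuZ using prob_base by (intro prob_space_PiM) auto
sublocale MuW: prob_space MuW using prob_base by (intro prob_space_PiM) auto
sublocale LS: sigma_finite_measure LS by (rule sigma_finite_block_lborel)
sublocale LU: sigma_finite_measure LU by (rule sigma_finite_block_lborel)
sublocale LY: sigma_finite_measure LY by (rule sigma_finite_block_lborel)

lemma coord_measurable:
  "g \<in> N \<rightarrow>\<^sub>M block_measure n borel \<Longrightarrow> t < n \<Longrightarrow> (\<lambda>x. g x t) \<in> N \<rightarrow>\<^sub>M borel"
  by (rule measurable_coord) auto

text \<open>The transition density from the source block to the auxiliary block, whose letters are P
  s + v with v of covariance \<open>K\<close>.\<close>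

definition ker :: "(nat \<Rightarrow> real^'k) \<Rightarrow> (nat \<Rightarrow> real^'j) \<Rightarrow> real" where
  "ker s u = (\<Prod>t<n. gauss_density K (u t - P *v s t))"

definition ch :: "real \<Rightarrow> (nat \<Rightarrow> real) \<Rightarrow> (nat \<Rightarrow> real) \<Rightarrow> real" where
  "ch N x y = (\<Prod>t<n. normal_density 0 (sqrt N) (y t - x t))"

definition gd :: "real^'a^'a \<Rightarrow> (nat \<Rightarrow> real^'a) \<Rightarrow> (nat \<Rightarrow> real^'a) \<Rightarrow> real" where
  "gd B x y = (\<Prod>t<n. gauss_density B (y t - x t))"

lemma ker_measurable:
  assumes "\<And>t. t < n \<Longrightarrow> (\<lambda>x. s x t) \<in> borel_measurable N" "\<And>t. t < n \<Longrightarrow> (\<lambda>x. u x t) \<in> borel_measurable N"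
  shows "(\<lambda>x. ker (s x) (u x)) \<in> borel_measurable N"
  unfolding ker_def
  by (intro borel_measurable_prod measurable_compose[OF _ gauss_density_measurable] borel_measurable_diff borel_measurable_matrix_vector_mult assms) auto

lemma gd_measurable:
  assumes "\<And>t. t < n \<Longrightarrow> (\<lambda>x. s x t) \<in> borel_measurable N" "\<And>t. t < n \<Longrightarrow> (\<lambda>x. u x t) \<in> borel_measurable N"
  shows "(\<lambda>x. gd B (s x) (u x)) \<in> borel_measurable N"
  unfolding gd_def
  by (intro borel_measurable_prod measurable_compose[OF _ gauss_density_measurable] borel_measurable_diff assms) auto

lemma ch_measurable:
  assumes "\<And>t. t < n \<Longrightarrow> (\<lambda>x. s x t) \<in> borel_measurable N" "\<And>t. t < n \<Longrightarrow> (\<lambda>x. u x t) \<in> borel_measurable N"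
  shows "(\<lambda>x. ch \<tau> (s x) (u x)) \<in> borel_measurable N"
  unfolding ch_def
  by (intro borel_measurable_prod measurable_compose[OF _ borel_measurable_normal_density] borel_measurable_diff assms) auto

lemma ker_pos: "0 < ker s u" unfolding ker_def by (intro prod_pos) (simp add: gauss_density_pos K)
lemma gd_pos: "pos_def B \<Longrightarrow> 0 < gd B x y" unfolding gd_def by (intro prod_pos) (simp add: gauss_density_pos)
lemma ch_pos: "0 < \<tau> \<Longrightarrow> 0 < ch \<tau> x y" unfolding ch_def by (intro prod_pos) (simp add: normal_density_pos)

text \<open>The covariance of P s + v when s has covariance \<open>B\<close>. It is used for
  \<open>B = A\<close>, the auxiliary variable itself, and for \<open>B = Th\<close>, its error
  given the first output.\<close>

definition QK :: "real^'k^'k \<Rightarrow> real^'j^'j" where "QK B = P ** B ** transpose P + K"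

lemma QK_pos_def: "pos_def B \<Longrightarrow> pos_def (QK B)"
  unfolding QK_def by (rule gauss_density_convolution(1)[OF _ K])

text \<open>The normaliser of the Gaussian posterior of s given u, when s is centred at
  \<open>x\<close> with covariance \<open>B\<close>: a product of convolutions, one for each
  letter.\<close>

lemma nn_integral_gauss_ker:
  assumes B: "pos_def B"
  shows "(\<integral>\<^sup>+s. ennreal (gd B x s) * ker s u \<partial>LS) = gd (QK B) (\<lambda>t. P *v x t) u"
proof -
  have "(\<integral>\<^sup>+s. ennreal (gd B x s) * ker s u \<partial>LS)
    = (\<integral>\<^sup>+s. (\<Prod>t<n. ennreal (gauss_density B (s t - x t)) * gauss_density K (u t - P *v s t)) \<partial>LS)"
    unfolding gd_def ker_def
    by (simp add: prod.distrib prod_ennreal gauss_density_pos[OF B] gauss_density_pos[OF K] less_imp_le)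
  also have "\<dots> = (\<Prod>t<n. \<integral>\<^sup>+s. ennreal (gauss_density B (s - x t)) * gauss_density K (u t - P *v s) \<partial>lborel)"
    by (rule nn_integral_block_prod) (auto intro: lborel.sigma_finite_measure_axioms)
  also have "\<dots> = (\<Prod>t<n. ennreal (gauss_density (QK B) (u t - P *v x t)))"
  proof (intro prod.cong refl)
    fix t
    have "(\<integral>\<^sup>+s. ennreal (gauss_density B (s - x t)) * gauss_density K (u t - P *v s) \<partial>lborel)
      = (\<integral>\<^sup>+s. ennreal (gauss_density B (x t + s - x t)) * gauss_density K (u t - P *v (x t + s)) \<partial>lborel)"
      by (rule nn_integral_lborel_translate[symmetric]) measurable
    also have "\<dots> = (\<integral>\<^sup>+s. gauss_density B s * gauss_density K ((u t - P *v x t) - P *v s) \<partial>lborel)"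
      by (simp add: ennreal_mult'' gauss_density_pos[OF K] less_imp_le matrix_vector_right_distrib algebra_simps)
    also have "\<dots> = gauss_density (QK B) (u t - P *v x t)"
      unfolding QK_def by (rule gauss_density_convolution(2)[OF B K])
    finally show "(\<integral>\<^sup>+s. ennreal (gauss_density B (s - x t)) * gauss_density K (u t - P *v s) \<partial>lborel) = ennreal (gauss_density (QK B) (u t - P *v x t))" .
  qed
  also have "\<dots> = gd (QK B) (\<lambda>t. P *v x t) u"
    unfolding gd_def by (rule prod_ennreal) (simp add: gauss_density_pos[OF QK_pos_def[OF B]] less_imp_le)
  finally show ?thesis .
qed

lemma nn_integral_MuS:
  assumes [measurable]: "h \<in> borel_measurable LS"
  shows "(\<integral>\<^sup>+s. h s \<partial>MuS) = (\<integral>\<^sup>+s. ennreal (gd A (\<lambda>_. 0) s) * h s \<partial>LS)"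
proof -
  have "(\<integral>\<^sup>+s. h s \<partial>MuS) = (\<integral>\<^sup>+v. h (\<lambda>t\<in>{..<n}. 0 + v t) \<partial>MuS)"
    by (intro nn_integral_cong) (simp add: space_PiM PiE_restrict)
  also have "\<dots> = (\<integral>\<^sup>+s. (\<Prod>t<n. ennreal (gauss_density A (s t - 0))) * h s \<partial>LS)"
    unfolding gauss_measure_def
    by (rule nn_integral_block_density)
      (use prob_space_imp_sigma_finite[OF prob_base(1)] in \<open>auto simp: gauss_measure_def\<close>)
  finally show ?thesis by (simp add: gd_def prod_ennreal gauss_density_pos[OF A] less_imp_le)
qed

lemma nn_integral_MuV:
  assumes [measurable]: "h \<in> borel_measurable LU"
  shows "(\<integral>\<^sup>+v. h (\<lambda>t\<in>{..<n}. P *v s t + v t) \<partial>MuV) = (\<integral>\<^sup>+u. ennreal (ker s u) * h u \<partial>LU)"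
  using nn_integral_block_density[of "\<lambda>x. ennreal (gauss_density K x)" h n "\<lambda>t. P *v s t"] prob_space_imp_sigma_finite[OF prob_base(2)]
  by (simp add: gauss_measure_def ker_def prod_ennreal gauss_density_pos[OF K] less_imp_le)

lemma nn_integral_noise:
  assumes [measurable]: "h \<in> borel_measurable LY" and "0 < N"
  shows "(\<integral>\<^sup>+z. h (\<lambda>t\<in>{..<n}. x t + z t) \<partial>block_measure n (noise N)) = (\<integral>\<^sup>+y. ennreal (ch N x y) * h y \<partial>LY)"
  using nn_integral_block_density[of "\<lambda>x. ennreal (normal_density 0 (sqrt N) x)" h n x] assms
    prob_space_imp_sigma_finite[OF prob_space_normal_density[of "sqrt N" 0]]
  by (simp add: ch_def prod_ennreal)

sublocale mix: gauss_mixture MuS LU ker f "sqrt N1"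
proof
  show "(\<lambda>(s, u). ker s u) \<in> borel_measurable (MuS \<Otimes>\<^sub>M LU)"
    unfolding case_prod_beta
    by (intro ker_measurable coord_measurable) (auto intro: measurable_fst measurable_snd simp: measurable_cong_sets[OF sets_pair_measure_cong[OF sets_M(1) refl] refl])
  show "(\<lambda>s. f s i) \<in> borel_measurable MuS" for i using f_meas[of i] by measurable
  fix u assume "u \<in> space LU"
  have [measurable]: "(\<lambda>s. ker s u) \<in> borel_measurable LS"
    by (rule ker_measurable) (auto intro: coord_measurable[of "\<lambda>x. x"])
  have "(\<integral>\<^sup>+s. ker s u \<partial>MuS) = gd (QK A) (\<lambda>t. P *v 0) u"
    by (subst nn_integral_MuS) (auto simp: nn_integral_gauss_ker[OF A])
  then show "integrable MuS (\<lambda>s. ker s u)"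
    using ker_pos by (intro integrableI_nonneg) (auto simp: less_imp_le)
qed (use N1 ker_pos in auto)

text \<open>Before any output is seen, the mixture is the marginal law of the auxiliary block and
  hence explicit. It is the denominator left by the telescoping product of the conditional
  densities.\<close>

lemma dens_0: 
  assumes "u \<in> space LU"
  shows "mix.dens 0 u y = gd (QK A) (\<lambda>_. 0) u"
proof -
  have [measurable]: "(\<lambda>s. ker s u) \<in> borel_measurable LS"
    by (rule ker_measurable) (auto intro: coord_measurable[of "\<lambda>x. x"])
  have "ennreal (mix.dens 0 u y) = (\<integral>\<^sup>+s. ker s u \<partial>MuS)"
    by (subst mix.dens_nn[OF assms]) simp
  also have "\<dots> = gd (QK A) (\<lambda>t. P *v 0) u"
    by (subst nn_integral_MuS) (auto simp: nn_integral_gauss_ker[OF A])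
  finally show ?thesis
    using mix.dens_pos[OF assms, of 0 y] gd_pos[OF QK_pos_def[OF A], of "\<lambda>_. 0" u] by (simp add: ennreal_inj less_imp_le)
qed

lemma ch_eq: "(\<Prod>i<n. normal_density (x i) (sqrt N) (y i)) = ch N x y"
  by (simp add: ch_def normal_density_def)

lemma dens_n: "u \<in> space LU \<Longrightarrow> ennreal (mix.dens n u y) = (\<integral>\<^sup>+s. ennreal (ker s u * ch N1 (f s) y) \<partial>MuS)"
  by (subst mix.dens_nn) (auto simp: ch_eq)

end

section \<open>Joint densities of source, outputs and auxiliary variable, and the masses of the two
  ratios\<close>

context broadcast_model
begin

definition outU :: "(nat \<Rightarrow> real^'k) \<Rightarrow> (nat \<Rightarrow> real^'j) \<Rightarrow> nat \<Rightarrow> real^'j" where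
  "outU s v = (\<lambda>t\<in>{..<n}. P *v s t + v t)"

definition outY :: "(nat \<Rightarrow> real^'k) \<Rightarrow> (nat \<Rightarrow> real) \<Rightarrow> nat \<Rightarrow> real" where
  "outY s z = (\<lambda>t\<in>{..<n}. f s t + z t)"

definition outZ :: "(nat \<Rightarrow> real) \<Rightarrow> (nat \<Rightarrow> real) \<Rightarrow> nat \<Rightarrow> real" where
  "outZ y w = (\<lambda>t\<in>{..<n}. y t + w t)"

lemma coord_lborel:
  "g \<in> N \<rightarrow>\<^sub>M block_measure n lborel \<Longrightarrow> t < n \<Longrightarrow> (\<lambda>x. g x t) \<in> borel_measurable N"
  using measurable_coord[of g N "{..<n}" lborel t] by simp

lemma f_compose: "s \<in> N \<rightarrow>\<^sub>M LS \<Longrightarrow> (\<lambda>x. f (s x) t) \<in> borel_measurable N"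
  and sh_compose: "y \<in> N \<rightarrow>\<^sub>M LY \<Longrightarrow> (\<lambda>x. sh (y x) t) \<in> borel_measurable N"
  and uh_compose: "y \<in> N \<rightarrow>\<^sub>M LY \<Longrightarrow> (\<lambda>x. uh (y x) t) \<in> borel_measurable N"
  using measurable_compose[OF _ f_meas] measurable_compose[OF _ sh_meas] measurable_compose[OF _ uh_meas]
  by (simp_all add: measurable_cong_sets[OF refl sets_L(1)] measurable_cong_sets[OF refl sets_L(3)])

lemma block_intro:
  assumes "\<And>t. t < n \<Longrightarrow> (\<lambda>x. g x t) \<in> borel_measurable N"
  shows "(\<lambda>x. \<lambda>t\<in>{..<n}. g x t) \<in> N \<rightarrow>\<^sub>M block_measure n lborel"
  by (rule measurable_restrict) (use assms in simp)

lemma out_measurable [measurable (raw)]: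
  "s \<in> N \<rightarrow>\<^sub>M LS \<Longrightarrow> v \<in> N \<rightarrow>\<^sub>M LU \<Longrightarrow> (\<lambda>x. outU (s x) (v x)) \<in> N \<rightarrow>\<^sub>M LU"
  "s \<in> N \<rightarrow>\<^sub>M LS \<Longrightarrow> z \<in> N \<rightarrow>\<^sub>M LY \<Longrightarrow> (\<lambda>x. outY (s x) (z x)) \<in> N \<rightarrow>\<^sub>M LY"
  "y \<in> N \<rightarrow>\<^sub>M LY \<Longrightarrow> z \<in> N \<rightarrow>\<^sub>M LY \<Longrightarrow> (\<lambda>x. outZ (y x) (z x)) \<in> N \<rightarrow>\<^sub>M LY"
  unfolding outU_def outY_def outZ_def
  by (rule block_intro, rule borel_measurable_add; intro borel_measurable_matrix_vector_mult coord_lborel f_compose; assumption)+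

lemma factor_measurable [measurable (raw)]:
  "s \<in> N \<rightarrow>\<^sub>M LS \<Longrightarrow> u \<in> N \<rightarrow>\<^sub>M LU \<Longrightarrow> (\<lambda>x. ker (s x) (u x)) \<in> borel_measurable N"
  "s \<in> N \<rightarrow>\<^sub>M LS \<Longrightarrow> y \<in> N \<rightarrow>\<^sub>M LY \<Longrightarrow> (\<lambda>x. ch \<tau> (f (s x)) (y x)) \<in> borel_measurable N"
  "z \<in> N \<rightarrow>\<^sub>M LY \<Longrightarrow> y \<in> N \<rightarrow>\<^sub>M LY \<Longrightarrow> (\<lambda>x. ch \<tau> (z x) (y x)) \<in> borel_measurable N"
  "y \<in> N \<rightarrow>\<^sub>M LY \<Longrightarrow> (\<lambda>x. ch \<tau> (\<lambda>_. 0) (y x)) \<in> borel_measurable N"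
  "s \<in> N \<rightarrow>\<^sub>M LS \<Longrightarrow> (\<lambda>x. gd A (\<lambda>_. 0) (s x)) \<in> borel_measurable N"
  "y \<in> N \<rightarrow>\<^sub>M LY \<Longrightarrow> s \<in> N \<rightarrow>\<^sub>M LS \<Longrightarrow> (\<lambda>x. gd Th (sh (y x)) (s x)) \<in> borel_measurable N"
  "y \<in> N \<rightarrow>\<^sub>M LY \<Longrightarrow> u \<in> N \<rightarrow>\<^sub>M LU \<Longrightarrow> (\<lambda>x. gd (QK Th) (\<lambda>t. P *v sh (y x) t) (u x)) \<in> borel_measurable N"
  "y \<in> N \<rightarrow>\<^sub>M LY \<Longrightarrow> u \<in> N \<rightarrow>\<^sub>M LU \<Longrightarrow> (\<lambda>x. gd D (uh (y x)) (u x)) \<in> borel_measurable N"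
  by (rule ker_measurable ch_measurable gd_measurable,
      ((intro f_compose sh_compose uh_compose borel_measurable_const borel_measurable_matrix_vector_mult | rule coord_lborel);
        (assumption | erule (1) less_trans))+)+

lemma dens_block_measurable [measurable (raw)]:
  assumes "u \<in> N \<rightarrow>\<^sub>M LU" "y \<in> N \<rightarrow>\<^sub>M LY"
  shows "(\<lambda>x. mix.dens n (u x) (y x)) \<in> borel_measurable N"
    and "t < n \<Longrightarrow> (\<lambda>x. mix.transp t (u x) (y x)) \<in> borel_measurable N"
proof -
  have y: "(\<lambda>x. y x i) \<in> borel_measurable N" if "i < n" for i using assms(2) that by (rule coord_lborel)
  show "(\<lambda>x. mix.dens n (u x) (y x)) \<in> borel_measurable N"
    by (rule mix.dens_measurable) (use assms y in auto)
  show "(\<lambda>x. mix.transp t (u x) (y x)) \<in> borel_measurable N" if "t < n"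
    unfolding mix.transp_def by (rule mix.transp_measurable) (use assms y that in auto)
qed

lemma prod_backward_measurable [measurable (raw)]:
  assumes "u \<in> N \<rightarrow>\<^sub>M LU" "y \<in> N \<rightarrow>\<^sub>M LY" "z \<in> N \<rightarrow>\<^sub>M LY"
  shows "(\<lambda>x. \<Prod>t<n. mix.backward c b t (u x) (z x t) (y x) (y x t)) \<in> borel_measurable N"
  by (rule borel_measurable_prod, rule mix.backward_measurable) (auto intro: coord_lborel assms)

text \<open>The independent triple of source, first channel noise and auxiliary noise. The noise
  added by the second receiver joins only later, so that \<open>R2\<close> lives on this smaller
  space.\<close>

abbreviation "Om3 \<equiv> (MuS \<Otimes>\<^sub>M MuZ) \<Otimes>\<^sub>M MuV"

text \<open>Passes from the independent variables to the joint density of source, first output and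
  auxiliary variable. The source is integrated innermost so that it can be eliminated for fixed
  outputs.\<close>

lemma nn_integral_Om3:
  assumes h: "(\<lambda>(s, y, u). h s y u) \<in> borel_measurable (LS \<Otimes>\<^sub>M (LY \<Otimes>\<^sub>M LU))"
  shows "(\<integral>\<^sup>+x. h (fst (fst x)) (outY (fst (fst x)) (snd (fst x))) (outU (fst (fst x)) (snd x)) \<partial>Om3)
    = (\<integral>\<^sup>+y. \<integral>\<^sup>+u. \<integral>\<^sup>+s. ennreal (gd A (\<lambda>_. 0) s * ch N1 (f s) y * ker s u) * h s y u \<partial>LS \<partial>LU \<partial>LY)"
proof -
  have hc[measurable (raw)]: "(\<lambda>x. h (s x) (y x) (u x)) \<in> borel_measurable N"
    if "s \<in> N \<rightarrow>\<^sub>M LS" "y \<in> N \<rightarrow>\<^sub>M LY" "u \<in> N \<rightarrow>\<^sub>M LU" for N s y u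
    using measurable_compose[OF measurable_Pair[OF that(1) measurable_Pair[OF that(2,3)]] h] by simp
  interpret SY: pair_sigma_finite LS LY ..
  interpret SU: pair_sigma_finite LS LU ..
  have 1: "0 \<le> gd A (\<lambda>_. 0) s" "0 \<le> ch N1 (f s) y" "0 \<le> ker s u" for s y u
    using gd_pos[OF A] ch_pos[OF N1] ker_pos by (auto simp: less_imp_le)
  have "(\<integral>\<^sup>+x. h (fst (fst x)) (outY (fst (fst x)) (snd (fst x))) (outU (fst (fst x)) (snd x)) \<partial>Om3)
    = (\<integral>\<^sup>+x. \<integral>\<^sup>+v. h (fst x) (outY (fst x) (snd x)) (outU (fst x) v) \<partial>MuV \<partial>(MuS \<Otimes>\<^sub>M MuZ))"
    by (subst MuV.nn_integral_fst[symmetric]) auto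
  also have "\<dots> = (\<integral>\<^sup>+s. \<integral>\<^sup>+z. \<integral>\<^sup>+v. h s (outY s z) (outU s v) \<partial>MuV \<partial>MuZ \<partial>MuS)"
    by (subst MuZ.nn_integral_fst[symmetric]) auto
  also have "\<dots> = (\<integral>\<^sup>+s. \<integral>\<^sup>+z. (\<integral>\<^sup>+u. ennreal (ker s u) * h s (outY s z) u \<partial>LU) \<partial>MuZ \<partial>MuS)"
  proof (intro nn_integral_cong)
    fix s z assume "s \<in> space MuS" "z \<in> space MuZ"
    then have [measurable]: "s \<in> space LS" "z \<in> space LY" by (auto simp: space_PiM)
    have "(\<lambda>u. h s (outY s z) u) \<in> borel_measurable LU" by measurable
    from nn_integral_MuV[OF this, of s]
    show "(\<integral>\<^sup>+v. h s (outY s z) (outU s v) \<partial>MuV) = (\<integral>\<^sup>+u. ennreal (ker s u) * h s (outY s z) u \<partial>LU)"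
      by (simp add: outU_def)
  qed
  also have "\<dots> = (\<integral>\<^sup>+s. \<integral>\<^sup>+y. ennreal (ch N1 (f s) y) * (\<integral>\<^sup>+u. ennreal (ker s u) * h s y u \<partial>LU) \<partial>LY \<partial>MuS)"
  proof (rule nn_integral_cong)
    fix s assume "s \<in> space MuS"
    then have [measurable]: "s \<in> space LS" by (simp add: space_PiM)
    have "(\<lambda>y. \<integral>\<^sup>+u. ennreal (ker s u) * h s y u \<partial>LU) \<in> borel_measurable LY" by measurable
    from nn_integral_noise[OF this N1, of "f s"]
    show "(\<integral>\<^sup>+z. (\<integral>\<^sup>+u. ennreal (ker s u) * h s (outY s z) u \<partial>LU) \<partial>MuZ) = (\<integral>\<^sup>+y. ennreal (ch N1 (f s) y) * (\<integral>\<^sup>+u. ennreal (ker s u) * h s y u \<partial>LU) \<partial>LY)"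
      by (simp add: outY_def)
  qed
  also have "\<dots> = (\<integral>\<^sup>+s. ennreal (gd A (\<lambda>_. 0) s) * (\<integral>\<^sup>+y. ennreal (ch N1 (f s) y) * (\<integral>\<^sup>+u. ennreal (ker s u) * h s y u \<partial>LU) \<partial>LY) \<partial>LS)"
    by (rule nn_integral_MuS) measurable
  also have "\<dots> = (\<integral>\<^sup>+s. \<integral>\<^sup>+y. \<integral>\<^sup>+u. ennreal (gd A (\<lambda>_. 0) s * ch N1 (f s) y * ker s u) * h s y u \<partial>LU \<partial>LY \<partial>LS)"
  proof (intro nn_integral_cong)
    fix s assume [measurable]: "s \<in> space LS"
    show "ennreal (gd A (\<lambda>_. 0) s) * (\<integral>\<^sup>+y. ennreal (ch N1 (f s) y) * (\<integral>\<^sup>+u. ennreal (ker s u) * h s y u \<partial>LU) \<partial>LY)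
      = (\<integral>\<^sup>+y. \<integral>\<^sup>+u. ennreal (gd A (\<lambda>_. 0) s * ch N1 (f s) y * ker s u) * h s y u \<partial>LU \<partial>LY)"
    proof (subst nn_integral_cmult[symmetric])
      show "(\<lambda>y. ennreal (ch N1 (f s) y) * (\<integral>\<^sup>+u. ennreal (ker s u) * h s y u \<partial>LU)) \<in> borel_measurable LY" by measurable
      show "(\<integral>\<^sup>+y. ennreal (gd A (\<lambda>_. 0) s) * (ennreal (ch N1 (f s) y) * (\<integral>\<^sup>+u. ennreal (ker s u) * h s y u \<partial>LU)) \<partial>LY)
        = (\<integral>\<^sup>+y. \<integral>\<^sup>+u. ennreal (gd A (\<lambda>_. 0) s * ch N1 (f s) y * ker s u) * h s y u \<partial>LU \<partial>LY)"
      proof (intro nn_integral_cong)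
        fix y assume [measurable]: "y \<in> space LY"
        show "ennreal (gd A (\<lambda>_. 0) s) * (ennreal (ch N1 (f s) y) * (\<integral>\<^sup>+u. ennreal (ker s u) * h s y u \<partial>LU))
          = (\<integral>\<^sup>+u. ennreal (gd A (\<lambda>_. 0) s * ch N1 (f s) y * ker s u) * h s y u \<partial>LU)"
          unfolding mult.assoc[symmetric] ennreal_mult[OF 1(1,2), symmetric]
          by (subst nn_integral_cmult[symmetric]) (auto simp: 1 ennreal_mult mult.assoc)
      qed
    qed
  qed
  also have "\<dots> = (\<integral>\<^sup>+y. \<integral>\<^sup>+s. \<integral>\<^sup>+u. ennreal (gd A (\<lambda>_. 0) s * ch N1 (f s) y * ker s u) * h s y u \<partial>LU \<partial>LS \<partial>LY)"
    by (rule SY.Fubini'[symmetric]) measurable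
  also have "\<dots> = (\<integral>\<^sup>+y. \<integral>\<^sup>+u. \<integral>\<^sup>+s. ennreal (gd A (\<lambda>_. 0) s * ch N1 (f s) y * ker s u) * h s y u \<partial>LS \<partial>LU \<partial>LY)"
    by (intro nn_integral_cong SU.Fubini'[symmetric]) measurable
  finally show ?thesis .
qed

lemma nn_integral_dens_kernel:
  assumes [measurable]: "u \<in> space LU" "y \<in> space LY"
  shows "(\<integral>\<^sup>+s. ennreal (gd A (\<lambda>_. 0) s * ch N1 (f s) y * ker s u) \<partial>LS) = mix.dens n u y"
proof -
  have "ennreal (mix.dens n u y) = (\<integral>\<^sup>+s. ennreal (gd A (\<lambda>_. 0) s) * ennreal (ker s u * ch N1 (f s) y) \<partial>LS)"
    unfolding dens_n[OF assms(1)] by (rule nn_integral_MuS) measurable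
  then show ?thesis
    by (simp add: ennreal_mult'[symmetric] gd_pos[OF A] less_imp_le mult_ac)
qed

lemma prob_Om3: "prob_space Om3"
proof -
  interpret p1: pair_prob_space MuS MuZ ..
  interpret p2: pair_prob_space "MuS \<Otimes>\<^sub>M MuZ" MuV ..
  show ?thesis by (rule p2.prob_space_axioms)
qed

lemma nn_integral_Om3_dens:
  assumes h: "(\<lambda>(y, u). h y u) \<in> borel_measurable (LY \<Otimes>\<^sub>M LU)"
  shows "(\<integral>\<^sup>+x. h (outY (fst (fst x)) (snd (fst x))) (outU (fst (fst x)) (snd x)) \<partial>Om3)
    = (\<integral>\<^sup>+y. \<integral>\<^sup>+u. ennreal (mix.dens n u y) * h y u \<partial>LU \<partial>LY)"
proof -
  have [measurable]: "(\<lambda>x. h (fst (snd x)) (snd (snd x))) \<in> borel_measurable (LS \<Otimes>\<^sub>M (LY \<Otimes>\<^sub>M LU))"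
    using measurable_compose[OF measurable_snd h] by (simp add: case_prod_beta)
  have "(\<integral>\<^sup>+x. h (outY (fst (fst x)) (snd (fst x))) (outU (fst (fst x)) (snd x)) \<partial>Om3)
    = (\<integral>\<^sup>+y. \<integral>\<^sup>+u. \<integral>\<^sup>+s. ennreal (gd A (\<lambda>_. 0) s * ch N1 (f s) y * ker s u) * h y u \<partial>LS \<partial>LU \<partial>LY)"
    by (rule nn_integral_Om3) (simp add: case_prod_beta)
  also have "\<dots> = (\<integral>\<^sup>+y. \<integral>\<^sup>+u. ennreal (mix.dens n u y) * h y u \<partial>LU \<partial>LY)"
  proof (intro nn_integral_cong)
    fix y u assume y[measurable]: "y \<in> space LY" and u[measurable]: "u \<in> space LU"
    show "(\<integral>\<^sup>+s. ennreal (gd A (\<lambda>_. 0) s * ch N1 (f s) y * ker s u) * h y u \<partial>LS) = ennreal (mix.dens n u y) * h y u"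
      by (subst nn_integral_multc, measurable) (simp only: nn_integral_dens_kernel[OF u y])
  qed
  finally show ?thesis .
qed

lemma nn_integral_dens: "(\<integral>\<^sup>+y. \<integral>\<^sup>+u. ennreal (mix.dens n u y) \<partial>LU \<partial>LY) = 1"
proof -
  interpret prob_space Om3 by (rule prob_Om3)
  show ?thesis using nn_integral_Om3_dens[of "\<lambda>_ _. 1"] by (simp add: emeasure_space_1)
qed

lemma nn_integral_gd:
  assumes B: "pos_def B"
  shows "(\<integral>\<^sup>+u. gd B x u \<partial>block_measure n lborel) = 1"
proof -
  interpret B: prob_space "gauss_measure B" by (rule prob_space_gauss_measure[OF B])
  interpret BB: prob_space "block_measure n (gauss_measure B)" by (intro prob_space_PiM B.prob_space_axioms)
  have "(\<integral>\<^sup>+u. (\<Prod>t<n. ennreal (gauss_density B (u t - x t))) * 1 \<partial>block_measure n lborel) = (\<integral>\<^sup>+v. 1 \<partial>block_measure n (gauss_measure B))"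
    unfolding gauss_measure_def
    by (rule nn_integral_block_density[symmetric]) (use B.sigma_finite_measure_axioms in \<open>auto simp: gauss_measure_def\<close>)
  then show ?thesis
    by (simp add: gd_def prod_ennreal gauss_density_pos[OF B] less_imp_le BB.emeasure_space_1)
qed

lemma nn_integral_ch:
  assumes N: "0 < N" shows "(\<integral>\<^sup>+y. ch N x y \<partial>LY) = 1"
proof -
  interpret B: prob_space "noise N" by (rule prob_space_normal_density) (simp add: N)
  interpret BB: prob_space "block_measure n (noise N)" by (intro prob_space_PiM B.prob_space_axioms)
  show ?thesis using nn_integral_noise[of "\<lambda>_. 1" N x] N by (simp add: BB.emeasure_space_1)
qed

text \<open>The kernel density \<open>ker\<close> occurs in the law as well as in the Gaussian posterior and has been
  cancelled.\<close>

definition R2 :: "(nat \<Rightarrow> real^'k) \<Rightarrow> (nat \<Rightarrow> real) \<Rightarrow> (nat \<Rightarrow> real^'j) \<Rightarrow> real" where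
  "R2 s y u = mix.dens n u y * gd Th (sh y) s / (gd (QK Th) (\<lambda>t. P *v sh y t) u * gd A (\<lambda>_. 0) s * ch N1 (f s) y)"

text \<open>The denominator is the true density of (u, y, y2). The numerator takes \<open>y2\<close>
  as white Gaussian of power \<open>Q\<close>, \<open>u\<close> as Gaussian of covariance
  \<open>D\<close> around the estimate made from \<open>y2\<close>, and \<open>y\<close> from the
  backward test densities.\<close>

definition R1 :: "real \<Rightarrow> real \<Rightarrow> (nat \<Rightarrow> real) \<Rightarrow> (nat \<Rightarrow> real^'j) \<Rightarrow> (nat \<Rightarrow> real) \<Rightarrow> real" where
  "R1 c b y u y2 = ch Q (\<lambda>_. 0) y2 * gd D (uh y2) u * (\<Prod>t<n. mix.backward c b t u (y2 t) y (y t)) / (mix.dens n u y * ch \<delta> y y2)"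

lemma R2_measurable [measurable (raw)]:
  "s \<in> N \<rightarrow>\<^sub>M LS \<Longrightarrow> y \<in> N \<rightarrow>\<^sub>M LY \<Longrightarrow> u \<in> N \<rightarrow>\<^sub>M LU \<Longrightarrow> (\<lambda>x. R2 (s x) (y x) (u x)) \<in> borel_measurable N"
  unfolding R2_def by (intro borel_measurable_divide borel_measurable_times factor_measurable dens_block_measurable)

lemma R1_measurable [measurable (raw)]:
  "y \<in> N \<rightarrow>\<^sub>M LY \<Longrightarrow> u \<in> N \<rightarrow>\<^sub>M LU \<Longrightarrow> z \<in> N \<rightarrow>\<^sub>M LY \<Longrightarrow> (\<lambda>x. R1 c b (y x) (u x) (z x)) \<in> borel_measurable N"
  unfolding R1_def by (intro borel_measurable_divide borel_measurable_times factor_measurable dens_block_measurable prod_backward_measurable)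

text \<open>Multiplied by the joint density of the law, the ratio becomes the density of (u, y)
  times the normalised posterior of s, which integrates to 1 over s.\<close>

lemma nn_integral_R2:
  "(\<integral>\<^sup>+x. R2 (fst (fst x)) (outY (fst (fst x)) (snd (fst x))) (outU (fst (fst x)) (snd x)) \<partial>Om3) = 1"
proof -
  have "(\<integral>\<^sup>+x. R2 (fst (fst x)) (outY (fst (fst x)) (snd (fst x))) (outU (fst (fst x)) (snd x)) \<partial>Om3)
    = (\<integral>\<^sup>+y. \<integral>\<^sup>+u. \<integral>\<^sup>+s. ennreal (gd A (\<lambda>_. 0) s * ch N1 (f s) y * ker s u) * ennreal (R2 s y u) \<partial>LS \<partial>LU \<partial>LY)"
    by (rule nn_integral_Om3) measurable
  also have "\<dots> = (\<integral>\<^sup>+y. \<integral>\<^sup>+u. ennreal (mix.dens n u y) \<partial>LU \<partial>LY)"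
  proof (intro nn_integral_cong)
    fix y u assume y[measurable]: "y \<in> space LY" and u[measurable]: "u \<in> space LU"
    let ?g = "gd (QK Th) (\<lambda>t. P *v sh y t) u"
    have g: "0 < ?g" by (rule gd_pos[OF QK_pos_def[OF Th]])
    have d: "0 < mix.dens n u y" by (rule mix.dens_pos[OF u])
    have "(\<integral>\<^sup>+s. ennreal (gd A (\<lambda>_. 0) s * ch N1 (f s) y * ker s u) * ennreal (R2 s y u) \<partial>LS)
      = (\<integral>\<^sup>+s. ennreal (mix.dens n u y / ?g) * (ennreal (gd Th (sh y) s) * ker s u) \<partial>LS)"
    proof (rule nn_integral_cong)
      fix s
      have "0 < gd A (\<lambda>_. 0) s" "0 < ch N1 (f s) y" "0 < ker s u" "0 < gd Th (sh y) s"
        by (auto intro: gd_pos A Th ch_pos N1 ker_pos)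
      then show "ennreal (gd A (\<lambda>_. 0) s * ch N1 (f s) y * ker s u) * ennreal (R2 s y u) = ennreal (mix.dens n u y / ?g) * (ennreal (gd Th (sh y) s) * ker s u)"
        using g d by (simp add: R2_def ennreal_mult'[symmetric] ennreal_mult''[symmetric])
    qed
    also have "\<dots> = ennreal (mix.dens n u y / ?g) * ?g"
      by (subst nn_integral_cmult) (auto simp: nn_integral_gauss_ker[OF Th])
    also have "\<dots> = mix.dens n u y" using g d by (simp add: ennreal_mult''[symmetric])
    finally show "(\<integral>\<^sup>+s. ennreal (gd A (\<lambda>_. 0) s * ch N1 (f s) y * ker s u) * ennreal (R2 s y u) \<partial>LS) = ennreal (mix.dens n u y)" .
  qed
  also have "\<dots> = 1" by (rule nn_integral_dens)
  finally show ?thesis .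
qed

text \<open>Although \<open>y2\<close> is generated from \<open>y\<close>, the integral is taken in
  the opposite direction: first \<open>y\<close>, where the backward densities have mass at most 1,
  then \<open>u\<close>, then \<open>y2\<close>. Nonnegativity permits the reordering.\<close>

lemma nn_integral_R1:
  assumes "0 < c" "0 \<le> b"
  shows "(\<integral>\<^sup>+x. R1 c b (outY (fst (fst (fst x))) (snd (fst (fst x)))) (outU (fst (fst (fst x))) (snd (fst x)))
      (outZ (outY (fst (fst (fst x))) (snd (fst (fst x)))) (snd x)) \<partial>(Om3 \<Otimes>\<^sub>M MuW)) \<le> 1"
proof -
  interpret UY: pair_sigma_finite LU LY ..
  interpret YY: pair_sigma_finite LY LY ..
  define H where "H y u = (\<integral>\<^sup>+y2. ennreal (ch \<delta> y y2) * R1 c b y u y2 \<partial>LY)" for y u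
  have "(\<integral>\<^sup>+x. R1 c b (outY (fst (fst (fst x))) (snd (fst (fst x)))) (outU (fst (fst (fst x))) (snd (fst x)))
      (outZ (outY (fst (fst (fst x))) (snd (fst (fst x)))) (snd x)) \<partial>(Om3 \<Otimes>\<^sub>M MuW))
    = (\<integral>\<^sup>+x. \<integral>\<^sup>+w. R1 c b (outY (fst (fst x)) (snd (fst x))) (outU (fst (fst x)) (snd x))
      (outZ (outY (fst (fst x)) (snd (fst x))) w) \<partial>MuW \<partial>Om3)"
    by (subst MuW.nn_integral_fst[symmetric]) auto
  also have "\<dots> = (\<integral>\<^sup>+x. H (outY (fst (fst x)) (snd (fst x))) (outU (fst (fst x)) (snd x)) \<partial>Om3)"
  proof (rule nn_integral_cong)
    fix x assume x: "x \<in> space Om3"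
    define y where "y = outY (fst (fst x)) (snd (fst x))"
    define u where "u = outU (fst (fst x)) (snd x)"
    have [measurable]: "y \<in> space LY" "u \<in> space LU" by (auto simp: y_def u_def outY_def outU_def space_PiM)
    have "(\<lambda>y2. ennreal (R1 c b y u y2)) \<in> borel_measurable LY" by measurable
    from nn_integral_noise[OF this \<delta>, of y]
    show "(\<integral>\<^sup>+w. R1 c b (outY (fst (fst x)) (snd (fst x))) (outU (fst (fst x)) (snd x))
      (outZ (outY (fst (fst x)) (snd (fst x))) w) \<partial>MuW) = H (outY (fst (fst x)) (snd (fst x))) (outU (fst (fst x)) (snd x))"
      unfolding y_def[symmetric] u_def[symmetric] H_def by (simp add: outZ_def)
  qed
  also have "\<dots> = (\<integral>\<^sup>+y. \<integral>\<^sup>+u. ennreal (mix.dens n u y) * H y u \<partial>LU \<partial>LY)"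
    by (rule nn_integral_Om3_dens) (simp add: H_def case_prod_beta)
  also have "\<dots> = (\<integral>\<^sup>+y. \<integral>\<^sup>+u. \<integral>\<^sup>+y2. ennreal (ch Q (\<lambda>_. 0) y2 * gd D (uh y2) u) * ennreal (\<Prod>t<n. mix.backward c b t u (y2 t) y (y t)) \<partial>LY \<partial>LU \<partial>LY)"
  proof (intro nn_integral_cong)
    fix y u assume y[measurable]: "y \<in> space LY" and u[measurable]: "u \<in> space LU"
    have d: "0 < mix.dens n u y" by (rule mix.dens_pos[OF u])
    have "0 < ch \<delta> y y2" "0 < ch Q (\<lambda>_. 0) y2" "0 < gd D (uh y2) u" "0 < (\<Prod>t<n. mix.backward c b t u (y2 t) y (y t))" for y2
      using assms by (auto intro!: ch_pos \<delta> Q gd_pos D prod_pos mix.backward_pos[OF u])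
    note p = this[THEN less_imp_le] this
    show "ennreal (mix.dens n u y) * H y u = (\<integral>\<^sup>+y2. ennreal (ch Q (\<lambda>_. 0) y2 * gd D (uh y2) u) * ennreal (\<Prod>t<n. mix.backward c b t u (y2 t) y (y t)) \<partial>LY)"
      unfolding H_def
      by (subst nn_integral_cmult[symmetric])
        (use d p in \<open>auto intro!: nn_integral_cong simp: R1_def ennreal_mult'[symmetric] ennreal_mult''[symmetric] less_imp_le less_imp_neq[symmetric]\<close>)
  qed
  also have "\<dots> = (\<integral>\<^sup>+u. \<integral>\<^sup>+y. \<integral>\<^sup>+y2. ennreal (ch Q (\<lambda>_. 0) y2 * gd D (uh y2) u) * ennreal (\<Prod>t<n. mix.backward c b t u (y2 t) y (y t)) \<partial>LY \<partial>LY \<partial>LU)"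
    by (rule UY.Fubini') measurable
  also have "\<dots> = (\<integral>\<^sup>+u. \<integral>\<^sup>+y2. \<integral>\<^sup>+y. ennreal (ch Q (\<lambda>_. 0) y2 * gd D (uh y2) u) * ennreal (\<Prod>t<n. mix.backward c b t u (y2 t) y (y t)) \<partial>LY \<partial>LY \<partial>LU)"
    by (intro nn_integral_cong YY.Fubini') measurable
  also have "\<dots> \<le> (\<integral>\<^sup>+u. \<integral>\<^sup>+y2. ennreal (ch Q (\<lambda>_. 0) y2 * gd D (uh y2) u) \<partial>LY \<partial>LU)"
  proof (intro nn_integral_mono)
    fix u y2 assume u[measurable]: "u \<in> space LU" and y2[measurable]: "y2 \<in> space LY"
    have "(\<integral>\<^sup>+y. ennreal (\<Prod>t<n. mix.backward c b t u (y2 t) y (y t)) \<partial>LY) \<le> 1"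
      using mix.nn_integral_backward_le[OF u, of c b n y2] assms mix.backward_pos[OF u assms]
      by (simp add: prod_ennreal less_imp_le)
    then show "(\<integral>\<^sup>+y. ennreal (ch Q (\<lambda>_. 0) y2 * gd D (uh y2) u) * ennreal (\<Prod>t<n. mix.backward c b t u (y2 t) y (y t)) \<partial>LY)
      \<le> ennreal (ch Q (\<lambda>_. 0) y2 * gd D (uh y2) u)"
      by (subst nn_integral_cmult) (auto intro: mult_left_le)
  qed
  also have "\<dots> = (\<integral>\<^sup>+y2. \<integral>\<^sup>+u. ennreal (ch Q (\<lambda>_. 0) y2 * gd D (uh y2) u) \<partial>LU \<partial>LY)"
    by (rule UY.Fubini'[symmetric]) measurable
  also have "\<dots> = (\<integral>\<^sup>+y2. ennreal (ch Q (\<lambda>_. 0) y2) \<partial>LY)"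
  proof (intro nn_integral_cong)
    fix y2 assume y2[measurable]: "y2 \<in> space LY"
    have "(\<lambda>u. ennreal (gd D (uh y2) u)) \<in> borel_measurable LU" by measurable
    then have "(\<integral>\<^sup>+u. ennreal (ch Q (\<lambda>_. 0) y2) * ennreal (gd D (uh y2) u) \<partial>LU) = ennreal (ch Q (\<lambda>_. 0) y2)"
      by (subst nn_integral_cmult) (auto simp: nn_integral_gd[OF D])
    then show "(\<integral>\<^sup>+u. ennreal (ch Q (\<lambda>_. 0) y2 * gd D (uh y2) u) \<partial>LU) = ennreal (ch Q (\<lambda>_. 0) y2)"
      by (simp add: ennreal_mult' ch_pos[OF Q] less_imp_le)
  qed
  also have "\<dots> = 1" by (rule nn_integral_ch[OF Q])
  finally show ?thesis .
qed

end

subsection \<open>Second moments of blocks\<close>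

lemma (in prob_space) integrable_of_square:
  fixes f :: "'a \<Rightarrow> real"
  assumes "f \<in> borel_measurable M" "integrable M (\<lambda>x. (f x)\<^sup>2)"
  shows "integrable M f"
  using integrable_mult_of_squares[OF assms(1) _ assms(2), of "\<lambda>_. 1"] by simp

lemma pair_integral_mult:
  fixes a :: "'a \<Rightarrow> real" and b :: "'b \<Rightarrow> real"
  assumes "prob_space A" "prob_space B" and a: "integrable A a" and b: "integrable B b"
  shows "integrable (A \<Otimes>\<^sub>M B) (\<lambda>x. a (fst x) * b (snd x))"
    and "(\<integral>x. a (fst x) * b (snd x) \<partial>(A \<Otimes>\<^sub>M B)) = (\<integral>x. a x \<partial>A) * (\<integral>x. b x \<partial>B)"
proof -
  interpret A: prob_space A by fact
  interpret B: prob_space B by fact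
  interpret pair_prob_space A B ..
  have [measurable]: "a \<in> borel_measurable A" "b \<in> borel_measurable B" using a b by auto
  show i: "integrable (A \<Otimes>\<^sub>M B) (\<lambda>x. a (fst x) * b (snd x))"
  proof (rule Fubini_integrable)
    show "integrable A (\<lambda>x. \<integral>y. norm (a (fst (x, y)) * b (snd (x, y))) \<partial>B)"
      using a by (simp add: abs_mult)
    show "AE x in A. integrable B (\<lambda>y. a (fst (x, y)) * b (snd (x, y)))"
      using b by simp
  qed measurable
  show "(\<integral>x. a (fst x) * b (snd x) \<partial>(A \<Otimes>\<^sub>M B)) = (\<integral>x. a x \<partial>A) * (\<integral>x. b x \<partial>B)"
    by (subst integral_fst'[OF i, symmetric]) simp
qed

text \<open>The two mixed products vanish because the summands on \<open>B\<close> have mean 0 and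
  are independent of those on \<open>A\<close>.\<close>

lemma pair_integral_mult_add:
  fixes a a' :: "'a \<Rightarrow> real" and b b' :: "'b \<Rightarrow> real"
  assumes p: "prob_space A" "prob_space B"
    and a: "a \<in> borel_measurable A" "a' \<in> borel_measurable A" "integrable A (\<lambda>x. (a x)\<^sup>2)" "integrable A (\<lambda>x. (a' x)\<^sup>2)"
    and b: "b \<in> borel_measurable B" "b' \<in> borel_measurable B" "integrable B (\<lambda>x. (b x)\<^sup>2)" "integrable B (\<lambda>x. (b' x)\<^sup>2)"
    and 0: "(\<integral>x. b x \<partial>B) = 0" "(\<integral>x. b' x \<partial>B) = 0"
  shows "integrable (A \<Otimes>\<^sub>M B) (\<lambda>x. (a (fst x) + b (snd x)) * (a' (fst x) + b' (snd x)))"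
    and "(\<integral>x. (a (fst x) + b (snd x)) * (a' (fst x) + b' (snd x)) \<partial>(A \<Otimes>\<^sub>M B)) = (\<integral>x. a x * a' x \<partial>A) + (\<integral>x. b x * b' x \<partial>B)"
proof -
  interpret A: prob_space A by fact
  interpret B: prob_space B by fact
  have ia: "integrable A a" "integrable A a'" "integrable A (\<lambda>x. a x * a' x)"
    by (fact A.integrable_of_square[OF a(1,3)] A.integrable_of_square[OF a(2,4)] integrable_mult_of_squares[OF a])+
  have ib: "integrable B b" "integrable B b'" "integrable B (\<lambda>x. b x * b' x)"
    by (fact B.integrable_of_square[OF b(1,3)] B.integrable_of_square[OF b(2,4)] integrable_mult_of_squares[OF b])+
  note m1 = pair_integral_mult[OF p ia(3), of "\<lambda>_. 1"]
  note m2 = pair_integral_mult[OF p ia(1) ib(2)]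
  note m3 = pair_integral_mult[OF p ia(2) ib(1)]
  note m4 = pair_integral_mult[OF p, of "\<lambda>_. 1", OF _ ib(3)]
  have e: "(\<lambda>x. (a (fst x) + b (snd x)) * (a' (fst x) + b' (snd x)))
    = (\<lambda>x. a (fst x) * a' (fst x) * 1 + a (fst x) * b' (snd x) + a' (fst x) * b (snd x) + 1 * (b (snd x) * b' (snd x)))"
    by (auto simp: algebra_simps)
  have i: "integrable (A \<Otimes>\<^sub>M B) (\<lambda>x. a (fst x) * a' (fst x) * 1)" "integrable (A \<Otimes>\<^sub>M B) (\<lambda>x. a (fst x) * b' (snd x))"
    "integrable (A \<Otimes>\<^sub>M B) (\<lambda>x. a' (fst x) * b (snd x))" "integrable (A \<Otimes>\<^sub>M B) (\<lambda>x. 1 * (b (snd x) * b' (snd x)))"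
    using m1(1) m2(1) m3(1) m4(1) by auto
  show "integrable (A \<Otimes>\<^sub>M B) (\<lambda>x. (a (fst x) + b (snd x)) * (a' (fst x) + b' (snd x)))"
    unfolding e by (intro Bochner_Integration.integrable_add i)
  have "(\<integral>x. (a (fst x) + b (snd x)) * (a' (fst x) + b' (snd x)) \<partial>(A \<Otimes>\<^sub>M B)) =
    (\<integral>x. a (fst x) * a' (fst x) * 1 \<partial>(A \<Otimes>\<^sub>M B)) + (\<integral>x. a (fst x) * b' (snd x) \<partial>(A \<Otimes>\<^sub>M B))
    + (\<integral>x. a' (fst x) * b (snd x) \<partial>(A \<Otimes>\<^sub>M B)) + (\<integral>x. 1 * (b (snd x) * b' (snd x)) \<partial>(A \<Otimes>\<^sub>M B))"
    unfolding e by (simp only: Bochner_Integration.integral_add Bochner_Integration.integrable_add i)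
  also have "\<dots> = (\<integral>x. a x * a' x \<partial>A) + (\<integral>x. b x * b' x \<partial>B)"
    using m1(2) m2(2) m3(2) m4(2) 0 by (simp add: A.prob_space B.prob_space)
  finally show "(\<integral>x. (a (fst x) + b (snd x)) * (a' (fst x) + b' (snd x)) \<partial>(A \<Otimes>\<^sub>M B)) = (\<integral>x. a x * a' x \<partial>A) + (\<integral>x. b x * b' x \<partial>B)" .
qed

definition block_square_integrable :: "'a measure \<Rightarrow> nat \<Rightarrow> ('a \<Rightarrow> nat \<Rightarrow> real^'k) \<Rightarrow> bool" where
  "block_square_integrable M n e \<longleftrightarrow> (\<forall>t<n. \<forall>i. (\<lambda>x. e x t $ i) \<in> borel_measurable M \<and> integrable M (\<lambda>x. (e x t $ i)\<^sup>2))"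

definition block_moment :: "'a measure \<Rightarrow> nat \<Rightarrow> ('a \<Rightarrow> nat \<Rightarrow> real^'k) \<Rightarrow> real^'k^'k" where
  "block_moment M n e = (\<chi> i j. (1 / real n) * (\<Sum>t<n. \<integral>x. e x t $ i * e x t $ j \<partial>M))"

lemma block_square_integrable_mult:
  "block_square_integrable M n e \<Longrightarrow> t < n \<Longrightarrow> integrable M (\<lambda>x. e x t $ i * e x t $ j)"
  by (rule integrable_mult_of_squares) (auto simp: block_square_integrable_def)

text \<open>By linearity an expected quadratic form depends on a block only through its moment
  matrix averaged over letters. This is what makes the final bound single-letter.\<close>

lemma block_quadratic_form:
  fixes e :: "'a \<Rightarrow> nat \<Rightarrow> real^'k"
  assumes e: "block_square_integrable M n e" and n: "0 < n"
  shows "integrable M (\<lambda>x. \<Sum>t<n. e x t \<bullet> (B *v e x t))"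
    and "(\<integral>x. (\<Sum>t<n. e x t \<bullet> (B *v e x t)) \<partial>M) = real n * (\<Sum>i\<in>UNIV. \<Sum>j\<in>UNIV. B $ i $ j * block_moment M n e $ i $ j)"
proof -
  note i = block_square_integrable_mult[OF e]
  show "integrable M (\<lambda>x. \<Sum>t<n. e x t \<bullet> (B *v e x t))"
    unfolding inner_matrix_vector_sum by (intro Bochner_Integration.integrable_sum integrable_mult_right i) auto
  have "(\<integral>x. (\<Sum>t<n. e x t \<bullet> (B *v e x t)) \<partial>M) = (\<Sum>t<n. \<Sum>i\<in>UNIV. \<Sum>j\<in>UNIV. B $ i $ j * (\<integral>x. e x t $ i * e x t $ j \<partial>M))"
    unfolding inner_matrix_vector_sum
    by (subst Bochner_Integration.integral_sum, (intro Bochner_Integration.integrable_sum integrable_mult_right i; simp))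
      (intro sum.cong refl, subst Bochner_Integration.integral_sum, (intro Bochner_Integration.integrable_sum integrable_mult_right i; simp),
        intro sum.cong refl, subst Bochner_Integration.integral_sum, (intro integrable_mult_right i; simp), simp)
  also have "\<dots> = (\<Sum>i\<in>UNIV. \<Sum>j\<in>UNIV. B $ i $ j * (\<Sum>t<n. \<integral>x. e x t $ i * e x t $ j \<partial>M))"
    unfolding sum_distrib_left by (subst sum.swap, intro sum.cong refl, rule sum.swap)
  also have "\<dots> = real n * (\<Sum>i\<in>UNIV. \<Sum>j\<in>UNIV. B $ i $ j * block_moment M n e $ i $ j)"
    using n by (simp add: block_moment_def sum_distrib_left mult_ac)
  finally show "(\<integral>x. (\<Sum>t<n. e x t \<bullet> (B *v e x t)) \<partial>M) = real n * (\<Sum>i\<in>UNIV. \<Sum>j\<in>UNIV. B $ i $ j * block_moment M n e $ i $ j)" .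
qed

text \<open>The double sum is the trace of the product of the inverse of \<open>C\<close> with
  \<open>E\<close>. The whitening columns turn it into a sum of values of the quadratic form of
  \<open>E\<close>, and there the form of \<open>C\<close> equals 1.\<close>

lemma sum_inv_mult_le:
  fixes C E :: "real^'k^'k"
  assumes C: "pos_def C" and EC: "E \<preceq> C"
  shows "(\<Sum>i\<in>UNIV. \<Sum>j\<in>UNIV. matrix_inv C $ i $ j * E $ i $ j) \<le> CARD('k)"
    and "(\<Sum>i\<in>UNIV. \<Sum>j\<in>UNIV. matrix_inv C $ i $ j * C $ i $ j) = CARD('k)"
proof -
  obtain B where B0: "det B \<noteq> 0" "transpose B ** C ** B = mat 1" and B: "matrix_inv C = B ** transpose B"
    "det C * (det B)\<^sup>2 = 1" by (rule pos_def_whitening[OF C])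
  have tr: "(\<Sum>i\<in>UNIV. \<Sum>j\<in>UNIV. matrix_inv C $ i $ j * X $ i $ j) = (\<Sum>l\<in>UNIV. column l B \<bullet> (X *v column l B))" for X
  proof -
    have "(\<Sum>i\<in>UNIV. \<Sum>j\<in>UNIV. matrix_inv C $ i $ j * X $ i $ j) = (\<Sum>i\<in>UNIV. \<Sum>j\<in>UNIV. \<Sum>l\<in>UNIV. X $ i $ j * (B $ i $ l * B $ j $ l))"
      unfolding B(1) by (simp add: matrix_matrix_mult_def transpose_def sum_distrib_left sum_distrib_right mult_ac)
    also have "\<dots> = (\<Sum>i\<in>UNIV. \<Sum>l\<in>UNIV. \<Sum>j\<in>UNIV. X $ i $ j * (B $ i $ l * B $ j $ l))"
      by (intro sum.cong refl sum.swap)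
    also have "\<dots> = (\<Sum>l\<in>UNIV. \<Sum>i\<in>UNIV. \<Sum>j\<in>UNIV. X $ i $ j * (B $ i $ l * B $ j $ l))"
      by (rule sum.swap)
    finally show ?thesis by (simp add: inner_matrix_vector_sum column_def)
  qed
  have c1: "column l B \<bullet> (C *v column l B) = 1" for l
  proof -
    have "column l B \<bullet> (C *v column l B) = (transpose B ** C ** B) $ l $ l"
      unfolding matrix_mul_assoc[symmetric]
      by (simp add: inner_vec_def matrix_matrix_mult_def transpose_def column_def matrix_vector_mult_def)
    then show ?thesis by (simp add: B0(2) mat_def)
  qed
  show *: "(\<Sum>i\<in>UNIV. \<Sum>j\<in>UNIV. matrix_inv C $ i $ j * C $ i $ j) = CARD('k)"
    unfolding tr c1 by simp
  have "0 \<le> column l B \<bullet> ((C - E) *v column l B)" for l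
    using EC by (simp add: loewner_le_def pos_semidef_def)
  then have "(\<Sum>l\<in>UNIV. column l B \<bullet> (E *v column l B)) \<le> (\<Sum>l\<in>UNIV. column l B \<bullet> (C *v column l B))"
    by (intro sum_mono) (simp add: matrix_vector_mult_diff_rdistrib inner_diff_right)
  then show "(\<Sum>i\<in>UNIV. \<Sum>j\<in>UNIV. matrix_inv C $ i $ j * E $ i $ j) \<le> CARD('k)"
    unfolding tr c1 by simp
qed

lemma block_quadratic_le:
  fixes e :: "'a \<Rightarrow> nat \<Rightarrow> real^'k"
  assumes e: "block_square_integrable M n e" and n: "0 < n" and C: "pos_def C" and E: "block_moment M n e \<preceq> C"
  shows "(\<integral>x. (\<Sum>t<n. e x t \<bullet> (matrix_inv C *v e x t)) \<partial>M) \<le> real n * CARD('k)"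
  unfolding block_quadratic_form(2)[OF e n] by (intro mult_left_mono sum_inv_mult_le(1)[OF C E]) simp

lemma block_quadratic_eq:
  fixes e :: "'a \<Rightarrow> nat \<Rightarrow> real^'k"
  assumes e: "block_square_integrable M n e" and n: "0 < n" and C: "pos_def C" and E: "block_moment M n e = C"
  shows "(\<integral>x. (\<Sum>t<n. e x t \<bullet> (matrix_inv C *v e x t)) \<partial>M) = real n * CARD('k)"
  unfolding block_quadratic_form(2)[OF e n] E using sum_inv_mult_le(2)[OF C, of C] by (simp add: loewner_le_def pos_semidef_def transpose_def vec_eq_iff)

lemma block_linear_image:
  fixes e :: "'a \<Rightarrow> nat \<Rightarrow> real^'k" and P :: "real^'k^'j"
  assumes e: "block_square_integrable M n e"
  shows "block_square_integrable M n (\<lambda>x t. P *v e x t)"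
    and "block_moment M n (\<lambda>x t. P *v e x t) = P ** block_moment M n e ** transpose P"
proof -
  note i = block_square_integrable_mult[OF e]
  have pe: "(P *v v) $ i * (P *v v) $ j = (\<Sum>k\<in>UNIV. \<Sum>l\<in>UNIV. P $ i $ k * P $ j $ l * (v $ k * v $ l))" for v i j
    unfolding matrix_vector_mult_def vec_lambda_beta sum_product by (simp add: mult_ac)
  have [measurable]: "(\<lambda>x. e x t $ i) \<in> borel_measurable M" if "t < n" for t i
    using e that by (auto simp: block_square_integrable_def)
  show "block_square_integrable M n (\<lambda>x t. P *v e x t)"
    unfolding block_square_integrable_def
  proof (intro allI impI conjI)
    fix t i assume t: "t < n"
    show "(\<lambda>x. (P *v e x t) $ i) \<in> borel_measurable M" unfolding matrix_vector_mult_def using t by simp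
    show "integrable M (\<lambda>x. ((P *v e x t) $ i)\<^sup>2)"
      unfolding power2_eq_square pe by (intro Bochner_Integration.integrable_sum integrable_mult_right i t)
  qed
  have I: "(\<integral>x. (P *v e x t) $ i * (P *v e x t) $ j \<partial>M) = (\<Sum>k\<in>UNIV. \<Sum>l\<in>UNIV. P $ i $ k * P $ j $ l * (\<integral>x. e x t $ k * e x t $ l \<partial>M))" if t: "t < n" for t i j
    unfolding pe
    by (subst Bochner_Integration.integral_sum, (intro Bochner_Integration.integrable_sum integrable_mult_right i t),
        intro sum.cong refl, subst Bochner_Integration.integral_sum, (intro integrable_mult_right i t), simp)
  have "(1 / real n) * (\<Sum>t<n. \<integral>x. (P *v e x t) $ i * (P *v e x t) $ j \<partial>M) = (P ** block_moment M n e ** transpose P) $ i $ j" for i j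
  proof -
    have "(1 / real n) * (\<Sum>t<n. \<integral>x. (P *v e x t) $ i * (P *v e x t) $ j \<partial>M)
      = (1 / real n) * (\<Sum>t<n. \<Sum>k\<in>UNIV. \<Sum>l\<in>UNIV. P $ i $ k * P $ j $ l * (\<integral>x. e x t $ k * e x t $ l \<partial>M))"
      using I by simp
    also have "\<dots> = (1 / real n) * (\<Sum>k\<in>UNIV. \<Sum>l\<in>UNIV. P $ i $ k * P $ j $ l * (\<Sum>t<n. \<integral>x. e x t $ k * e x t $ l \<partial>M))"
      unfolding sum_distrib_left by (subst sum.swap, intro sum.cong refl, rule sum.swap)
    also have "\<dots> = (\<Sum>l\<in>UNIV. \<Sum>k\<in>UNIV. P $ i $ k * P $ j $ l * block_moment M n e $ k $ l)"
      by (subst sum.swap) (simp add: block_moment_def sum_distrib_left mult_ac)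
    also have "\<dots> = (P ** block_moment M n e ** transpose P) $ i $ j"
      by (simp add: matrix_matrix_mult_def transpose_def sum_distrib_left sum_distrib_right mult_ac)
    finally show ?thesis .
  qed
  then show "block_moment M n (\<lambda>x t. P *v e x t) = P ** block_moment M n e ** transpose P"
    by (simp add: block_moment_def vec_eq_iff)
qed

lemma block_add_independent:
  fixes e :: "'a \<Rightarrow> nat \<Rightarrow> real^'k" and v :: "'b \<Rightarrow> nat \<Rightarrow> real^'k"
  assumes p: "prob_space A" "prob_space B" and e: "block_square_integrable A n e" and v: "block_square_integrable B n v"
    and 0: "\<And>t i. t < n \<Longrightarrow> (\<integral>x. v x t $ i \<partial>B) = 0"
  shows "block_square_integrable (A \<Otimes>\<^sub>M B) n (\<lambda>x t. e (fst x) t + v (snd x) t)"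
    and "block_moment (A \<Otimes>\<^sub>M B) n (\<lambda>x t. e (fst x) t + v (snd x) t) = block_moment A n e + block_moment B n v"
proof -
  have m: "(\<lambda>x. e x t $ i) \<in> borel_measurable A" "(\<lambda>x. v x t $ i) \<in> borel_measurable B"
    "integrable A (\<lambda>x. (e x t $ i)\<^sup>2)" "integrable B (\<lambda>x. (v x t $ i)\<^sup>2)" if "t < n" for t i
    using e v that by (auto simp: block_square_integrable_def)
  note q = pair_integral_mult_add[OF p m(1) m(1) m(3) m(3) m(2) m(2) m(4) m(4) 0 0]
  show "block_square_integrable (A \<Otimes>\<^sub>M B) n (\<lambda>x t. e (fst x) t + v (snd x) t)"
    unfolding block_square_integrable_def
  proof (intro allI impI conjI)
    fix t i assume t: "t < n"
    note [measurable] = m(1,2)[OF t]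
    show "(\<lambda>x. (e (fst x) t + v (snd x) t) $ i) \<in> borel_measurable (A \<Otimes>\<^sub>M B)"
      unfolding vector_add_component by measurable
    show "integrable (A \<Otimes>\<^sub>M B) (\<lambda>x. ((e (fst x) t + v (snd x) t) $ i)\<^sup>2)"
      unfolding vector_add_component power2_eq_square by (rule q) (rule t)+
  qed
  show "block_moment (A \<Otimes>\<^sub>M B) n (\<lambda>x t. e (fst x) t + v (snd x) t) = block_moment A n e + block_moment B n v"
    by (simp add: block_moment_def vec_eq_iff q(2) sum.distrib add_divide_distrib)
qed

lemma block_distr:
  fixes e :: "'b \<Rightarrow> nat \<Rightarrow> real^'k"
  assumes g[measurable]: "g \<in> M \<rightarrow>\<^sub>M N" and d: "distr M N g = N" and e: "block_square_integrable N n e"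
  shows "block_square_integrable M n (\<lambda>x. e (g x))"
    and "block_moment M n (\<lambda>x. e (g x)) = block_moment N n e"
proof -
  have m[measurable]: "(\<lambda>x. e x t $ i) \<in> borel_measurable N" and q: "integrable N (\<lambda>x. (e x t $ i)\<^sup>2)" if "t < n" for t i
    using e that by (auto simp: block_square_integrable_def)
  show "block_square_integrable M n (\<lambda>x. e (g x))"
    unfolding block_square_integrable_def
  proof (intro allI impI conjI)
    fix t i assume t: "t < n"
    show "(\<lambda>x. e (g x) t $ i) \<in> borel_measurable M" using measurable_compose[OF g m[OF t]] .
    show "integrable M (\<lambda>x. (e (g x) t $ i)\<^sup>2)"
      by (subst integrable_distr_eq[OF g, of "\<lambda>x. (e x t $ i)\<^sup>2", symmetric]) (use m[OF t] q[OF t] in \<open>auto simp: d\<close>)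
  qed
  have "(\<integral>x. e (g x) t $ i * e (g x) t $ j \<partial>M) = (\<integral>x. e x t $ i * e x t $ j \<partial>N)" if "t < n" for t i j
    using m[OF that] by (subst integral_distr[OF g, of "\<lambda>x. e x t $ i * e x t $ j", symmetric]) (auto simp: d)
  then show "block_moment M n (\<lambda>x. e (g x)) = block_moment N n e" by (simp add: block_moment_def)
qed

lemma block_coordinates:
  fixes B :: "real^'k^'k"
  assumes B: "pos_def B" and n: "0 < n"
  shows "block_square_integrable (block_measure n (gauss_measure B)) n (\<lambda>x. x)"
    and "block_moment (block_measure n (gauss_measure B)) n (\<lambda>x. x) = B"
    and "t < n \<Longrightarrow> (\<integral>x. x t $ i \<partial>block_measure n (gauss_measure B)) = 0"
proof -
  interpret B: prob_space "gauss_measure B" by (rule prob_space_gauss_measure[OF B])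
  have d: "distr (block_measure n (gauss_measure B)) (gauss_measure B) (\<lambda>x. x t) = gauss_measure B" if "t < n" for t
    by (rule distr_PiM_component) (use that in \<open>auto intro: B.prob_space_axioms\<close>)
  have g: "(\<lambda>x. x t) \<in> block_measure n (gauss_measure B) \<rightarrow>\<^sub>M gauss_measure B" if "t < n" for t
    using that by (intro measurable_component_singleton) simp
  show "block_square_integrable (block_measure n (gauss_measure B)) n (\<lambda>x. x)"
    unfolding block_square_integrable_def
  proof (intro allI impI conjI)
    fix t i assume t: "t < n"
    show "(\<lambda>x. x t $ i) \<in> borel_measurable (block_measure n (gauss_measure B))"
      using measurable_compose[OF g[OF t], of "\<lambda>v. v $ i" borel] by simp
    show "integrable (block_measure n (gauss_measure B)) (\<lambda>x. (x t $ i)\<^sup>2)"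
      by (subst integrable_distr_eq[OF g[OF t], of "\<lambda>v. (v $ i)\<^sup>2", symmetric])
        (use gauss_measure_moments(3)[OF B, of i i] in \<open>auto simp: d t power2_eq_square\<close>)
  qed
  have "(\<integral>x. x t $ i * x t $ j \<partial>block_measure n (gauss_measure B)) = B $ i $ j" if t: "t < n" for t i j
    by (subst integral_distr[OF g[OF t], of "\<lambda>v. v $ i * v $ j", symmetric]) (auto simp: d t gauss_measure_moments(4)[OF B])
  then show "block_moment (block_measure n (gauss_measure B)) n (\<lambda>x. x) = B"
    using n by (simp add: block_moment_def vec_eq_iff)
  show "(\<integral>x. x t $ i \<partial>block_measure n (gauss_measure B)) = 0" if t: "t < n"
    by (subst integral_distr[OF g[OF t], of "\<lambda>v. v $ i", symmetric]) (auto simp: d t gauss_measure_moments(2)[OF B])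
qed

lemma noise_coordinates:
  assumes N: "0 < N" and t: "t < n"
  shows "integrable (block_measure n (noise N)) (\<lambda>x. x t)" "(\<integral>x. x t \<partial>block_measure n (noise N)) = 0"
    "integrable (block_measure n (noise N)) (\<lambda>x. (x t)\<^sup>2)" "(\<integral>x. (x t)\<^sup>2 \<partial>block_measure n (noise N)) = N"
    "(\<lambda>x. x t) \<in> borel_measurable (block_measure n (noise N))"
proof -
  have sN: "0 < sqrt N" using N by simp
  interpret B: prob_space "noise N" by (rule prob_space_normal_density) (simp add: N)
  have d: "distr (block_measure n (noise N)) (noise N) (\<lambda>x. x t) = noise N"
    by (rule distr_PiM_component) (use t in \<open>auto intro: B.prob_space_axioms\<close>)
  have g: "(\<lambda>x. x t) \<in> block_measure n (noise N) \<rightarrow>\<^sub>M noise N"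
    using t by (intro measurable_component_singleton) simp
  show "(\<lambda>x. x t) \<in> borel_measurable (block_measure n (noise N))"
    using measurable_compose[OF g, of "\<lambda>x. x" borel] by simp
  have m: "integrable (noise N) (\<lambda>x. x)" "(\<integral>x. x \<partial>noise N) = 0" "integrable (noise N) (\<lambda>x. x\<^sup>2)" "(\<integral>x. x\<^sup>2 \<partial>noise N) = N"
    using integrable_normal_moment_nz_1[OF sN, of 0] integral_normal_moment_nz_1[OF sN, of 0]
      integrable_normal_moment[OF sN, of 0 2] integral_normal_moment_even[OF sN, of 0 1] N
    by (simp_all add: integrable_density integral_density)
  show "integrable (block_measure n (noise N)) (\<lambda>x. x t)"
    by (rule iffD1[OF integrable_distr_eq[OF g, of "\<lambda>x. x"]]) (simp_all only: d m, simp)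
  show "integrable (block_measure n (noise N)) (\<lambda>x. (x t)\<^sup>2)"
    by (rule iffD1[OF integrable_distr_eq[OF g, of "\<lambda>x. x\<^sup>2"]]) (simp_all only: d m, simp)
  have "(\<integral>x. x t \<partial>block_measure n (noise N)) = (\<integral>x. x \<partial>noise N)"
    using integral_distr[OF g, of "\<lambda>x. x"] unfolding d by simp
  then show "(\<integral>x. x t \<partial>block_measure n (noise N)) = 0" unfolding m .
  have "(\<integral>x. (x t)\<^sup>2 \<partial>block_measure n (noise N)) = (\<integral>x. x\<^sup>2 \<partial>noise N)"
    using integral_distr[OF g, of "\<lambda>x. x\<^sup>2"] unfolding d by simp
  then show "(\<integral>x. (x t)\<^sup>2 \<partial>block_measure n (noise N)) = N" unfolding m .
qed

subsection \<open>The inequality for the Gaussian model\<close>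

context broadcast_model
begin

abbreviation "MuZ2 \<equiv> block_measure n (noise (N1 + \<delta>))"
abbreviation "Om \<equiv> Om3 \<Otimes>\<^sub>M MuW"

lemma sets_MuZ2 [measurable_cong]: "sets MuZ2 = sets LY"
  by (auto intro!: sets_block_measure_cong)

lemma prob_MuZ2: "prob_space MuZ2"
  by (intro prob_space_PiM prob_space_normal_density) (use N1 \<delta> in auto)

text \<open>The convolution of two centred normal densities, letter by letter: the second receiver
  sees a noise of variance \<open>N1 + \<delta>\<close>.\<close>

lemma nn_integral_noise_add:
  assumes [measurable]: "h \<in> borel_measurable LY"
  shows "(\<integral>\<^sup>+z. \<integral>\<^sup>+w. h (outZ z w) \<partial>MuW \<partial>MuZ) = (\<integral>\<^sup>+y. h y \<partial>MuZ2)"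
proof -
  interpret Z: pair_sigma_finite MuZ LY ..
  have e: "(\<integral>\<^sup>+z. ch \<delta> z y \<partial>MuZ) = ch (N1 + \<delta>) (\<lambda>_. 0) y" for y
  proof -
    have "(\<integral>\<^sup>+z. ch \<delta> z y \<partial>MuZ) = (\<integral>\<^sup>+z. (\<Prod>t<n. ennreal (normal_density 0 (sqrt \<delta>) (y t - z t))) \<partial>MuZ)"
      by (simp add: ch_def prod_ennreal)
    also have "\<dots> = (\<Prod>t<n. \<integral>\<^sup>+z. normal_density 0 (sqrt \<delta>) (y t - z) \<partial>noise N1)"
      by (rule nn_integral_block_prod) (use prob_space_imp_sigma_finite[OF prob_base(3)] in auto)
    also have "\<dots> = (\<Prod>t<n. ennreal (normal_density 0 (sqrt (N1 + \<delta>)) (y t)))"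
    proof (intro prod.cong refl)
      fix t
      have "(\<integral>\<^sup>+z. normal_density 0 (sqrt \<delta>) (y t - z) \<partial>noise N1)
        = (\<integral>\<^sup>+z. ennreal (normal_density 0 (sqrt \<delta>) (y t - z) * normal_density 0 (sqrt N1) z) \<partial>lborel)"
        by (subst nn_integral_density) (auto simp: ennreal_mult' mult.commute)
      also have "\<dots> = normal_density 0 (sqrt (N1 + \<delta>)) (y t)"
        using conv_normal_density_zero_mean[of "sqrt \<delta>" "sqrt N1"] N1 \<delta> by (simp add: fun_eq_iff add.commute)
      finally show "(\<integral>\<^sup>+z. normal_density 0 (sqrt \<delta>) (y t - z) \<partial>noise N1) = ennreal (normal_density 0 (sqrt (N1 + \<delta>)) (y t))" .
    qed
    finally show ?thesis by (simp add: ch_def prod_ennreal)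
  qed
  have "(\<integral>\<^sup>+z. \<integral>\<^sup>+w. h (outZ z w) \<partial>MuW \<partial>MuZ) = (\<integral>\<^sup>+z. \<integral>\<^sup>+y. ennreal (ch \<delta> z y) * h y \<partial>LY \<partial>MuZ)"
    unfolding outZ_def by (intro nn_integral_cong nn_integral_noise \<delta>) measurable
  also have "\<dots> = (\<integral>\<^sup>+y. \<integral>\<^sup>+z. ennreal (ch \<delta> z y) * h y \<partial>MuZ \<partial>LY)"
    by (rule Z.Fubini'[symmetric]) measurable
  also have "\<dots> = (\<integral>\<^sup>+y. ennreal (ch (N1 + \<delta>) (\<lambda>_. 0) y) * h y \<partial>LY)"
    by (intro nn_integral_cong) (simp add: nn_integral_multc e)
  also have "\<dots> = (\<integral>\<^sup>+z. h (\<lambda>t\<in>{..<n}. 0 + z t) \<partial>MuZ2)"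
    by (rule nn_integral_noise[symmetric]) (use N1 \<delta> in auto)
  also have "\<dots> = (\<integral>\<^sup>+z. h z \<partial>MuZ2)"
    by (intro nn_integral_cong) (simp add: space_PiM PiE_restrict)
  finally show ?thesis .
qed

text \<open>Forgets how the noise of the second receiver splits. Moments at the second receiver are
  then computed in a product space where that noise is one independent block, which is where the
  given code supplies them.\<close>

definition toZ2 :: "(((nat \<Rightarrow> real^'k) \<times> (nat \<Rightarrow> real)) \<times> (nat \<Rightarrow> real^'j)) \<times> (nat \<Rightarrow> real) \<Rightarrow> ((nat \<Rightarrow> real^'k) \<times> (nat \<Rightarrow> real)) \<times> (nat \<Rightarrow> real^'j)" where
  "toZ2 x = ((fst (fst (fst x)), outZ (snd (fst (fst x))) (snd x)), snd (fst x))"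

lemma prob_Om: "prob_space Om"
proof -
  interpret O3: prob_space Om3 by (rule prob_Om3)
  interpret pair_prob_space Om3 MuW ..
  show ?thesis by (rule prob_space_axioms)
qed

lemma toZ2_measurable: "toZ2 \<in> Om \<rightarrow>\<^sub>M (MuS \<Otimes>\<^sub>M MuZ2) \<Otimes>\<^sub>M MuV"
  unfolding toZ2_def[abs_def] by measurable

text \<open>Fubini moves the auxiliary noise out of the way, so that the added noise is integrated
  next to the first channel noise and merges with it.\<close>

lemma distr_toZ2: "distr Om ((MuS \<Otimes>\<^sub>M MuZ2) \<Otimes>\<^sub>M MuV) toZ2 = (MuS \<Otimes>\<^sub>M MuZ2) \<Otimes>\<^sub>M MuV"
proof (rule measure_eqI)
  interpret Z2: prob_space MuZ2 by (rule prob_MuZ2)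
  interpret VW: pair_sigma_finite MuW MuV ..
  fix X assume "X \<in> sets (distr Om ((MuS \<Otimes>\<^sub>M MuZ2) \<Otimes>\<^sub>M MuV) toZ2)"
  then have X[measurable]: "X \<in> sets ((MuS \<Otimes>\<^sub>M MuZ2) \<Otimes>\<^sub>M MuV)" by simp
  define g where "g s y v = (indicator X ((s, y), v) :: ennreal)" for s y v
  have g[measurable (raw)]: "(\<lambda>x. g (s x) (y x) (v x)) \<in> borel_measurable N"
    if [measurable]: "s \<in> N \<rightarrow>\<^sub>M LS" "y \<in> N \<rightarrow>\<^sub>M LY" "v \<in> N \<rightarrow>\<^sub>M LU" for N s y v
  proof -
    have "(\<lambda>x. ((s x, y x), v x)) \<in> N \<rightarrow>\<^sub>M (MuS \<Otimes>\<^sub>M MuZ2) \<Otimes>\<^sub>M MuV" by measurable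
    from measurable_compose[OF this borel_measurable_indicator[OF X]] show ?thesis unfolding g_def .
  qed
  have "emeasure (distr Om ((MuS \<Otimes>\<^sub>M MuZ2) \<Otimes>\<^sub>M MuV) toZ2) X = (\<integral>\<^sup>+x. indicator X (toZ2 x) \<partial>Om)"
    by (subst nn_integral_indicator[symmetric], simp add: X, subst nn_integral_distr[OF toZ2_measurable]) auto
  also have "\<dots> = (\<integral>\<^sup>+x. g (fst (fst (fst x))) (outZ (snd (fst (fst x))) (snd x)) (snd (fst x)) \<partial>Om)"
    by (simp add: g_def toZ2_def)
  also have "\<dots> = (\<integral>\<^sup>+x. \<integral>\<^sup>+w. g (fst (fst x)) (outZ (snd (fst x)) w) (snd x) \<partial>MuW \<partial>Om3)"
    by (subst MuW.nn_integral_fst[symmetric]) auto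
  also have "\<dots> = (\<integral>\<^sup>+x. \<integral>\<^sup>+v. \<integral>\<^sup>+w. g (fst x) (outZ (snd x) w) v \<partial>MuW \<partial>MuV \<partial>(MuS \<Otimes>\<^sub>M MuZ))"
    by (subst MuV.nn_integral_fst[symmetric]) auto
  also have "\<dots> = (\<integral>\<^sup>+s. \<integral>\<^sup>+z. \<integral>\<^sup>+v. \<integral>\<^sup>+w. g s (outZ z w) v \<partial>MuW \<partial>MuV \<partial>MuZ \<partial>MuS)"
    by (subst MuZ.nn_integral_fst[symmetric]) auto
  also have "\<dots> = (\<integral>\<^sup>+s. \<integral>\<^sup>+z. \<integral>\<^sup>+w. \<integral>\<^sup>+v. g s (outZ z w) v \<partial>MuV \<partial>MuW \<partial>MuZ \<partial>MuS)"
  proof (intro nn_integral_cong VW.Fubini')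
    fix s z assume "s \<in> space MuS" "z \<in> space MuZ"
    then have [measurable]: "s \<in> space LS" "z \<in> space LY" by (auto simp: space_PiM)
    show "(\<lambda>(w, v). g s (outZ z w) v) \<in> borel_measurable (MuW \<Otimes>\<^sub>M MuV)" by measurable
  qed
  also have "\<dots> = (\<integral>\<^sup>+s. \<integral>\<^sup>+y. \<integral>\<^sup>+v. g s y v \<partial>MuV \<partial>MuZ2 \<partial>MuS)"
  proof (intro nn_integral_cong)
    fix s assume "s \<in> space MuS"
    then have [measurable]: "s \<in> space LS" by (auto simp: space_PiM)
    have "(\<lambda>y. \<integral>\<^sup>+v. g s y v \<partial>MuV) \<in> borel_measurable LY" by measurable
    from nn_integral_noise_add[OF this]
    show "(\<integral>\<^sup>+z. \<integral>\<^sup>+w. \<integral>\<^sup>+v. g s (outZ z w) v \<partial>MuV \<partial>MuW \<partial>MuZ) = (\<integral>\<^sup>+y. \<integral>\<^sup>+v. g s y v \<partial>MuV \<partial>MuZ2)" .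
  qed
  also have "\<dots> = (\<integral>\<^sup>+x. \<integral>\<^sup>+v. g (fst x) (snd x) v \<partial>MuV \<partial>(MuS \<Otimes>\<^sub>M MuZ2))"
    by (subst Z2.nn_integral_fst[symmetric]) auto
  also have "\<dots> = (\<integral>\<^sup>+x. g (fst (fst x)) (snd (fst x)) (snd x) \<partial>((MuS \<Otimes>\<^sub>M MuZ2) \<Otimes>\<^sub>M MuV))"
    by (subst MuV.nn_integral_fst[symmetric]) auto
  also have "\<dots> = emeasure ((MuS \<Otimes>\<^sub>M MuZ2) \<Otimes>\<^sub>M MuV) X"
    by (simp add: g_def)
  finally show "emeasure (distr Om ((MuS \<Otimes>\<^sub>M MuZ2) \<Otimes>\<^sub>M MuV) toZ2) X = emeasure ((MuS \<Otimes>\<^sub>M MuZ2) \<Otimes>\<^sub>M MuV) X" .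
qed simp

lemma outZ_outY: "outZ (outY s z) w = outY s (outZ z w)"
  by (auto simp: outZ_def outY_def fun_eq_iff restrict_def)

text \<open>A first moment is enough, because the transport map is multiplied only by an independent
  integrable noise.\<close>

lemma integrable_transp:
  assumes t: "t < n"
  shows "integrable Om3 (\<lambda>x. mix.transp t (outU (fst (fst x)) (snd x)) (outY (fst (fst x)) (snd (fst x))))"
proof (rule integrableI_bounded)
  let ?C = "(\<integral>x. std_normal_density x * \<bar>x\<bar> \<partial>lborel) + 1"
  interpret UY: pair_sigma_finite LU LY ..
  show "(\<lambda>x. mix.transp t (outU (fst (fst x)) (snd x)) (outY (fst (fst x)) (snd (fst x)))) \<in> borel_measurable Om3"
    using t by measurable
  note [measurable] = dens_block_measurable(2)[OF _ _ t]
  have "(\<integral>\<^sup>+x. ennreal (norm (mix.transp t (outU (fst (fst x)) (snd x)) (outY (fst (fst x)) (snd (fst x))))) \<partial>Om3)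
    = (\<integral>\<^sup>+y. \<integral>\<^sup>+u. ennreal (mix.dens n u y) * ennreal (norm (mix.transp t u y)) \<partial>LU \<partial>LY)"
    by (rule nn_integral_Om3_dens) measurable
  also have "\<dots> = (\<integral>\<^sup>+u. \<integral>\<^sup>+y. ennreal (mix.dens n u y) * ennreal (norm (mix.transp t u y)) \<partial>LY \<partial>LU)"
    by (rule UY.Fubini') measurable
  also have "\<dots> \<le> (\<integral>\<^sup>+u. ennreal ?C * ennreal (gd (QK A) (\<lambda>_. 0) u) \<partial>LU)"
  proof (rule nn_integral_mono)
    fix u assume u: "u \<in> space LU"
    have "(\<integral>\<^sup>+y. ennreal (mix.dens n u y) * ennreal (norm (mix.transp t u y)) \<partial>LY) = (\<integral>\<^sup>+y. ennreal (\<bar>mix.transp t u y\<bar> * mix.dens n u y) \<partial>LY)"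
      using mix.dens_pos[OF u] by (intro nn_integral_cong, subst ennreal_mult''[symmetric]) (auto simp: mult.commute)
    also have "\<dots> \<le> ennreal ?C * mix.dens 0 u (\<lambda>_. 0)" by (rule mix.nn_integral_abs_transp_le[OF u t])
    finally show "(\<integral>\<^sup>+y. ennreal (mix.dens n u y) * ennreal (norm (mix.transp t u y)) \<partial>LY) \<le> ennreal ?C * ennreal (gd (QK A) (\<lambda>_. 0) u)"
      by (simp add: dens_0[OF u])
  qed
  also have "\<dots> = ennreal ?C"
  proof -
    have "(\<lambda>u. ennreal (gd (QK A) (\<lambda>_. 0) u)) \<in> borel_measurable LU"
      by (rule measurable_compose[OF gd_measurable]) (auto intro: coord_lborel)
    then show ?thesis by (simp add: nn_integral_cmult nn_integral_gd[OF QK_pos_def[OF A]])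
  qed
  finally show "(\<integral>\<^sup>+x. ennreal (norm (mix.transp t (outU (fst (fst x)) (snd x)) (outY (fst (fst x)) (snd (fst x))))) \<partial>Om3) < \<infinity>"
    by (simp add: order_le_less_trans)
qed

definition quad :: "real^'a^'a \<Rightarrow> (nat \<Rightarrow> real^'a) \<Rightarrow> (nat \<Rightarrow> real^'a) \<Rightarrow> real" where
  "quad B x y = (\<Sum>t<n. (y t - x t) \<bullet> (matrix_inv B *v (y t - x t)))"

definition sqd :: "(nat \<Rightarrow> real) \<Rightarrow> (nat \<Rightarrow> real) \<Rightarrow> real" where
  "sqd x y = (\<Sum>t<n. (y t - x t)\<^sup>2)"

lemma ln_gd:
  fixes B :: "real^'a^'a"
  assumes B: "pos_def B"
  shows "ln (gd B x y) = - (real n / 2) * (real CARD('a) * ln (2 * pi) + ln (det B)) - quad B x y / 2"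
proof -
  have d: "0 < det B" by (rule pos_def_det_pos[OF B])
  have "ln (gauss_density B v) = - (v \<bullet> (matrix_inv B *v v)) / 2 - (real CARD('a) * ln (2 * pi) + ln (det B)) / 2" for v
  proof -
    have "ln (gauss_density B v) = - (v \<bullet> (matrix_inv B *v v)) / 2 - ln (sqrt ((2 * pi) ^ CARD('a) * det B))"
      unfolding gauss_density_def using d by (subst ln_div) auto
    also have "ln (sqrt ((2 * pi) ^ CARD('a) * det B)) = ln ((2 * pi) ^ CARD('a) * det B) / 2"
      using d by (simp add: ln_sqrt)
    also have "ln ((2 * pi) ^ CARD('a) * det B) = real CARD('a) * ln (2 * pi) + ln (det B)"
      using d ln_realpow[of "2 * pi" "CARD('a)"] by (subst ln_mult) (auto simp del: power_mult_distrib)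
    finally show ?thesis .
  qed
  then show ?thesis
    unfolding gd_def quad_def
    by (subst ln_prod) (auto simp: gauss_density_pos[OF B] sum_subtractf sum_negf sum_divide_distrib[symmetric] less_imp_neq[symmetric])
qed

lemma ln_ch:
  assumes N: "0 < N"
  shows "ln (ch N x y) = - (real n / 2) * (ln (2 * pi) + ln N) - sqd x y / (2 * N)"
proof -
  have "ln (normal_density 0 (sqrt N) v) = - (ln (2 * pi) + ln N) / 2 - v\<^sup>2 / (2 * N)" for v
  proof -
    have "ln (normal_density 0 (sqrt N) v) = - ln (2 * pi * N) / 2 - v\<^sup>2 / (2 * N)"
      unfolding normal_density_def using N by (subst ln_mult) (auto simp: ln_div ln_sqrt)
    also have "ln (2 * pi * N) = ln (2 * pi) + ln N" using N by (subst ln_mult) auto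
    finally show ?thesis .
  qed
  then show ?thesis
    unfolding ch_def sqd_def
    by (subst ln_prod) (auto simp: normal_density_pos N sum_subtractf sum_divide_distrib[symmetric] less_imp_neq[symmetric], simp add: algebra_simps)
qed

text \<open>The logarithm of \<open>mix.dens n u y\<close> occurs with coefficient -1 in the
  denominator of \<open>R1\<close>, with \<open>1 - lam\<close> after the conditional densities have
  telescoped, and with \<open>lam\<close> from \<open>R2\<close>. These add up to 0, so the bound
  contains only Gaussian densities and the cross term with the transport map.\<close>

lemma log_ratio_lower_bound:
  assumes u: "u \<in> space LU" and lam: "0 < lam" "lam < 1"
  shows "ln (R1 (sqrt (lam / \<delta>)) (sqrt (1 - lam)) y u y2) + lam * ln (R2 s y u)
    \<ge> ln (ch Q (\<lambda>_. 0) y2) + ln (gd D (uh y2) u)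
      + (real n * (- lam / 2 * ln (2 * pi) - lam / 2 * ln (lam * \<delta>) - (1 - lam) / 2 * ln (1 - lam)) - lam * sqd y y2 / (2 * \<delta>)
         + sqrt (lam / \<delta>) * sqrt (1 - lam) * (\<Sum>t<n. mix.transp t u y * (y2 t - y t)))
      - (1 - lam) * ln (gd (QK A) (\<lambda>_. 0) u) - ln (ch \<delta> y y2)
      + lam * (ln (gd Th (sh y) s) - ln (gd (QK Th) (\<lambda>t. P *v sh y t) u) - ln (gd A (\<lambda>_. 0) s) - ln (ch N1 (f s) y))"
proof -
  define c b where "c = sqrt (lam / \<delta>)" and "b = sqrt (1 - lam)"
  have c: "0 < c" "0 \<le> b" using lam \<delta> by (auto simp: c_def b_def)
  define B where "B t = mix.backward c b t u (y2 t) y (y t)" for t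
  have Bp: "0 < B t" for t unfolding B_def by (rule mix.backward_pos[OF u c])
  have p: "0 < mix.dens n u y" "0 < ch Q (\<lambda>_. 0) y2" "0 < gd D (uh y2) u" "0 < (\<Prod>t<n. B t)" "0 < ch \<delta> y y2"
    "0 < gd Th (sh y) s" "0 < gd (QK Th) (\<lambda>t. P *v sh y t) u" "0 < gd A (\<lambda>_. 0) s" "0 < ch N1 (f s) y" "0 < gd (QK A) (\<lambda>_. 0) u"
    by (auto intro!: mix.dens_pos u ch_pos gd_pos prod_pos Bp QK_pos_def Q D \<delta> Th A N1)
  have l1: "ln (R1 c b y u y2) = ln (ch Q (\<lambda>_. 0) y2) + ln (gd D (uh y2) u) + ln (\<Prod>t<n. B t) - ln (mix.dens n u y) - ln (ch \<delta> y y2)"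
    unfolding R1_def B_def[symmetric] using p Bp[THEN less_imp_neq, symmetric] by (simp add: ln_div ln_mult)
  have l2: "ln (R2 s y u) = ln (mix.dens n u y) + ln (gd Th (sh y) s) - ln (gd (QK Th) (\<lambda>t. P *v sh y t) u) - ln (gd A (\<lambda>_. 0) s) - ln (ch N1 (f s) y)"
    unfolding R2_def using p by (simp add: ln_div ln_mult)
  have cp: "0 < mix.cond t u y (y t)" for t unfolding mix.cond_self by (simp add: mix.dens_pos[OF u])
  have "(\<Sum>t<n. ln (mix.cond t u y (y t))) = ln (\<Prod>t<n. mix.cond t u y (y t))"
    by (rule ln_prod[symmetric]) (use cp in \<open>auto simp: less_imp_neq[symmetric]\<close>)
  also have "\<dots> = ln (mix.dens n u y) - ln (gd (QK A) (\<lambda>_. 0) u)"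
    unfolding mix.prod_cond[OF u] dens_0[OF u] using p by (simp add: ln_div)
  finally have lc: "(\<Sum>t<n. ln (mix.cond t u y (y t))) = ln (mix.dens n u y) - ln (gd (QK A) (\<lambda>_. 0) u)" .
  define kap where "kap = - lam / 2 * ln (2 * pi) - lam / 2 * ln (lam * \<delta>) - (1 - lam) / 2 * ln (1 - lam)"
  have "ln (\<Prod>t<n. B t) = (\<Sum>t<n. ln (B t))" by (rule ln_prod) (use Bp in \<open>auto simp: less_imp_neq[symmetric]\<close>)
  also have "\<dots> \<ge> (\<Sum>t<n. (- lam / 2 * ln (2 * pi) - lam / 2 * ln (lam * \<delta>) - (1 - lam) / 2 * ln (1 - lam)) - lam / (2 * \<delta>) * (y2 t - y t)\<^sup>2
      + c * b * (mix.transp t u y * (y2 t - y t)) + (1 - lam) * ln (mix.cond t u y (y t)))"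
  proof (rule sum_mono)
    fix t
    show "(- lam / 2 * ln (2 * pi) - lam / 2 * ln (lam * \<delta>) - (1 - lam) / 2 * ln (1 - lam)) - lam / (2 * \<delta>) * (y2 t - y t)\<^sup>2
      + c * b * (mix.transp t u y * (y2 t - y t)) + (1 - lam) * ln (mix.cond t u y (y t)) \<le> ln (B t)"
      using mix.ln_backward_ge[OF u lam \<delta>, where t=t and y=y and x="y t" and z="y2 t"]
      by (simp add: B_def c_def b_def mix.transp_def)
  qed
  also have "(\<Sum>t<n. (- lam / 2 * ln (2 * pi) - lam / 2 * ln (lam * \<delta>) - (1 - lam) / 2 * ln (1 - lam)) - lam / (2 * \<delta>) * (y2 t - y t)\<^sup>2
      + c * b * (mix.transp t u y * (y2 t - y t)) + (1 - lam) * ln (mix.cond t u y (y t)))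
    = real n * (- lam / 2 * ln (2 * pi) - lam / 2 * ln (lam * \<delta>) - (1 - lam) / 2 * ln (1 - lam)) - lam / (2 * \<delta>) * sqd y y2
      + c * b * (\<Sum>t<n. mix.transp t u y * (y2 t - y t)) + (1 - lam) * (ln (mix.dens n u y) - ln (gd (QK A) (\<lambda>_. 0) u))"
    unfolding kap_def[symmetric] sum.distrib sum_subtractf sum_distrib_left[symmetric] sqd_def lc by simp
  finally have lb: "ln (\<Prod>t<n. B t) \<ge> real n * (- lam / 2 * ln (2 * pi) - lam / 2 * ln (lam * \<delta>) - (1 - lam) / 2 * ln (1 - lam)) - lam / (2 * \<delta>) * sqd y y2
      + c * b * (\<Sum>t<n. mix.transp t u y * (y2 t - y t)) + (1 - lam) * (ln (mix.dens n u y) - ln (gd (QK A) (\<lambda>_. 0) u))" .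
  show ?thesis
    using lb unfolding c_def[symmetric] b_def[symmetric] l1 l2 by (simp add: algebra_simps)
qed

end

lemma integral_pair_fst:
  fixes a :: "'a \<Rightarrow> real"
  assumes "prob_space A" "prob_space B" "integrable A a"
  shows "integrable (A \<Otimes>\<^sub>M B) (\<lambda>x. a (fst x))" "(\<integral>x. a (fst x) \<partial>(A \<Otimes>\<^sub>M B)) = (\<integral>x. a x \<partial>A)"
proof -
  interpret B: prob_space B by fact
  show "integrable (A \<Otimes>\<^sub>M B) (\<lambda>x. a (fst x))" "(\<integral>x. a (fst x) \<partial>(A \<Otimes>\<^sub>M B)) = (\<integral>x. a x \<partial>A)"
    using pair_integral_mult[OF assms, of "\<lambda>_. 1"] by (simp_all add: B.prob_space)
qed

lemma integral_pair_snd: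
  fixes b :: "'b \<Rightarrow> real"
  assumes "prob_space A" "prob_space B" "integrable B b"
  shows "integrable (A \<Otimes>\<^sub>M B) (\<lambda>x. b (snd x))" "(\<integral>x. b (snd x) \<partial>(A \<Otimes>\<^sub>M B)) = (\<integral>x. b x \<partial>B)"
proof -
  interpret A: prob_space A by fact
  show "integrable (A \<Otimes>\<^sub>M B) (\<lambda>x. b (snd x))" "(\<integral>x. b (snd x) \<partial>(A \<Otimes>\<^sub>M B)) = (\<integral>x. b x \<partial>B)"
    using pair_integral_mult[OF assms(1,2), of "\<lambda>_. 1" b] assms(3) by (simp_all add: A.prob_space)
qed

lemma nonneg_integral_le_1:
  fixes R :: "'a \<Rightarrow> real"
  assumes "R \<in> borel_measurable M" "\<And>x. x \<in> space M \<Longrightarrow> 0 \<le> R x" "(\<integral>\<^sup>+x. R x \<partial>M) \<le> 1"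
  shows "integrable M R" "(\<integral>x. R x \<partial>M) \<le> 1"
proof -
  show i: "integrable M R"
    by (rule integrableI_nonneg) (use assms in \<open>auto intro: order_le_less_trans\<close>)
  have "ennreal (\<integral>x. R x \<partial>M) = (\<integral>\<^sup>+x. R x \<partial>M)"
    by (rule nn_integral_eq_integral[symmetric]) (use i assms in auto)
  with assms(3) have "ennreal (\<integral>x. R x \<partial>M) \<le> ennreal 1" by simp
  then show "(\<integral>x. R x \<partial>M) \<le> 1" by (subst (asm) ennreal_le_iff) auto
qed

section \<open>Expectations of the remaining terms, and the single-letter inequality for one
  weight\<close>

context broadcast_model
begin

abbreviation "rS x \<equiv> fst (fst (fst x))"
abbreviation "rZ x \<equiv> snd (fst (fst x))"
abbreviation "rV x \<equiv> snd (fst x)"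
abbreviation "rY x \<equiv> outY (rS x) (rZ x)"
abbreviation "rU x \<equiv> outU (rS x) (rV x)"
abbreviation "rY2 x \<equiv> outZ (rY x) (snd x)"

lemma probs: "prob_space MuS" "prob_space MuZ" "prob_space MuV" "prob_space MuW" "prob_space (MuS \<Otimes>\<^sub>M MuZ)"
  "prob_space (MuS \<Otimes>\<^sub>M MuZ2)" "prob_space ((MuS \<Otimes>\<^sub>M MuZ2) \<Otimes>\<^sub>M MuV)"
proof -
  interpret Z2: prob_space MuZ2 by (rule prob_MuZ2)
  interpret SZ: pair_prob_space MuS MuZ ..
  interpret SZ2: pair_prob_space MuS MuZ2 ..
  interpret SZ2V: pair_prob_space "MuS \<Otimes>\<^sub>M MuZ2" MuV ..
  show "prob_space MuS" "prob_space MuZ" "prob_space MuV" "prob_space MuW" "prob_space (MuS \<Otimes>\<^sub>M MuZ)"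
    "prob_space (MuS \<Otimes>\<^sub>M MuZ2)" "prob_space ((MuS \<Otimes>\<^sub>M MuZ2) \<Otimes>\<^sub>M MuV)"
    by (rule MuS.prob_space_axioms MuZ.prob_space_axioms MuV.prob_space_axioms MuW.prob_space_axioms SZ.prob_space_axioms
       SZ2.prob_space_axioms SZ2V.prob_space_axioms)+
qed

lemma integral_toZ2:
  fixes a :: "_ \<Rightarrow> real"
  assumes "integrable ((MuS \<Otimes>\<^sub>M MuZ2) \<Otimes>\<^sub>M MuV) a"
  shows "integrable Om (\<lambda>x. a (toZ2 x))" "(\<integral>x. a (toZ2 x) \<partial>Om) = (\<integral>x. a x \<partial>((MuS \<Otimes>\<^sub>M MuZ2) \<Otimes>\<^sub>M MuV))"
proof -
  have m: "a \<in> borel_measurable ((MuS \<Otimes>\<^sub>M MuZ2) \<Otimes>\<^sub>M MuV)" using assms by auto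
  show "integrable Om (\<lambda>x. a (toZ2 x))"
    by (rule iffD1[OF integrable_distr_eq[OF toZ2_measurable m]]) (simp only: distr_toZ2 assms)
  show "(\<integral>x. a (toZ2 x) \<partial>Om) = (\<integral>x. a x \<partial>((MuS \<Otimes>\<^sub>M MuZ2) \<Otimes>\<^sub>M MuV))"
    using integral_distr[OF toZ2_measurable m] unfolding distr_toZ2 by simp
qed

text \<open>The first error moment is prescribed exactly because the quadratic forms that it
  determines enter the bound with both signs. Power and second error enter with a negative sign
  only, so upper bounds suffice for them.\<close>

context
  fixes Pw :: real
  assumes n: "0 < n" and QPw: "Q = Pw + N1 + \<delta>"
    and f_sq: "\<And>t. t < n \<Longrightarrow> integrable MuS (\<lambda>s. (f s t)\<^sup>2)" and f_pw: "(\<Sum>t<n. \<integral>s. (f s t)\<^sup>2 \<partial>MuS) \<le> real n * Pw"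
    and e1_sq: "block_square_integrable (MuS \<Otimes>\<^sub>M MuZ) n (\<lambda>x t. fst x t - sh (outY (fst x) (snd x)) t)"
    and e1_mom: "block_moment (MuS \<Otimes>\<^sub>M MuZ) n (\<lambda>x t. fst x t - sh (outY (fst x) (snd x)) t) = Th"
    and e2_sq: "block_square_integrable (MuS \<Otimes>\<^sub>M MuZ2) n (\<lambda>x t. P *v fst x t - uh (outY (fst x) (snd x)) t)"
    and e2_mom: "block_moment (MuS \<Otimes>\<^sub>M MuZ2) n (\<lambda>x t. P *v fst x t - uh (outY (fst x) (snd x)) t) + K \<preceq> D"
begin

lemma f_meas_MuS: "(\<lambda>s. f s t) \<in> borel_measurable MuS"
  using f_meas[of t] by measurable

lemma E_output_power:
  "integrable Om (\<lambda>x. sqd (\<lambda>_. 0) (rY2 x))" "(\<integral>x. sqd (\<lambda>_. 0) (rY2 x) \<partial>Om) \<le> real n * Q"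
proof -
  have N12: "0 < N1 + \<delta>" using N1 \<delta> by simp
  have t: "integrable Om (\<lambda>x. (f (rS x) t + outZ (rZ x) (snd x) t)\<^sup>2)
    \<and> (\<integral>x. (f (rS x) t + outZ (rZ x) (snd x) t)\<^sup>2 \<partial>Om) = (\<integral>s. (f s t)\<^sup>2 \<partial>MuS) + (N1 + \<delta>)" if t: "t < n" for t
  proof -
    note q = pair_integral_mult_add[OF probs(1) prob_MuZ2 f_meas_MuS f_meas_MuS f_sq[OF t] f_sq[OF t]
      noise_coordinates(5)[OF N12 t] noise_coordinates(5)[OF N12 t] noise_coordinates(3)[OF N12 t] noise_coordinates(3)[OF N12 t]
      noise_coordinates(2)[OF N12 t] noise_coordinates(2)[OF N12 t], folded power2_eq_square, unfolded noise_coordinates(4)[OF N12 t]]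
    note r = integral_pair_fst[OF probs(6,3) q(1)]
    show ?thesis using integral_toZ2[OF r(1)] r(2) q(2) by (simp add: toZ2_def)
  qed
  have e: "sqd (\<lambda>_. 0) (rY2 x) = (\<Sum>t<n. (f (rS x) t + outZ (rZ x) (snd x) t)\<^sup>2)" for x
    unfolding sqd_def by (rule sum.cong) (auto simp: outZ_def outY_def add.assoc)
  show "integrable Om (\<lambda>x. sqd (\<lambda>_. 0) (rY2 x))"
    unfolding e using t by (intro Bochner_Integration.integrable_sum) auto
  have "(\<integral>x. sqd (\<lambda>_. 0) (rY2 x) \<partial>Om) = (\<Sum>t<n. (\<integral>s. (f s t)\<^sup>2 \<partial>MuS) + (N1 + \<delta>))"
    unfolding e using t by (subst Bochner_Integration.integral_sum) auto
  also have "\<dots> \<le> real n * Q"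
    using f_pw by (simp add: sum.distrib QPw algebra_simps)
  finally show "(\<integral>x. sqd (\<lambda>_. 0) (rY2 x) \<partial>Om) \<le> real n * Q" .
qed

lemmas K_coordinates = block_coordinates[OF K n] and A_coordinates = block_coordinates[OF A n]

text \<open>The error of the auxiliary variable is the error of the decoder plus the independent
  auxiliary noise, which adds \<open>K\<close> to the moment matrix.\<close>

lemma E_second_decoder:
  "integrable Om (\<lambda>x. quad D (uh (rY2 x)) (rU x))" "(\<integral>x. quad D (uh (rY2 x)) (rU x) \<partial>Om) \<le> real n * CARD('j)"
proof -
  let ?e = "\<lambda>x t. P *v fst (fst x) t - uh (outY (fst (fst x)) (snd (fst x))) t + snd x t"
  have b: "block_square_integrable ((MuS \<Otimes>\<^sub>M MuZ2) \<Otimes>\<^sub>M MuV) n ?e"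
    by (rule block_add_independent(1)[OF probs(6,3) e2_sq K_coordinates(1,3)])
  have "block_moment ((MuS \<Otimes>\<^sub>M MuZ2) \<Otimes>\<^sub>M MuV) n ?e
    = block_moment (MuS \<Otimes>\<^sub>M MuZ2) n (\<lambda>x t. P *v fst x t - uh (outY (fst x) (snd x)) t) + K"
    by (rule trans[OF block_add_independent(2)[OF probs(6,3) e2_sq K_coordinates(1,3)]]) (simp_all only: K_coordinates(2))
  then have m: "block_moment ((MuS \<Otimes>\<^sub>M MuZ2) \<Otimes>\<^sub>M MuV) n ?e \<preceq> D"
    using e2_mom by simp
  note i = block_quadratic_form(1)[OF b n, of "matrix_inv D"]
  have e: "quad D (uh (rY2 x)) (rU x) = (\<Sum>t<n. (P *v fst (fst (toZ2 x)) t - uh (outY (fst (fst (toZ2 x))) (snd (fst (toZ2 x)))) t + snd (toZ2 x) t)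
    \<bullet> (matrix_inv D *v (P *v fst (fst (toZ2 x)) t - uh (outY (fst (fst (toZ2 x))) (snd (fst (toZ2 x)))) t + snd (toZ2 x) t)))" for x
    unfolding quad_def by (rule sum.cong) (auto simp: toZ2_def outZ_outY outU_def algebra_simps)
  show "integrable Om (\<lambda>x. quad D (uh (rY2 x)) (rU x))" unfolding e by (rule integral_toZ2(1)[OF i])
  show "(\<integral>x. quad D (uh (rY2 x)) (rU x) \<partial>Om) \<le> real n * CARD('j)"
    unfolding e integral_toZ2(2)[OF i] by (rule block_quadratic_le[OF b n D m])
qed

lemma E_added_noise:
  "integrable Om (\<lambda>x. sqd (rY x) (rY2 x))" "(\<integral>x. sqd (rY x) (rY2 x) \<partial>Om) = real n * \<delta>"
proof -
  have e: "sqd (rY x) (rY2 x) = (\<Sum>t<n. (snd x t)\<^sup>2)" for x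
    unfolding sqd_def by (rule sum.cong) (auto simp: outZ_def)
  note i = integral_pair_snd[OF prob_Om3 probs(4) noise_coordinates(3)[OF \<delta>], unfolded noise_coordinates(4)[OF \<delta>]]
  show "integrable Om (\<lambda>x. sqd (rY x) (rY2 x))" unfolding e using i(1) by (intro Bochner_Integration.integrable_sum) auto
  show "(\<integral>x. sqd (rY x) (rY2 x) \<partial>Om) = real n * \<delta>"
    unfolding e using i noise_coordinates(4)[OF \<delta>] by (subst Bochner_Integration.integral_sum) auto
qed

text \<open>The difference of the two outputs is the added noise, of mean 0 and independent of the
  first output and the auxiliary variable.\<close>

lemma E_transp:
  "integrable Om (\<lambda>x. \<Sum>t<n. mix.transp t (rU x) (rY x) * (rY2 x t - rY x t))"
  "(\<integral>x. (\<Sum>t<n. mix.transp t (rU x) (rY x) * (rY2 x t - rY x t)) \<partial>Om) = 0"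
proof -
  have e: "(\<Sum>t<n. mix.transp t (rU x) (rY x) * (rY2 x t - rY x t)) = (\<Sum>t<n. mix.transp t (rU x) (rY x) * snd x t)" for x
    by (rule sum.cong) (auto simp: outZ_def)
  note i = pair_integral_mult[OF prob_Om3 probs(4) integrable_transp noise_coordinates(1)[OF \<delta>]]
  show "integrable Om (\<lambda>x. \<Sum>t<n. mix.transp t (rU x) (rY x) * (rY2 x t - rY x t))"
    unfolding e using i(1) by (intro Bochner_Integration.integrable_sum) auto
  show "(\<integral>x. (\<Sum>t<n. mix.transp t (rU x) (rY x) * (rY2 x t - rY x t)) \<partial>Om) = 0"
    unfolding e using i noise_coordinates(2)[OF \<delta>] by (subst Bochner_Integration.integral_sum) auto
qed

lemma E_auxiliary:
  "integrable Om (\<lambda>x. quad (QK A) (\<lambda>_. 0) (rU x))" "(\<integral>x. quad (QK A) (\<lambda>_. 0) (rU x) \<partial>Om) = real n * CARD('j)"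
proof -
  note l = block_linear_image[OF A_coordinates(1), of P]
  note d = block_distr[OF measurable_fst MuZ.distr_pair_fst l(1)]
  let ?e = "\<lambda>x t. P *v fst (fst x) t + snd x t"
  have b: "block_square_integrable Om3 n ?e"
    by (rule block_add_independent(1)[OF probs(5,3) d(1) K_coordinates(1,3)])
  have m: "block_moment Om3 n ?e = QK A"
    by (rule trans[OF block_add_independent(2)[OF probs(5,3) d(1) K_coordinates(1,3)]])
      (simp_all only: d(2) l(2) A_coordinates(2) K_coordinates(2) QK_def)
  note i = block_quadratic_form(1)[OF b n, of "matrix_inv (QK A)"]
  note r = integral_pair_fst[OF prob_Om3 probs(4) i]
  have e: "quad (QK A) (\<lambda>_. 0) (rU x) = (\<Sum>t<n. (P *v rS x t + rV x t) \<bullet> (matrix_inv (QK A) *v (P *v rS x t + rV x t)))" for x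
    unfolding quad_def by (rule sum.cong) (auto simp: outU_def)
  show "integrable Om (\<lambda>x. quad (QK A) (\<lambda>_. 0) (rU x))" unfolding e by (rule r(1))
  show "(\<integral>x. quad (QK A) (\<lambda>_. 0) (rU x) \<partial>Om) = real n * CARD('j)"
    unfolding e by (rule trans[OF r(2)], rule block_quadratic_eq[OF b n QK_pos_def[OF A] m])
qed

lemma E_first_decoder:
  "integrable Om (\<lambda>x. quad Th (sh (rY x)) (rS x))" "(\<integral>x. quad Th (sh (rY x)) (rS x) \<partial>Om) = real n * CARD('k)"
proof -
  note i = block_quadratic_form(1)[OF e1_sq n, of "matrix_inv Th"]
  note r = integral_pair_fst[OF probs(5,3) i]
  note r' = integral_pair_fst[OF prob_Om3 probs(4) r(1)]
  show "integrable Om (\<lambda>x. quad Th (sh (rY x)) (rS x))" unfolding quad_def by (rule r'(1))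
  show "(\<integral>x. quad Th (sh (rY x)) (rS x) \<partial>Om) = real n * CARD('k)"
    unfolding quad_def r'(2) r(2) by (rule block_quadratic_eq[OF e1_sq n Th e1_mom])
qed

lemma E_auxiliary_error:
  "integrable Om (\<lambda>x. quad (QK Th) (\<lambda>t. P *v sh (rY x) t) (rU x))"
  "(\<integral>x. quad (QK Th) (\<lambda>t. P *v sh (rY x) t) (rU x) \<partial>Om) = real n * CARD('j)"
proof -
  note l = block_linear_image[OF e1_sq, of P]
  let ?e = "\<lambda>x t. P *v (fst (fst x) t - sh (outY (fst (fst x)) (snd (fst x))) t) + snd x t"
  have b: "block_square_integrable Om3 n ?e"
    by (rule block_add_independent(1)[OF probs(5,3) l(1) K_coordinates(1,3)])
  have m: "block_moment Om3 n ?e = QK Th"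
    by (rule trans[OF block_add_independent(2)[OF probs(5,3) l(1) K_coordinates(1,3)]])
      (simp_all only: l(2) e1_mom K_coordinates(2) QK_def)
  note i = block_quadratic_form(1)[OF b n, of "matrix_inv (QK Th)"]
  note r = integral_pair_fst[OF prob_Om3 probs(4) i]
  have e: "quad (QK Th) (\<lambda>t. P *v sh (rY x) t) (rU x) = (\<Sum>t<n. (P *v (rS x t - sh (rY x) t) + rV x t) \<bullet> (matrix_inv (QK Th) *v (P *v (rS x t - sh (rY x) t) + rV x t)))" for x
    unfolding quad_def by (rule sum.cong) (auto simp: outU_def algebra_simps)
  show "integrable Om (\<lambda>x. quad (QK Th) (\<lambda>t. P *v sh (rY x) t) (rU x))" unfolding e by (rule r(1))
  show "(\<integral>x. quad (QK Th) (\<lambda>t. P *v sh (rY x) t) (rU x) \<partial>Om) = real n * CARD('j)"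
    unfolding e by (rule trans[OF r(2)], rule block_quadratic_eq[OF b n QK_pos_def[OF Th] m])
qed

lemma E_source:
  "integrable Om (\<lambda>x. quad A (\<lambda>_. 0) (rS x))" "(\<integral>x. quad A (\<lambda>_. 0) (rS x) \<partial>Om) = real n * CARD('k)"
proof -
  note i = block_quadratic_form(1)[OF A_coordinates(1) n, of "matrix_inv A"]
  note r = integral_pair_fst[OF probs(1,2) i]
  note r' = integral_pair_fst[OF probs(5,3) r(1)]
  note r'' = integral_pair_fst[OF prob_Om3 probs(4) r'(1)]
  show "integrable Om (\<lambda>x. quad A (\<lambda>_. 0) (rS x))" unfolding quad_def diff_zero by (rule r''(1))
  show "(\<integral>x. quad A (\<lambda>_. 0) (rS x) \<partial>Om) = real n * CARD('k)"
    unfolding quad_def diff_zero r''(2) r'(2) r(2) by (rule block_quadratic_eq[OF A_coordinates(1) n A A_coordinates(2)])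
qed

lemma E_channel_noise:
  "integrable Om (\<lambda>x. sqd (f (rS x)) (rY x))" "(\<integral>x. sqd (f (rS x)) (rY x) \<partial>Om) = real n * N1"
proof -
  have e: "sqd (f (rS x)) (rY x) = (\<Sum>t<n. (rZ x t)\<^sup>2)" for x
    unfolding sqd_def by (rule sum.cong) (auto simp: outY_def)
  have i: "integrable Om (\<lambda>x. (rZ x t)\<^sup>2) \<and> (\<integral>x. (rZ x t)\<^sup>2 \<partial>Om) = N1" if t: "t < n" for t
  proof -
    note r = integral_pair_snd[OF probs(1,2) noise_coordinates(3)[OF N1 t]]
    note r' = integral_pair_fst[OF probs(5,3) r(1)]
    note r'' = integral_pair_fst[OF prob_Om3 probs(4) r'(1)]
    show ?thesis using r''(1) unfolding r''(2) r'(2) r(2) noise_coordinates(4)[OF N1 t] by simp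
  qed
  show "integrable Om (\<lambda>x. sqd (f (rS x)) (rY x))" unfolding e using i by (intro Bochner_Integration.integrable_sum) auto
  show "(\<integral>x. sqd (f (rS x)) (rY x) \<partial>Om) = real n * N1"
    unfolding e using i by (subst Bochner_Integration.integral_sum) auto
qed

lemma R_integrals:
  assumes "0 < c" "0 \<le> b"
  shows "integrable Om (\<lambda>x. R1 c b (rY x) (rU x) (rY2 x))" "(\<integral>x. R1 c b (rY x) (rU x) (rY2 x) \<partial>Om) \<le> 1"
    "integrable Om (\<lambda>x. R2 (rS x) (rY x) (rU x))" "(\<integral>x. R2 (rS x) (rY x) (rU x) \<partial>Om) \<le> 1"
    "\<And>x. 0 < R1 c b (rY x) (rU x) (rY2 x)" "\<And>x. 0 < R2 (rS x) (rY x) (rU x)"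
proof -
  have U: "rU x \<in> space LU" for x :: "((_ \<times> _) \<times> _) \<times> _" by (simp add: outU_def space_PiM)
  show p1: "0 < R1 c b (rY x) (rU x) (rY2 x)" for x
    unfolding R1_def by (intro divide_pos_pos mult_pos_pos prod_pos ch_pos gd_pos mix.dens_pos ballI mix.backward_pos U Q D \<delta> assms)
  have p2: "0 < R2 s y (outU s v)" for s y v
    unfolding R2_def using U[of "(((s, undefined), v), undefined)"]
    by (intro divide_pos_pos mult_pos_pos ch_pos gd_pos mix.dens_pos QK_pos_def Th A N1) simp
  show "0 < R2 (rS x) (rY x) (rU x)" for x by (rule p2)
  show "integrable Om (\<lambda>x. R1 c b (rY x) (rU x) (rY2 x))" "(\<integral>x. R1 c b (rY x) (rU x) (rY2 x) \<partial>Om) \<le> 1"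
    by (rule nonneg_integral_le_1; use p1 nn_integral_R1[OF assms] in \<open>auto simp: less_imp_le\<close>)+
  have "integrable Om3 (\<lambda>x. R2 (fst (fst x)) (outY (fst (fst x)) (snd (fst x))) (outU (fst (fst x)) (snd x)))"
    "(\<integral>x. R2 (fst (fst x)) (outY (fst (fst x)) (snd (fst x))) (outU (fst (fst x)) (snd x)) \<partial>Om3) \<le> 1"
    by (rule nonneg_integral_le_1; use p2 nn_integral_R2 in \<open>auto simp: less_imp_le\<close>)+
  note i = this
  note r = integral_pair_fst[OF prob_Om3 probs(4) i(1)]
  show "integrable Om (\<lambda>x. R2 (rS x) (rY x) (rU x))" by (rule r(1))
  show "(\<integral>x. R2 (rS x) (rY x) (rU x) \<partial>Om) \<le> 1" using i(2) r(2) by simp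
qed

text \<open>Both ratios have mean at most 1, so the lower bound for ln R1 + lam ln R2 has
  expectation at most 0. After the quadratic terms have been evaluated, only normalising constants
  are left, and they form this inequality.\<close>

lemma model_inequality:
  assumes lam: "0 < lam" "lam < 1"
  shows "lam * ln (N1 * det A * det (QK Th) / (lam * det Th)) + (1 - lam) * ln (\<delta> * det (QK A) / (1 - lam)) \<le> ln (Q * det D)"
proof -
  interpret Om: prob_space Om by (rule prob_Om)
  define c b where "c = sqrt (lam / \<delta>)" and "b = sqrt (1 - lam)"
  have cb: "0 < c" "0 \<le> b" using lam \<delta> by (auto simp: c_def b_def)
  define l where "l = ln (2 * pi)"
  define kap where "kap = - lam / 2 * l - lam / 2 * ln (lam * \<delta>) - (1 - lam) / 2 * ln (1 - lam)"
  \<comment> \<open>All normalising constants of the Gaussian densities, together with the constants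
    of the backward densities.\<close>
  define C where "C = - (real n / 2) * (l + ln Q) - (real n / 2) * (real CARD('j) * l + ln (det D)) + real n * kap
     + (1 - lam) * ((real n / 2) * (real CARD('j) * l + ln (det (QK A)))) + (real n / 2) * (l + ln \<delta>)
     + lam * (- (real n / 2) * (real CARD('k) * l + ln (det Th)) + (real n / 2) * (real CARD('j) * l + ln (det (QK Th)))
        + (real n / 2) * (real CARD('k) * l + ln (det A)) + (real n / 2) * (l + ln N1))"
  define T where "T x = C - sqd (\<lambda>_. 0) (rY2 x) / (2 * Q) - quad D (uh (rY2 x)) (rU x) / 2
     + (1 - lam) / (2 * \<delta>) * sqd (rY x) (rY2 x)
     + c * b * (\<Sum>t<n. mix.transp t (rU x) (rY x) * (rY2 x t - rY x t))
     + (1 - lam) / 2 * quad (QK A) (\<lambda>_. 0) (rU x)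
     - lam / 2 * quad Th (sh (rY x)) (rS x) + lam / 2 * quad (QK Th) (\<lambda>t. P *v sh (rY x) t) (rU x)
     + lam / 2 * quad A (\<lambda>_. 0) (rS x) + lam / (2 * N1) * sqd (f (rS x)) (rY x)" for x
  \<comment> \<open>The logarithms are bounded pointwise by R - 1. Thus only \<open>T\<close> and
    the ratios have to be integrable, never a logarithm of an unknown density.\<close>
  have T_le: "T x \<le> R1 c b (rY x) (rU x) (rY2 x) - 1 + lam * (R2 (rS x) (rY x) (rU x) - 1)" for x
  proof -
    have u: "rU x \<in> space LU" by (simp add: outU_def space_PiM)
    have "T x \<le> ln (R1 c b (rY x) (rU x) (rY2 x)) + lam * ln (R2 (rS x) (rY x) (rU x))"
      using log_ratio_lower_bound[OF u lam, where y="rY x" and ?y2.0="rY2 x" and s="rS x"]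
      unfolding c_def[symmetric] b_def[symmetric] kap_def[symmetric] l_def[symmetric]
        ln_ch[OF Q] ln_gd[OF D] ln_gd[OF QK_pos_def[OF A]] ln_ch[OF \<delta>] ln_gd[OF Th] ln_gd[OF QK_pos_def[OF Th]] ln_gd[OF A] ln_ch[OF N1]
      unfolding l_def[symmetric] T_def C_def by (simp add: algebra_simps add_divide_distrib diff_divide_distrib)
    also have "\<dots> \<le> R1 c b (rY x) (rU x) (rY2 x) - 1 + lam * (R2 (rS x) (rY x) (rU x) - 1)"
      using lam by (intro add_mono mult_left_mono ln_le_minus_one R_integrals[OF cb]) auto
    finally show ?thesis .
  qed
  note E = E_output_power E_second_decoder E_added_noise E_transp E_auxiliary E_first_decoder E_auxiliary_error E_source E_channel_noise
  have Ti: "integrable Om T"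
    unfolding T_def
    by (intro Bochner_Integration.integrable_add Bochner_Integration.integrable_diff integrable_divide integrable_mult_right Om.integrable_const E)
  have "(\<integral>x. T x \<partial>Om) \<le> (\<integral>x. R1 c b (rY x) (rU x) (rY2 x) - 1 + lam * (R2 (rS x) (rY x) (rU x) - 1) \<partial>Om)"
    by (intro integral_mono Ti T_le Bochner_Integration.integrable_add Bochner_Integration.integrable_diff integrable_mult_right Om.integrable_const R_integrals[OF cb])
  also have "\<dots> = (\<integral>x. R1 c b (rY x) (rU x) (rY2 x) \<partial>Om) - 1 + lam * ((\<integral>x. R2 (rS x) (rY x) (rU x) \<partial>Om) - 1)"
    by (simp add: R_integrals[OF cb] Om.prob_space)
  also have "\<dots> \<le> 0"
    using R_integrals(2,4)[OF cb] lam by (simp add: add_nonpos_nonpos mult_nonneg_nonpos)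
  finally have ET: "(\<integral>x. T x \<partial>Om) \<le> 0" .
  have "(\<integral>x. T x \<partial>Om) = C - (\<integral>x. sqd (\<lambda>_. 0) (rY2 x) \<partial>Om) / (2 * Q) - (\<integral>x. quad D (uh (rY2 x)) (rU x) \<partial>Om) / 2
     + (1 - lam) / (2 * \<delta>) * (real n * \<delta>) + c * b * 0 + (1 - lam) / 2 * (real n * CARD('j))
     - lam / 2 * (real n * CARD('k)) + lam / 2 * (real n * CARD('j)) + lam / 2 * (real n * CARD('k)) + lam / (2 * N1) * (real n * N1)"
    unfolding T_def
    by (simp only: Bochner_Integration.integral_add Bochner_Integration.integral_diff Bochner_Integration.integrable_add
      Bochner_Integration.integrable_diff integrable_divide integral_divide_zero integral_mult_right_zero integrable_mult_right Om.integrable_const E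
      lebesgue_integral_const Om.prob_space scaleR_one)
  moreover have "(\<integral>x. sqd (\<lambda>_. 0) (rY2 x) \<partial>Om) / (2 * Q) \<le> real n / 2"
    using E_output_power(2) Q by (simp add: divide_simps mult.commute)
  moreover have "(\<integral>x. quad D (uh (rY2 x)) (rU x) \<partial>Om) / 2 \<le> real n * CARD('j) / 2"
    using E_second_decoder(2) by simp
  ultimately have "C - real n / 2 - real n * CARD('j) / 2 + (1 - lam) * real n / 2 + (1 - lam) / 2 * (real n * CARD('j))
     + lam / 2 * (real n * CARD('j)) + lam * real n / 2 \<le> 0"
    using ET \<delta> N1 by simp
  \<comment> \<open>Each Gaussian quadratic contributes half its dimension per letter, and these
    contributions cancel: -1 - j + (1 - lam)(1 + j) + lam j + lam = 0 with j =
    \<open>CARD('j)\<close>; the two terms in \<open>CARD('k)\<close> have already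
    cancelled.\<close>
  moreover have "C - real n / 2 - real n * CARD('j) / 2 + (1 - lam) * real n / 2 + (1 - lam) / 2 * (real n * CARD('j))
     + lam / 2 * (real n * CARD('j)) + lam * real n / 2 = C" by (simp add: field_simps)
  ultimately have "C \<le> 0" by simp
  moreover have "C = real n / 2 * (lam * (ln N1 + ln (det A) + ln (det (QK Th)) - ln lam - ln (det Th))
    + (1 - lam) * (ln \<delta> + ln (det (QK A)) - ln (1 - lam)) - (ln Q + ln (det D)))"
    using lam \<delta> unfolding C_def kap_def l_def[symmetric] by (simp add: ln_mult field_simps)
  ultimately have "lam * (ln N1 + ln (det A) + ln (det (QK Th)) - ln lam - ln (det Th))
    + (1 - lam) * (ln \<delta> + ln (det (QK A)) - ln (1 - lam)) \<le> ln Q + ln (det D)"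
    using n by (simp add: mult_le_0_iff)
  moreover have "0 < det A" "0 < det (QK Th)" "0 < det Th" "0 < det (QK A)" "0 < det D"
    by (auto intro: pos_def_det_pos A Th D QK_pos_def)
  ultimately show ?thesis using lam N1 \<delta> Q by (simp add: ln_mult ln_div diff_diff_eq)
qed

end

end

subsection \<open>Independent blocks\<close>

text \<open>Regroups a block of independent pairs into a pair of independent blocks. The induction
  peels off the last pair and uses Fubini to bring its first component next to the first
  block.\<close>

lemma nn_integral_unzip:
  fixes \<mu> :: "'a measure" and \<nu> :: "'b measure"
  assumes p: "prob_space \<mu>" "prob_space \<nu>"
    and h: "(\<lambda>(a, b). h a b) \<in> borel_measurable (block_measure n \<mu> \<Otimes>\<^sub>M block_measure n \<nu>)"
  shows "(\<integral>\<^sup>+x. h (\<lambda>t\<in>{..<n}. fst (x t)) (\<lambda>t\<in>{..<n}. snd (x t)) \<partial>block_measure n (\<mu> \<Otimes>\<^sub>M \<nu>))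
    = (\<integral>\<^sup>+a. \<integral>\<^sup>+b. h a b \<partial>block_measure n \<nu> \<partial>block_measure n \<mu>)"
  using h
proof (induction n arbitrary: h)
  case 0
  then show ?case by (simp add: PiM_empty nn_integral_count_space_finite restrict_def)
next
  case (Suc n)
  interpret \<mu>: prob_space \<mu> by fact
  interpret \<nu>: prob_space \<nu> by fact
  interpret \<mu>\<nu>: pair_prob_space \<mu> \<nu> ..
  interpret PM: product_prob_space "\<lambda>_::nat. \<mu>" by unfold_locales
  interpret PN: product_prob_space "\<lambda>_::nat. \<nu>" by unfold_locales
  interpret PMN: product_prob_space "\<lambda>_::nat. \<mu> \<Otimes>\<^sub>M \<nu>" by unfold_locales
  interpret Bn: prob_space "block_measure n \<nu>" by (intro prob_space_PiM \<nu>.prob_space_axioms)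
  interpret An: prob_space "block_measure n \<mu>" by (intro prob_space_PiM \<mu>.prob_space_axioms)
  interpret AB: pair_sigma_finite \<mu> "block_measure n \<nu>" ..
  have ins: "{..<Suc n} = insert n {..<n}" by auto
  have hc[measurable (raw)]: "(\<lambda>x. h (a x) (b x)) \<in> borel_measurable N"
    if "a \<in> N \<rightarrow>\<^sub>M block_measure (Suc n) \<mu>" "b \<in> N \<rightarrow>\<^sub>M block_measure (Suc n) \<nu>" for N a b
    using measurable_compose[OF measurable_Pair[OF that] Suc.prems] by simp
  have updA[measurable (raw)]: "(\<lambda>x. (a x)(n := c x)) \<in> N \<rightarrow>\<^sub>M block_measure (Suc n) \<mu>"
    if "a \<in> N \<rightarrow>\<^sub>M block_measure n \<mu>" "c \<in> N \<rightarrow>\<^sub>M \<mu>" for N a c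
    unfolding ins using measurable_compose[OF measurable_Pair[OF that] measurable_add_dim] by (simp add: case_prod_beta)
  have updB[measurable (raw)]: "(\<lambda>x. (a x)(n := c x)) \<in> N \<rightarrow>\<^sub>M block_measure (Suc n) \<nu>"
    if "a \<in> N \<rightarrow>\<^sub>M block_measure n \<nu>" "c \<in> N \<rightarrow>\<^sub>M \<nu>" for N a c
    unfolding ins using measurable_compose[OF measurable_Pair[OF that] measurable_add_dim] by (simp add: case_prod_beta)
  define H where "H a b = (\<integral>\<^sup>+p. h (a(n := fst p)) (b(n := snd p)) \<partial>(\<mu> \<Otimes>\<^sub>M \<nu>))" for a b
  have Hm: "(\<lambda>(a, b). H a b) \<in> borel_measurable (block_measure n \<mu> \<Otimes>\<^sub>M block_measure n \<nu>)"
    unfolding H_def case_prod_beta by (rule \<mu>\<nu>.borel_measurable_nn_integral) (simp add: case_prod_beta, measurable)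
  have mz: "(\<lambda>x. \<lambda>t\<in>{..<m}. fst (x t)) \<in> block_measure m (\<mu> \<Otimes>\<^sub>M \<nu>) \<rightarrow>\<^sub>M block_measure m \<mu>"
    "(\<lambda>x. \<lambda>t\<in>{..<m}. snd (x t)) \<in> block_measure m (\<mu> \<Otimes>\<^sub>M \<nu>) \<rightarrow>\<^sub>M block_measure m \<nu>" for m
    by (auto intro!: measurable_restrict measurable_compose[OF measurable_component_singleton])
  have "(\<integral>\<^sup>+x. h (\<lambda>t\<in>{..<Suc n}. fst (x t)) (\<lambda>t\<in>{..<Suc n}. snd (x t)) \<partial>block_measure (Suc n) (\<mu> \<Otimes>\<^sub>M \<nu>))
    = (\<integral>\<^sup>+x. \<integral>\<^sup>+p. h (\<lambda>t\<in>{..<Suc n}. fst ((x(n := p)) t)) (\<lambda>t\<in>{..<Suc n}. snd ((x(n := p)) t)) \<partial>(\<mu> \<Otimes>\<^sub>M \<nu>) \<partial>block_measure n (\<mu> \<Otimes>\<^sub>M \<nu>))"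
    unfolding ins
  proof (rule PMN.product_nn_integral_insert)
    show "(\<lambda>x. h (\<lambda>t\<in>insert n {..<n}. fst (x t)) (\<lambda>t\<in>insert n {..<n}. snd (x t))) \<in> borel_measurable (Pi\<^sub>M (insert n {..<n}) (\<lambda>_. \<mu> \<Otimes>\<^sub>M \<nu>))"
      unfolding ins[symmetric] by (rule hc[OF mz])
  qed auto
  also have "\<dots> = (\<integral>\<^sup>+x. H (\<lambda>t\<in>{..<n}. fst (x t)) (\<lambda>t\<in>{..<n}. snd (x t)) \<partial>block_measure n (\<mu> \<Otimes>\<^sub>M \<nu>))"
  proof -
    have "(\<lambda>t\<in>{..<Suc n}. fst ((x(n := p)) t)) = (\<lambda>t\<in>{..<n}. fst (x t))(n := fst p)"
      "(\<lambda>t\<in>{..<Suc n}. snd ((x(n := p)) t)) = (\<lambda>t\<in>{..<n}. snd (x t))(n := snd p)" for x :: "nat \<Rightarrow> 'a \<times> 'b" and p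
      by (auto simp: fun_eq_iff restrict_def)
    then show ?thesis by (simp add: H_def)
  qed
  also have "\<dots> = (\<integral>\<^sup>+a. \<integral>\<^sup>+b. H a b \<partial>block_measure n \<nu> \<partial>block_measure n \<mu>)"
    by (rule Suc.IH[OF Hm])
  also have "\<dots> = (\<integral>\<^sup>+a. \<integral>\<^sup>+b. \<integral>\<^sup>+x. \<integral>\<^sup>+y. h (a(n := x)) (b(n := y)) \<partial>\<nu> \<partial>\<mu> \<partial>block_measure n \<nu> \<partial>block_measure n \<mu>)"
    unfolding H_def
  proof (intro nn_integral_cong)
    fix a b assume [measurable]: "a \<in> space (block_measure n \<mu>)" "b \<in> space (block_measure n \<nu>)"
    show "(\<integral>\<^sup>+p. h (a(n := fst p)) (b(n := snd p)) \<partial>(\<mu> \<Otimes>\<^sub>M \<nu>)) = (\<integral>\<^sup>+x. \<integral>\<^sup>+y. h (a(n := x)) (b(n := y)) \<partial>\<nu> \<partial>\<mu>)"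
      by (subst \<nu>.nn_integral_fst[symmetric]) simp_all
  qed
  also have "\<dots> = (\<integral>\<^sup>+a. \<integral>\<^sup>+x. \<integral>\<^sup>+b. \<integral>\<^sup>+y. h (a(n := x)) (b(n := y)) \<partial>\<nu> \<partial>block_measure n \<nu> \<partial>\<mu> \<partial>block_measure n \<mu>)"
  proof (intro nn_integral_cong AB.Fubini')
    fix a assume [measurable]: "a \<in> space (block_measure n \<mu>)"
    show "(\<lambda>(x, b). \<integral>\<^sup>+y. h (a(n := x)) (b(n := y)) \<partial>\<nu>) \<in> borel_measurable (\<mu> \<Otimes>\<^sub>M block_measure n \<nu>)" by measurable
  qed
  also have "\<dots> = (\<integral>\<^sup>+a. \<integral>\<^sup>+x. \<integral>\<^sup>+b. h (a(n := x)) b \<partial>block_measure (Suc n) \<nu> \<partial>\<mu> \<partial>block_measure n \<mu>)"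
  proof (intro nn_integral_cong)
    fix a x assume [measurable]: "a \<in> space (block_measure n \<mu>)" "x \<in> space \<mu>"
    show "(\<integral>\<^sup>+b. \<integral>\<^sup>+y. h (a(n := x)) (b(n := y)) \<partial>\<nu> \<partial>block_measure n \<nu>) = (\<integral>\<^sup>+b. h (a(n := x)) b \<partial>block_measure (Suc n) \<nu>)"
      unfolding ins by (rule PN.product_nn_integral_insert[symmetric]) (auto simp: ins[symmetric])
  qed
  also have "\<dots> = (\<integral>\<^sup>+a. \<integral>\<^sup>+b. h a b \<partial>block_measure (Suc n) \<nu> \<partial>block_measure (Suc n) \<mu>)"
  proof -
    interpret Bs: prob_space "block_measure (Suc n) \<nu>" by (intro prob_space_PiM \<nu>.prob_space_axioms)
    have m: "(\<lambda>a. \<integral>\<^sup>+b. h a b \<partial>block_measure (Suc n) \<nu>) \<in> borel_measurable (block_measure (Suc n) \<mu>)" by measurable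
    show ?thesis
      unfolding ins by (rule PM.product_nn_integral_insert[symmetric]) (use m in \<open>auto simp: ins[symmetric]\<close>)
  qed
  finally show ?case .
qed

text \<open>Independence over time gives the law of the block of pairs; independence within each
  letter then allows the regrouping. This carries the actual process over to the product spaces of
  the model.\<close>

lemma (in prob_space) distr_blocks_independent:
  fixes S :: "nat \<Rightarrow> 'a \<Rightarrow> 'b::{second_countable_topology}" and Z :: "nat \<Rightarrow> 'a \<Rightarrow> 'c::{second_countable_topology}"
  assumes ind: "indep_vars (\<lambda>_. borel) (\<lambda>t \<omega>. (S t \<omega>, Z t \<omega>)) UNIV"
    and d: "\<And>t. distr M borel (\<lambda>\<omega>. (S t \<omega>, Z t \<omega>)) = \<mu> \<Otimes>\<^sub>M \<nu>"
    and p: "prob_space \<mu>" "prob_space \<nu>" and s: "sets \<mu> = sets borel" "sets \<nu> = sets borel" and n: "0 < n"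
  shows "(\<lambda>\<omega>. (block n S \<omega>, block n Z \<omega>)) \<in> M \<rightarrow>\<^sub>M block_measure n \<mu> \<Otimes>\<^sub>M block_measure n \<nu>"
    and "distr M (block_measure n \<mu> \<Otimes>\<^sub>M block_measure n \<nu>) (\<lambda>\<omega>. (block n S \<omega>, block n Z \<omega>)) = block_measure n \<mu> \<Otimes>\<^sub>M block_measure n \<nu>"
proof -
  interpret \<mu>: prob_space \<mu> by fact
  interpret \<nu>: prob_space \<nu> by fact
  interpret Bn: prob_space "block_measure n \<nu>" by (intro prob_space_PiM \<nu>.prob_space_axioms)
  note [measurable_cong] = s
  have rv[measurable]: "(\<lambda>\<omega>. (S t \<omega>, Z t \<omega>)) \<in> borel_measurable M" for t
    using ind by (auto simp: indep_vars_def)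
  have [measurable]: "S t \<in> borel_measurable M" "Z t \<in> borel_measurable M" for t
  proof -
    have "(fst :: 'b \<times> 'c \<Rightarrow> 'b) \<in> borel_measurable borel" "(snd :: 'b \<times> 'c \<Rightarrow> 'c) \<in> borel_measurable borel"
      by (rule borel_measurable_continuous_onI, rule continuous_on_fst continuous_on_snd, rule continuous_on_id)+
    from measurable_compose[OF rv this(1)] measurable_compose[OF rv this(2)]
    show "S t \<in> borel_measurable M" "Z t \<in> borel_measurable M" by simp_all
  qed
  show mb: "(\<lambda>\<omega>. (block n S \<omega>, block n Z \<omega>)) \<in> M \<rightarrow>\<^sub>M block_measure n \<mu> \<Otimes>\<^sub>M block_measure n \<nu>"
    unfolding block_def by (intro measurable_Pair measurable_restrict) measurable
  have sb: "sets (\<mu> \<Otimes>\<^sub>M \<nu>) = sets borel" by (rule trans[OF sets_pair_measure_cong[OF s]]) (simp only: borel_prod)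
  have "indep_vars (\<lambda>_. borel) (\<lambda>t \<omega>. (S t \<omega>, Z t \<omega>)) {..<n}" by (rule indep_vars_subset[OF ind]) simp
  then have dP: "distr M (block_measure n borel) (\<lambda>\<omega>. \<lambda>t\<in>{..<n}. (S t \<omega>, Z t \<omega>)) = block_measure n (\<mu> \<Otimes>\<^sub>M \<nu>)"
    by (subst (asm) indep_vars_iff_distr_eq_PiM'[OF _ rv]) (use n in \<open>auto simp: d\<close>)
  show "distr M (block_measure n \<mu> \<Otimes>\<^sub>M block_measure n \<nu>) (\<lambda>\<omega>. (block n S \<omega>, block n Z \<omega>)) = block_measure n \<mu> \<Otimes>\<^sub>M block_measure n \<nu>"
  proof (rule measure_eqI)
    fix X assume "X \<in> sets (distr M (block_measure n \<mu> \<Otimes>\<^sub>M block_measure n \<nu>) (\<lambda>\<omega>. (block n S \<omega>, block n Z \<omega>)))"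
    then have X[measurable]: "X \<in> sets (block_measure n \<mu> \<Otimes>\<^sub>M block_measure n \<nu>)" by simp
    have iX: "(\<lambda>(a, b). indicator X (a, b) :: ennreal) \<in> borel_measurable (block_measure n \<mu> \<Otimes>\<^sub>M block_measure n \<nu>)"
      by simp
    have mz: "(\<lambda>x. (\<lambda>t\<in>{..<n}. fst (x t), \<lambda>t\<in>{..<n}. snd (x t))) \<in> block_measure n (\<mu> \<Otimes>\<^sub>M \<nu>) \<rightarrow>\<^sub>M block_measure n \<mu> \<Otimes>\<^sub>M block_measure n \<nu>"
      by (intro measurable_Pair measurable_restrict measurable_compose[OF measurable_component_singleton]) auto
    have mz': "(\<lambda>x. (\<lambda>t\<in>{..<n}. fst (x t), \<lambda>t\<in>{..<n}. snd (x t))) \<in> block_measure n borel \<rightarrow>\<^sub>M block_measure n \<mu> \<Otimes>\<^sub>M block_measure n \<nu>"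
      using mz by (simp add: measurable_cong_sets[OF sets_block_measure_cong[OF sb] refl])
    have mp: "(\<lambda>\<omega>. \<lambda>t\<in>{..<n}. (S t \<omega>, Z t \<omega>)) \<in> M \<rightarrow>\<^sub>M block_measure n borel"
      by (intro measurable_restrict) measurable
    have "emeasure (distr M (block_measure n \<mu> \<Otimes>\<^sub>M block_measure n \<nu>) (\<lambda>\<omega>. (block n S \<omega>, block n Z \<omega>))) X
      = (\<integral>\<^sup>+\<omega>. indicator X (block n S \<omega>, block n Z \<omega>) \<partial>M)"
      by (subst nn_integral_indicator[symmetric], simp, subst nn_integral_distr[OF mb]) auto
    also have "\<dots> = (\<integral>\<^sup>+\<omega>. indicator X (\<lambda>t\<in>{..<n}. fst ((\<lambda>t\<in>{..<n}. (S t \<omega>, Z t \<omega>)) t), \<lambda>t\<in>{..<n}. snd ((\<lambda>t\<in>{..<n}. (S t \<omega>, Z t \<omega>)) t)) \<partial>M)"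
      by (simp add: block_def cong: restrict_cong)
    also have "\<dots> = (\<integral>\<^sup>+x. indicator X (\<lambda>t\<in>{..<n}. fst (x t), \<lambda>t\<in>{..<n}. snd (x t)) \<partial>block_measure n (\<mu> \<Otimes>\<^sub>M \<nu>))"
      unfolding dP[symmetric]
    proof (rule nn_integral_distr[symmetric, OF mp])
      have "(\<lambda>x. indicator X (\<lambda>t\<in>{..<n}. fst (x t), \<lambda>t\<in>{..<n}. snd (x t)) :: ennreal) \<in> borel_measurable (block_measure n borel)"
        by (rule measurable_compose[OF mz']) simp
      then show "(\<lambda>x. indicator X (\<lambda>t\<in>{..<n}. fst (x t), \<lambda>t\<in>{..<n}. snd (x t)) :: ennreal)
        \<in> borel_measurable (distr M (block_measure n borel) (\<lambda>\<omega>. \<lambda>t\<in>{..<n}. (S t \<omega>, Z t \<omega>)))" by simp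
    qed
    also have "\<dots> = (\<integral>\<^sup>+a. \<integral>\<^sup>+b. indicator X (a, b) \<partial>block_measure n \<nu> \<partial>block_measure n \<mu>)"
      by (rule nn_integral_unzip[OF p iX])
    also have "\<dots> = emeasure (block_measure n \<mu> \<Otimes>\<^sub>M block_measure n \<nu>) X"
      by (subst Bn.nn_integral_fst) auto
    finally show "emeasure (distr M (block_measure n \<mu> \<Otimes>\<^sub>M block_measure n \<nu>) (\<lambda>\<omega>. (block n S \<omega>, block n Z \<omega>))) X
      = emeasure (block_measure n \<mu> \<Otimes>\<^sub>M block_measure n \<nu>) X" .
  qed simp
qed

subsection \<open>Linear estimation\<close>

lemma block_moment_symmetric: "transpose (block_moment M n e) = block_moment M n e"
  by (simp add: block_moment_def transpose_def vec_eq_iff mult.commute)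

lemma block_moment_form:
  fixes e :: "'a \<Rightarrow> nat \<Rightarrow> real^'k"
  assumes e: "block_square_integrable M n e"
  shows "x \<bullet> (block_moment M n e *v x) = (1 / real n) * (\<Sum>t<n. \<integral>\<omega>. (x \<bullet> e \<omega> t)\<^sup>2 \<partial>M)"
proof -
  note i = block_square_integrable_mult[OF e]
  have sq: "(x \<bullet> v)\<^sup>2 = (\<Sum>i\<in>UNIV. \<Sum>j\<in>UNIV. x $ i * x $ j * (v $ i * v $ j))" for v
    unfolding inner_vec_def power2_eq_square sum_product by (simp add: mult_ac)
  have I: "(\<integral>\<omega>. (x \<bullet> e \<omega> t)\<^sup>2 \<partial>M) = (\<Sum>i\<in>UNIV. \<Sum>j\<in>UNIV. x $ i * x $ j * (\<integral>\<omega>. e \<omega> t $ i * e \<omega> t $ j \<partial>M))" if t: "t < n" for t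
    unfolding sq
    by (subst Bochner_Integration.integral_sum, (intro Bochner_Integration.integrable_sum integrable_mult_right i t),
        intro sum.cong refl, subst Bochner_Integration.integral_sum, (intro integrable_mult_right i t), simp)
  have "(\<Sum>t<n. \<integral>\<omega>. (x \<bullet> e \<omega> t)\<^sup>2 \<partial>M) = (\<Sum>t<n. \<Sum>i\<in>UNIV. \<Sum>j\<in>UNIV. x $ i * x $ j * (\<integral>\<omega>. e \<omega> t $ i * e \<omega> t $ j \<partial>M))"
    using I by simp
  also have "\<dots> = (\<Sum>i\<in>UNIV. \<Sum>j\<in>UNIV. x $ i * x $ j * (\<Sum>t<n. \<integral>\<omega>. e \<omega> t $ i * e \<omega> t $ j \<partial>M))"
    unfolding sum_distrib_left by (subst sum.swap, intro sum.cong refl, rule sum.swap)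
  finally show ?thesis
    by (simp add: inner_matrix_vector_sum block_moment_def sum_distrib_left mult_ac)
qed

lemma block_moment_pos_semidef: "block_square_integrable M n e \<Longrightarrow> pos_semidef (block_moment M n e)"
  unfolding pos_semidef_def by (auto simp: block_moment_symmetric block_moment_form intro!: divide_nonneg_nonneg sum_nonneg integral_nonneg_AE)

lemma block_square_integrable_inner:
  fixes e :: "'a \<Rightarrow> nat \<Rightarrow> real^'k"
  assumes e: "block_square_integrable M n e" and t: "t < n"
  shows "(\<lambda>\<omega>. x \<bullet> e \<omega> t) \<in> borel_measurable M" "integrable M (\<lambda>\<omega>. (x \<bullet> e \<omega> t)\<^sup>2)"
proof -
  note i = block_square_integrable_mult[OF e]
  have [measurable]: "(\<lambda>x. e x t $ i) \<in> borel_measurable M" for i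
    using e t by (auto simp: block_square_integrable_def)
  show "(\<lambda>\<omega>. x \<bullet> e \<omega> t) \<in> borel_measurable M" unfolding inner_vec_def by simp
  have sq: "(x \<bullet> v)\<^sup>2 = (\<Sum>i\<in>UNIV. \<Sum>j\<in>UNIV. x $ i * x $ j * (v $ i * v $ j))" for v
    unfolding inner_vec_def power2_eq_square sum_product by (simp add: mult_ac)
  show "integrable M (\<lambda>\<omega>. (x \<bullet> e \<omega> t)\<^sup>2)"
    unfolding sq by (intro Bochner_Integration.integrable_sum integrable_mult_right i t)
qed

text \<open>The range of a symmetric matrix is the orthogonal complement of its kernel. The normal
  equations of linear estimation can thus be solved even if the moment matrix of the observation is
  singular.\<close>

lemma in_range_symmetric_matrix:
  fixes G :: "real^'n^'n"
  assumes s: "transpose G = G" and k: "\<And>v. G *v v = 0 \<Longrightarrow> c \<bullet> v = 0"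
  shows "\<exists>a. G *v a = c"
proof -
  let ?f = "(*v) G"
  have l: "linear ?f" by simp
  have adj: "adjoint ?f = ?f" by (simp add: adjoint_matrix s)
  have "?f -` {0} = (range ?f)\<^sup>\<bottom>" using ker_orthogonal_comp_adjoint[OF l] unfolding adj .
  then have "c \<in> (range ?f)\<^sup>\<bottom>\<^sup>\<bottom>"
    using k by (auto simp: orthogonal_comp_def orthogonal_def inner_commute)
  also have "(range ?f)\<^sup>\<bottom>\<^sup>\<bottom> = range ?f"
    by (rule orthogonal_comp_self) (simp add: linear_subspace_image[OF l])
  finally show ?thesis by auto
qed

lemma block_diff:
  fixes a b :: "'a \<Rightarrow> nat \<Rightarrow> real^'k"
  assumes a: "block_square_integrable M n a" and b: "block_square_integrable M n b"
  shows "block_square_integrable M n (\<lambda>\<omega> t. a \<omega> t - b \<omega> t)"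
  unfolding block_square_integrable_def
proof (intro allI impI conjI)
  fix t i assume t: "t < n"
  have m: "(\<lambda>x. a x t $ i) \<in> borel_measurable M" "(\<lambda>x. b x t $ i) \<in> borel_measurable M"
    "integrable M (\<lambda>x. (a x t $ i)\<^sup>2)" "integrable M (\<lambda>x. (b x t $ i)\<^sup>2)"
    using a b t by (auto simp: block_square_integrable_def)
  show "(\<lambda>\<omega>. (a \<omega> t - b \<omega> t) $ i) \<in> borel_measurable M"
    unfolding vector_minus_component using m(1,2) by (rule borel_measurable_diff)
  have "integrable M (\<lambda>\<omega>. (a \<omega> t $ i)\<^sup>2 - 2 * (a \<omega> t $ i * b \<omega> t $ i) + (b \<omega> t $ i)\<^sup>2)"
    using m integrable_mult_of_squares[OF m] by simp
  then show "integrable M (\<lambda>\<omega>. ((a \<omega> t - b \<omega> t) $ i)\<^sup>2)"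
    by (simp add: power2_diff algebra_simps)
qed

lemma block_cong:
  assumes "\<And>\<omega> t. \<omega> \<in> space M \<Longrightarrow> t < n \<Longrightarrow> e \<omega> t = e' \<omega> t"
  shows "block_square_integrable M n e \<longleftrightarrow> block_square_integrable M n e'" "block_moment M n e = block_moment M n e'"
proof -
  have "((\<lambda>x. e x t $ i) \<in> borel_measurable M) = ((\<lambda>x. e' x t $ i) \<in> borel_measurable M)"
    "integrable M (\<lambda>x. (e x t $ i)\<^sup>2) = integrable M (\<lambda>x. (e' x t $ i)\<^sup>2)" if "t < n" for t i
    using assms that by (auto intro!: measurable_cong Bochner_Integration.integrable_cong)
  then show "block_square_integrable M n e \<longleftrightarrow> block_square_integrable M n e'"
    by (simp add: block_square_integrable_def)
  have "(\<integral>x. e x t $ i * e x t $ j \<partial>M) = (\<integral>x. e' x t $ i * e' x t $ j \<partial>M)" if "t < n" for t i j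
    using assms that by (intro Bochner_Integration.integral_cong) auto
  then show "block_moment M n e = block_moment M n e'" by (simp add: block_moment_def)
qed

text \<open>Carries moments from the space of the code to the space of the model. Measurability on
  the target is a hypothesis because it cannot be read off from the composition with
  \<open>g\<close>.\<close>

lemma block_distr_rev:
  fixes e :: "'b \<Rightarrow> nat \<Rightarrow> real^'k"
  assumes g[measurable]: "g \<in> M \<rightarrow>\<^sub>M N" and d: "distr M N g = N" and e: "block_square_integrable M n (\<lambda>x. e (g x))"
    and m: "\<And>t. t < n \<Longrightarrow> (\<lambda>x. e x t) \<in> borel_measurable N"
  shows "block_square_integrable N n e" and "block_moment N n e = block_moment M n (\<lambda>x. e (g x))"
proof -
  have mi: "(\<lambda>x. e x t $ i) \<in> borel_measurable N" if "t < n" for t i using m[OF that] by measurable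
  show b: "block_square_integrable N n e"
    unfolding block_square_integrable_def
  proof (intro allI impI conjI)
    fix t i assume t: "t < n"
    show "(\<lambda>x. e x t $ i) \<in> borel_measurable N" by (rule mi[OF t])
    have "integrable (distr M N g) (\<lambda>x. (e x t $ i)\<^sup>2)"
      by (rule iffD2[OF integrable_distr_eq[OF g]]) (use mi[OF t] e t in \<open>auto simp: block_square_integrable_def\<close>)
    then show "integrable N (\<lambda>x. (e x t $ i)\<^sup>2)" unfolding d .
  qed
  show "block_moment N n e = block_moment M n (\<lambda>x. e (g x))" using block_distr(2)[OF g d b] by simp
qed

lemma affine_nonneg_imp_zero:
  fixes a b :: real
  assumes "\<And>r. 0 \<le> a - 2 * r * b" shows "b = 0"
proof (rule ccontr)
  assume "b \<noteq> 0"
  then show False using assms[of "(a + 1) / (2 * b)"] by simp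
qed

text \<open>\<open>A\<close> is the matrix of the optimal linear estimator; shrinking it by the factor \<open>1 - sqrt \<epsilon>\<close>
  keeps the error covariance away from singularity.\<close>

lemma linear_estimator:
  fixes s :: "'a \<Rightarrow> nat \<Rightarrow> real^'k" and g :: "'a \<Rightarrow> nat \<Rightarrow> real^'j" and P :: "real^'k^'j"
  assumes n: "0 < n" and s: "block_square_integrable M n s" and g: "block_square_integrable M n g"
    and pd: "pos_def (block_moment M n s)" and D: "block_moment M n (\<lambda>\<omega> t. P *v s \<omega> t - g \<omega> t) \<preceq> D"
    and \<epsilon>: "0 < \<epsilon>" "\<epsilon> < 1"
  defines "Th B \<equiv> block_moment M n (\<lambda>\<omega> t. s \<omega> t - B *v g \<omega> t)"
  shows "\<exists>B. block_square_integrable M n (\<lambda>\<omega> t. s \<omega> t - B *v g \<omega> t) \<and> pos_def (Th B) \<and> Th B \<preceq> block_moment M n s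
    \<and> P ** Th B ** transpose P \<preceq> (1 - \<epsilon>) *\<^sub>R D + \<epsilon> *\<^sub>R (P ** block_moment M n s ** transpose P)"
proof -
  define S where "S = block_moment M n s"
  define G where "G = block_moment M n g"
  define C :: "real^'j^'k" where "C = (\<chi> i j. (1 / real n) * (\<Sum>t<n. \<integral>\<omega>. s \<omega> t $ i * g \<omega> t $ j \<partial>M))"
  note si = block_square_integrable_inner[OF s] and gi = block_square_integrable_inner[OF g]
  have sgi: "integrable M (\<lambda>\<omega>. (x \<bullet> s \<omega> t) * (y \<bullet> g \<omega> t))" if "t < n" for t x y
    by (rule integrable_mult_of_squares) (use si gi that in auto)
  have cross: "(1 / real n) * (\<Sum>t<n. \<integral>\<omega>. (x \<bullet> s \<omega> t) * (y \<bullet> g \<omega> t) \<partial>M) = x \<bullet> (C *v y)" for x y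
  proof -
    have ij: "integrable M (\<lambda>\<omega>. s \<omega> t $ i * g \<omega> t $ j)" if "t < n" for t i j
      using sgi[OF that, of "axis i 1" "axis j 1"] by (simp add: inner_axis')
    have e: "(x \<bullet> a) * (y \<bullet> b) = (\<Sum>i\<in>UNIV. \<Sum>j\<in>UNIV. x $ i * y $ j * (a $ i * b $ j))" for a b
      unfolding inner_vec_def sum_product by (simp add: mult_ac)
    have "(\<Sum>t<n. \<integral>\<omega>. (x \<bullet> s \<omega> t) * (y \<bullet> g \<omega> t) \<partial>M) = (\<Sum>t<n. \<Sum>i\<in>UNIV. \<Sum>j\<in>UNIV. x $ i * y $ j * (\<integral>\<omega>. s \<omega> t $ i * g \<omega> t $ j \<partial>M))"
      unfolding e
      by (intro sum.cong refl, subst Bochner_Integration.integral_sum, (intro Bochner_Integration.integrable_sum integrable_mult_right ij, simp),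
        intro sum.cong refl, subst Bochner_Integration.integral_sum, (intro integrable_mult_right ij, simp), simp)
    also have "\<dots> = (\<Sum>i\<in>UNIV. \<Sum>j\<in>UNIV. x $ i * y $ j * (\<Sum>t<n. \<integral>\<omega>. s \<omega> t $ i * g \<omega> t $ j \<partial>M))"
      unfolding sum_distrib_left by (subst sum.swap, intro sum.cong refl, rule sum.swap)
    finally show ?thesis by (simp add: inner_matrix_vector_sum C_def sum_distrib_left mult_ac)
  qed
  \<comment> \<open>The mean squared error of estimating the functional x of the source by the
    functional y of the observation. All matrix inequalities below are read off from this form for
    suitable x and y.\<close>
  have F: "(1 / real n) * (\<Sum>t<n. \<integral>\<omega>. (x \<bullet> s \<omega> t - y \<bullet> g \<omega> t)\<^sup>2 \<partial>M) = x \<bullet> (S *v x) - 2 * (x \<bullet> (C *v y)) + y \<bullet> (G *v y)" for x y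
  proof -
    have "(\<integral>\<omega>. (x \<bullet> s \<omega> t - y \<bullet> g \<omega> t)\<^sup>2 \<partial>M) = (\<integral>\<omega>. (x \<bullet> s \<omega> t)\<^sup>2 \<partial>M) - 2 * (\<integral>\<omega>. (x \<bullet> s \<omega> t) * (y \<bullet> g \<omega> t) \<partial>M) + (\<integral>\<omega>. (y \<bullet> g \<omega> t)\<^sup>2 \<partial>M)" if "t < n" for t
    proof -
      have "(\<integral>\<omega>. (x \<bullet> s \<omega> t - y \<bullet> g \<omega> t)\<^sup>2 \<partial>M) = (\<integral>\<omega>. (x \<bullet> s \<omega> t)\<^sup>2 - 2 * ((x \<bullet> s \<omega> t) * (y \<bullet> g \<omega> t)) + (y \<bullet> g \<omega> t)\<^sup>2 \<partial>M)"
        by (simp add: power2_diff algebra_simps)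
      then show ?thesis using si[OF that] gi[OF that] sgi[OF that] by simp
    qed
    then have "(\<Sum>t<n. \<integral>\<omega>. (x \<bullet> s \<omega> t - y \<bullet> g \<omega> t)\<^sup>2 \<partial>M)
      = (\<Sum>t<n. \<integral>\<omega>. (x \<bullet> s \<omega> t)\<^sup>2 \<partial>M) - 2 * (\<Sum>t<n. \<integral>\<omega>. (x \<bullet> s \<omega> t) * (y \<bullet> g \<omega> t) \<partial>M) + (\<Sum>t<n. \<integral>\<omega>. (y \<bullet> g \<omega> t)\<^sup>2 \<partial>M)"
      by (simp add: sum.distrib sum_subtractf sum_distrib_left)
    then show ?thesis
      unfolding S_def G_def block_moment_form[OF s] block_moment_form[OF g] cross[symmetric]
      by (simp add: diff_divide_distrib add_divide_distrib)
  qed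
  have F0: "0 \<le> x \<bullet> (S *v x) - 2 * (x \<bullet> (C *v y)) + y \<bullet> (G *v y)" for x y
    unfolding F[symmetric] by (intro mult_nonneg_nonneg sum_nonneg integral_nonneg_AE) auto
  have Gs: "transpose G = G" by (simp add: G_def block_moment_symmetric)
  \<comment> \<open>The normal equations. On a kernel vector of \<open>G\<close> the error form is
    affine in the scale \<open>r\<close>, and being nonnegative it must have slope 0.\<close>
  have "\<exists>a. G *v a = C $ i" for i
  proof (rule in_range_symmetric_matrix[OF Gs])
    fix v assume v: "G *v v = 0"
    have Cv: "axis i 1 \<bullet> (C *v y) = C $ i \<bullet> y" for y
    proof -
      have "axis i 1 \<bullet> (C *v y) = (C *v y) $ i" by (simp add: inner_axis')
      also have "\<dots> = C $ i \<bullet> y" by (simp add: matrix_vector_mult_def inner_vec_def)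
      finally show ?thesis .
    qed
    show "C $ i \<bullet> v = 0"
    proof (rule affine_nonneg_imp_zero)
      fix r
      show "0 \<le> axis i 1 \<bullet> (S *v axis i 1) - 2 * r * (C $ i \<bullet> v)"
        using F0[of "axis i 1" "r *\<^sub>R v"] unfolding Cv by (simp add: v matrix_vector_mult_scaleR mult.assoc)
    qed
  qed
  then obtain a where a: "\<And>i. G *v a i = C $ i" by metis
  define A :: "real^'j^'k" where "A = (\<chi> i. a i)"
  have CA: "x \<bullet> (C *v y) = (transpose A *v x) \<bullet> (G *v y)" for x y
  proof -
    have "(C *v y) $ i = (A *v (G *v y)) $ i" for i
    proof -
      have "(C *v y) $ i = (G *v a i) \<bullet> y" unfolding a by (simp add: matrix_vector_mult_def inner_vec_def)
      also have "\<dots> = a i \<bullet> (G *v y)" by (metis Gs inner_matrix_vector)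
      also have "\<dots> = A $ i \<bullet> (G *v y)" by (simp add: A_def)
      also have "\<dots> = (A *v (G *v y)) $ i" unfolding matrix_vector_mult_def[of A] by (simp add: inner_vec_def)
      finally show ?thesis .
    qed
    then have "C *v y = A *v (G *v y)" by (simp add: vec_eq_iff)
    then show ?thesis by (simp only: inner_matrix_vector)
  qed
  have Gp: "0 \<le> y \<bullet> (G *v y)" for y
    using block_moment_pos_semidef[OF g] by (simp add: G_def pos_semidef_def)
  \<comment> \<open>Scaling the optimal estimator by \<open>c\<close> keeps the fraction 2 c - c^2
    of its error reduction \<open>w\<close>; this \<open>c\<close> makes the fraction
    \<open>1 - \<epsilon>\<close>.\<close>
  define c where "c = 1 - sqrt \<epsilon>"
  have c: "2 * c - c\<^sup>2 = 1 - \<epsilon>"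
    using \<epsilon> by (simp add: c_def power2_diff)
  define B where "B = c *\<^sub>R A"
  define w where "w x = (transpose A *v x) \<bullet> (G *v (transpose A *v x))" for x
  have Bx: "transpose B *v x = c *\<^sub>R (transpose A *v x)" for x
    by (simp add: B_def transpose_def vec_eq_iff matrix_vector_mult_def sum_distrib_left mult.assoc)
  have bsi: "block_square_integrable M n (\<lambda>\<omega> t. s \<omega> t - B *v g \<omega> t)"
    by (intro block_diff s block_linear_image g)
  have ThB: "x \<bullet> (Th B *v x) = x \<bullet> (S *v x) - (1 - \<epsilon>) * w x" for x
  proof -
    have "x \<bullet> (Th B *v x) = (1 / real n) * (\<Sum>t<n. \<integral>\<omega>. (x \<bullet> s \<omega> t - (transpose B *v x) \<bullet> g \<omega> t)\<^sup>2 \<partial>M)"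
      unfolding Th_def block_moment_form[OF bsi] by (simp only: inner_diff_right inner_matrix_vector)
    also have "\<dots> = x \<bullet> (S *v x) - (2 * c - c\<^sup>2) * w x"
      unfolding F CA Bx w_def by (simp add: matrix_vector_mult_scaleR power2_eq_square algebra_simps del: transpose_matrix_vector)
    finally show ?thesis unfolding c .
  qed
  have w_le: "w x \<le> x \<bullet> (S *v x)" for x
    using F0[of x "transpose A *v x"] by (simp add: CA w_def del: transpose_matrix_vector)
  have w0: "0 \<le> w x" for x unfolding w_def by (rule Gp)
  have sS: "transpose S = S" and sT: "transpose (Th B) = Th B" by (simp_all add: S_def Th_def block_moment_symmetric)
  have "pos_def (Th B)"
    unfolding pos_def_def
  proof (intro conjI allI impI sT)
    fix x :: "real^'k" assume "x \<noteq> 0"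
    then have "0 < x \<bullet> (S *v x)" using pd by (simp add: S_def pos_def_def)
    then have "0 < \<epsilon> * (x \<bullet> (S *v x))" using \<epsilon> by simp
    moreover have "(1 - \<epsilon>) * w x \<le> (1 - \<epsilon>) * (x \<bullet> (S *v x))" using \<epsilon> w_le by (intro mult_left_mono) auto
    ultimately show "0 < x \<bullet> (Th B *v x)" unfolding ThB by (simp add: algebra_simps)
  qed
  moreover have "Th B \<preceq> S"
    unfolding loewner_le_def pos_semidef_def
    using \<epsilon> w0 by (auto simp: transpose_diff sS sT matrix_vector_mult_diff_rdistrib inner_diff_right ThB)
  moreover have "P ** Th B ** transpose P \<preceq> (1 - \<epsilon>) *\<^sub>R D + \<epsilon> *\<^sub>R (P ** S ** transpose P)"
  proof -
    let ?D = "block_moment M n (\<lambda>\<omega> t. P *v s \<omega> t - g \<omega> t)"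
    have bd: "block_square_integrable M n (\<lambda>\<omega> t. P *v s \<omega> t - g \<omega> t)"
      by (intro block_diff block_linear_image s g)
    have sD: "transpose D = D"
    proof -
      have "transpose (D - ?D) = D - ?D" using D by (simp add: loewner_le_def pos_semidef_def)
      then show ?thesis by (simp add: transpose_diff block_moment_symmetric)
    qed
    have tP: "transpose (P ** X ** transpose P) = P ** X ** transpose P" if "transpose X = X" for X :: "real^'k^'k"
      by (simp add: matrix_transpose_mul that matrix_mul_assoc)
    have fP: "y \<bullet> (P ** X ** transpose P *v y) = (transpose P *v y) \<bullet> (X *v (transpose P *v y))" for X :: "real^'k^'k" and y
      unfolding matrix_vector_mul_assoc[symmetric] inner_matrix_vector ..
    have ts: "transpose (r *\<^sub>R X) = r *\<^sub>R transpose X" for r and X :: "real^'j^'j" by (simp add: transpose_def vec_eq_iff)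
    have sc: "(r *\<^sub>R X) *v y = r *\<^sub>R (X *v y)" for r and X :: "real^'j^'j" and y
      by (simp add: scaleR_matrix_vector_assoc)
    have main: "y \<bullet> (P ** Th B ** transpose P *v y) \<le> (1 - \<epsilon>) * (y \<bullet> (D *v y)) + \<epsilon> * (y \<bullet> (P ** S ** transpose P *v y))" for y
    proof -
      define x where "x = transpose P *v y"
      have "0 \<le> y \<bullet> ((D - ?D) *v y)" using D by (simp add: loewner_le_def pos_semidef_def)
      then have "y \<bullet> (?D *v y) \<le> y \<bullet> (D *v y)" by (simp add: matrix_vector_mult_diff_rdistrib inner_diff_right)
      moreover have "y \<bullet> (?D *v y) = x \<bullet> (S *v x) - 2 * (x \<bullet> (C *v y)) + y \<bullet> (G *v y)"
      proof -
        have "y \<bullet> (P *v a) = x \<bullet> a" for a unfolding x_def by (rule inner_matrix_vector)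
        then show ?thesis unfolding block_moment_form[OF bd] inner_diff_right by (simp only: F)
      qed
      \<comment> \<open>Optimality by completing the square: the decoder output itself is one linear
        estimator, so its error is no smaller than that of the optimal one.\<close>
      moreover have "x \<bullet> (S *v x) - w x \<le> x \<bullet> (S *v x) - 2 * (x \<bullet> (C *v y)) + y \<bullet> (G *v y)"
      proof -
        let ?z = "transpose A *v x"
        have "0 \<le> (?z - y) \<bullet> (G *v (?z - y))" by (rule Gp)
        moreover have "y \<bullet> (G *v ?z) = ?z \<bullet> (G *v y)" by (metis Gs inner_commute inner_matrix_vector)
        ultimately show ?thesis
          unfolding CA w_def by (simp add: matrix_vector_mult_diff_distrib inner_diff_left inner_diff_right del: transpose_matrix_vector)
      qed
      ultimately have "(1 - \<epsilon>) * (x \<bullet> (S *v x) - w x) \<le> (1 - \<epsilon>) * (y \<bullet> (D *v y))"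
        using \<epsilon> by (intro mult_left_mono) auto
      then show ?thesis unfolding fP x_def[symmetric] ThB by (simp add: algebra_simps)
    qed
    show ?thesis
      unfolding loewner_le_def pos_semidef_def
      using main by (auto simp: transpose_diff transpose_add ts sD tP[OF sT] tP[OF sS] matrix_vector_mult_diff_rdistrib matrix_vector_mult_add_rdistrib
        inner_diff_right inner_add_right sc)
  qed
  ultimately show ?thesis using bsi by (auto simp: S_def)
qed

text \<open>The constraint gives integrability only of sums over letters. On the diagonal these are
  sums of squares and dominate each single square; the mixed products then follow.\<close>

lemma distortion_block:
  fixes S :: "nat \<Rightarrow> 'w \<Rightarrow> real^'m"
  assumes n: "0 < n" and d: "distortion_le M n S S' D"
    and m: "\<And>t. t < n \<Longrightarrow> (\<lambda>\<omega>. S t \<omega> - S' \<omega> t) \<in> borel_measurable M"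
  shows "block_square_integrable M n (\<lambda>\<omega> t. S t \<omega> - S' \<omega> t)" "block_moment M n (\<lambda>\<omega> t. S t \<omega> - S' \<omega> t) \<preceq> D"
proof -
  have m'[measurable]: "(\<lambda>\<omega>. (S t \<omega> - S' \<omega> t) $ i) \<in> borel_measurable M" if "t < n" for t i
    using m[OF that] by measurable
  show b: "block_square_integrable M n (\<lambda>\<omega> t. S t \<omega> - S' \<omega> t)"
    unfolding block_square_integrable_def
  proof (intro allI impI conjI m')
    fix t i assume t: "t < n"
    have "integrable M (\<lambda>\<omega>. \<Sum>t<n. (S t \<omega> - S' \<omega> t) $ i * (S t \<omega> - S' \<omega> t) $ i)"
      using d unfolding distortion_le_def by blast
    then show "integrable M (\<lambda>\<omega>. ((S t \<omega> - S' \<omega> t) $ i)\<^sup>2)"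
    proof (rule Bochner_Integration.integrable_bound)
      show "AE \<omega> in M. norm (((S t \<omega> - S' \<omega> t) $ i)\<^sup>2) \<le> norm (\<Sum>t<n. (S t \<omega> - S' \<omega> t) $ i * (S t \<omega> - S' \<omega> t) $ i)"
      proof (rule AE_I2)
        fix \<omega>
        have "((S t \<omega> - S' \<omega> t) $ i)\<^sup>2 \<le> (\<Sum>t<n. (S t \<omega> - S' \<omega> t) $ i * (S t \<omega> - S' \<omega> t) $ i)"
          unfolding power2_eq_square using t by (intro member_le_sum) auto
        then show "norm (((S t \<omega> - S' \<omega> t) $ i)\<^sup>2) \<le> norm (\<Sum>t<n. (S t \<omega> - S' \<omega> t) $ i * (S t \<omega> - S' \<omega> t) $ i)" by simp
      qed
      show "(\<lambda>\<omega>. ((S t \<omega> - S' \<omega> t) $ i)\<^sup>2) \<in> borel_measurable M" using m'[OF t] by measurable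
    qed
  qed
  have "(\<integral>\<omega>. (\<Sum>t<n. (S t \<omega> - S' \<omega> t) $ i * (S t \<omega> - S' \<omega> t) $ j) \<partial>M) = (\<Sum>t<n. \<integral>\<omega>. (S t \<omega> - S' \<omega> t) $ i * (S t \<omega> - S' \<omega> t) $ j \<partial>M)" for i j
    by (rule Bochner_Integration.integral_sum) (use block_square_integrable_mult[OF b] in auto)
  then show "block_moment M n (\<lambda>\<omega> t. S t \<omega> - S' \<omega> t) \<preceq> D"
    using d by (simp add: distortion_le_def block_moment_def)
qed

subsection \<open>The bound for a single code\<close>

definition proj_left :: "real^('a::finite + 'b::finite)^'a" where
  "proj_left = (\<chi> i k. if k = Inl i then 1 else 0)"

definition proj_right :: "real^('a::finite + 'b::finite)^'b" where
  "proj_right = (\<chi> j k. if k = Inr j then 1 else 0)"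

lemma proj_left_mult: "proj_left *v x = (\<chi> i. x $ Inl i)"
  by (simp add: proj_left_def matrix_vector_mult_def vec_eq_iff if_distrib[where f="\<lambda>y. y * _"] cong: if_cong)

lemma proj_right_mult: "proj_right *v x = (\<chi> i. x $ Inr i)"
  by (simp add: proj_right_def matrix_vector_mult_def vec_eq_iff if_distrib[where f="\<lambda>y. y * _"] cong: if_cong)

lemma proj_left_stack [simp]: "proj_left *v stack x y = x"
  and proj_right_stack [simp]: "proj_right *v stack x y = y"
  by (simp_all add: proj_left_mult proj_right_mult stack_def vec_eq_iff)

text \<open>Blocks written as congruences: in this form the estimation lemma with
  \<open>P = proj_left\<close> and the matrix \<open>QK\<close> with \<open>P = proj_right\<close>
  deliver them.\<close>

lemma proj_left_conj: "proj_left ** A ** transpose proj_left = upper_left A"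
  by (simp add: proj_left_def matrix_matrix_mult_def transpose_def upper_left_def vec_eq_iff
     if_distrib[where f="\<lambda>y. y * _"] if_distrib[where f="\<lambda>y. _ * y"] cong: if_cong)

lemma proj_right_conj: "proj_right ** A ** transpose proj_right = lower_right A"
  by (simp add: proj_right_def matrix_matrix_mult_def transpose_def lower_right_def vec_eq_iff
     if_distrib[where f="\<lambda>y. y * _"] if_distrib[where f="\<lambda>y. _ * y"] cong: if_cong)

lemma stack_measurable [measurable (raw)]:
  fixes f :: "'x \<Rightarrow> real^'a" and g :: "'x \<Rightarrow> real^'b"
  assumes [measurable]: "f \<in> borel_measurable M" "g \<in> borel_measurable M"
  shows "(\<lambda>x. stack (f x) (g x)) \<in> borel_measurable M"
  unfolding stack_def
proof (rule borel_measurable_vec_lambda)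
  fix k :: "'a + 'b"
  show "(\<lambda>x. case k of Inl i \<Rightarrow> f x $ i | Inr j \<Rightarrow> g x $ j) \<in> borel_measurable M"
    by (cases k) auto
qed

lemma block_coord: "t < n \<Longrightarrow> block n S \<omega> t = S t \<omega>"
  by (simp add: block_def)

section \<open>Laws of the source and noise blocks\<close>

context gaussian_broadcast
begin

definition source :: "nat \<Rightarrow> 'w \<Rightarrow> real^('m1 + 'm2)" where
  "source t \<omega> = stack (S1 t \<omega>) (S2 t \<omega>)"

lemma letter_measurable: "(\<lambda>\<omega>. (S1 t \<omega>, S2 t \<omega>, Z1 t \<omega>, Z2 t \<omega>)) \<in> borel_measurable M"
  using indep_over_time by (auto simp: indep_vars_def)

lemma variables_measurable [measurable]:
  "S1 t \<in> borel_measurable M" "S2 t \<in> borel_measurable M" "Z1 t \<in> borel_measurable M" "Z2 t \<in> borel_measurable M"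
proof -
  let ?B = "borel \<Otimes>\<^sub>M (borel \<Otimes>\<^sub>M (borel \<Otimes>\<^sub>M borel)) :: ((real^'m1) \<times> (real^'m2) \<times> real \<times> real) measure"
  have "(\<lambda>p. fst p) \<in> borel_measurable ?B" "(\<lambda>p. fst (snd p)) \<in> borel_measurable ?B"
    "(\<lambda>p. fst (snd (snd p))) \<in> borel_measurable ?B" "(\<lambda>p. snd (snd (snd p))) \<in> borel_measurable ?B"
    by measurable
  note this[unfolded borel_prod, THEN measurable_compose[OF letter_measurable[of t]]]
  then show "S1 t \<in> borel_measurable M" "S2 t \<in> borel_measurable M" "Z1 t \<in> borel_measurable M" "Z2 t \<in> borel_measurable M"
    by simp_all
qed

lemma source_measurable [measurable]: "source t \<in> borel_measurable M"
  unfolding source_def[abs_def] by measurable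

lemma source_law:
  assumes "pos_def \<Sigma>"
  shows "distr M borel (source t) = gauss_measure \<Sigma>"
    "integrable M (\<lambda>\<omega>. source t \<omega> $ i * source t \<omega> $ j)" "(\<integral>\<omega>. source t \<omega> $ i * source t \<omega> $ j \<partial>M) = \<Sigma> $ i $ j"
  using gaussian_vec_distr[OF prob_space_axioms source_gaussian[of t] source_mean source_cov assms]
  by (simp_all add: source_def[abs_def])

lemma cov_matrix_S2: "cov_matrix M (S2 t) = lower_right \<Sigma>"
proof -
  have "mean_vec M (S2 t) $ j = mean_vec M (\<lambda>\<omega>. stack (S1 t \<omega>) (S2 t \<omega>)) $ Inr j" for j
    by (simp add: mean_vec_def stack_def)
  then show ?thesis
    unfolding source_cov[of t, symmetric] by (simp add: cov_matrix_def lower_right_def vec_eq_iff stack_def)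
qed

text \<open>The function \<open>h\<close> selects one of the two noises. Independence is given for
  generated sigma-algebras, so the events of the source and of the noise have to be exhibited there;
  agreement on rectangles then determines the joint law.\<close>

lemma source_noise_law:
  assumes pd: "pos_def \<Sigma>" and N: "0 < N" and Z: "Z t = (\<lambda>\<omega>. h (Z1 t \<omega>, Z2 t \<omega>))" "h \<in> borel_measurable borel"
    and d: "distributed M lborel (Z t) (normal_density 0 (sqrt N))"
  shows "distr M borel (\<lambda>\<omega>. (source t \<omega>, Z t \<omega>)) = gauss_measure \<Sigma> \<Otimes>\<^sub>M noise N"
proof (rule pair_measure_eqI[symmetric])
  show "sigma_finite_measure (gauss_measure \<Sigma>)" "sigma_finite_measure (noise N)"
    by (intro prob_space_imp_sigma_finite prob_space_gauss_measure prob_space_normal_density pd; simp add: N)+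
  have "sets (gauss_measure \<Sigma> \<Otimes>\<^sub>M noise N) = sets (borel \<Otimes>\<^sub>M borel)" by (rule sets_pair_measure_cong) auto
  then show "sets (gauss_measure \<Sigma> \<Otimes>\<^sub>M noise N) = sets (distr M borel (\<lambda>\<omega>. (source t \<omega>, Z t \<omega>)))"
    by (simp only: sets_distr borel_prod)
  fix A B assume "A \<in> sets (gauss_measure \<Sigma>)" "B \<in> sets (noise N)"
  then have A[measurable]: "A \<in> sets borel" and B[measurable]: "B \<in> sets borel" by simp_all
  note h[measurable] = Z(2)
  have Zm[measurable]: "Z t \<in> borel_measurable M" unfolding Z(1) by measurable
  have EA: "{\<omega>\<in>space M. source t \<omega> \<in> A} \<in> sets (vimage_algebra (space M) (\<lambda>\<omega>. (S1 t \<omega>, S2 t \<omega>)) borel)"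
  proof -
    have "(\<lambda>p. stack (fst p) (snd p)) \<in> (borel \<Otimes>\<^sub>M borel) \<rightarrow>\<^sub>M (borel :: (real^('m1+'m2)) measure)" by measurable
    then have m: "(\<lambda>p. stack (fst p) (snd p)) \<in> borel \<rightarrow>\<^sub>M (borel :: (real^('m1+'m2)) measure)" by (simp only: borel_prod)
    have "(\<lambda>p. stack (fst p) (snd p)) -` A \<in> sets borel" using measurable_sets[OF m A] by simp
    then have "(\<lambda>\<omega>. (S1 t \<omega>, S2 t \<omega>)) -` ((\<lambda>p. stack (fst p) (snd p)) -` A) \<inter> space M \<in> sets (vimage_algebra (space M) (\<lambda>\<omega>. (S1 t \<omega>, S2 t \<omega>)) borel)"
      by (rule in_vimage_algebra)
    also have "(\<lambda>\<omega>. (S1 t \<omega>, S2 t \<omega>)) -` ((\<lambda>p. stack (fst p) (snd p)) -` A) \<inter> space M = {\<omega>\<in>space M. source t \<omega> \<in> A}"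
      by (auto simp: source_def)
    finally show ?thesis .
  qed
  have EB: "{\<omega>\<in>space M. Z t \<omega> \<in> B} \<in> sets (vimage_algebra (space M) (\<lambda>\<omega>. (Z1 t \<omega>, Z2 t \<omega>)) borel)"
  proof -
    have "h -` B \<in> sets borel" using measurable_sets[OF h B] by simp
    then have "(\<lambda>\<omega>. (Z1 t \<omega>, Z2 t \<omega>)) -` (h -` B) \<inter> space M \<in> sets (vimage_algebra (space M) (\<lambda>\<omega>. (Z1 t \<omega>, Z2 t \<omega>)) borel)"
      by (rule in_vimage_algebra)
    also have "(\<lambda>\<omega>. (Z1 t \<omega>, Z2 t \<omega>)) -` (h -` B) \<inter> space M = {\<omega>\<in>space M. Z t \<omega> \<in> B}" by (auto simp: Z(1))
    finally show ?thesis .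
  qed
  have "emeasure (gauss_measure \<Sigma>) A = emeasure M {\<omega>\<in>space M. source t \<omega> \<in> A}"
    unfolding source_law(1)[OF pd, of t, symmetric] by (subst emeasure_distr) (auto intro!: arg_cong[where f="emeasure M"])
  moreover have "emeasure (noise N) B = emeasure M {\<omega>\<in>space M. Z t \<omega> \<in> B}"
  proof -
    have dd: "noise N = distr M lborel (Z t)" using d by (simp add: distributed_def)
    show ?thesis unfolding dd by (subst emeasure_distr) (auto intro!: arg_cong[where f="emeasure M"])
  qed
  moreover have "prob ({\<omega>\<in>space M. Z t \<omega> \<in> B} \<inter> {\<omega>\<in>space M. source t \<omega> \<in> A}) = prob {\<omega>\<in>space M. Z t \<omega> \<in> B} * prob {\<omega>\<in>space M. source t \<omega> \<in> A}"
    by (rule indep_setD[OF noise_indep_source EB EA])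
  moreover have "emeasure (distr M borel (\<lambda>\<omega>. (source t \<omega>, Z t \<omega>))) (A \<times> B) = emeasure M ({\<omega>\<in>space M. Z t \<omega> \<in> B} \<inter> {\<omega>\<in>space M. source t \<omega> \<in> A})"
  proof (subst emeasure_distr)
    show "(\<lambda>\<omega>. (source t \<omega>, Z t \<omega>)) \<in> borel_measurable M" by measurable
    show "A \<times> B \<in> sets borel" unfolding borel_prod[symmetric] by (intro pair_measureI A B)
  qed (auto intro!: arg_cong[where f="emeasure M"])
  ultimately show "emeasure (gauss_measure \<Sigma>) A * emeasure (noise N) B = emeasure (distr M borel (\<lambda>\<omega>. (source t \<omega>, Z t \<omega>))) (A \<times> B)"
    by (simp add: emeasure_eq_measure ennreal_mult mult.commute)
qed

text \<open>The source together with the noise of one receiver at a time. No joint law of the two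
  noises is asserted, and the error constraints of a code require none.\<close>

lemma source_noise_block_law:
  fixes Z :: "nat \<Rightarrow> 'w \<Rightarrow> real"
  assumes pd: "pos_def \<Sigma>" and N: "0 < N" and Z: "\<And>t. Z t = (\<lambda>\<omega>. h (Z1 t \<omega>, Z2 t \<omega>))" and h: "h \<in> borel_measurable borel"
    and d: "\<And>t. distributed M lborel (Z t) (normal_density 0 (sqrt N))" and n: "0 < n"
  shows "(\<lambda>\<omega>. (block n source \<omega>, block n Z \<omega>)) \<in> M \<rightarrow>\<^sub>M block_measure n (gauss_measure \<Sigma>) \<Otimes>\<^sub>M block_measure n (noise N)"
    "distr M (block_measure n (gauss_measure \<Sigma>) \<Otimes>\<^sub>M block_measure n (noise N)) (\<lambda>\<omega>. (block n source \<omega>, block n Z \<omega>))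
      = block_measure n (gauss_measure \<Sigma>) \<Otimes>\<^sub>M block_measure n (noise N)"
proof -
  let ?\<phi> = "\<lambda>p :: (real^'m1) \<times> (real^'m2) \<times> real \<times> real. (stack (fst p) (fst (snd p)), h (snd (snd p)))"
  note [measurable] = h
  have hh: "h \<in> (borel \<Otimes>\<^sub>M borel) \<rightarrow>\<^sub>M borel" using h by (simp only: borel_prod)
  have "(\<lambda>p. h (snd (snd p))) \<in> borel_measurable (borel \<Otimes>\<^sub>M (borel \<Otimes>\<^sub>M (borel \<Otimes>\<^sub>M borel)))"
    by (rule measurable_compose[OF _ hh]) measurable
  then have "?\<phi> \<in> (borel \<Otimes>\<^sub>M (borel \<Otimes>\<^sub>M (borel \<Otimes>\<^sub>M borel))) \<rightarrow>\<^sub>M (borel \<Otimes>\<^sub>M borel)" by measurable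
  then have \<phi>: "?\<phi> \<in> borel \<rightarrow>\<^sub>M borel" by (simp only: borel_prod)
  have "indep_vars (\<lambda>_. borel) (\<lambda>t \<omega>. ?\<phi> (S1 t \<omega>, S2 t \<omega>, Z1 t \<omega>, Z2 t \<omega>)) UNIV"
    by (rule indep_vars_compose2[OF indep_over_time]) (rule \<phi>)
  then have ind: "indep_vars (\<lambda>_. borel) (\<lambda>t \<omega>. (source t \<omega>, Z t \<omega>)) UNIV"
    by (simp add: source_def Z)
  have law: "distr M borel (\<lambda>\<omega>. (source t \<omega>, Z t \<omega>)) = gauss_measure \<Sigma> \<Otimes>\<^sub>M noise N" for t
    by (rule source_noise_law[OF pd N Z h d])
  have ps: "prob_space (gauss_measure \<Sigma>)" "prob_space (noise N)"
    by (intro prob_space_gauss_measure prob_space_normal_density pd; simp add: N)+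
  show "(\<lambda>\<omega>. (block n source \<omega>, block n Z \<omega>)) \<in> M \<rightarrow>\<^sub>M block_measure n (gauss_measure \<Sigma>) \<Otimes>\<^sub>M block_measure n (noise N)"
    "distr M (block_measure n (gauss_measure \<Sigma>) \<Otimes>\<^sub>M block_measure n (noise N)) (\<lambda>\<omega>. (block n source \<omega>, block n Z \<omega>))
      = block_measure n (gauss_measure \<Sigma>) \<Otimes>\<^sub>M block_measure n (noise N)"
    using distr_blocks_independent[OF ind law ps _ _ n] by auto
qed

end

text \<open>For \<open>lam = \<alpha> / (\<alpha> + \<beta>)\<close> both quotients equal
  \<open>\<alpha> + \<beta>\<close>, so the weighted mean of logarithms collapses to a single one.
  It is the weight that maximises the left side.\<close>

lemma weighted_log_bound:
  fixes \<alpha> \<beta> q :: real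
  assumes "0 < \<alpha>" "0 < \<beta>" "0 < q"
    and "\<And>lam. 0 < lam \<Longrightarrow> lam < 1 \<Longrightarrow> lam * ln (\<alpha> / lam) + (1 - lam) * ln (\<beta> / (1 - lam)) \<le> ln q"
  shows "\<alpha> + \<beta> \<le> q"
proof -
  define lam where "lam = \<alpha> / (\<alpha> + \<beta>)"
  have lam: "0 < lam" "lam < 1" and e: "\<alpha> / lam = \<alpha> + \<beta>" "1 - lam = \<beta> / (\<alpha> + \<beta>)"
    using assms(1,2) by (auto simp: lam_def field_simps)
  have "\<beta> / (1 - lam) = \<alpha> + \<beta>" using assms(1,2) unfolding e(2) by (simp add: field_simps)
  with assms(4)[OF lam] e(1) have "ln (\<alpha> + \<beta>) \<le> ln q" by (simp add: algebra_simps)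
  then show ?thesis using assms(1-3) by simp
qed

lemma loewner_le_add_right: "A \<preceq> B \<Longrightarrow> A + K \<preceq> B + K"
  by (simp add: loewner_le_def)

lemma pos_semidef_of_loewner_le:
  assumes "pos_semidef A" "A \<preceq> B" shows "pos_semidef B"
proof -
  have "transpose (B - A) = B - A" "transpose A = A" using assms by (auto simp: loewner_le_def pos_semidef_def)
  then have t: "transpose B = B" by (simp add: transpose_diff)
  have "0 \<le> x \<bullet> (B *v x)" for x
  proof -
    have "0 \<le> x \<bullet> ((B - A) *v x)" "0 \<le> x \<bullet> (A *v x)" using assms by (auto simp: loewner_le_def pos_semidef_def)
    then show ?thesis by (simp add: matrix_vector_mult_diff_rdistrib inner_diff_right)
  qed
  with t show ?thesis by (simp add: pos_semidef_def)
qed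

section \<open>From a code to the model inequality\<close>

context gaussian_broadcast
begin

text \<open>\<open>Th\<close> is fixed by the code and \<open>\<epsilon>\<close> alone, and the
  inequality then holds for every \<open>K\<close>; this order of choices matches an infimum over
  \<open>\<Theta>\<close> outside the supremum. \<open>Th\<close> is the error covariance of the
  shrunken linear estimate of the whole source from the output of the first decoder.\<close>

lemma code_bound:
  assumes N: "0 < N1" "N1 < N2" and pd: "pos_def \<Sigma>" and n: "0 < n" and \<epsilon>: "0 < \<epsilon>" "\<epsilon> < 1"
    and code: "broadcast_code M S1 S2 Z1 Z2 n Pw D1 D2 f g1 g2"
  obtains Th where "pos_def Th" "Th \<preceq> \<Sigma>" "upper_left Th \<preceq> (1 - \<epsilon>) *\<^sub>R D1 + \<epsilon> *\<^sub>R upper_left \<Sigma>"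
    and "\<And>K. pos_def K \<Longrightarrow> N1 * det \<Sigma> * det (lower_right Th + K) / det Th + (N2 - N1) * det (lower_right \<Sigma> + K) \<le> (Pw + N2) * det (D2 + K)"
    and "0 \<le> Pw" "pos_semidef D2"
proof -
  define X where "X = channel_input n S1 S2 f"
  define Y1 Y2 where "Y1 = channel_output n X Z1" and "Y2 = channel_output n X Z2"
  have f: "f \<in> blocks n \<Otimes>\<^sub>M blocks n \<rightarrow>\<^sub>M blocks n" and g1: "g1 \<in> blocks n \<rightarrow>\<^sub>M blocks n" and g2: "g2 \<in> blocks n \<rightarrow>\<^sub>M blocks n"
    and pw: "power_le M n X Pw" and d1: "distortion_le M n S1 (\<lambda>\<omega>. g1 (Y1 \<omega>)) D1" and d2: "distortion_le M n S2 (\<lambda>\<omega>. g2 (Y2 \<omega>)) D2"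
    using code by (auto simp: broadcast_code_def X_def Y1_def Y2_def Let_def)
  \<comment> \<open>The encoder, rewritten to read the stacked source. Beyond the block it gets the
    default 0, because the model asks for measurability at every index.\<close>
  define f' where "f' s t = (if t < n then f (\<lambda>t\<in>{..<n}. proj_left *v s t, \<lambda>t\<in>{..<n}. proj_right *v s t) t else 0)"
    for s :: "nat \<Rightarrow> real^('m1 + 'm2)" and t
  have f'_meas: "(\<lambda>s. f' s t) \<in> borel_measurable (block_measure n borel)" for t
  proof (cases "t < n")
    case True
    have m: "(\<lambda>s. (\<lambda>t\<in>{..<n}. proj_left *v s t, \<lambda>t\<in>{..<n}. proj_right *v s t)) \<in> block_measure n (borel :: (real^('m1+'m2)) measure) \<rightarrow>\<^sub>M blocks n \<Otimes>\<^sub>M blocks n"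
      by (intro measurable_Pair measurable_restrict borel_measurable_matrix_vector_mult measurable_component_singleton)
    show ?thesis using True measurable_coord[OF measurable_compose[OF m f], of t] by (simp add: f'_def)
  qed (simp add: f'_def)
  have f'_source: "f' (block n source \<omega>) t = X \<omega> t" if "t < n" for \<omega> t
  proof -
    have "(\<lambda>t\<in>{..<n}. proj_left *v block n source \<omega> t) = block n S1 \<omega>" "(\<lambda>t\<in>{..<n}. proj_right *v block n source \<omega> t) = block n S2 \<omega>"
      by (auto simp: block_def source_def fun_eq_iff)
    then show ?thesis using that by (simp add: f'_def X_def channel_input_def)
  qed
  have out: "channel_output n X Z \<omega> = (\<lambda>t\<in>{..<n}. f' (block n source \<omega>) t + block n Z \<omega> t)" for Z \<omega>
    unfolding channel_output_def by (intro restrict_ext) (simp add: f'_source block_coord)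
  have fs: "(fst :: real \<times> real \<Rightarrow> real) \<in> borel_measurable borel" "(snd :: real \<times> real \<Rightarrow> real) \<in> borel_measurable borel"
    by (rule borel_measurable_continuous_onI, rule continuous_on_fst continuous_on_snd, rule continuous_on_id)+
  have N2: "0 < N2" using N by simp
  note L1 = source_noise_block_law[where Z=Z1 and h=fst, OF pd N(1) _ fs(1) noise1 n, simplified]
  note L2 = source_noise_block_law[where Z=Z2 and h=snd, OF pd N2 _ fs(2) noise2 n, simplified]
  have ps: "prob_space (block_measure n (gauss_measure \<Sigma>))" "prob_space (block_measure n (noise N1))"
    by (intro prob_space_PiM prob_space_gauss_measure prob_space_normal_density pd; simp add: N)+
  have X_meas: "(\<lambda>\<omega>. X \<omega> t) \<in> borel_measurable M" if "t < n" for t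
  proof -
    have m: "(\<lambda>\<omega>. (block n S1 \<omega>, block n S2 \<omega>)) \<in> M \<rightarrow>\<^sub>M blocks n \<Otimes>\<^sub>M blocks n"
      unfolding block_def by (intro measurable_Pair measurable_restrict) measurable
    show ?thesis using measurable_coord[OF measurable_compose[OF m f], of t] that by (simp add: X_def channel_input_def)
  qed
  have Y_meas: "Y1 \<in> M \<rightarrow>\<^sub>M blocks n" "Y2 \<in> M \<rightarrow>\<^sub>M blocks n"
    unfolding Y1_def Y2_def channel_output_def
    by (intro measurable_restrict borel_measurable_add X_meas variables_measurable; simp)+
  have g_meas: "(\<lambda>y. g1 y t) \<in> borel_measurable (blocks n)" "(\<lambda>y. g2 y t) \<in> borel_measurable (blocks n)" if "t < n" for t
    using measurable_coord[OF g1, of t] measurable_coord[OF g2, of t] that by auto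
  have gY_meas: "(\<lambda>\<omega>. g1 (Y1 \<omega>) t) \<in> borel_measurable M" "(\<lambda>\<omega>. g2 (Y2 \<omega>) t) \<in> borel_measurable M" if "t < n" for t
    using measurable_compose[OF Y_meas(1) g_meas(1)[OF that]] measurable_compose[OF Y_meas(2) g_meas(2)[OF that]] by auto

  have s_sq: "block_square_integrable M n (\<lambda>\<omega> t. source t \<omega>)"
    unfolding block_square_integrable_def
  proof (intro allI impI conjI)
    fix t i
    show "(\<lambda>\<omega>. source t \<omega> $ i) \<in> borel_measurable M" by measurable
    show "integrable M (\<lambda>\<omega>. (source t \<omega> $ i)\<^sup>2)" using source_law(2)[OF pd, of t i i] by (simp add: power2_eq_square)
  qed
  have s_mom: "block_moment M n (\<lambda>\<omega> t. source t \<omega>) = \<Sigma>"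
    using n by (simp add: block_moment_def source_law(3)[OF pd] vec_eq_iff)
  have pS: "proj_left *v source t \<omega> = S1 t \<omega>" "proj_right *v source t \<omega> = S2 t \<omega>" for t \<omega> by (simp_all add: source_def)
  have m1: "(\<lambda>\<omega>. S1 t \<omega> - g1 (Y1 \<omega>) t) \<in> borel_measurable M" if "t < n" for t
    by (intro borel_measurable_diff gY_meas that variables_measurable)
  have m2: "(\<lambda>\<omega>. S2 t \<omega> - g2 (Y2 \<omega>) t) \<in> borel_measurable M" if "t < n" for t
    by (intro borel_measurable_diff gY_meas that variables_measurable)
  note e1 = distortion_block[OF n d1 m1]
  note e2 = distortion_block[OF n d2 m2]
  \<comment> \<open>The decoder output is the source minus the error, and both are square
    integrable.\<close>
  have g_sq: "block_square_integrable M n (\<lambda>\<omega>. g1 (Y1 \<omega>))"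
    using block_diff[OF block_linear_image(1)[OF s_sq, of proj_left] e1(1)] by (simp add: pS)
  obtain B where B_sq: "block_square_integrable M n (\<lambda>\<omega> t. source t \<omega> - B *v g1 (Y1 \<omega>) t)"
    and Th: "pos_def (block_moment M n (\<lambda>\<omega> t. source t \<omega> - B *v g1 (Y1 \<omega>) t))"
      "block_moment M n (\<lambda>\<omega> t. source t \<omega> - B *v g1 (Y1 \<omega>) t) \<preceq> \<Sigma>"
      "proj_left ** block_moment M n (\<lambda>\<omega> t. source t \<omega> - B *v g1 (Y1 \<omega>) t) ** transpose proj_left
        \<preceq> (1 - \<epsilon>) *\<^sub>R D1 + \<epsilon> *\<^sub>R (proj_left ** \<Sigma> ** transpose proj_left)"
    using linear_estimator[OF n s_sq g_sq _ _ \<epsilon>, where P=proj_left and D=D1, unfolded s_mom pS, OF pd e1(2)] by auto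
  define Th where "Th = block_moment M n (\<lambda>\<omega> t. source t \<omega> - B *v g1 (Y1 \<omega>) t)"
  have X_sq: "integrable M (\<lambda>\<omega>. (X \<omega> t)\<^sup>2)" if t: "t < n" for t
  proof (rule Bochner_Integration.integrable_bound)
    show "integrable M (\<lambda>\<omega>. \<Sum>t<n. (X \<omega> t)\<^sup>2)" using pw by (simp add: power_le_def)
    show "(\<lambda>\<omega>. (X \<omega> t)\<^sup>2) \<in> borel_measurable M" using X_meas[OF t] by measurable
    show "AE \<omega> in M. norm ((X \<omega> t)\<^sup>2) \<le> norm (\<Sum>t<n. (X \<omega> t)\<^sup>2)"
    proof (rule AE_I2)
      fix \<omega>
      have "(X \<omega> t)\<^sup>2 \<le> (\<Sum>t<n. (X \<omega> t)\<^sup>2)" using t by (intro member_le_sum) auto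
      then show "norm ((X \<omega> t)\<^sup>2) \<le> norm (\<Sum>t<n. (X \<omega> t)\<^sup>2)" by simp
    qed
  qed
  have X_pw: "(\<Sum>t<n. \<integral>\<omega>. (X \<omega> t)\<^sup>2 \<partial>M) \<le> real n * Pw"
  proof -
    have "(1 / real n) * (\<Sum>t<n. \<integral>\<omega>. (X \<omega> t)\<^sup>2 \<partial>M) \<le> Pw"
      using pw X_sq by (simp add: power_le_def)
    then show ?thesis using n by (simp add: field_simps)
  qed
  have "0 \<le> (\<Sum>t<n. \<integral>\<omega>. (X \<omega> t)\<^sup>2 \<partial>M)" by (intro sum_nonneg integral_nonneg_AE) auto
  with X_pw have P0: "0 \<le> Pw" using n by (smt (verit) mult_pos_neg of_nat_0_less_iff)
  have D2: "pos_semidef D2" by (rule pos_semidef_of_loewner_le[OF block_moment_pos_semidef[OF e2(1)] e2(2)])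
  have main: "N1 * det \<Sigma> * det (lower_right Th + K) / det Th + (N2 - N1) * det (lower_right \<Sigma> + K) \<le> (Pw + N2) * det (D2 + K)"
    if K: "pos_def K" for K
  proof -
    define sh where "sh y t = (if t < n then B *v g1 y t else 0)" for y t
    define uh where "uh y t = (if t < n then g2 y t else 0)" for y t
    have DK: "pos_def (D2 + K)" using pos_def_add[OF K D2] by (simp add: add.commute)
    \<comment> \<open>The auxiliary variable is \<open>S2\<close> plus noise of covariance
      \<open>K\<close>, hence the second error bound \<open>D2 + K\<close>. The second output has
      power at most \<open>Pw + N2\<close>, and the added noise has variance
      \<open>N2 - N1\<close>.\<close>
    interpret md: broadcast_model n \<Sigma> Th K "D2 + K" proj_right N1 "N2 - N1" "Pw + N2" f' sh uh
    proof
      show "(\<lambda>y. sh y t) \<in> borel_measurable (block_measure n borel)" for t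
        unfolding sh_def using g_meas(1)[of t] by (cases "t < n") auto
      show "(\<lambda>y. uh y t) \<in> borel_measurable (block_measure n borel)" for t
        unfolding uh_def using g_meas(2)[of t] by (cases "t < n") auto
    qed (use pd Th(1) K DK N P0 N2 f'_meas in \<open>auto simp: Th_def\<close>)
    have Y: "Y1 \<omega> = md.outY (block n source \<omega>) (block n Z1 \<omega>)" "Y2 \<omega> = md.outY (block n source \<omega>) (block n Z2 \<omega>)" for \<omega>
      unfolding Y1_def Y2_def out md.outY_def by auto
    have sN: "N1 + (N2 - N1) = N2" by simp
    have dS: "distr M (block_measure n (gauss_measure \<Sigma>)) (block n source) = block_measure n (gauss_measure \<Sigma>)"
      and mS: "block n source \<in> M \<rightarrow>\<^sub>M block_measure n (gauss_measure \<Sigma>)"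
    proof -
      show mS: "block n source \<in> M \<rightarrow>\<^sub>M block_measure n (gauss_measure \<Sigma>)"
        using measurable_compose[OF L1(1) measurable_fst] by simp
      have "distr M (block_measure n (gauss_measure \<Sigma>)) (block n source)
        = distr (distr M (block_measure n (gauss_measure \<Sigma>) \<Otimes>\<^sub>M block_measure n (noise N1)) (\<lambda>\<omega>. (block n source \<omega>, block n Z1 \<omega>))) (block_measure n (gauss_measure \<Sigma>)) fst"
        by (subst distr_distr[OF measurable_fst L1(1)]) (simp add: comp_def)
      also have "\<dots> = block_measure n (gauss_measure \<Sigma>)"
        unfolding L1(2) by (rule md.MuZ.distr_pair_fst)
      finally show "distr M (block_measure n (gauss_measure \<Sigma>)) (block n source) = block_measure n (gauss_measure \<Sigma>)" .
    qed
    have fm: "(\<lambda>s. (f' s t)\<^sup>2) \<in> borel_measurable (block_measure n (gauss_measure \<Sigma>))" for t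
      using md.f_meas_MuS[of t] f'_meas[of t] by measurable
    have fi: "integrable (block_measure n (gauss_measure \<Sigma>)) (\<lambda>s. (f' s t)\<^sup>2)"
      and fe: "(\<integral>s. (f' s t)\<^sup>2 \<partial>block_measure n (gauss_measure \<Sigma>)) = (\<integral>\<omega>. (X \<omega> t)\<^sup>2 \<partial>M)" if t: "t < n" for t
    proof -
      have "integrable (distr M (block_measure n (gauss_measure \<Sigma>)) (block n source)) (\<lambda>s. (f' s t)\<^sup>2)"
        by (rule iffD2[OF integrable_distr_eq[OF mS fm]]) (simp add: f'_source[OF t] X_sq[OF t])
      then show "integrable (block_measure n (gauss_measure \<Sigma>)) (\<lambda>s. (f' s t)\<^sup>2)" unfolding dS .
      show "(\<integral>s. (f' s t)\<^sup>2 \<partial>block_measure n (gauss_measure \<Sigma>)) = (\<integral>\<omega>. (X \<omega> t)\<^sup>2 \<partial>M)"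
        using integral_distr[OF mS fm, of t] unfolding dS by (simp add: f'_source[OF t])
    qed
    have em1: "(\<lambda>x. fst x t - sh (md.outY (fst x) (snd x)) t) \<in> borel_measurable (block_measure n (gauss_measure \<Sigma>) \<Otimes>\<^sub>M block_measure n (noise N1))" if "t < n" for t
      by (intro borel_measurable_diff md.coord_lborel md.sh_compose that) measurable
    have em2: "(\<lambda>x. proj_right *v fst x t - uh (md.outY (fst x) (snd x)) t) \<in> borel_measurable (block_measure n (gauss_measure \<Sigma>) \<Otimes>\<^sub>M block_measure n (noise N2))" if "t < n" for t
      using md.sets_MuZ2 unfolding sN
      by (intro borel_measurable_diff borel_measurable_matrix_vector_mult md.coord_lborel md.uh_compose that) measurable
    let ?e1 = "\<lambda>\<omega> t. fst (block n source \<omega>, block n Z1 \<omega>) t - sh (md.outY (fst (block n source \<omega>, block n Z1 \<omega>)) (snd (block n source \<omega>, block n Z1 \<omega>))) t"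
    let ?e2 = "\<lambda>\<omega> t. proj_right *v fst (block n source \<omega>, block n Z2 \<omega>) t - uh (md.outY (fst (block n source \<omega>, block n Z2 \<omega>)) (snd (block n source \<omega>, block n Z2 \<omega>))) t"
    have c1: "block_square_integrable M n ?e1"
      "block_moment M n ?e1 = Th"
    proof -
      have e: "?e1 \<omega> t
        = source t \<omega> - B *v g1 (Y1 \<omega>) t" if "t < n" for \<omega> t
        unfolding fst_conv snd_conv Y(1)[symmetric] sh_def using that by (simp add: block_coord)
      show "block_square_integrable M n ?e1"
        by (rule iffD2[OF block_cong(1) B_sq]) (rule e)
      show "block_moment M n ?e1 = Th"
        unfolding Th_def by (rule block_cong(2)) (rule e)
    qed
    have c2: "block_square_integrable M n ?e2"
      "block_moment M n ?e2 \<preceq> D2"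
    proof -
      have e: "?e2 \<omega> t
        = S2 t \<omega> - g2 (Y2 \<omega>) t" if "t < n" for \<omega> t
        unfolding fst_conv snd_conv Y(2)[symmetric] uh_def using that by (simp add: block_coord pS)
      show "block_square_integrable M n ?e2"
        by (rule iffD2[OF block_cong(1) e2(1)]) (rule e)
      have "block_moment M n ?e2
        = block_moment M n (\<lambda>\<omega> t. S2 t \<omega> - g2 (Y2 \<omega>) t)"
        by (rule block_cong(2)) (rule e)
      then show "block_moment M n ?e2 \<preceq> D2"
        using e2(2) by simp
    qed
    note r1 = block_distr_rev[OF L1 c1(1) em1]
    note r2 = block_distr_rev[OF L2 c2(1) em2]
    have ineq: "lam * ln (N1 * det \<Sigma> * det (lower_right Th + K) / (lam * det Th)) + (1 - lam) * ln ((N2 - N1) * det (lower_right \<Sigma> + K) / (1 - lam))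
      \<le> ln ((Pw + N2) * det (D2 + K))" if lam: "0 < lam" "lam < 1" for lam
    proof (rule md.model_inequality[of Pw lam, unfolded md.QK_def proj_right_conj sN])
      show "(\<Sum>t<n. \<integral>s. (f' s t)\<^sup>2 \<partial>block_measure n (gauss_measure \<Sigma>)) \<le> real n * Pw" using X_pw by (simp add: fe)
      show "block_moment (block_measure n (gauss_measure \<Sigma>) \<Otimes>\<^sub>M block_measure n (noise N1)) n (\<lambda>x t. fst x t - sh (md.outY (fst x) (snd x)) t) = Th"
        using r1(2) c1(2) by simp
      show "block_moment (block_measure n (gauss_measure \<Sigma>) \<Otimes>\<^sub>M block_measure n (noise N2)) n (\<lambda>x t. proj_right *v fst x t - uh (md.outY (fst x) (snd x)) t) + K \<preceq> D2 + K"
        using r2(2) c2(2) by (intro loewner_le_add_right) simp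
    qed (use n lam fi r1(1) r2(1) in auto)
    have pos: "0 < det \<Sigma>" "0 < det (lower_right Th + K)" "0 < det Th" "0 < det (lower_right \<Sigma> + K)" "0 < det (D2 + K)"
      using pos_def_det_pos[OF pd] pos_def_det_pos[OF md.Th] pos_def_det_pos[OF DK]
        pos_def_det_pos[OF md.QK_pos_def[OF md.Th]] pos_def_det_pos[OF md.QK_pos_def[OF pd]]
      unfolding md.QK_def proj_right_conj by auto
    show ?thesis
    \<comment> \<open>The inequality holds for all weights, so the one adapted to the two
      determinant terms may be chosen.\<close>
    proof (rule weighted_log_bound)
      fix lam :: real assume "0 < lam" "lam < 1"
      from ineq[OF this] show "lam * ln (N1 * det \<Sigma> * det (lower_right Th + K) / det Th / lam) + (1 - lam) * ln ((N2 - N1) * det (lower_right \<Sigma> + K) / (1 - lam)) \<le> ln ((Pw + N2) * det (D2 + K))"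
        by (simp add: mult.commute)
    qed (use pos N P0 N2 in auto)
  qed
  show thesis
    by (rule that[OF Th[folded Th_def, unfolded proj_left_conj] main P0 D2])
qed

end

subsection \<open>Closure of the achievable region\<close>

lemma tendsto_matrix_entry:
  fixes A :: "nat \<Rightarrow> real^'n^'m"
  assumes "A \<longlonglongrightarrow> L" shows "(\<lambda>k. A k $ i $ j) \<longlonglongrightarrow> L $ i $ j"
  by (intro tendsto_vec_nth assms)

lemma tendsto_det:
  fixes A :: "nat \<Rightarrow> real^'n^'n"
  assumes "A \<longlonglongrightarrow> L" shows "(\<lambda>k. det (A k)) \<longlonglongrightarrow> det L"
  unfolding det_def by (intro tendsto_intros tendsto_matrix_entry assms)

lemma pos_semidef_limit:
  fixes A :: "nat \<Rightarrow> real^'n^'n"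
  assumes A: "A \<longlonglongrightarrow> L" and p: "\<And>k. pos_semidef (A k)"
  shows "pos_semidef L"
  unfolding pos_semidef_def
proof (intro conjI allI)
  have "A k $ i $ j = A k $ j $ i" for k i j
    using p[of k] by (auto simp: pos_semidef_def transpose_def vec_eq_iff)
  then have "L $ i $ j = L $ j $ i" for i j
    using LIMSEQ_unique[OF tendsto_matrix_entry[OF A, of i j]] tendsto_matrix_entry[OF A, of j i] by simp
  then show "transpose L = L" by (simp add: transpose_def vec_eq_iff)
  fix x
  have "(\<lambda>k. x \<bullet> (A k *v x)) \<longlonglongrightarrow> x \<bullet> (L *v x)"
    unfolding inner_matrix_vector_sum by (intro tendsto_intros tendsto_matrix_entry A)
  then show "0 \<le> x \<bullet> (L *v x)" by (rule LIMSEQ_le_const) (use p in \<open>auto simp: pos_semidef_def\<close>)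
qed

text \<open>If the form vanishes at \<open>x\<close>, then along each line through some
  \<open>y\<close> in direction \<open>x\<close> it is affine and nonnegative, hence constant. So
  \<open>A\<close> annihilates \<open>x\<close>.\<close>

lemma pos_semidef_det_nonzero:
  assumes p: "pos_semidef A" and d: "det A \<noteq> 0"
  shows "pos_def A"
  unfolding pos_def_def
proof (intro conjI allI impI)
  show t: "transpose A = A" using p by (simp add: pos_semidef_def)
  fix x :: "real^'a" assume "x \<noteq> 0"
  have nn: "0 \<le> z \<bullet> (A *v z)" for z using p by (simp add: pos_semidef_def)
  show "0 < x \<bullet> (A *v x)"
  proof (rule ccontr)
    assume "\<not> 0 < x \<bullet> (A *v x)"
    then have 0: "x \<bullet> (A *v x) = 0" using nn[of x] by simp
    have "y \<bullet> (A *v x) = 0" for y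
    proof (rule affine_nonneg_imp_zero)
      fix r
      have "x \<bullet> (A *v y) = y \<bullet> (A *v x)" by (metis inner_commute inner_matrix_vector t)
      then show "0 \<le> y \<bullet> (A *v y) - 2 * r * (y \<bullet> (A *v x))"
        using nn[of "y - r *\<^sub>R x"] 0
        by (simp add: matrix_vector_mult_diff_distrib matrix_vector_mult_scaleR inner_diff_left inner_diff_right)
    qed
    from this[of "A *v x"] have "A *v x = 0" by simp
    then have "x = 0" by (metis d matrix_inv_mult(1) matrix_vector_mul_assoc matrix_vector_mul_lid matrix_vector_mult_0_right)
    then show False using \<open>x \<noteq> 0\<close> by simp
  qed
qed

lemma lower_right_form: "x \<bullet> (lower_right A *v x) = (transpose proj_right *v x) \<bullet> (A *v (transpose proj_right *v x))"
  unfolding proj_right_conj[symmetric] matrix_vector_mul_assoc[symmetric] inner_matrix_vector ..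

lemma transpose_lower_right: "transpose (lower_right A) = lower_right (transpose A)"
  by (simp add: lower_right_def transpose_def vec_eq_iff)

lemma pos_semidef_lower_right: "pos_semidef A \<Longrightarrow> pos_semidef (lower_right A)"
  by (auto simp: pos_semidef_def transpose_lower_right lower_right_form simp del: transpose_matrix_vector)

lemma pos_def_lower_right:
  fixes A :: "real^('a::finite + 'b::finite)^('a + 'b)"
  assumes A: "pos_def A" shows "pos_def (lower_right A)"
  unfolding pos_def_def
proof (intro conjI allI impI)
  show "transpose (lower_right A) = lower_right A" using A by (simp add: pos_def_def transpose_lower_right)
  fix x :: "real^'b" assume x: "x \<noteq> 0"
  have "(proj_right :: real^('a + 'b)^'b) ** transpose proj_right = mat 1"
  proof -
    have "lower_right (mat 1 :: real^('a + 'b)^('a + 'b)) = mat 1" by (simp add: lower_right_def mat_def vec_eq_iff)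
    then show ?thesis using proj_right_conj[of "mat 1 :: real^('a + 'b)^('a + 'b)"] by simp
  qed
  note P = this
  have "transpose (proj_right :: real^('a + 'b)^'b) *v x \<noteq> 0"
  proof
    assume "transpose (proj_right :: real^('a + 'b)^'b) *v x = 0"
    then have "(proj_right :: real^('a + 'b)^'b) *v (transpose proj_right *v x) = 0" by simp
    then show False using x unfolding matrix_vector_mul_assoc P by simp
  qed
  then show "0 < x \<bullet> (lower_right A *v x)" using A unfolding lower_right_form pos_def_def by blast
qed

text \<open>Testing the form on the sum and the difference of two unit vectors bounds the entry by
  the diagonal, which is dominated by the diagonal of \<open>B\<close>.\<close>

lemma pos_semidef_entry_le:
  assumes A: "pos_semidef A" and B: "A \<preceq> B"
  shows "\<bar>A $ i $ j\<bar> \<le> (B $ i $ i + B $ j $ j) / 2"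
proof -
  have ent: "axis i 1 \<bullet> (C *v axis j 1) = C $ i $ j" for C :: "real^'a^'a" and i j
    by (simp add: inner_axis' matrix_vector_mult_basis column_def)
  have nn: "0 \<le> z \<bullet> (A *v z)" "0 \<le> z \<bullet> ((B - A) *v z)" for z using A B by (auto simp: pos_semidef_def loewner_le_def)
  have "A $ j $ i = A $ i $ j" using A by (auto simp: pos_semidef_def transpose_def vec_eq_iff)
  then have "0 \<le> A $ i $ i + 2 * A $ i $ j + A $ j $ j" "0 \<le> A $ i $ i - 2 * A $ i $ j + A $ j $ j"
    using nn(1)[of "axis i 1 + axis j 1"] nn(1)[of "axis i 1 - axis j 1"]
    by (simp_all add: matrix_vector_right_distrib matrix_vector_mult_diff_distrib inner_add_left inner_add_right inner_diff_left inner_diff_right ent)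
  moreover have "A $ l $ l \<le> B $ l $ l" for l
    using nn(2)[of "axis l 1"] by (simp add: ent)
  from this[of i] this[of j] calculation have "A $ i $ j \<le> (B $ i $ i + B $ j $ j) / 2" "- (A $ i $ j) \<le> (B $ i $ i + B $ j $ j) / 2"
    by simp_all
  then show ?thesis by (rule abs_leI)
qed

lemma bounded_loewner_interval: "bounded {A. pos_semidef A \<and> A \<preceq> B}" for B :: "real^'n^'n"
proof (rule boundedI)
  fix A assume "A \<in> {A. pos_semidef A \<and> A \<preceq> B}"
  then have A: "\<bar>A $ i $ j\<bar> \<le> (B $ i $ i + B $ j $ j) / 2" for i j by (intro pos_semidef_entry_le) auto
  have "norm A \<le> (\<Sum>i\<in>UNIV. norm (A $ i))" unfolding norm_vec_def by (rule L2_set_le_sum) simp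
  also have "\<dots> \<le> (\<Sum>i\<in>UNIV. \<Sum>j\<in>UNIV. (B $ i $ i + B $ j $ j) / 2)"
    by (intro sum_mono order_trans[OF norm_le_l1_cart] A)
  finally show "norm A \<le> (\<Sum>i\<in>UNIV. \<Sum>j\<in>UNIV. (B $ i $ i + B $ j $ j) / 2)" .
qed

context gaussian_broadcast
begin

text \<open>The matrices \<open>Th\<close> of a sequence of codes lie between 0 and \<Sigma>, so a
  subsequence converges. The inequality is multiplied by \<open>det Th\<close> before passing to the
  limit, because at that stage the limit could still be singular.\<close>

lemma region_bound:
  assumes N: "0 < N1" "N1 < N2" and pd: "pos_def \<Sigma>"
    and region: "(Pw, D1, D2) \<in> power_distortion_region M S1 S2 Z1 Z2"
  obtains Th where "pos_def Th" "Th \<preceq> \<Sigma>" "upper_left Th \<preceq> D1"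
    and "\<And>K. pos_def K \<Longrightarrow> N1 * det \<Sigma> * det (lower_right Th + K) + (N2 - N1) * det (lower_right \<Sigma> + K) * det Th \<le> (Pw + N2) * det (D2 + K) * det Th"
    and "pos_semidef D2"
proof -
  obtain x where x: "\<And>k. x k \<in> achievable M S1 S2 Z1 Z2" and lim: "x \<longlonglongrightarrow> (Pw, D1, D2)"
    using region unfolding power_distortion_region_def closure_sequential by auto
  define p d1 d2 where "p k = fst (x k)" and "d1 k = fst (snd (x k))" and "d2 k = snd (snd (x k))" for k
  have p: "p \<longlonglongrightarrow> Pw" and d1: "d1 \<longlonglongrightarrow> D1" and d2: "d2 \<longlonglongrightarrow> D2"
    using tendsto_fst[OF lim] tendsto_fst[OF tendsto_snd[OF lim]] tendsto_snd[OF tendsto_snd[OF lim]]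
    by (simp_all add: p_def[abs_def] d1_def[abs_def] d2_def[abs_def])
  \<comment> \<open>The perturbation vanishes along the sequence of codes; the shift by 2 keeps it
    below 1 from the start.\<close>
  define e where "e k = 1 / real (k + 2)" for k
  have e: "0 < e k" "e k < 1" for k by (auto simp: e_def)
  have e0: "e \<longlonglongrightarrow> 0"
    unfolding e_def[abs_def] using LIMSEQ_ignore_initial_segment[OF lim_1_over_n, of 2] by simp
  have "\<exists>Th. pos_def Th \<and> Th \<preceq> \<Sigma> \<and> upper_left Th \<preceq> (1 - e k) *\<^sub>R d1 k + e k *\<^sub>R upper_left \<Sigma>
    \<and> (\<forall>K. pos_def K \<longrightarrow> N1 * det \<Sigma> * det (lower_right Th + K) / det Th + (N2 - N1) * det (lower_right \<Sigma> + K) \<le> (p k + N2) * det (d2 k + K))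
    \<and> pos_semidef (d2 k)" for k
  proof -
    obtain n f g1 g2 where n: "1 \<le> n" and c: "broadcast_code M S1 S2 Z1 Z2 n (p k) (d1 k) (d2 k) f g1 g2"
      using x[of k] by (auto simp: achievable_def p_def d1_def d2_def split: prod.splits)
    have "0 < n" using n by simp
    from code_bound[OF N pd this e c] show ?thesis by metis
  qed
  then obtain Th where Th: "\<And>k. pos_def (Th k)" "\<And>k. Th k \<preceq> \<Sigma>" "\<And>k. upper_left (Th k) \<preceq> (1 - e k) *\<^sub>R d1 k + e k *\<^sub>R upper_left \<Sigma>"
    and bound: "\<And>k K. pos_def K \<Longrightarrow> N1 * det \<Sigma> * det (lower_right (Th k) + K) / det (Th k) + (N2 - N1) * det (lower_right \<Sigma> + K) \<le> (p k + N2) * det (d2 k + K)"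
    and d2p: "\<And>k. pos_semidef (d2 k)"
    by metis
  have "bounded (range Th)"
    by (rule bounded_subset[OF bounded_loewner_interval[of \<Sigma>]]) (use Th pos_def_imp_semidef in auto)
  then obtain L r where r: "strict_mono r" and L: "(Th \<circ> r) \<longlonglongrightarrow> L"
    using bounded_imp_convergent_subsequence by blast
  have L': "(\<lambda>k. Th (r k)) \<longlonglongrightarrow> L" using L by (simp add: comp_def)
  have p': "(\<lambda>k. p (r k)) \<longlonglongrightarrow> Pw" and d1': "(\<lambda>k. d1 (r k)) \<longlonglongrightarrow> D1" and d2': "(\<lambda>k. d2 (r k)) \<longlonglongrightarrow> D2" and e0': "(\<lambda>k. e (r k)) \<longlonglongrightarrow> 0"
    using LIMSEQ_subseq_LIMSEQ[OF p r] LIMSEQ_subseq_LIMSEQ[OF d1 r] LIMSEQ_subseq_LIMSEQ[OF d2 r] LIMSEQ_subseq_LIMSEQ[OF e0 r]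
    by (simp_all add: comp_def)
  have lr: "(\<lambda>k. lower_right (Th (r k))) \<longlonglongrightarrow> lower_right L" and ul: "(\<lambda>k. upper_left (Th (r k))) \<longlonglongrightarrow> upper_left L"
  proof -
    show "(\<lambda>k. lower_right (Th (r k))) \<longlonglongrightarrow> lower_right L"
      unfolding lower_right_def by (rule vec_tendstoI, simp, rule vec_tendstoI, simp, rule tendsto_matrix_entry[OF L'])
    show "(\<lambda>k. upper_left (Th (r k))) \<longlonglongrightarrow> upper_left L"
      unfolding upper_left_def by (rule vec_tendstoI, simp, rule vec_tendstoI, simp, rule tendsto_matrix_entry[OF L'])
  qed
  have L_psd: "pos_semidef L" by (rule pos_semidef_limit[OF L']) (rule pos_def_imp_semidef[OF Th(1)])
  have L_S: "L \<preceq> \<Sigma>"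
    unfolding loewner_le_def
    by (rule pos_semidef_limit[OF tendsto_diff[OF tendsto_const L']]) (use Th(2) in \<open>simp add: loewner_le_def\<close>)
  have L_D1: "upper_left L \<preceq> D1"
  proof -
    have "(\<lambda>k. (1 - e (r k)) *\<^sub>R d1 (r k) + e (r k) *\<^sub>R upper_left \<Sigma> - upper_left (Th (r k))) \<longlonglongrightarrow> (1 - 0) *\<^sub>R D1 + 0 *\<^sub>R upper_left \<Sigma> - upper_left L"
      by (intro tendsto_intros e0' d1' ul)
    from pos_semidef_limit[OF this] show ?thesis using Th(3) by (simp add: loewner_le_def)
  qed
  have D2_psd: "pos_semidef D2" by (rule pos_semidef_limit[OF d2']) (rule d2p)
  have det_nn: "0 \<le> det L"
    by (rule LIMSEQ_le_const[OF tendsto_det[OF L']]) (use pos_def_det_pos[OF Th(1)] in \<open>auto simp: less_imp_le\<close>)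
  have main: "N1 * det \<Sigma> * det (lower_right L + K) + (N2 - N1) * det (lower_right \<Sigma> + K) * det L \<le> (Pw + N2) * det (D2 + K) * det L"
    if K: "pos_def K" for K
  proof (rule LIMSEQ_le)
    show "(\<lambda>k. N1 * det \<Sigma> * det (lower_right (Th (r k)) + K) + (N2 - N1) * det (lower_right \<Sigma> + K) * det (Th (r k)))
      \<longlonglongrightarrow> N1 * det \<Sigma> * det (lower_right L + K) + (N2 - N1) * det (lower_right \<Sigma> + K) * det L"
      by (intro tendsto_add tendsto_mult tendsto_const tendsto_det lr L')
    show "(\<lambda>k. (p (r k) + N2) * det (d2 (r k) + K) * det (Th (r k))) \<longlonglongrightarrow> (Pw + N2) * det (D2 + K) * det L"
      by (intro tendsto_add tendsto_mult tendsto_const tendsto_det p' d2' L')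
    have "N1 * det \<Sigma> * det (lower_right (Th k) + K) + (N2 - N1) * det (lower_right \<Sigma> + K) * det (Th k) \<le> (p k + N2) * det (d2 k + K) * det (Th k)" for k
    proof -
      have d: "0 < det (Th k)" by (rule pos_def_det_pos[OF Th(1)])
      have "(N1 * det \<Sigma> * det (lower_right (Th k) + K) / det (Th k) + (N2 - N1) * det (lower_right \<Sigma> + K)) * det (Th k) \<le> (p k + N2) * det (d2 k + K) * det (Th k)"
        using bound[OF K, of k] d by (intro mult_right_mono) auto
      then show ?thesis using d by (simp add: distrib_right)
    qed
    then show "\<exists>N. \<forall>k\<ge>N. N1 * det \<Sigma> * det (lower_right (Th (r k)) + K) + (N2 - N1) * det (lower_right \<Sigma> + K) * det (Th (r k))
      \<le> (p (r k) + N2) * det (d2 (r k) + K) * det (Th (r k))" by blast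
  qed
  \<comment> \<open>With \<open>K = lower_right \<Sigma>\<close> a singular limit would make the
    right side 0, while the first term on the left stays positive.\<close>
  have "det L \<noteq> 0"
  proof
    assume 0: "det L = 0"
    have K: "pos_def (lower_right \<Sigma>)" by (rule pos_def_lower_right[OF pd])
    have "0 < det (lower_right L + lower_right \<Sigma>)"
      using pos_def_det_pos[OF pos_def_add[OF K pos_semidef_lower_right[OF L_psd]]] by (simp add: add.commute)
    then have "0 < N1 * det \<Sigma> * det (lower_right L + lower_right \<Sigma>)" using N pos_def_det_pos[OF pd] by simp
    then show False using main[OF K] by (simp add: 0)
  qed
  then have "pos_def L" by (rule pos_semidef_det_nonzero[OF L_psd])
  from that[OF this L_S L_D1 main D2_psd] show thesis .
qed

end

theorem theorem1:
  fixes M :: "'w measure"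
    and \<Sigma> :: "real^('m1::finite + 'm2::finite)^('m1 + 'm2)"
    and N1 N2 :: real
    and S1 :: "nat \<Rightarrow> 'w \<Rightarrow> real^'m1"
    and S2 :: "nat \<Rightarrow> 'w \<Rightarrow> real^'m2"
    and Z1 Z2 :: "nat \<Rightarrow> 'w \<Rightarrow> real"
    and D1 :: "real^'m1^'m1"
    and D2 :: "real^'m2^'m2"
  assumes "0 < N1" and "N1 < N2"
    and "0 \<prec> \<Sigma>"
    and "gaussian_broadcast M \<Sigma> N1 N2 S1 S2 Z1 Z2"
    and "0 \<prec> D1" and "0 \<prec> D2"
  shows "min_power M S1 S2 Z1 Z2 D1 D2 \<ge>
    (INF \<Theta> \<in> {\<Theta> :: real^('m1 + 'm2)^('m1 + 'm2). 0 \<prec> \<Theta> \<and> \<Theta> \<preceq> \<Sigma> \<and> upper_left \<Theta> \<preceq> D1}.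
     SUP U \<in> {U :: real^('m1 + 'm2)^('m1 + 'm2). 0 \<prec> U}.
       ereal (N1 * (det \<Sigma> * det (lower_right \<Theta> + lower_right U))
                  / (det \<Theta> * det (D2 + lower_right U))
            + (N2 - N1) * det (cov_matrix M (S2 0) + lower_right U) / det (D2 + lower_right U)
            - N2))"
  unfolding min_power_def
proof (rule INF_greatest)
  interpret gaussian_broadcast M \<Sigma> N1 N2 S1 S2 Z1 Z2 by fact
  have pd: "pos_def \<Sigma>" using assms(3) by (simp add: pos_def_zero_less)
  fix Pw assume "Pw \<in> {P. (P, D1, D2) \<in> power_distortion_region M S1 S2 Z1 Z2}"
  then have "(Pw, D1, D2) \<in> power_distortion_region M S1 S2 Z1 Z2" by simp
  from region_bound[OF assms(1,2) pd this] obtain Th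
    where Th: "pos_def Th" "Th \<preceq> \<Sigma>" "upper_left Th \<preceq> D1"
      and bound: "\<And>K. pos_def K \<Longrightarrow> N1 * det \<Sigma> * det (lower_right Th + K) + (N2 - N1) * det (lower_right \<Sigma> + K) * det Th \<le> (Pw + N2) * det (D2 + K) * det Th"
      and D2: "pos_semidef D2" by metis
  show "(INF \<Theta> \<in> {\<Theta>. 0 \<prec> \<Theta> \<and> \<Theta> \<preceq> \<Sigma> \<and> upper_left \<Theta> \<preceq> D1}.
     SUP U \<in> {U :: real^('m1 + 'm2)^('m1 + 'm2). 0 \<prec> U}.
       ereal (N1 * (det \<Sigma> * det (lower_right \<Theta> + lower_right U))
                  / (det \<Theta> * det (D2 + lower_right U))
            + (N2 - N1) * det (cov_matrix M (S2 0) + lower_right U) / det (D2 + lower_right U)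
            - N2)) \<le> ereal Pw"
  \<comment> \<open>The matrix obtained from the region serves as one candidate for the infimum, and
    its bound is valid for all \<open>U\<close> simultaneously.\<close>
  proof (rule INF_lower2)
    show "Th \<in> {\<Theta>. 0 \<prec> \<Theta> \<and> \<Theta> \<preceq> \<Sigma> \<and> upper_left \<Theta> \<preceq> D1}" using Th by (simp add: pos_def_zero_less)
    show "(SUP U \<in> {U :: real^('m1 + 'm2)^('m1 + 'm2). 0 \<prec> U}.
       ereal (N1 * (det \<Sigma> * det (lower_right Th + lower_right U))
                  / (det Th * det (D2 + lower_right U))
            + (N2 - N1) * det (cov_matrix M (S2 0) + lower_right U) / det (D2 + lower_right U)
            - N2)) \<le> ereal Pw"
    proof (rule SUP_least)
      fix U :: "real^('m1 + 'm2)^('m1 + 'm2)" assume "U \<in> {U. 0 \<prec> U}"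
      \<comment> \<open>The objective involves \<open>U\<close> only through its lower-right block,
        which takes the part of the auxiliary covariance \<open>K\<close>.\<close>
      then have K: "pos_def (lower_right U)" by (intro pos_def_lower_right) (simp add: pos_def_zero_less)
      define a b where "a = det Th" and "b = det (D2 + lower_right U)"
      have a: "0 < a" unfolding a_def by (rule pos_def_det_pos[OF Th(1)])
      have b: "0 < b" unfolding b_def using pos_def_det_pos[OF pos_def_add[OF K D2]] by (simp add: add.commute)
      have "N1 * det \<Sigma> * det (lower_right Th + lower_right U) + (N2 - N1) * det (lower_right \<Sigma> + lower_right U) * a \<le> (Pw + N2) * b * a"
        using bound[OF K] by (simp add: a_def b_def)
      then have "(N1 * det \<Sigma> * det (lower_right Th + lower_right U) + (N2 - N1) * det (lower_right \<Sigma> + lower_right U) * a) / (a * b) \<le> Pw + N2"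
        using a b by (simp add: divide_le_eq mult_ac)
      then show "ereal (N1 * (det \<Sigma> * det (lower_right Th + lower_right U)) / (det Th * det (D2 + lower_right U))
            + (N2 - N1) * det (cov_matrix M (S2 0) + lower_right U) / det (D2 + lower_right U) - N2) \<le> ereal Pw"
        unfolding cov_matrix_S2 a_def[symmetric] b_def[symmetric] using a b
        by (simp add: add_divide_distrib mult.assoc)
    qed
  qed
qed

end
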